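(* The problem of determining the position of a (saturated) FDFA using duo-normalization in the Wagner hierarchy is PSPACE-complete.
   Context: $\Sigma$ is a finite alphabet. For a (complete deterministic) automaton $\mathcal A$ and $w\in\Sigma^*$, $\mathcal A(w)$ is the state reached from the initial state on reading $w$; $[\![\mathcal D]\!]$ is the language of a DFA $\mathcal D$. An FDFA (family of DFAs) is a pair $\mathcal F=(\mathcal Q,\{\mathcal P_q\}_{q\in Q})$ of a leading automaton structure $\mathcal Q$ (a complete deterministic automaton without acceptance condition, with state set $Q$) and a progress DFA $\mathcal P_q$ for each $q\in Q$; write $\mathcal P_u=\mathcal P_{\mathcal Q(u)}$ for $u\in\Sigma^*$. For $u\in\Sigma^*$, $v\in\Sigma^+$: $(u,v)$ is a decomposition of $w\in\Sigma^\omega$ if $uv^\omega=w$; it is normalized if $\mathcal Q(uv)=\mathcal Q(u)$; it is duo-normalized if it is normalized and $\mathcal P_u(vv)=\mathcal P_u(v)$. An FDFA using duo-normalization (duo-normalized acceptance) accepts $(u,v)$, written $(u,v)\in[\![\mathcal F]\!]$, iff there is a duo-normalized decomposition $(x,y)$ of $uv^\omega$ with $y\in[\![\mathcal P_x]\!]$. $\mathcal F$ is saturated if, for every ultimately periodic word $w$, all duo-normalized decompositions $(x,y)$ of $w$ agree on whether $y\in[\![\mathcal P_x]\!]$. The language recognized by $\mathcal F$ is the $\omega$-regular language whose ultimately periodic words are the words $uv^\omega$ with $(u,v)\in[\![\mathcal F]\!]$ (an $\omega$-regular language is determined by its ultimately periodic words). Wagner hierarchy. A DMA is a complete deterministic Muller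 automaton $\mathcal M$ with acceptance condition $\alpha$, a set of sets of states (a run is accepting iff the set of states visited infinitely often is in $\alpha$). An SCC is a nonempty set $S$ of states, not necessarily maximal, such that there is a path within $S$ between every pair of its states (a singleton must have a self-loop); it is accepting if $S\in\alpha$, otherwise rejecting. $|\mathcal M|_{\subseteq}^{+}$ (resp. $|\mathcal M|_{\subseteq}^{-}$) is the maximal length $k$ of a strict inclusion chain $S_1\subset S_2\subset\dots\subset S_k$ of SCCs of alternating acceptance with $S_1$ accepting (resp. rejecting). For a positive integer $k$, the classes of the Wagner hierarchy are: $\mathbb{DM}_k^{+}$, the languages recognized by some DMA $\mathcal M$ with $|\mathcal M|_{\subseteq}^{+}\le k$ and $|\mathcal M|_{\subseteq}^{-}<k$; $\mathbb{DM}_k^{-}$, those recognized by some DMA with $|\mathcal M|_{\subseteq}^{+}<k$ and $|\mathcal M|_{\subseteq}^{-}\le k$; and $\mathbb{DM}_k^{\pm}$, those recognized by some DMA with $|\mathcal M|_{\subseteq}^{+}\le k$ and $|\mathcal M|_{\subseteq}^{-}\le k$. The position of an FDFA in the Wagner hierarchy is the position of the language it recognizes among these classes. *)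

theory Defs
  imports Main "HOL-Library.Omega_Words_Fun"
begin

section \<open>Automata and families of DFAs\<close>

text \<open>
  Letters and states are numbered: an alphabet of size \<open>m\<close> is \<open>{..<m}\<close>, and the states of an
  automaton structure are \<open>{..<nstates A}\<close>. The behaviour of \<open>step\<close> outside these ranges is
  irrelevant. \<open>\<omega>\<close>-words, concatenation and \<open>\<omega>\<close>-iteration are those of
  \<^theory>\<open>HOL-Library.Omega_Words_Fun\<close>.
\<close>

record dts =
  nstates :: nat
  init :: nat
  step :: "nat \<Rightarrow> nat \<Rightarrow> nat"

record dfa = dts +
  final :: "nat set"

record dma = dts +
  acc :: "nat set set"

record fdfa =
  alph :: nat
  leading :: dts
  progress :: "nat \<Rightarrow> dfa"

definition wf_dts :: "nat \<Rightarrow> 'z dts_scheme \<Rightarrow> bool" where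
  "wf_dts m A \<longleftrightarrow> init A < nstates A \<and> (\<forall>q<nstates A. \<forall>a<m. step A q a < nstates A)"

definition wf_dfa :: "nat \<Rightarrow> dfa \<Rightarrow> bool" where
  "wf_dfa m A \<longleftrightarrow> wf_dts m A \<and> final A \<subseteq> {..<nstates A}"

definition wf_dma :: "nat \<Rightarrow> dma \<Rightarrow> bool" where
  "wf_dma m M \<longleftrightarrow> wf_dts m M \<and> acc M \<subseteq> Pow {..<nstates M}"

definition wf_fdfa :: "fdfa \<Rightarrow> bool" where
  "wf_fdfa F \<longleftrightarrow> 0 < alph F \<and> wf_dts (alph F) (leading F) \<and>
     (\<forall>q<nstates (leading F). wf_dfa (alph F) (progress F q))"

definition reach :: "'z dts_scheme \<Rightarrow> nat list \<Rightarrow> nat" where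
  "reach A w = foldl (step A) (init A) w"

definition dfa_accepts :: "dfa \<Rightarrow> nat list \<Rightarrow> bool" where
  "dfa_accepts A w \<longleftrightarrow> reach A w \<in> final A"

definition progress_at :: "fdfa \<Rightarrow> nat list \<Rightarrow> dfa" where
  "progress_at F u = progress F (reach (leading F) u)"

definition decomposition :: "nat \<Rightarrow> nat list \<Rightarrow> nat list \<Rightarrow> nat word \<Rightarrow> bool" where
  "decomposition m u v w \<longleftrightarrow>
     set u \<subseteq> {..<m} \<and> set v \<subseteq> {..<m} \<and> v \<noteq> [] \<and> u \<frown> v\<^sup>\<omega> = w"

definition normalized :: "fdfa \<Rightarrow> nat list \<Rightarrow> nat list \<Rightarrow> bool" where
  "normalized F u v \<longleftrightarrow> reach (leading F) (u @ v) = reach (leading F) u"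

definition duo_normalized :: "fdfa \<Rightarrow> nat list \<Rightarrow> nat list \<Rightarrow> bool" where
  "duo_normalized F u v \<longleftrightarrow>
     normalized F u v \<and> reach (progress_at F u) (v @ v) = reach (progress_at F u) v"

definition duo_accepts :: "fdfa \<Rightarrow> nat list \<Rightarrow> nat list \<Rightarrow> bool" where
  "duo_accepts F u v \<longleftrightarrow>
     (\<exists>x y. decomposition (alph F) x y (u \<frown> v\<^sup>\<omega>) \<and> duo_normalized F x y \<and>
        dfa_accepts (progress_at F x) y)"

definition saturated :: "fdfa \<Rightarrow> bool" where
  "saturated F \<longleftrightarrow>
     (\<forall>w x y x' y'.
        decomposition (alph F) x y w \<and> duo_normalized F x y \<and>
        decomposition (alph F) x' y' w \<and> duo_normalized F x' y' \<longrightarrow>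
        dfa_accepts (progress_at F x) y = dfa_accepts (progress_at F x') y')"

definition dma_run :: "dma \<Rightarrow> nat word \<Rightarrow> nat word" where
  "dma_run M w = (\<lambda>i. reach M (map w [0..<i]))"

definition dma_language :: "nat \<Rightarrow> dma \<Rightarrow> nat word set" where
  "dma_language m M = {w. range w \<subseteq> {..<m} \<and> limit (dma_run M w) \<in> acc M}"

definition omega_regular :: "nat \<Rightarrow> nat word set \<Rightarrow> bool" where
  "omega_regular m L \<longleftrightarrow> (\<exists>M. wf_dma m M \<and> L = dma_language m M)"

text \<open>
  The description is proper for well-formed saturated \<open>F\<close>: there, acceptance of \<open>(u, v)\<close> depends only
  on the word \<open>u v\<^sup>\<omega>\<close>, and an \<open>\<omega>\<close>-regular language is determined by its ultimately periodic words.
\<close>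

definition fdfa_language :: "fdfa \<Rightarrow> nat word set" where
  "fdfa_language F = (THE L. omega_regular (alph F) L \<and>
     (\<forall>u v. set u \<subseteq> {..<alph F} \<and> set v \<subseteq> {..<alph F} \<and> v \<noteq> [] \<longrightarrow>
        (u \<frown> v\<^sup>\<omega> \<in> L \<longleftrightarrow> duo_accepts F u v)))"


section \<open>The Wagner hierarchy\<close>

text \<open>
  Using the transitive (not reflexive) closure makes a singleton an SCC only if it has a self-loop.
  SCCs need be neither maximal nor reachable.
\<close>

definition edges_within :: "nat \<Rightarrow> 'z dts_scheme \<Rightarrow> nat set \<Rightarrow> (nat \<times> nat) set" where
  "edges_within m A S = {(p, q). p \<in> S \<and> q \<in> S \<and> (\<exists>a<m. step A p a = q)}"

definition scc :: "nat \<Rightarrow> 'z dts_scheme \<Rightarrow> nat set \<Rightarrow> bool" where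
  "scc m A S \<longleftrightarrow> S \<noteq> {} \<and> S \<subseteq> {..<nstates A} \<and> S \<times> S \<subseteq> (edges_within m A S)\<^sup>+"

text \<open>The flag \<open>b\<close> tells whether the first (smallest) SCC of the chain is accepting.\<close>

definition alternating_chain :: "nat \<Rightarrow> dma \<Rightarrow> bool \<Rightarrow> nat set list \<Rightarrow> bool" where
  "alternating_chain m M b Ss \<longleftrightarrow> sorted_wrt (\<subset>) Ss \<and>
     (\<forall>i<length Ss. scc m M (Ss ! i) \<and> (Ss ! i \<in> acc M \<longleftrightarrow> even i = b))"

text \<open>
  The empty chain is admitted, so the measure is \<open>0\<close> if no SCC has the required acceptance. The set
  is finite, as chains consist of strictly increasing subsets of a finite set.
\<close>

definition inclusion_measure :: "nat \<Rightarrow> dma \<Rightarrow> bool \<Rightarrow> nat" where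
  "inclusion_measure m M b = Max {length Ss | Ss. alternating_chain m M b Ss}"

datatype wsign = Plus | Minus | PlusMinus

fun within_bounds :: "wsign \<Rightarrow> nat \<Rightarrow> nat \<Rightarrow> nat \<Rightarrow> bool" where
  "within_bounds Plus k p n \<longleftrightarrow> p \<le> k \<and> n < k"
| "within_bounds Minus k p n \<longleftrightarrow> p < k \<and> n \<le> k"
| "within_bounds PlusMinus k p n \<longleftrightarrow> p \<le> k \<and> n \<le> k"

definition wagner_class :: "nat \<Rightarrow> wsign \<Rightarrow> nat \<Rightarrow> nat word set set" where
  "wagner_class m s k = {L. \<exists>M. wf_dma m M \<and> L = dma_language m M \<and>
     within_bounds s k (inclusion_measure m M True) (inclusion_measure m M False)}"

text \<open>The position of a language is the least class of the hierarchy containing it.\<close>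

definition wagner_position :: "nat \<Rightarrow> nat word set \<Rightarrow> wsign \<Rightarrow> nat \<Rightarrow> bool" where
  "wagner_position m L s k \<longleftrightarrow> 0 < k \<and> L \<in> wagner_class m s k \<and>
     (\<forall>s' k'. 0 < k' \<and> L \<in> wagner_class m s' k' \<longrightarrow> wagner_class m s k \<subseteq> wagner_class m s' k')"


section \<open>Turing machines, PSPACE and completeness\<close>

text \<open>
  Deterministic multi-tape machines with two-way infinite tapes. A tape is its content together with
  the head position. States are \<open>{..<tm_states M}\<close>, where \<open>0\<close> is initial, \<open>1\<close> accepting and
  \<open>2\<close> rejecting; tape symbols are \<open>{..<tm_symbols M}\<close>, where \<open>0\<close> is blank and \<open>1\<close>, \<open>2\<close> are the
  input symbols. The transition function maps a state and the symbols read to the new state and,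
  for each tape, the symbol written and the head movement (\<open>-1\<close>, \<open>0\<close> or \<open>1\<close>).
\<close>

record tm =
  tm_tapes :: nat
  tm_states :: nat
  tm_symbols :: nat
  tm_delta :: "nat \<Rightarrow> nat list \<Rightarrow> nat \<times> (nat \<times> int) list"

definition wf_tm :: "tm \<Rightarrow> bool" where
  "wf_tm M \<longleftrightarrow> 0 < tm_tapes M \<and> 3 \<le> tm_states M \<and> 3 \<le> tm_symbols M \<and>
     (\<forall>q ss. q < tm_states M \<and> length ss = tm_tapes M \<and> set ss \<subseteq> {..<tm_symbols M} \<longrightarrow>
        fst (tm_delta M q ss) < tm_states M \<and>
        length (snd (tm_delta M q ss)) = tm_tapes M \<and>
        set (snd (tm_delta M q ss)) \<subseteq> {..<tm_symbols M} \<times> {-1, 0, 1})"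

type_synonym tape = "(int \<Rightarrow> nat) \<times> int"
type_synonym config = "nat \<times> tape list"

fun read_tape :: "tape \<Rightarrow> nat" where
  "read_tape (c, h) = c h"

fun act_tape :: "tape \<Rightarrow> nat \<times> int \<Rightarrow> tape" where
  "act_tape (c, h) (s, d) = (c(h := s), h + d)"

fun tm_step :: "tm \<Rightarrow> config \<Rightarrow> config" where
  "tm_step M (q, ts) =
     (if q = 1 \<or> q = 2 then (q, ts)
      else (let (q', as) = tm_delta M q (map read_tape ts) in (q', map2 act_tape ts as)))"

definition string_content :: "bool list \<Rightarrow> int \<Rightarrow> nat" where
  "string_content x i =
     (if 0 \<le> i \<and> i < int (length x) then (if x ! nat i then 2 else 1) else 0)"

definition tm_init :: "tm \<Rightarrow> bool list \<Rightarrow> config" where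
  "tm_init M x = (0, (string_content x, 0) # replicate (tm_tapes M - 1) (\<lambda>_. 0, 0))"

definition tm_conf :: "tm \<Rightarrow> bool list \<Rightarrow> nat \<Rightarrow> config" where
  "tm_conf M x t = (tm_step M ^^ t) (tm_init M x)"

definition tm_decides :: "tm \<Rightarrow> bool list set \<Rightarrow> bool" where
  "tm_decides M L \<longleftrightarrow> (\<forall>x. \<exists>t. fst (tm_conf M x t) = (if x \<in> L then 1 else 2))"

text \<open>
  The cells visited on a tape form an interval around \<open>0\<close>, so their number is at most \<open>2 s + 1\<close> if
  all head positions have absolute value at most \<open>s\<close>. Every polynomial is bounded by \<open>n ^ d + d\<close>
  for a suitable \<open>d\<close>.
\<close>

definition tm_poly_space :: "tm \<Rightarrow> bool" where
  "tm_poly_space M \<longleftrightarrow>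
     (\<exists>d. \<forall>x t. \<forall>(c, h) \<in> set (snd (tm_conf M x t)). \<bar>h\<bar> \<le> int (length x ^ d + d))"

definition PSPACE :: "bool list set set" where
  "PSPACE = {L. \<exists>M. wf_tm M \<and> tm_decides M L \<and> tm_poly_space M}"

text \<open>The output is the content of the last tape upon halting in state \<open>1\<close>.\<close>

definition poly_time_computable :: "(bool list \<Rightarrow> bool list) \<Rightarrow> bool" where
  "poly_time_computable f \<longleftrightarrow>
     (\<exists>M d. wf_tm M \<and> (\<forall>x. \<exists>t \<le> length x ^ d + d.
        fst (tm_conf M x t) = 1 \<and>
        fst (last (snd (tm_conf M x t))) = string_content (f x)))"

text \<open>
  A promise problem is given by its yes-instances \<open>Y\<close> and its no-instances \<open>N\<close>. Strings in neither
  violate the promise: a decision procedure may answer arbitrarily on them, and a reduction must not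
  produce them.
\<close>

definition promise_in_PSPACE :: "bool list set \<Rightarrow> bool list set \<Rightarrow> bool" where
  "promise_in_PSPACE Y N \<longleftrightarrow> (\<exists>L\<in>PSPACE. Y \<subseteq> L \<and> L \<inter> N = {})"

definition promise_PSPACE_hard :: "bool list set \<Rightarrow> bool list set \<Rightarrow> bool" where
  "promise_PSPACE_hard Y N \<longleftrightarrow>
     (\<forall>L\<in>PSPACE. \<exists>f. poly_time_computable f \<and>
        (\<forall>x. (x \<in> L \<longrightarrow> f x \<in> Y) \<and> (x \<notin> L \<longrightarrow> f x \<in> N)))"

definition promise_PSPACE_complete :: "bool list set \<Rightarrow> bool list set \<Rightarrow> bool" where
  "promise_PSPACE_complete Y N \<longleftrightarrow> promise_in_PSPACE Y N \<and> promise_PSPACE_hard Y N"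


section \<open>The position problem\<close>

text \<open>
  An instance is written as a sequence of numbers, each in binary (least significant bit first).
  Every bit is preceded by \<open>True\<close> and the number is closed by \<open>False\<close>, so that the sequence can be
  recovered. All list lengths are determined by the numbers preceding them.
\<close>

fun nat_bits :: "nat \<Rightarrow> bool list" where
  "nat_bits n = (if n = 0 then [] else odd n # nat_bits (n div 2))"

declare nat_bits.simps [simp del]

definition encode_nat :: "nat \<Rightarrow> bool list" where
  "encode_nat n = concat (map (\<lambda>b. [True, b]) (nat_bits n)) @ [False]"

definition dts_numbers :: "nat \<Rightarrow> 'z dts_scheme \<Rightarrow> nat list" where
  "dts_numbers m A = nstates A # init A #
     concat (map (\<lambda>q. map (step A q) [0..<m]) [0..<nstates A])"

definition dfa_numbers :: "nat \<Rightarrow> dfa \<Rightarrow> nat list" where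
  "dfa_numbers m A = dts_numbers m A @ map (\<lambda>q. of_bool (q \<in> final A)) [0..<nstates A]"

definition fdfa_numbers :: "fdfa \<Rightarrow> nat list" where
  "fdfa_numbers F = alph F # dts_numbers (alph F) (leading F) @
     concat (map (\<lambda>q. dfa_numbers (alph F) (progress F q)) [0..<nstates (leading F)])"

fun wsign_number :: "wsign \<Rightarrow> nat" where
  "wsign_number Plus = 0"
| "wsign_number Minus = 1"
| "wsign_number PlusMinus = 2"

definition encode_instance :: "fdfa \<Rightarrow> wsign \<Rightarrow> nat \<Rightarrow> bool list" where
  "encode_instance F s k =
     concat (map encode_nat (fdfa_numbers F @ [wsign_number s, k]))"

definition position_yes :: "bool list set" where
  "position_yes = {encode_instance F s k | F s k. wf_fdfa F \<and> saturated F \<and> 0 < k \<and>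
     wagner_position (alph F) (fdfa_language F) s k}"

definition position_no :: "bool list set" where
  "position_no = {encode_instance F s k | F s k. wf_fdfa F \<and> saturated F \<and> 0 < k \<and>
     \<not> wagner_position (alph F) (fdfa_language F) s k}"

end

theory Submission
  imports Defs
begin

text \<open>
  The position of an \<open>\<omega>\<close>-regular language depends only on the lengths of alternating chains of words
  \<open>v 0, \<dots>, v (k - 1)\<close> after a prefix \<open>u\<close>: membership of a word that repeats some of the \<open>v i\<close> forever is
  decided by the parity of the largest index repeated. Such chains correspond to the inclusion chains of
  SCCs of a Muller automaton, all of whose states are reachable. The language of a saturated FDFA is
  \<open>\<omega>\<close>-regular because the words inducing the same transformations form a finite congruence, for which
  McNaughton's theorem is proved.

  Upper bound: as powers are idempotent, a chain for a saturated FDFA can be chosen such that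
  \<open>e i @ e j\<close> and \<open>e (max i j)\<close> lead to the same state of one progress DFA. Its existence is
  equivalent to the existence of sets of states \<open>T 0, \<dots>, T k\<close> such that for every \<open>i\<close> a single word maps each
  \<open>T j\<close> into \<open>T (max (i + 1) j)\<close>. These sets are guessed, and the words are found by Savitch's argument on
  tuples of sets. The procedure is written as an arithmetic expression with bounded iteration and
  quantified Boolean arrays, which is compiled to a Turing machine.

  Lower bound: a computation in polynomial space is a word of letters that announce the machine state and the
  symbols read, and it is correct iff small monitors, one for each tape cell, all accept it. The
  progress DFA has an odd level for each monitor and even levels between them; an accepting loop on level
  \<open>2 * c + 1\<close> runs monitor \<open>c\<close>. A chain of length \<open>2 * m + 1\<close> visits all \<open>m\<close> monitors with the same word, and it
  exists iff the machine accepts.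
\<close>

section \<open>A programming language for Turing machines\<close>

text \<open>The Muller automaton that McNaughton's theorem yields is too large to be inspected in
  polynomial space. Chains are therefore restated by words, which can be tested on one progress DFA:
  products of idempotents turn a chain into loops that absorb all smaller ones. It suffices that all
  words with the same largest index end in a set on which acceptance is constant; saturation
  transfers acceptance from a power of a word to the word itself. The number \<open>k\<close> is
  written in binary, but no chain exceeds the size of a progress DFA, so a large \<open>k\<close> is
  refuted at once.

  In the lower bound the family has to be saturated also for rejected inputs. Acceptance of a loop
  must not depend on where the loop is cut, whereas a check has to begin somewhere. Therefore a
  monitor waits for a separator, starts afresh at each one, and a failure raises the level for good.
  As levels never fall, \<open>m\<close> accepting levels admit no chain with \<open>m + 1\<close>
  accepting members; this settles one of the two conditions on the position in advance.\<close>

text \<open>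
  Register \<open>r\<close> is the head position of tape \<open>r\<close>. Numbers are thus in unary, and a bound on the registers
  is a bound on the space.
\<close>

datatype test = Nz nat | Ne nat nat

datatype com = Skip | Halt bool | Inc nat | Dec nat | Put nat nat | Emit bool
  | Seq com com (infixr \<open>;;\<close> 60) | Cond test com com | While test com

type_synonym mem = "(nat \<Rightarrow> nat) \<times> (nat \<Rightarrow> nat \<Rightarrow> nat) \<times> bool list"

datatype act = Nop | AInc nat | ADec nat | APut nat nat | AEmit bool

fun holds :: "mem \<Rightarrow> test \<Rightarrow> bool" where
  "holds (p, c, w) (Nz r) \<longleftrightarrow> p r \<noteq> 0"
| "holds (p, c, w) (Ne r s) \<longleftrightarrow> c r (p r) \<noteq> s"

fun perform :: "act \<Rightarrow> mem \<Rightarrow> mem" where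
  "perform Nop \<mu> = \<mu>"
| "perform (AInc r) (p, c, w) = (p(r := Suc (p r)), c, w)"
| "perform (ADec r) (p, c, w) = (p(r := p r - 1), c, w)"
| "perform (APut r s) (p, c, w) = (p, c(r := (c r)(p r := s)), w)"
| "perform (AEmit b) (p, c, w) = (p, c, w @ [b])"

text \<open>The memory enters only through the truth of tests. The transition function of the
  machine can therefore be the same function, applied to the tests as decided by the symbols under
  the heads.\<close>

fun nxt :: "(test \<Rightarrow> bool) \<Rightarrow> com \<Rightarrow> com \<times> act" where
  "nxt t Skip = (Skip, Nop)"
| "nxt t (Halt b) = (Halt b, Nop)"
| "nxt t (Inc r) = (Skip, AInc r)"
| "nxt t (Dec r) = (Skip, ADec r)"
| "nxt t (Put r s) = (Skip, APut r s)"
| "nxt t (Emit b) = (Skip, AEmit b)"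
| "nxt t (k ;; l) = (if k = Skip then (l, Nop) else (fst (nxt t k) ;; l, snd (nxt t k)))"
| "nxt t (Cond b k l) = (if t b then k else l, Nop)"
| "nxt t (While b k) = (if t b then k ;; While b k else Skip, Nop)"

definition cstep :: "com \<times> mem \<Rightarrow> com \<times> mem" where
  "cstep x = (fst (nxt (holds (snd x)) (fst x)), perform (snd (nxt (holds (snd x)) (fst x))) (snd x))"

text \<open>\<open>run B\<close> describes the runs during which no register exceeds \<open>B\<close>; \<open>Halt\<close> has none.\<close>

inductive run :: "nat \<Rightarrow> com \<Rightarrow> mem \<Rightarrow> mem \<Rightarrow> bool" for B where
  run_Skip: "run B Skip \<mu> \<mu>"
| run_Inc: "Suc (p r) \<le> B \<Longrightarrow> run B (Inc r) (p, c, w) (p(r := Suc (p r)), c, w)"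
| run_Dec: "run B (Dec r) (p, c, w) (p(r := p r - 1), c, w)"
| run_Put: "run B (Put r s) (p, c, w) (p, c(r := (c r)(p r := s)), w)"
| run_Emit: "run B (Emit b) (p, c, w) (p, c, w @ [b])"
| run_Seq: "run B k \<mu> \<mu>' \<Longrightarrow> run B l \<mu>' \<mu>'' \<Longrightarrow> run B (k ;; l) \<mu> \<mu>''"
| run_True: "holds \<mu> b \<Longrightarrow> run B k \<mu> \<mu>' \<Longrightarrow> run B (Cond b k l) \<mu> \<mu>'"
| run_False: "\<not> holds \<mu> b \<Longrightarrow> run B l \<mu> \<mu>' \<Longrightarrow> run B (Cond b k l) \<mu> \<mu>'"
| run_Stop: "\<not> holds \<mu> b \<Longrightarrow> run B (While b k) \<mu> \<mu>"
| run_Loop: "holds \<mu> b \<Longrightarrow> run B k \<mu> \<mu>' \<Longrightarrow> run B (While b k) \<mu>' \<mu>'' \<Longrightarrow> run B (While b k) \<mu> \<mu>''"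

definition bounded :: "nat \<Rightarrow> mem \<Rightarrow> bool" where
  "bounded B \<mu> \<longleftrightarrow> (\<forall>r. fst \<mu> r \<le> B)"

text \<open>Excluding \<open>Skip\<close> allows a step of \<open>k\<close> to be replayed inside
  \<open>k ;; l\<close>, where \<open>Skip ;; l\<close> would already pass on to
  \<open>l\<close>.\<close>

definition bstep :: "nat \<Rightarrow> com \<times> mem \<Rightarrow> com \<times> mem \<Rightarrow> bool" where
  "bstep B x y \<longleftrightarrow> fst x \<noteq> Skip \<and> y = cstep x \<and> bounded B (snd x) \<and> bounded B (snd y)"

lemma bsteps_Seq:
  "(bstep B)\<^sup>*\<^sup>* (k, \<mu>) (k', \<mu>') \<Longrightarrow> (bstep B)\<^sup>*\<^sup>* (k ;; l, \<mu>) (k' ;; l, \<mu>')"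
proof (induction "(k', \<mu>')" arbitrary: k' \<mu>' rule: rtranclp_induct)
  case base
  then show ?case by simp
next
  case (step y)
  obtain k1 \<mu>1 where y: "y = (k1, \<mu>1)" by (cases y)
  have "bstep B (k1 ;; l, \<mu>1) (k' ;; l, \<mu>')"
    using step(2) by (auto simp: y bstep_def cstep_def)
  with step(3)[OF y] show ?case by simp
qed

lemma run_bsteps:
  "run B k \<mu> \<mu>' \<Longrightarrow> bounded B \<mu> \<Longrightarrow> (bstep B)\<^sup>*\<^sup>* (k, \<mu>) (Skip, \<mu>') \<and> bounded B \<mu>'"
proof (induction rule: run.induct)
  case (run_Seq k \<mu> \<mu>' l \<mu>'')
  have "bstep B (Skip ;; l, \<mu>') (l, \<mu>')"
    using run_Seq by (auto simp: bstep_def cstep_def)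
  then show ?case using run_Seq bsteps_Seq[of B k \<mu> Skip \<mu>' l]
    by (meson converse_rtranclp_into_rtranclp rtranclp_trans)
next
  case (run_True \<mu> b k \<mu>' l)
  then have "bstep B (Cond b k l, \<mu>) (k, \<mu>)" by (auto simp: bstep_def cstep_def)
  then show ?case using run_True by (meson converse_rtranclp_into_rtranclp)
next
  case (run_False \<mu> b l \<mu>' k)
  then have "bstep B (Cond b k l, \<mu>) (l, \<mu>)" by (auto simp: bstep_def cstep_def)
  then show ?case using run_False by (meson converse_rtranclp_into_rtranclp)
next
  case (run_Loop \<mu> b k \<mu>' \<mu>'')
  have "bstep B (While b k, \<mu>) (k ;; While b k, \<mu>)" using run_Loop by (auto simp: bstep_def cstep_def)
  moreover have "bstep B (Skip ;; While b k, \<mu>') (While b k, \<mu>')"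
    using run_Loop by (auto simp: bstep_def cstep_def)
  ultimately show ?case using run_Loop bsteps_Seq[of B k \<mu> Skip \<mu>' "While b k"]
    by (meson converse_rtranclp_into_rtranclp rtranclp_trans)
next
  case (run_Inc p r c w)
  then show ?case
    by (intro conjI r_into_rtranclp) (simp_all add: bstep_def cstep_def bounded_def)
next
  case (run_Dec r p c w)
  have "p v - 1 \<le> B" for v
    using run_Dec le_trans[OF diff_le_self] by (simp add: bounded_def)
  with run_Dec show ?case
    by (intro conjI r_into_rtranclp) (simp_all add: bstep_def cstep_def bounded_def)
next
  case (run_Put r s p c w)
  then show ?case by (intro conjI r_into_rtranclp) (simp_all add: bstep_def cstep_def bounded_def)
next
  case (run_Emit b p c w)
  then show ?case by (intro conjI r_into_rtranclp) (simp_all add: bstep_def cstep_def bounded_def)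
next
  case (run_Stop \<mu> b k)
  then have "bstep B (While b k, \<mu>) (Skip, \<mu>)" by (simp add: bstep_def cstep_def)
  then show ?case using run_Stop by auto
qed auto

lemma bsteps_funpow:
  assumes "(bstep B)\<^sup>*\<^sup>* x y" "bounded B (snd x)"
  shows "\<exists>t. (cstep ^^ t) x = y \<and> (\<forall>i\<le>t. bounded B (snd ((cstep ^^ i) x)))"
  using assms(1)
proof (induction rule: rtranclp_induct)
  case base
  then show ?case using assms(2) by (intro exI[of _ 0]) auto
next
  case (step y z)
  then obtain t where "(cstep ^^ t) x = y" "\<forall>i\<le>t. bounded B (snd ((cstep ^^ i) x))" by blast
  with step(2) show ?case
    by (intro exI[of _ "Suc t"]) (auto simp: bstep_def le_Suc_eq)
qed

text \<open>The commands into which \<open>k\<close> can evolve. They are finitely many, since a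
  loop only puts residuals of its body in front of itself, and they become the control states of the
  machine.\<close>

fun residuals :: "com \<Rightarrow> com set" where
  "residuals (k ;; l) = (\<lambda>k'. k' ;; l) ` residuals k \<union> residuals l"
| "residuals (Cond b k l) = {Cond b k l} \<union> residuals k \<union> residuals l"
| "residuals (While b k) = {While b k, Skip} \<union> (\<lambda>k'. k' ;; While b k) ` residuals k"
| "residuals k = {k, Skip}"

lemma finite_residuals: "finite (residuals k)"
  by (induction k) auto

lemma residuals_self: "k \<in> residuals k"
  by (induction k) auto

lemma residuals_nxt: "k' \<in> residuals k \<Longrightarrow> fst (nxt t k') \<in> residuals k"
  by (induction k arbitrary: k') (auto simp: residuals_self split: if_splits)

fun test_ok :: "nat \<Rightarrow> test \<Rightarrow> bool" where
  "test_ok K (Nz r) \<longleftrightarrow> r < K"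
| "test_ok K (Ne r s) \<longleftrightarrow> r < K"

primrec com_ok :: "nat \<Rightarrow> com \<Rightarrow> bool" where
  "com_ok K (Inc r) \<longleftrightarrow> r < K"
| "com_ok K (Dec r) \<longleftrightarrow> r < K"
| "com_ok K (Put r s) \<longleftrightarrow> r < K \<and> s < 3"
| "com_ok K (k ;; l) \<longleftrightarrow> com_ok K k \<and> com_ok K l"
| "com_ok K (Cond b k l) \<longleftrightarrow> test_ok K b \<and> com_ok K k \<and> com_ok K l"
| "com_ok K (While b k) \<longleftrightarrow> test_ok K b \<and> com_ok K k"
| "com_ok K Skip \<longleftrightarrow> True"
| "com_ok K (Halt b) \<longleftrightarrow> True"
| "com_ok K (Emit b) \<longleftrightarrow> True"

lemma com_ok_residuals: "com_ok K k \<Longrightarrow> k' \<in> residuals k \<Longrightarrow> com_ok K k'"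
proof (induction k arbitrary: k')
  case (Seq k l)
  from Seq.prems(1) have kl: "com_ok K k" "com_ok K l" by simp_all
  note IH = Seq.IH(1)[OF kl(1)] Seq.IH(2)[OF kl(2)]
  from Seq.prems(2) show ?case using IH kl(2) by auto
next
  case (Cond b k l)
  from Cond.prems(1) have kl: "com_ok K k" "com_ok K l" by simp_all
  note IH = Cond.IH(1)[OF kl(1)] Cond.IH(2)[OF kl(2)]
  from Cond.prems show ?case using IH by auto
next
  case (While b k)
  from While.prems(1) have k: "com_ok K k" by simp
  note IH = While.IH[OF k]
  from While.prems show ?case using IH by auto
qed auto

definition states_of :: "com \<Rightarrow> com set" where
  "states_of k = residuals k \<union> {Halt True, Halt False}"

lemma states_of_self: "k \<in> states_of k"
  by (simp add: states_of_def residuals_self)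

definition enum :: "com \<Rightarrow> com \<Rightarrow> nat" where
  "enum k = (SOME f. inj_on f (states_of k) \<and> f ` states_of k = {..<card (states_of k)})"

lemma finite_states_of: "finite (states_of k)"
  by (simp add: states_of_def finite_residuals)

lemma enum: "inj_on (enum k) (states_of k)" "enum k ` states_of k = {..<card (states_of k)}"
proof -
  obtain f where "bij_betw f (states_of k) {0..<card (states_of k)}"
    using ex_bij_betw_finite_nat[OF finite_states_of] by blast
  then have "inj_on f (states_of k) \<and> f ` states_of k = {..<card (states_of k)}"
    by (auto simp: bij_betw_def)
  then have "inj_on (enum k) (states_of k) \<and> enum k ` states_of k = {..<card (states_of k)}"
    unfolding enum_def by (rule someI[where P = "\<lambda>f. inj_on f (states_of k) \<and> f ` states_of k = {..<card (states_of k)}"])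
  then show "inj_on (enum k) (states_of k)" "enum k ` states_of k = {..<card (states_of k)}"
    by blast+
qed

text \<open>States 1 and 2 are prescribed for halting, and 0 is reserved for the very first step,
  which prepares the tapes.\<close>

definition code :: "com \<Rightarrow> com \<Rightarrow> nat" where
  "code k l = (if l = Halt True then 1 else if l = Halt False then 2 else 3 + enum k l)"

definition decode :: "com \<Rightarrow> nat \<Rightarrow> com" where
  "decode k q = (if q \<in> code k ` states_of k then inv_into (states_of k) (code k) q else Halt True)"

lemma inj_code: "inj_on (code k) (states_of k)"
  using enum(1)[of k] by (auto simp: inj_on_def code_def)

lemma decode_code: "l \<in> states_of k \<Longrightarrow> decode k (code k l) = l"
  by (simp add: decode_def inv_into_f_f[OF inj_code])

lemma decode_in: "decode k q \<in> states_of k"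
  unfolding decode_def by (simp add: inv_into_into) (simp add: states_of_def)

lemma code_less: "l \<in> states_of k \<Longrightarrow> code k l < 3 + card (states_of k)"
  using enum(2)[of k] by (auto simp: code_def)

lemma states_nxt: "l \<in> states_of k \<Longrightarrow> fst (nxt t l) \<in> states_of k"
  by (auto simp: states_of_def residuals_nxt)

lemma code_halt: "l \<in> states_of k \<Longrightarrow> code k l = 1 \<longleftrightarrow> l = Halt True"
  "l \<in> states_of k \<Longrightarrow> code k l = 2 \<longleftrightarrow> l = Halt False" "code k l \<noteq> 0"
  by (auto simp: code_def)

text \<open>A cell at position \<open>0\<close> carries its symbol increased by \<open>3\<close>, so that the head can recognize it.\<close>

fun sym_holds :: "nat list \<Rightarrow> test \<Rightarrow> bool" where
  "sym_holds ss (Nz r) \<longleftrightarrow> ss ! r < 3"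
| "sym_holds ss (Ne r s) \<longleftrightarrow> ss ! r mod 3 \<noteq> s"

text \<open>The tapes below \<open>K\<close> are the registers, and tape \<open>K\<close> is the
  output. At a marked cell a decrement does not move, in accordance with \<open>0 - 1 = 0\<close>,
  and a write preserves the mark. Reducing \<open>s\<close> modulo 3 keeps the machine well-formed
  for every command.\<close>

fun act_on :: "nat \<Rightarrow> act \<Rightarrow> nat list \<Rightarrow> nat \<Rightarrow> nat \<times> int" where
  "act_on K (AInc r) ss v = (ss ! v, if v = r then 1 else 0)"
| "act_on K (ADec r) ss v = (ss ! v, if v = r \<and> ss ! v < 3 then - 1 else 0)"
| "act_on K (APut r s) ss v =
    (if v = r then s mod 3 + (if ss ! v < 3 then 0 else 3) else ss ! v, 0)"
| "act_on K (AEmit b) ss v = (if v = K then (if b then 2 else 1, 1) else (ss ! v, 0))"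
| "act_on K Nop ss v = (ss ! v, 0)"

text \<open>The transition from state 0 sets the marks. The output tape is left unmarked, because
  its content is the result.\<close>

definition tm_of :: "nat \<Rightarrow> com \<Rightarrow> tm" where
  "tm_of K k = \<lparr>tm_tapes = Suc K, tm_states = 3 + card (states_of k), tm_symbols = 6,
     tm_delta = (\<lambda>q ss.
       if q = 0 then (code k k, map (\<lambda>v. (if v < K then ss ! v mod 3 + 3 else ss ! v, 0)) [0..<Suc K])
       else (code k (fst (nxt (sym_holds ss) (decode k q))),
             map (act_on K (snd (nxt (sym_holds ss) (decode k q))) ss) [0..<Suc K]))\<rparr>"

lemma wf_tm_of: "wf_tm (tm_of K k)"
proof -
  have nth6: "ss ! v < 6" if "length ss = Suc K" "set ss \<subseteq> {..<6}" "v < Suc K" for v and ss :: "nat list"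
  proof -
    have "ss ! v \<in> set ss" using that(1,3) by simp
    with that(2) show ?thesis by blast
  qed
  have 1: "act_on K a ss v \<in> {..<6} \<times> {-1, 0, 1}"
    if "length ss = Suc K" "set ss \<subseteq> {..<6}" "v < Suc K" for a ss v
    using nth6[OF that] by (cases a) auto
  have 2: "ss ! v mod 3 + 3 < (6::nat)" for ss v by simp
  show ?thesis
    unfolding wf_tm_def tm_of_def using 1 2 nth6
    by (auto simp: code_less states_nxt decode_in states_of_self image_subset_iff simp del: upt_Suc)
qed

section \<open>Simulation of commands by the machine\<close>

definition tape_of :: "mem \<Rightarrow> nat \<Rightarrow> tape" where
  "tape_of \<mu> v = (\<lambda>i. if i < 0 then 0 else fst (snd \<mu>) v (nat i) + (if i = 0 then 3 else 0),
     int (fst \<mu> v))"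

definition tapes_of :: "nat \<Rightarrow> mem \<Rightarrow> tape list" where
  "tapes_of K \<mu> = map (tape_of \<mu>) [0..<K] @
     [(string_content (snd (snd \<mu>)), int (length (snd (snd \<mu>))))]"

lemma string_content_append:
  "string_content (w @ [b]) = (string_content w)(int (length w) := if b then 2 else 1)"
  by (auto simp: string_content_def fun_eq_iff nth_append)

lemma tapes_of_nth:
  "v < K \<Longrightarrow> tapes_of K \<mu> ! v = tape_of \<mu> v"
  "tapes_of K \<mu> ! K = (string_content (snd (snd \<mu>)), int (length (snd (snd \<mu>))))"
  "length (tapes_of K \<mu>) = Suc K"
  by (auto simp: tapes_of_def nth_append)

definition small :: "mem \<Rightarrow> bool" where
  "small \<mu> \<longleftrightarrow> (\<forall>v i. fst (snd \<mu>) v i < 3)"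

lemma read_tape_of: "v < K \<Longrightarrow>
  map read_tape (tapes_of K (p, c, w)) ! v = c v (p v) + (if p v = 0 then 3 else 0)"
  by (simp add: tapes_of_nth) (simp add: tape_of_def)

lemma sym_holds_tapes:
  assumes "small \<mu>" "test_ok K b"
  shows "sym_holds (map read_tape (tapes_of K \<mu>)) b = holds \<mu> b"
proof -
  obtain p c w where \<mu>: "\<mu> = (p, c, w)" by (cases \<mu>)
  have "c r i < 3 \<and> c r i mod 3 = c r i" for r i using assms(1) by (auto simp: small_def \<mu>)
  then show ?thesis using assms(2)
    by (cases b) (auto simp: \<mu> read_tape_of simp del: nth_map)
qed

lemma nxt_cong:
  assumes "com_ok K k" "\<And>b. test_ok K b \<Longrightarrow> t b = t' b"
  shows "nxt t k = nxt t' k"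
  using assms by (induction k) auto

fun act_ok :: "nat \<Rightarrow> act \<Rightarrow> bool" where
  "act_ok K (AInc r) \<longleftrightarrow> r < K"
| "act_ok K (ADec r) \<longleftrightarrow> r < K"
| "act_ok K (APut r s) \<longleftrightarrow> r < K \<and> s < 3"
| "act_ok K _ \<longleftrightarrow> True"

lemma com_ok_act_ok: "com_ok K k \<Longrightarrow> act_ok K (snd (nxt t k))"
  by (induction k) auto

lemma act_tapes:
  assumes "act_ok K a" "small \<mu>"
  shows "map2 act_tape (tapes_of K \<mu>) (map (act_on K a (map read_tape (tapes_of K \<mu>))) [0..<Suc K])
    = tapes_of K (perform a \<mu>)"
proof (rule nth_equalityI)
  fix v assume "v < length (map2 act_tape (tapes_of K \<mu>) (map (act_on K a (map read_tape (tapes_of K \<mu>))) [0..<Suc K]))"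
  then have v: "v < Suc K" by (simp add: tapes_of_nth)
  obtain p c w where \<mu>: "\<mu> = (p, c, w)" by (cases \<mu>)
  have 3: "c r i < 3" for r i using assms(2) by (auto simp: small_def \<mu>)
  have L: "map2 act_tape (tapes_of K \<mu>) (map (act_on K a (map read_tape (tapes_of K \<mu>))) [0..<Suc K]) ! v
    = act_tape (tapes_of K \<mu> ! v) (act_on K a (map read_tape (tapes_of K \<mu>)) v)"
    using v by (simp add: tapes_of_nth del: upt_Suc)
  show "map2 act_tape (tapes_of K \<mu>) (map (act_on K a (map read_tape (tapes_of K \<mu>))) [0..<Suc K]) ! v
    = tapes_of K (perform a \<mu>) ! v"
  proof (cases "v = K")
    case True
    have "map read_tape (tapes_of K \<mu>) ! K = string_content w (int (length w))"
      by (simp add: tapes_of_nth \<mu>)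
    then show ?thesis using assms(1) True unfolding L
      by (cases a) (auto simp: tapes_of_nth \<mu> string_content_append string_content_def fun_eq_iff simp del: nth_map)
  next
    case False
    then have vK: "v < K" using v by simp
    have R: "map read_tape (tapes_of K (p, c, w)) ! v = c v (p v) + (if p v = 0 then 3 else 0)"
      using vK by (simp add: read_tape_of \<mu> del: nth_map)
    show ?thesis using assms(1) vK 3[of v "p v"] unfolding L
      by (cases a) (auto simp: tapes_of_nth R \<mu> tape_of_def fun_eq_iff nat_diff_distrib of_nat_diff simp del: nth_map)
  qed
qed (simp add: tapes_of_nth)

lemma small_perform: "act_ok K a \<Longrightarrow> small \<mu> \<Longrightarrow> small (perform a \<mu>)"
  by (cases "(a, \<mu>)" rule: perform.cases) (auto simp: small_def)

lemma tm_step_of: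
  assumes "com_ok K k" "l \<in> states_of k" "small \<mu>"
  shows "tm_step (tm_of K k) (code k l, tapes_of K \<mu>) =
    (code k (fst (cstep (l, \<mu>))), tapes_of K (snd (cstep (l, \<mu>))))"
proof (cases "\<exists>b. l = Halt b")
  case True
  then show ?thesis by (auto simp: code_def cstep_def)
next
  case False
  then have "code k l \<noteq> 1" "code k l \<noteq> 2" "code k l \<noteq> 0" using assms(2) False code_halt by blast+
  moreover have okl: "com_ok K l" using assms com_ok_residuals by (auto simp: states_of_def)
  moreover have "nxt (sym_holds (map read_tape (tapes_of K \<mu>))) l = nxt (holds \<mu>) l"
    using assms okl by (intro nxt_cong[of K]) (auto simp: sym_holds_tapes)
  ultimately show ?thesis
    using act_tapes[OF com_ok_act_ok[OF okl] assms(3), of "holds \<mu>"] assms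
    by (simp add: tm_of_def decode_code cstep_def del: upt_Suc)
qed

definition init_mem :: "bool list \<Rightarrow> mem" where
  "init_mem x = ((\<lambda>_. 0), (\<lambda>v i. if v = 0 then string_content x (int i) else 0), [])"

text \<open>The machine is one step behind, since its first step only marks the tapes.\<close>

lemma tm_conf_of:
  assumes "com_ok K k" "0 < K"
  shows "tm_conf (tm_of K k) x (Suc t) =
    (code k (fst ((cstep ^^ t) (k, init_mem x))), tapes_of K (snd ((cstep ^^ t) (k, init_mem x))))"
    "fst ((cstep ^^ t) (k, init_mem x)) \<in> states_of k \<and> small (snd ((cstep ^^ t) (k, init_mem x)))"
proof -
  have inv: "fst ((cstep ^^ t) (k, init_mem x)) \<in> states_of k \<and> small (snd ((cstep ^^ t) (k, init_mem x)))" for t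
  proof (induction t)
    case 0
    then show ?case by (auto simp: states_of_def residuals_self small_def init_mem_def string_content_def)
  next
    case (Suc t)
    then have "com_ok K (fst ((cstep ^^ t) (k, init_mem x)))"
      using assms(1) com_ok_residuals by (auto simp: states_of_def)
    moreover have "fst (cstep y) \<in> states_of k \<and> small (snd (cstep y))"
      if "com_ok K (fst y)" "fst y \<in> states_of k \<and> small (snd y)" for y
      using that by (auto simp: cstep_def states_nxt intro: small_perform[OF com_ok_act_ok])
    ultimately show ?case using Suc by simp
  qed
  have tn: "tapes_of K (init_mem x) ! v = (if v = K then (string_content [], 0) else
      ((\<lambda>i. (if v = 0 then string_content x i else 0) + (if i = 0 then 3 else 0)), 0))" if "v < Suc K" for v
    using that by (auto simp: tapes_of_def nth_append init_mem_def tape_of_def fun_eq_iff string_content_def)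
  have 0: "tm_conf (tm_of K k) x 1 = (code k k, tapes_of K (init_mem x))"
  proof -
    let ?ts = "(string_content x, 0::int) # replicate K (\<lambda>_. 0, 0)"
    have lt: "length (tapes_of K (init_mem x)) = Suc K" by (simp add: tapes_of_nth)
    have "tm_step (tm_of K k) (0, ?ts) = (code k k, tapes_of K (init_mem x))"
      using assms(2)
      apply (simp add: tm_of_def del: upt_Suc)
      apply (rule nth_equalityI)
       apply (simp add: lt)
      apply (auto simp: tn nth_Cons' string_content_def fun_eq_iff simp del: upt_Suc)
      done
    then show ?thesis by (simp add: tm_conf_def tm_init_def tm_of_def)
  qed
  show "tm_conf (tm_of K k) x (Suc t) =
    (code k (fst ((cstep ^^ t) (k, init_mem x))), tapes_of K (snd ((cstep ^^ t) (k, init_mem x))))"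
  proof (induction t)
    case 0
    then show ?case using \<open>tm_conf (tm_of K k) x 1 = _\<close> by simp
  next
    case (Suc t)
    have "tm_conf (tm_of K k) x (Suc (Suc t)) = tm_step (tm_of K k) (tm_conf (tm_of K k) x (Suc t))"
      by (simp add: tm_conf_def)
    then show ?case
      using Suc tm_step_of[OF assms(1), of "fst ((cstep ^^ t) (k, init_mem x))" "snd ((cstep ^^ t) (k, init_mem x))"] inv[of t]
      by simp
  qed
  show "fst ((cstep ^^ t) (k, init_mem x)) \<in> states_of k \<and> small (snd ((cstep ^^ t) (k, init_mem x)))"
    by (rule inv)
qed

text \<open>The base \<open>n + 2\<close> is at least 2, so constants and sums are absorbed by a
  larger exponent.\<close>

definition polyb :: "(nat \<Rightarrow> nat) \<Rightarrow> bool" where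
  "polyb f \<longleftrightarrow> (\<exists>a. \<forall>n. f n \<le> (n + 2) ^ a)"

lemma polyb_const: "polyb (\<lambda>_. c)"
proof -
  have "c \<le> (n + 2) ^ c" for n
    by (rule order.trans[OF less_imp_le[OF less_exp[of c]]]) (simp add: power_mono)
  then show ?thesis unfolding polyb_def by blast
qed

lemma polyb_id: "polyb (\<lambda>n. n)"
  unfolding polyb_def by (intro exI[of _ 1]) simp

lemma polyb_add:
  assumes "polyb f" "polyb g" shows "polyb (\<lambda>n. f n + g n)"
proof -
  obtain a b where ab: "\<And>n. f n \<le> (n + 2) ^ a" "\<And>n. g n \<le> (n + 2) ^ b"
    using assms unfolding polyb_def by blast
  have "f n + g n \<le> (n + 2) ^ (a + b + 1)" for n
  proof -
    have "f n \<le> (n + 2) ^ (a + b)" "g n \<le> (n + 2) ^ (a + b)"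
      using ab[of n] by (meson le_add1 le_add2 le_trans one_le_numeral power_increasing trans_le_add2)+
    then have "f n + g n \<le> 2 * (n + 2) ^ (a + b)" by simp
    also have "\<dots> \<le> (n + 2) * (n + 2) ^ (a + b)" by (rule mult_right_mono) auto
    finally show ?thesis by simp
  qed
  then show ?thesis unfolding polyb_def by blast
qed

lemma polyb_mult:
  assumes "polyb f" "polyb g" shows "polyb (\<lambda>n. f n * g n)"
proof -
  obtain a b where ab: "\<And>n. f n \<le> (n + 2) ^ a" "\<And>n. g n \<le> (n + 2) ^ b"
    using assms unfolding polyb_def by blast
  have "f n * g n \<le> (n + 2) ^ (a + b)" for n
    unfolding power_add by (intro mult_le_mono ab)
  then show ?thesis unfolding polyb_def by blast
qed

lemma polyb_power: "polyb f \<Longrightarrow> polyb (\<lambda>n. f n ^ k)"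
  by (induction k) (auto intro: polyb_mult polyb_const)

lemma polyb_bound:
  assumes "polyb f" shows "\<exists>d. \<forall>n. f n \<le> n ^ d + d"
proof -
  obtain a where a: "\<And>n. f n \<le> (n + 2) ^ a" using assms unfolding polyb_def by blast
  \<comment> \<open>The summand \<open>3 ^ a\<close> takes care of \<open>n < 2\<close>; for larger
    \<open>n\<close> the exponent \<open>2 * a\<close> suffices, because
    \<open>n + 2 \<le> n * n\<close>.\<close>
  have "f n \<le> n ^ (3 ^ a + 2 * a) + (3 ^ a + 2 * a)" for n
  proof (cases "n < 2")
    case True
    have "f n \<le> (n + 2) ^ a" by (rule a)
    also have "\<dots> \<le> 3 ^ a" using True by (intro power_mono) auto
    finally show ?thesis by simp
  next
    case False
    then have "n + 2 \<le> 2 * n" by simp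
    also have "\<dots> \<le> n\<^sup>2" using False by (simp add: power2_eq_square)
    finally have "n + 2 \<le> n\<^sup>2" .
    then have "(n + 2) ^ a \<le> (n\<^sup>2) ^ a" by (rule power_mono) simp
    also have "\<dots> = n ^ (2 * a)" by (simp add: power_mult)
    also have "\<dots> \<le> n ^ (3 ^ a + 2 * a)" using False by (intro power_increasing) auto
    finally show ?thesis using a[of n] by (meson le_trans trans_le_add1)
  qed
  then show ?thesis by blast
qed

section \<open>From bounded runs to polynomial space and polynomial time\<close>

lemma cstep_Halt: "(cstep ^^ i) (Halt b, \<mu>) = (Halt b, \<mu>)"
  by (induction i) (auto simp: cstep_def)

lemma out_mono: "i \<le> j \<Longrightarrow> length (snd (snd (snd ((cstep ^^ i) y)))) \<le> length (snd (snd (snd ((cstep ^^ j) y))))"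
proof (induction j rule: dec_induct)
  case (step j)
  have "length (snd (snd \<mu>)) \<le> length (snd (snd (perform a \<mu>)))" for a \<mu>
    by (cases "(a, \<mu>)" rule: perform.cases) auto
  then show ?case using step by (simp add: cstep_def) (meson le_trans)
qed simp

lemma bounded_init: "bounded B (init_mem x)"
  by (simp add: bounded_def init_mem_def)

lemma run_halt:
  assumes "run B k (init_mem x) \<mu>" "l = Cond b (Halt True) (Halt False) \<or> l = Halt True"
    "h = (l = Halt True \<or> holds \<mu> b)"
  obtains t where "\<And>i. t \<le> i \<Longrightarrow> (cstep ^^ i) (k ;; l, init_mem x) = (Halt h, \<mu>)"
    "\<And>i. bounded B (snd ((cstep ^^ i) (k ;; l, init_mem x)))"
proof -
  have 1: "(bstep B)\<^sup>*\<^sup>* (k, init_mem x) (Skip, \<mu>)" "bounded B \<mu>"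
    using run_bsteps[OF assms(1) bounded_init] by auto
  have "bstep B (Skip ;; l, \<mu>) (l, \<mu>)" using 1 by (auto simp: bstep_def cstep_def)
  moreover have "(bstep B)\<^sup>*\<^sup>* (l, \<mu>) (Halt h, \<mu>)"
    using assms(2,3) 1(2)
    by (auto simp: bstep_def cstep_def intro!: r_into_rtranclp)
  ultimately have "(bstep B)\<^sup>*\<^sup>* (k ;; l, init_mem x) (Halt h, \<mu>)"
    using bsteps_Seq[OF 1(1), of l] by (meson converse_rtranclp_into_rtranclp rtranclp_trans)
  from bsteps_funpow[OF this] bounded_init obtain t where
    t: "(cstep ^^ t) (k ;; l, init_mem x) = (Halt h, \<mu>)"
    "\<forall>i\<le>t. bounded B (snd ((cstep ^^ i) (k ;; l, init_mem x)))" by auto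
  have t': "(cstep ^^ i) (k ;; l, init_mem x) = (Halt h, \<mu>)" if "t \<le> i" for i
  proof -
    have "(cstep ^^ i) (k ;; l, init_mem x) = (cstep ^^ (i - t)) ((cstep ^^ t) (k ;; l, init_mem x))"
      using that by (metis funpow_add le_add_diff_inverse2 o_apply)
    then show ?thesis by (simp add: t(1) cstep_Halt)
  qed
  moreover have "bounded B (snd ((cstep ^^ i) (k ;; l, init_mem x)))" for i
    using t t'[of i] 1(2) by (cases "i \<le> t") auto
  ultimately show thesis using that by blast
qed

lemma tm_conf_0: "tm_conf M x 0 = (0, (string_content x, 0) # replicate (tm_tapes M - 1) (\<lambda>_. 0, 0))"
  by (simp add: tm_conf_def tm_init_def)

theorem PSPACE_if_run:
  assumes "com_ok K k" "r < K" "polyb B"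
    and "\<And>x. \<exists>p c. run (B (length x)) k (init_mem x) (p, c, []) \<and> (p r \<noteq> 0 \<longleftrightarrow> x \<in> L)"
  shows "L \<in> PSPACE"
proof -
  define l where "l = Cond (Nz r) (Halt True) (Halt False)"
  define M where "M = tm_of K (k ;; l)"
  have ok: "com_ok K (k ;; l)" "0 < K" using assms by (auto simp: l_def)
  obtain d where d: "\<And>n. B n \<le> n ^ d + d" using polyb_bound[OF assms(3)] by blast
  have key: "(\<exists>t. fst (tm_conf M x t) = (if x \<in> L then 1 else 2)) \<and>
    (\<forall>t. \<forall>(c, h)\<in>set (snd (tm_conf M x t)). \<bar>h\<bar> \<le> int (B (length x)))" for x
  proof -
    obtain p c where pc: "run (B (length x)) k (init_mem x) (p, c, [])" "p r \<noteq> 0 \<longleftrightarrow> x \<in> L"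
      using assms(4) by blast
    obtain t where t: "\<And>i. t \<le> i \<Longrightarrow> (cstep ^^ i) (k ;; l, init_mem x) = (Halt (x \<in> L), (p, c, []))"
      "\<And>i. bounded (B (length x)) (snd ((cstep ^^ i) (k ;; l, init_mem x)))"
      using run_halt[OF pc(1), of l "Nz r" "x \<in> L"] pc(2) by (auto simp: l_def)
    \<comment> \<open>The output head counts for the space bound as well. It never moves: the output
      only grows and is empty at the end.\<close>
    have w: "snd (snd (snd ((cstep ^^ i) (k ;; l, init_mem x)))) = []" for i
      using out_mono[of i "max i t" "(k ;; l, init_mem x)"] t(1)[of "max i t"] by simp
    have "\<forall>(c, h)\<in>set (snd (tm_conf M x i)). \<bar>h\<bar> \<le> int (B (length x))" for i
    proof (cases i)
      case 0
      then show ?thesis by (auto simp: tm_conf_0)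
    next
      case (Suc j)
      then show ?thesis using t(2)[of j] w[of j]
        by (auto simp: M_def tm_conf_of(1)[OF ok] tapes_of_def tape_of_def bounded_def)
    qed
    moreover have "fst (tm_conf M x (Suc t)) = (if x \<in> L then 1 else 2)"
      using t(1)[of t] by (simp add: M_def tm_conf_of(1)[OF ok] code_def)
    ultimately show ?thesis by blast
  qed
  have "tm_poly_space M"
    unfolding tm_poly_space_def
  proof (intro exI[of _ d] allI ballI, clarify)
    fix x t c and h :: int assume "(c, h) \<in> set (snd (tm_conf M x t))"
    then have "\<bar>h\<bar> \<le> int (B (length x))" using key[of x] by blast
    then show "\<bar>h\<bar> \<le> int (length x ^ d + d)" using d[of "length x"] by linarith
  qed
  moreover have "tm_decides M L" unfolding tm_decides_def using key by blast
  moreover have "wf_tm M" by (simp add: M_def wf_tm_of)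
  ultimately show ?thesis unfolding PSPACE_def by blast
qed

primrec noput :: "com \<Rightarrow> bool" where
  "noput Skip \<longleftrightarrow> True" | "noput (Halt b) \<longleftrightarrow> True" | "noput (Inc r) \<longleftrightarrow> True" | "noput (Dec r) \<longleftrightarrow> True"
| "noput (Emit b) \<longleftrightarrow> True" | "noput (Put r s) \<longleftrightarrow> False" | "noput (k ;; l) \<longleftrightarrow> noput k \<and> noput l"
| "noput (Cond b k l) \<longleftrightarrow> noput k \<and> noput l" | "noput (While b k) \<longleftrightarrow> noput k"

lemma noput_nxt: "noput k \<Longrightarrow> noput (fst (nxt t k)) \<and> snd (nxt t k) \<noteq> APut r s"
  by (induction k) auto

text \<open>Without \<open>Put\<close> only the control and the head positions determine the computation, so a halting
  run cannot be longer than the number of combinations of these.\<close>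

theorem poly_time_if_run:
  assumes "com_ok K k" "0 < K" "polyb B" "noput k"
    and "\<And>x. \<exists>p c. run (B (length x)) k (init_mem x) (p, c, f x)"
  shows "poly_time_computable f"
proof -
  define k0 where "k0 = k ;; Halt True"
  define M where "M = tm_of K k0"
  define T where "T n = card (states_of k0) * Suc (B n) ^ K" for n
  have ok: "com_ok K k0" using assms by (auto simp: k0_def)
  have "polyb (\<lambda>n. Suc (T n))"
    unfolding T_def Suc_eq_plus1
    by (intro polyb_add polyb_mult polyb_power polyb_const assms)
  then obtain d where d: "\<And>n. Suc (T n) \<le> n ^ d + d" using polyb_bound by blast
  have "\<exists>t \<le> length x ^ d + d. fst (tm_conf M x t) = 1 \<and>
        fst (last (snd (tm_conf M x t))) = string_content (f x)" for x
  proof -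
    define y where "y i = (cstep ^^ i) (k0, init_mem x)" for i
    have y_Suc: "y (Suc i) = cstep (y i)" for i by (simp add: y_def)
    obtain p c where pc: "run (B (length x)) k (init_mem x) (p, c, f x)"
      using assms(5) by blast
    obtain t where t: "\<And>i. t \<le> i \<Longrightarrow> y i = (Halt True, (p, c, f x))"
      "\<And>i. bounded (B (length x)) (snd (y i))"
      using run_halt[OF pc(1), of "Halt True" undefined True] by (auto simp: k0_def y_def)
    define t0 where "t0 = (LEAST i. fst (y i) = Halt True)"
    have t0: "fst (y t0) = Halt True" unfolding t0_def by (rule LeastI[of _ t]) (simp add: t)
    have least: "fst (y i) \<noteq> Halt True" if "i < t0" for i
      using not_less_Least that unfolding t0_def by blast
    have "t0 \<le> t" unfolding t0_def by (rule Least_le) (simp add: t)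
    then have "y t = (cstep ^^ (t - t0)) (y t0)"
      unfolding y_def by (metis funpow_add le_add_diff_inverse2 o_apply)
    then have "y t = y t0" using t0 by (metis cstep_Halt prod.collapse)
    then have yt0: "y t0 = (Halt True, (p, c, f x))" using t by simp
    have inv: "noput (fst (y i)) \<and> fst (snd (snd (y i))) = fst (snd (init_mem x))" for i
    proof (induction i)
      case 0
      then show ?case using assms(4) by (simp add: y_def k0_def)
    next
      case (Suc i)
      have *: "fst (snd (perform a \<mu>)) = fst (snd \<mu>)" if "\<forall>r s. a \<noteq> APut r s" for a \<mu>
        using that by (cases "(a, \<mu>)" rule: perform.cases) auto
      show ?case using Suc noput_nxt[of "fst (y i)"] by (auto simp: y_Suc cstep_def *)
    qed
    have st: "fst (y i) \<in> states_of k0" for i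
      using tm_conf_of(2)[OF ok assms(2)] by (simp add: y_def)
    define key where "key i = (fst (y i), map (fst (snd (y i))) [0..<K])" for i
    have key_Suc: "key (Suc i) = key (Suc j)" if "key i = key j" for i j
    proof -
      obtain k1 p1 c1 w1 where yi: "y i = (k1, p1, c1, w1)" by (metis prod.collapse)
      obtain k2 p2 c2 w2 where yj: "y j = (k2, p2, c2, w2)" by (metis prod.collapse)
      have eq: "k1 = k2" "\<And>v. v < K \<Longrightarrow> p1 v = p2 v" "c1 = c2"
        using that inv[of i] inv[of j] by (auto simp: key_def yi yj)
      have okk: "com_ok K k1" using ok com_ok_residuals st[of i] by (auto simp: yi states_of_def)
      have h: "holds (p1, c1, w1) b = holds (p2, c2, w2) b" if "test_ok K b" for b
        using that eq by (cases b) auto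
      have n: "nxt (holds (p1, c1, w1)) k1 = nxt (holds (p2, c2, w2)) k2"
        unfolding eq(1)[symmetric] by (rule nxt_cong[OF okk h])
      have "fst (perform a (p1, c1, w1)) v = fst (perform a (p2, c2, w2)) v" if "v < K" for a v
        using eq that by (cases a) auto
      then show ?thesis by (simp add: key_def y_Suc cstep_def yi yj n)
    qed
    \<comment> \<open>A repetition at times \<open>i < j\<close> would make the computation halt
      already at time \<open>t0 - (j - i)\<close>.\<close>
    have "inj_on key {..t0}"
    proof (rule linorder_inj_onI')
      fix i j assume ij: "i \<in> {..t0}" "i < j" "j \<in> {..t0}"
      show "key i \<noteq> key j"
      proof
        have lt: "i + (t0 - j) < t0" using ij by simp
        assume "key i = key j"
        then have "key (i + e) = key (j + e)" for e by (induction e) (auto intro: key_Suc)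
        from this[of "t0 - j"] have "fst (y (i + (t0 - j))) = fst (y t0)"
          using ij(3) by (simp add: key_def)
        then show False using least[of "i + (t0 - j)"] t0 lt by simp
      qed
    qed
    moreover have "key ` {..t0} \<subseteq> states_of k0 \<times> {xs. set xs \<subseteq> {..B (length x)} \<and> length xs = K}"
      using st t(2) by (auto simp: key_def bounded_def)
    moreover have "finite (states_of k0 \<times> {xs. set xs \<subseteq> {..B (length x)} \<and> length xs = K})"
      by (intro finite_cartesian_product finite_states_of finite_lists_length_eq) simp
    ultimately have "card {..t0} \<le> card (states_of k0 \<times> {xs. set xs \<subseteq> {..B (length x)} \<and> length xs = K})"
      by (rule card_inj_on_le)
    then have "Suc t0 \<le> T (length x)"
      by (simp add: T_def card_cartesian_product card_lists_length_eq)
    then have "Suc t0 \<le> length x ^ d + d" using d[of "length x"] by linarith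
    moreover have "fst (tm_conf M x (Suc t0)) = 1 \<and>
        fst (last (snd (tm_conf M x (Suc t0)))) = string_content (f x)"
      using yt0 by (simp add: M_def tm_conf_of(1)[OF ok assms(2)] code_def tapes_of_def y_def)
    ultimately show ?thesis by blast
  qed
  then show ?thesis unfolding poly_time_computable_def using wf_tm_of[of K k0]
    unfolding M_def by blast
qed

section \<open>Expressions with bounded iteration and quantified arrays\<close>

text \<open>
  The cap in each iteration keeps all values polynomially bounded, so that they fit into registers.
  \<open>Qbf A v len u b\<close> quantifies the bits of array \<open>A\<close> in turn, bit \<open>v\<close> universally if \<open>u\<close> holds.
\<close>

datatype exp = Vr nat | Nm nat | Add exp exp | Sub exp exp | Mul exp exp | Div exp exp
  | Ite exp exp exp | Bind nat exp exp | Inp exp | Arr nat exp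
  | It nat nat exp exp exp exp | Qbf nat nat exp exp exp

text \<open>The \<open>d\<close> bits from \<open>q\<close> on are still to be quantified; the
  earlier ones are fixed in \<open>W\<close>.\<close>

fun game :: "(nat \<Rightarrow> bool) \<Rightarrow> ((nat \<Rightarrow> bool) \<Rightarrow> bool) \<Rightarrow> nat \<Rightarrow> nat \<Rightarrow> (nat \<Rightarrow> bool) \<Rightarrow> bool" where
  "game U \<psi> 0 q W = \<psi> W"
| "game U \<psi> (Suc d) q W =
    (if U q then game U \<psi> d (Suc q) (W(q := False)) \<and> game U \<psi> d (Suc q) (W(q := True))
     else game U \<psi> d (Suc q) (W(q := False)) \<or> game U \<psi> d (Suc q) (W(q := True)))"

primrec ev :: "bool list \<Rightarrow> exp \<Rightarrow> (nat \<Rightarrow> nat) \<Rightarrow> (nat \<Rightarrow> nat \<Rightarrow> bool) \<Rightarrow> nat" where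
  "ev x (Vr v) \<eta> \<alpha> = \<eta> v"
| "ev x (Nm k) \<eta> \<alpha> = k"
| "ev x (Add a b) \<eta> \<alpha> = ev x a \<eta> \<alpha> + ev x b \<eta> \<alpha>"
| "ev x (Sub a b) \<eta> \<alpha> = ev x a \<eta> \<alpha> - ev x b \<eta> \<alpha>"
| "ev x (Mul a b) \<eta> \<alpha> = ev x a \<eta> \<alpha> * ev x b \<eta> \<alpha>"
| "ev x (Div a b) \<eta> \<alpha> = ev x a \<eta> \<alpha> div ev x b \<eta> \<alpha>"
| "ev x (Ite c a b) \<eta> \<alpha> = (if ev x c \<eta> \<alpha> \<noteq> 0 then ev x a \<eta> \<alpha> else ev x b \<eta> \<alpha>)"
| "ev x (Bind v a b) \<eta> \<alpha> = ev x b (\<eta>(v := ev x a \<eta> \<alpha>)) \<alpha>"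
| "ev x (Inp a) \<eta> \<alpha> = string_content x (int (ev x a \<eta> \<alpha>))"
| "ev x (Arr A a) \<eta> \<alpha> = of_bool (\<alpha> A (ev x a \<eta> \<alpha>))"
| "ev x (It i y n cap e b) \<eta> \<alpha> = rec_nat (min (ev x e \<eta> \<alpha>) (ev x cap \<eta> \<alpha>))
     (\<lambda>j z. min (ev x b (\<eta>(i := j, y := z)) \<alpha>) (ev x cap \<eta> \<alpha>)) (ev x n \<eta> \<alpha>)"
| "ev x (Qbf A v len u b) \<eta> \<alpha> = of_bool (game (\<lambda>q. ev x u (\<eta>(v := q)) \<alpha> \<noteq> 0)
     (\<lambda>W. ev x b \<eta> (\<alpha>(A := W)) \<noteq> 0) (ev x len \<eta> \<alpha>) 0 (\<lambda>_. False))"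

text \<open>Besides the value this bounds every register that the compiled program uses on the way.
  Hence there are summands for subexpressions that do not contribute to the value, and the argument
  grows where a variable is bound.\<close>

primrec value_bound :: "exp \<Rightarrow> nat \<Rightarrow> nat" where
  "value_bound (Vr v) M = M"
| "value_bound (Nm k) M = k"
| "value_bound (Add a b) M = value_bound a M + value_bound b M"
| "value_bound (Sub a b) M = value_bound a M + value_bound b M"
| "value_bound (Mul a b) M = value_bound a M + value_bound b M + value_bound a M * value_bound b M"
| "value_bound (Div a b) M = value_bound a M + value_bound b M"
| "value_bound (Ite c a b) M = value_bound c M + value_bound a M + value_bound b M"
| "value_bound (Bind v a b) M = value_bound a M + value_bound b (M + value_bound a M)"
| "value_bound (Inp a) M = value_bound a M + 2"
| "value_bound (Arr A a) M = value_bound a M + 1"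
| "value_bound (It i y n cap e b) M = value_bound n M + value_bound cap M + value_bound e M + value_bound b (M + value_bound n M + value_bound cap M)"
| "value_bound (Qbf A v len u b) M = 1 + value_bound len M + value_bound u (M + value_bound len M) + value_bound b M"

lemma polyb_value_bound: "polyb g \<Longrightarrow> polyb (\<lambda>n. value_bound e (g n))"
proof (induction e arbitrary: g)
  case (Vr v) then show ?case by simp
next
  case (Nm k) then show ?case by (simp add: polyb_const)
next
  case (Add a b) show ?case unfolding value_bound.simps by (intro polyb_add polyb_mult polyb_const Add)
next
  case (Sub a b) show ?case unfolding value_bound.simps by (intro polyb_add polyb_mult polyb_const Sub)
next
  case (Mul a b) show ?case unfolding value_bound.simps by (intro polyb_add polyb_mult polyb_const Mul)
next
  case (Div a b) show ?case unfolding value_bound.simps by (intro polyb_add polyb_mult polyb_const Div)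
next
  case (Ite c a b) show ?case unfolding value_bound.simps by (intro polyb_add polyb_mult polyb_const Ite)
next
  case (Bind v a b) show ?case unfolding value_bound.simps by (intro polyb_add polyb_mult polyb_const Bind)
next
  case (Inp a) show ?case unfolding value_bound.simps by (intro polyb_add polyb_mult polyb_const Inp)
next
  case (Arr A a) show ?case unfolding value_bound.simps by (intro polyb_add polyb_mult polyb_const Arr)
next
  case (It i y n cap e b) show ?case unfolding value_bound.simps by (intro polyb_add polyb_mult polyb_const It)
next
  case (Qbf A v len u b) show ?case unfolding value_bound.simps by (intro polyb_add polyb_mult polyb_const Qbf)
qed

lemma ev_le: "(\<And>v. \<eta> v \<le> M) \<Longrightarrow> ev x e \<eta> \<alpha> \<le> value_bound e M"
proof (induction e arbitrary: \<eta> \<alpha> M)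
  case (Add a b)
  show ?case using Add.IH(1)[of \<eta> M \<alpha>, OF Add.prems] Add.IH(2)[of \<eta> M \<alpha>, OF Add.prems] by (simp add: add_mono)
next
  case (Sub a b)
  show ?case using Sub.IH(1)[of \<eta> M \<alpha>, OF Sub.prems] by simp
next
  case (Mul a b)
  show ?case using mult_le_mono[OF Mul.IH(1)[of \<eta> M \<alpha>, OF Mul.prems] Mul.IH(2)[of \<eta> M \<alpha>, OF Mul.prems]] by simp
next
  case (Div a b)
  have "ev x a \<eta> \<alpha> div ev x b \<eta> \<alpha> \<le> ev x a \<eta> \<alpha>" by (rule div_le_dividend)
  also have "\<dots> \<le> value_bound a M" by (rule Div.IH(1)[of \<eta> M \<alpha>, OF Div.prems])
  finally show ?case by simp
next
  case (Ite c a b)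
  show ?case using Ite.IH(2)[of \<eta> M \<alpha>, OF Ite.prems] Ite.IH(3)[of \<eta> M \<alpha>, OF Ite.prems] by simp
next
  case (Bind v a b)
  have "ev x a \<eta> \<alpha> \<le> value_bound a M" using Bind by blast
  then have "(\<eta>(v := ev x a \<eta> \<alpha>)) u \<le> M + value_bound a M" for u
    using Bind.prems[of u] by simp
  then have "ev x b (\<eta>(v := ev x a \<eta> \<alpha>)) \<alpha> \<le> value_bound b (M + value_bound a M)" by (rule Bind.IH(2))
  then show ?case by simp
next
  case (Inp a)
  show ?case by (simp add: string_content_def)
next
  case (It i y n cap e b)
  have "ev x (It i y n cap e b) \<eta> \<alpha> \<le> ev x cap \<eta> \<alpha>"
    by (cases "ev x n \<eta> \<alpha>") auto
  also have "\<dots> \<le> value_bound cap M" using It by blast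
  finally show ?case by simp
qed auto

section \<open>Compilation of expressions\<close>

fun incs :: "nat list \<Rightarrow> com" where
  "incs [] = Skip"
| "incs (r # rs) = Inc r ;; incs rs"

text \<open>Reading a register destroys it, so a copy is made by moving to two registers and moving
  one of them back. An empty \<open>rs\<close> clears \<open>s\<close>.\<close>

definition move :: "nat \<Rightarrow> nat list \<Rightarrow> com" where
  "move s rs = While (Nz s) (Dec s ;; incs rs)"

text \<open>Register \<open>r + 3\<close> holds the cap. What is taken from it is remembered in
  \<open>r + 5\<close> and restored at the end, so that the cap survives the iterations.\<close>

definition min_into :: "nat \<Rightarrow> com" where
  "min_into r = While (Nz (r+4)) (Dec (r+4) ;;
     Cond (Nz (r+3)) (Dec (r+3) ;; Inc r ;; Inc (r+5)) Skip) ;; move (r+5) [r+3]"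

text \<open>One step of \<open>scan\<close>: register \<open>r\<close> holds the value of the leaf,
  \<open>r + 5\<close> tells whether the bit is universal, and the head of tape \<open>r + 1\<close>
  stands on the bit. Stopping clears \<open>r + 4\<close>.\<close>

definition decide :: "nat \<Rightarrow> com" where
  "decide r = (let go = Put (r+1) 0; stop = Put (r+1) 1 ;; Dec (r+4) in
     Cond (Ne (r+1) 1) (Cond (Nz r) (Cond (Nz (r+5)) stop go) (Cond (Nz (r+5)) go stop)) go)"

text \<open>Register \<open>r + 4\<close> says that the scan continues and \<open>r + 3\<close> that
  the search does. When all bits have been passed, both are cleared.\<close>

definition scan_com :: "nat \<Rightarrow> com \<Rightarrow> com" where
  "scan_com r k = While (Nz (r+4))
     (Cond (Nz (r+1)) (Dec (r+1) ;; k ;; decide r ;; move (r+5) []) (Dec (r+4) ;; Dec (r+3)))"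

text \<open>The registers from \<open>r\<close> on are used as a stack: they are empty before, and
  afterwards only \<open>r\<close> is changed. The array bound by \<open>Qbf\<close> is the content
  of tape \<open>r + 1\<close>, while the head position of this tape serves as the index of the
  scan.\<close>

primrec compile :: "exp \<Rightarrow> (nat \<Rightarrow> nat) \<Rightarrow> (nat \<Rightarrow> nat) \<Rightarrow> nat \<Rightarrow> com" where
  "compile (Vr v) \<rho> \<kappa> r = move (\<rho> v) [r, r+1] ;; move (r+1) [\<rho> v]"
| "compile (Nm k) \<rho> \<kappa> r = incs (replicate k r)"
| "compile (Add a b) \<rho> \<kappa> r = compile a \<rho> \<kappa> r ;; compile b \<rho> \<kappa> (r+1) ;; move (r+1) [r]"
| "compile (Sub a b) \<rho> \<kappa> r = compile a \<rho> \<kappa> r ;; compile b \<rho> \<kappa> (r+1) ;;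
     While (Nz (r+1)) (Dec (r+1) ;; Dec r)"
| "compile (Mul a b) \<rho> \<kappa> r = compile a \<rho> \<kappa> (r+1) ;; compile b \<rho> \<kappa> (r+2) ;;
     While (Nz (r+1)) (Dec (r+1) ;; move (r+2) [r, r+3] ;; move (r+3) [r+2]) ;; move (r+2) []"
| "compile (Div a b) \<rho> \<kappa> r = compile a \<rho> \<kappa> (r+1) ;; compile b \<rho> \<kappa> (r+2) ;;
     Cond (Nz (r+2))
       (While (Nz (r+1)) (Dec (r+1) ;; Dec (r+2) ;; Inc (r+3) ;;
          Cond (Nz (r+2)) Skip (Inc r ;; move (r+3) [r+2])))
       (move (r+1) []) ;; move (r+2) [] ;; move (r+3) []"
| "compile (Ite e a b) \<rho> \<kappa> r = compile e \<rho> \<kappa> r ;; Cond (Nz r) (move r [] ;; compile a \<rho> \<kappa> r) (compile b \<rho> \<kappa> r)"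
| "compile (Bind v a b) \<rho> \<kappa> r = compile a \<rho> \<kappa> (r+1) ;; compile b (\<rho>(v := r+1)) \<kappa> (r+2) ;;
     move (r+1) [] ;; move (r+2) [r]"
| "compile (Inp a) \<rho> \<kappa> r = compile a \<rho> \<kappa> r ;; move r [0] ;;
     Cond (Ne 0 1) (Cond (Ne 0 2) Skip (Inc r ;; Inc r)) (Inc r) ;; move 0 []"
| "compile (Arr A a) \<rho> \<kappa> r = compile a \<rho> \<kappa> r ;; move r [\<kappa> A] ;; Cond (Ne (\<kappa> A) 1) Skip (Inc r) ;; move (\<kappa> A) []"
| "compile (It i y n cap e b) \<rho> \<kappa> r =
     compile n \<rho> \<kappa> (r+2) ;; compile cap \<rho> \<kappa> (r+3) ;; compile e \<rho> \<kappa> (r+4) ;; min_into r ;;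
     While (Nz (r+2)) (Dec (r+2) ;; compile b (\<rho>(i := r+1, y := r)) \<kappa> (r+4) ;; move r [] ;;
       min_into r ;; Inc (r+1)) ;;
     move (r+1) [] ;; move (r+3) []"
| "compile (Qbf A v len u b) \<rho> \<kappa> r =
     compile len \<rho> \<kappa> (r+2) ;; Inc (r+3) ;;
     While (Nz (r+3)) (move r [] ;; compile b \<rho> (\<kappa>(A := r+1)) (r+4) ;;
       Cond (Nz (r+4)) (move (r+4) [] ;; Inc r) Skip ;;
       move (r+2) [r+1, r+4] ;; move (r+4) [r+2] ;; Inc (r+4) ;;
       scan_com r (compile u (\<rho>(v := r+1)) \<kappa> (r+5)) ;; move (r+1) []) ;;
     move (r+2) []"

section \<open>Correctness of the compiled programs\<close>

lemma run_incs:
  "distinct rs \<Longrightarrow> \<forall>r\<in>set rs. Suc (p r) \<le> B \<Longrightarrow>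
    run B (incs rs) (p, c, w) (\<lambda>v. if v \<in> set rs then Suc (p v) else p v, c, w)"
proof (induction rs arbitrary: p)
  case Nil
  then show ?case by (auto intro: run_Skip)
next
  case (Cons r rs)
  have "run B (incs rs) (p(r := Suc (p r)), c, w)
      (\<lambda>v. if v \<in> set rs then Suc ((p(r := Suc (p r))) v) else (p(r := Suc (p r))) v, c, w)"
    using Cons by (intro Cons.IH) auto
  moreover have "(\<lambda>v. if v \<in> set rs then Suc ((p(r := Suc (p r))) v) else (p(r := Suc (p r))) v) =
      (\<lambda>v. if v \<in> set (r # rs) then Suc (p v) else p v)"
    using Cons.prems(1) by (auto simp: fun_eq_iff)
  ultimately show ?case using Cons.prems by (auto intro: run_Seq run_Inc)
qed

lemma run_for:
  assumes "\<And>j. j < N \<Longrightarrow> run B k ((P j)(s := N - Suc j), C j, D j) (P (Suc j), C (Suc j), D (Suc j))"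
    and "\<And>j. j \<le> N \<Longrightarrow> P j s = N - j"
  shows "run B (While (Nz s) (Dec s ;; k)) (P 0, C 0, D 0) (P N, C N, D N)"
proof -
  have "run B (While (Nz s) (Dec s ;; k)) (P j, C j, D j) (P N, C N, D N)" if "j \<le> N" for j
    using that
  proof (induction rule: inc_induct)
    case base
    then show ?case using assms(2)[of N] by (intro run_Stop) simp
  next
    case (step j)
    have "run B (Dec s) (P j, C j, D j) ((P j)(s := N - Suc j), C j, D j)"
      using run_Dec[of B s "P j" "C j" "D j"] assms(2)[of j] step by simp
    then have "run B (Dec s ;; k) (P j, C j, D j) (P (Suc j), C (Suc j), D (Suc j))"
      using assms(1) step run_Seq by blast
    then show ?case using step assms(2)[of j] by (intro run_Loop[OF _ _ step.IH]) auto
  qed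
  then show ?thesis by blast
qed

lemma run_move:
  assumes "distinct rs" "s \<notin> set rs" "\<forall>v\<in>set rs. p v + p s \<le> B"
    and "p' = (\<lambda>v. if v = s then 0 else if v \<in> set rs then p v + p s else p v)"
  shows "run B (move s rs) (p, c, w) (p', c, w)"
proof -
  define P where "P j = (\<lambda>v. if v = s then p s - j else if v \<in> set rs then p v + j else p v)" for j
  have "run B (While (Nz s) (Dec s ;; incs rs)) (P 0, c, w) (P (p s), c, w)"
  proof (rule run_for[where C = "\<lambda>_. c" and D = "\<lambda>_. w"])
    fix j assume j: "j < p s"
    have "run B (incs rs) ((P j)(s := p s - Suc j), c, w)
      (\<lambda>v. if v \<in> set rs then Suc (((P j)(s := p s - Suc j)) v) else ((P j)(s := p s - Suc j)) v, c, w)"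
    proof (rule run_incs[OF assms(1)], clarify)
      fix r assume r: "r \<in> set rs"
      then have "p r + p s \<le> B" "r \<noteq> s" using assms by auto
      then show "Suc (((P j)(s := p s - Suc j)) r) \<le> B" using r j by (simp add: P_def)
    qed
    moreover have "(\<lambda>v. if v \<in> set rs then Suc (((P j)(s := p s - Suc j)) v) else ((P j)(s := p s - Suc j)) v) = P (Suc j)"
      using assms(2) by (auto simp: P_def fun_eq_iff)
    ultimately show "run B (incs rs) ((P j)(s := p s - Suc j), c, w) (P (Suc j), c, w)" by simp
  qed (simp add: P_def)
  moreover have "P 0 = p" "P (p s) = p'" using assms by (auto simp: P_def fun_eq_iff)
  ultimately show ?thesis by (simp add: move_def)
qed

lemma run_Cond: "(if holds \<mu> b then run B k \<mu> \<mu>' else run B l \<mu> \<mu>') \<Longrightarrow> run B (Cond b k l) \<mu> \<mu>'"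
  by (auto intro: run_True run_False split: if_splits)

lemma run_Inc': "Suc (p r) \<le> B \<Longrightarrow> p' = p(r := Suc (p r)) \<Longrightarrow> run B (Inc r) (p, c, w) (p', c, w)"
  by (simp add: run_Inc)

lemma run_Dec': "p' = p(r := p r - 1) \<Longrightarrow> run B (Dec r) (p, c, w) (p', c, w)"
  using run_Dec by metis

definition fit where
  "fit x \<eta> \<alpha> \<rho> \<kappa> r p c \<longleftrightarrow> (\<forall>v. \<rho> v < r \<and> p (\<rho> v) = \<eta> v) \<and>
     (\<forall>A. \<kappa> A < r \<and> p (\<kappa> A) = 0 \<and> (\<forall>i. c (\<kappa> A) i = of_bool (\<alpha> A i))) \<and>
     0 < r \<and> p 0 = 0 \<and> (\<forall>i. c 0 i = string_content x (int i)) \<and> (\<forall>s\<ge>r. p s = 0 \<and> c s = (\<lambda>_. 0))"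
  for \<eta> \<rho> \<kappa> p :: "nat \<Rightarrow> nat" and r :: nat and c :: "nat \<Rightarrow> nat \<Rightarrow> nat" and \<alpha> :: "nat \<Rightarrow> nat \<Rightarrow> bool"

lemma fit_mono:
  assumes "fit x \<eta> \<alpha> \<rho> \<kappa> r p c" "r \<le> r'" "\<And>s. s < r \<Longrightarrow> p' s = p s" "\<And>s. r' \<le> s \<Longrightarrow> p' s = 0"
    "\<And>s. s < r \<or> r' \<le> s \<Longrightarrow> c' s = c s"
  shows "fit x \<eta> \<alpha> \<rho> \<kappa> r' p' c'"
proof -
  have c: "c' s = c s" "p' s = p s" if "s < r" for s using that assms(3,5) by auto
  have z: "p' s = 0 \<and> c' s = (\<lambda>_. 0)" if "r' \<le> s" for s
    using that assms(1,2,4,5) by (auto simp: fit_def)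
  have l: "s < r'" if "s < r" for s using that assms(2) by simp
  show ?thesis using assms(1) c z l unfolding fit_def by simp
qed

lemma fit_zero: "fit x \<eta> \<alpha> \<rho> \<kappa> r p c \<Longrightarrow> r \<le> s \<Longrightarrow> p s = 0"
  "fit x \<eta> \<alpha> \<rho> \<kappa> r p c \<Longrightarrow> r \<le> s \<Longrightarrow> c s = (\<lambda>_. 0)"
  by (auto simp: fit_def)

lemma fit_bind: "fit x \<eta> \<alpha> \<rho> \<kappa> r p c \<Longrightarrow> s < r \<Longrightarrow> p s = z \<Longrightarrow> fit x (\<eta>(v := z)) \<alpha> (\<rho>(v := s)) \<kappa> r p c"
  by (auto simp: fit_def)

lemma fit_arr: "fit x \<eta> \<alpha> \<rho> \<kappa> r p c \<Longrightarrow> s < r \<Longrightarrow> p s = 0 \<Longrightarrow> (\<And>i. c s i = of_bool (W i)) \<Longrightarrow>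
    fit x \<eta> (\<alpha>(A := W)) \<rho> (\<kappa>(A := s)) r p c"
  by (auto simp: fit_def)

text \<open>
  A quantified formula is evaluated by backtracking: after a leaf of value \<open>z\<close> the bits are scanned from the
  last one down to the first whose second choice can still change the value; the bits passed are cleared.
\<close>

definition scan :: "(nat \<Rightarrow> bool) \<Rightarrow> bool \<Rightarrow> nat \<Rightarrow> (nat \<Rightarrow> bool) \<Rightarrow> bool \<times> (nat \<Rightarrow> bool)" where
  "scan U z q W = rec_nat (\<lambda>W. (True, W))
     (\<lambda>q f W. if \<not> W q \<and> z = U q then (False, W(q := True)) else f (W(q := False))) q W"

lemma scan_simps [simp]:
  "scan U z 0 W = (True, W)"
  "scan U z (Suc q) W = (if \<not> W q \<and> z = U q then (False, W(q := True)) else scan U z q (W(q := False)))"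
  by (simp_all add: scan_def)

text \<open>If no second choice can change the value any more, the value of the current leaf is that
  of the whole formula.\<close>

inductive qrun :: "(nat \<Rightarrow> bool) \<Rightarrow> ((nat \<Rightarrow> bool) \<Rightarrow> bool) \<Rightarrow> nat \<Rightarrow> (nat \<Rightarrow> bool) \<Rightarrow> bool \<Rightarrow> bool"
  for U \<psi> L where
  qrun_stop: "fst (scan U (\<psi> W) L W) \<Longrightarrow> qrun U \<psi> L W (\<psi> W)"
| qrun_go: "\<not> fst (scan U (\<psi> W) L W) \<Longrightarrow> qrun U \<psi> L (snd (scan U (\<psi> W) L W)) z \<Longrightarrow> qrun U \<psi> L W z"

text \<open>The induction needs a continuation. A search started at the first leaf of a subgame
  finally scans from \<open>q\<close> with the value \<open>v\<close> of that subgame, so the result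
  \<open>z\<close> obtained from there on is also the result of the search from the leaf.\<close>

lemma qrun_game_aux:
  assumes "q + d = L" "\<And>i. q \<le> i \<Longrightarrow> \<not> W i"
    and "v = game U \<psi> d q W"
    and "fst (scan U v q W) \<Longrightarrow> z = v"
    and "\<not> fst (scan U v q W) \<Longrightarrow> qrun U \<psi> L (snd (scan U v q W)) z"
  shows "qrun U \<psi> L W z"
  using assms
proof (induction d arbitrary: q W v)
  case 0
  then have q: "q = L" "v = \<psi> W" by simp_all
  show ?case
  proof (cases "fst (scan U (\<psi> W) L W)")
    case True
    then show ?thesis using 0(4) qrun_stop[of U \<psi> W L] by (simp add: q)
  next
    case False
    then show ?thesis using 0(5) qrun_go[of U \<psi> W L z] by (simp add: q)
  qed
next
  case (Suc d)
  have W0: "W(q := False) = W" using Suc.prems(2)[of q] by (auto simp: fun_eq_iff)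
  define v0 where "v0 = game U \<psi> d (Suc q) W"
  define v1 where "v1 = game U \<psi> d (Suc q) (W(q := True))"
  have v: "v = (if U q then v0 \<and> v1 else v0 \<or> v1)"
    unfolding Suc.prems(3) v0_def v1_def by (simp only: game.simps W0)
  show ?case
  proof (rule Suc.IH[OF _ _ v0_def])
    show "Suc q + d = L" using Suc.prems(1) by simp
    show "\<not> W i" if "Suc q \<le> i" for i using that Suc.prems(2)[of i] by simp
    show "z = v0" if "fst (scan U v0 (Suc q) W)"
    proof -
      have "v0 \<noteq> U q" "fst (scan U v0 q W)" using that Suc.prems(2)[of q] W0 by (auto split: if_splits)
      then show ?thesis using v Suc.prems(4) by (auto split: if_splits)
    qed
    show "qrun U \<psi> L (snd (scan U v0 (Suc q) W)) z" if nf: "\<not> fst (scan U v0 (Suc q) W)"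
    \<comment> \<open>The first choice settles bit \<open>q\<close> exactly if \<open>v0\<close>
      differs from \<open>U q\<close>: a false conjunct or a true disjunct.\<close>
    proof (cases "v0 = U q")
      case False
      then have "scan U v0 (Suc q) W = scan U v0 q W" using W0 Suc.prems(2)[of q] by simp
      moreover have "v = v0" using False v by auto
      ultimately show ?thesis using Suc.prems(5) nf by simp
    next
      case True
      then have s: "snd (scan U v0 (Suc q) W) = W(q := True)" using Suc.prems(2)[of q] by simp
      have v1: "v = v1" using True v by auto
      have sc: "scan U v1 (Suc q) (W(q := True)) = scan U v q W"
        by (simp add: v1 W0)
      show ?thesis unfolding s
      proof (rule Suc.IH[OF _ _ v1_def])
        show "Suc q + d = L" using Suc.prems(1) by simp
        show "\<not> (W(q := True)) i" if "Suc q \<le> i" for i using that Suc.prems(2)[of i] by simp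
        show "z = v1" if "fst (scan U v1 (Suc q) (W(q := True)))"
          using Suc.prems(4)[OF that[unfolded sc]] v1 by simp
        show "qrun U \<psi> L (snd (scan U v1 (Suc q) (W(q := True)))) z"
          if "\<not> fst (scan U v1 (Suc q) (W(q := True)))"
          unfolding sc by (rule Suc.prems(5)[OF that[unfolded sc]])
      qed
    qed
  qed
qed

lemma qrun_game: "qrun U \<psi> L (\<lambda>_. False) (game U \<psi> L 0 (\<lambda>_. False))"
  by (rule qrun_game_aux[of 0 L]) auto

lemma scan_above: "q \<le> i \<Longrightarrow> snd (scan U z q W) i = W i"
  by (induction q arbitrary: W) auto

lemma scan_finished: "fst (scan U z q W) \<Longrightarrow> i < q \<Longrightarrow> \<not> snd (scan U z q W) i"
proof (induction q arbitrary: W)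
  case (Suc q)
  then show ?case using scan_above[of q i U z "W(q := False)"]
    by (cases "i = q") (auto split: if_splits)
qed simp

lemma run_min_into:
  assumes "q r = 0" "q (r+5) = 0" "q (r+3) \<le> B"
  shows "run B (min_into r) (q, c, w) (q(r := min (q (r+4)) (q (r+3)), r+4 := 0), c, w)"
proof -
  define N where "N = q (r+4)"
  define m where "m = q (r+3)"
  define P where "P j = q(r := min j m, r+3 := m - j, r+4 := N - j, r+5 := min j m)" for j
  have *: "run B (While (Nz (r+4)) (Dec (r+4) ;; Cond (Nz (r+3)) (Dec (r+3) ;; Inc r ;; Inc (r+5)) Skip))
      (P 0, c, w) (P N, c, w)"
  proof (rule run_for[where C = "\<lambda>_. c" and D = "\<lambda>_. w"])
    fix j assume j: "j < N"
    show "run B (Cond (Nz (r+3)) (Dec (r+3) ;; Inc r ;; Inc (r+5)) Skip)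
       ((P j)(r+4 := N - Suc j), c, w) (P (Suc j), c, w)"
    proof (cases "j < m")
      case True
      have 1: "run B (Dec (r+3)) ((P j)(r+4 := N - Suc j), c, w) ((P j)(r+4 := N - Suc j, r+3 := m - Suc j), c, w)"
        by (rule run_Dec') (auto simp: P_def fun_eq_iff)
      have 2: "run B (Inc r) ((P j)(r+4 := N - Suc j, r+3 := m - Suc j), c, w)
          ((P j)(r+4 := N - Suc j, r+3 := m - Suc j, r := Suc j), c, w)"
        using assms True by (intro run_Inc') (auto simp: P_def m_def fun_eq_iff)
      have 3: "run B (Inc (r+5)) ((P j)(r+4 := N - Suc j, r+3 := m - Suc j, r := Suc j), c, w) (P (Suc j), c, w)"
        using assms True by (intro run_Inc') (auto simp: P_def m_def fun_eq_iff)
      show ?thesis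
        by (rule run_True[OF _ run_Seq[OF 1 run_Seq[OF 2 3]]]) (use True in \<open>simp add: P_def\<close>)
    next
      case False
      then have "(P j)(r+4 := N - Suc j) = P (Suc j)" by (auto simp: P_def fun_eq_iff)
      moreover have "\<not> holds (P (Suc j), c, w) (Nz (r+3))" using False by (simp add: P_def)
      ultimately show ?thesis using run_False[OF _ run_Skip] by (simp only:)
    qed
  qed (simp add: P_def)
  have "run B (While (Nz (r+4)) (Dec (r+4) ;; Cond (Nz (r+3)) (Dec (r+3) ;; Inc r ;; Inc (r+5)) Skip))
      (q, c, w) (P N, c, w)"
  proof -
    have "P 0 = q" using assms by (auto simp: P_def N_def m_def fun_eq_iff)
    with * show ?thesis by (simp only:)
  qed
  moreover have "run B (move (r+5) [r+3]) (P N, c, w) (q(r := min (q (r+4)) (q (r+3)), r+4 := 0), c, w)"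
    using assms by (intro run_move) (auto simp: P_def N_def m_def fun_eq_iff)
  ultimately show ?thesis unfolding min_into_def by (rule run_Seq)
qed

lemma run_mv0: "p' = p(s := 0) \<Longrightarrow> run B (move s []) (p, c, w) (p', c, w)"
  by (rule run_move) (auto simp: fun_eq_iff)

lemma run_decide:
  assumes "run B k \<mu> \<mu>1" "run B l \<mu> \<mu>2" "holds \<mu> a \<longleftrightarrow> \<not> y" "holds \<mu> b \<longleftrightarrow> z" "holds \<mu> d \<longleftrightarrow> u"
  shows "run B (Cond a (Cond b (Cond d k l) (Cond d l k)) l) \<mu> (if \<not> y \<and> z = u then \<mu>1 else \<mu>2)"
  using assms by (auto intro: run_True run_False)

lemma run_scan:
  fixes r L :: nat and p :: "nat \<Rightarrow> nat" and c :: "nat \<Rightarrow> nat \<Rightarrow> nat"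
  defines "P \<equiv> \<lambda>z q f g. p(r := of_bool z, r+1 := q, r+2 := L, r+3 := f, r+4 := g)"
    and "C \<equiv> \<lambda>W. c(r+1 := \<lambda>i. of_bool (W i))"
  assumes k: "\<And>W z q. q < L \<Longrightarrow>
      run B k (P z q 1 1, C W, w) ((P z q 1 1)(r+5 := uv q), C W, w)"
    and U: "\<And>q. U q \<longleftrightarrow> uv q \<noteq> 0" and p5: "p (r+5) = 0"
  shows "q \<le> L \<Longrightarrow> \<exists>q'. run B (scan_com r k) (P z q 1 1, C W, w)
    (P z q' (of_bool (\<not> fst (scan U z q W))) 0, C (snd (scan U z q W)), w)"
proof (induction q arbitrary: W)
  case 0
  have "run B (Dec (r+4) ;; Dec (r+3)) (P z 0 1 1, C W, w) (P z 0 0 0, C W, w)"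
    by (rule run_Seq[OF run_Dec' run_Dec'[where p = "P z 0 1 0"]]) (auto simp: P_def fun_eq_iff)
  then have "run B (Cond (Nz (r+1)) (Dec (r+1) ;; k ;; decide r ;; move (r+5) []) (Dec (r+4) ;; Dec (r+3)))
      (P z 0 1 1, C W, w) (P z 0 0 0, C W, w)"
    by (intro run_False) (auto simp: P_def)
  then have "run B (scan_com r k) (P z 0 1 1, C W, w) (P z 0 0 0, C W, w)"
    unfolding scan_com_def by (intro run_Loop[OF _ _ run_Stop]) (auto simp: P_def)
  then show ?case by auto
next
  case (Suc q)
  let ?stop = "\<not> W q \<and> z = U q"
  let ?p = "P z q 1 1" and ?p5 = "(P z q 1 1)(r+5 := uv q)"
  have 1: "run B (Dec (r+1)) (P z (Suc q) 1 1, C W, w) (?p, C W, w)"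
    by (rule run_Dec') (auto simp: P_def fun_eq_iff)
  have 2: "run B k (?p, C W, w) (?p5, C W, w)" using Suc by (intro k) simp
  have ps: "?p5 r = of_bool z" "?p5 (r+1) = q" "?p5 (r+5) = uv q" "C W (r+1) q = of_bool (W q)"
    by (auto simp: P_def C_def)
  have put: "run B (Put (r+1) b) (?p5, C W, w) (?p5, C (W(q := (b = 1))), w)" if "b < 2" for b
  proof -
    have *: "C (W(q := (b = 1))) = (C W)(r+1 := (C W (r+1))(q := b))"
      using that by (auto simp: C_def fun_eq_iff)
    show ?thesis using run_Put[of B "r+1" b ?p5 "C W" w] unfolding ps(2) * .
  qed
  have stop: "run B (Put (r+1) 1 ;; Dec (r+4)) (?p5, C W, w) (?p5(r+4 := 0), C (W(q := True)), w)"
    using put[of 1] by (auto intro!: run_Seq run_Dec' simp: P_def fun_eq_iff)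
  have go: "run B (Put (r+1) 0) (?p5, C W, w) (?p5, C (W(q := False)), w)"
    using put[of 0] by simp
  have 3: "run B (decide r) (?p5, C W, w)
      (if ?stop then (?p5(r+4 := 0), C (W(q := True)), w) else (?p5, C (W(q := False)), w))"
    unfolding decide_def Let_def
    by (rule run_decide[OF stop go]) (simp_all only: holds.simps ps U of_bool_eq_0_iff of_bool_eq_1_iff not_not)
  show ?case
  proof (cases ?stop)
    case True
    have "run B (move (r+5) []) (?p5(r+4 := 0), C (W(q := True)), w) (P z q 1 0, C (W(q := True)), w)"
      by (rule run_mv0) (auto simp: P_def p5 fun_eq_iff)
    then have "run B (Dec (r+1) ;; k ;; decide r ;; move (r+5) []) (P z (Suc q) 1 1, C W, w)
        (P z q 1 0, C (W(q := True)), w)"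
      by (rule run_Seq[OF 1 run_Seq[OF 2 run_Seq[OF 3[unfolded if_P[OF True]]]]])
    then have "run B (scan_com r k) (P z (Suc q) 1 1, C W, w) (P z q 1 0, C (W(q := True)), w)"
      unfolding scan_com_def
      by (intro run_Loop[OF _ run_True run_Stop]) (auto simp: P_def)
    moreover have "scan U z (Suc q) W = (False, W(q := True))" using True by simp
    ultimately show ?thesis by (simp only: fst_conv snd_conv not_False_eq_True of_bool_eq(2)) (rule exI)
  next
    case False
    have "run B (move (r+5) []) (?p5, C (W(q := False)), w) (?p, C (W(q := False)), w)"
      by (rule run_mv0) (auto simp: P_def p5 fun_eq_iff)
    moreover have "run B (decide r) (?p5, C W, w) (?p5, C (W(q := False)), w)"
      using 3 unfolding if_not_P[OF False] .
    ultimately have b: "run B (Dec (r+1) ;; k ;; decide r ;; move (r+5) []) (P z (Suc q) 1 1, C W, w)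
        (?p, C (W(q := False)), w)"
      by (blast intro: run_Seq[OF 1 run_Seq[OF 2 run_Seq]])
    from Suc.IH[OF Suc_leD[OF Suc.prems], of "W(q := False)"]
    obtain q' where X: "run B (scan_com r k) (?p, C (W(q := False)), w)
      (P z q' (of_bool (\<not> fst (scan U z q (W(q := False))))) 0, C (snd (scan U z q (W(q := False)))), w)"
      by blast
    have "holds (P z (Suc q) 1 1, C W, w) (Nz (r+4))" "holds (P z (Suc q) 1 1, C W, w) (Nz (r+1))"
      by (auto simp: P_def)
    note run_Loop[OF this(1) run_True[OF this(2) b] X[unfolded scan_com_def]]
    then have "run B (scan_com r k) (P z (Suc q) 1 1, C W, w)
      (P z q' (of_bool (\<not> fst (scan U z q (W(q := False))))) 0, C (snd (scan U z q (W(q := False)))), w)"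
      unfolding scan_com_def .
    moreover have "scan U z (Suc q) W = scan U z q (W(q := False))" unfolding scan_simps if_not_P[OF False] ..
    ultimately show ?thesis by (simp only:) (rule exI)
  qed
qed

theorem run_comp:
  assumes "fit x \<eta> \<alpha> \<rho> \<kappa> r p c" "\<And>v. \<eta> v \<le> M" "value_bound e M \<le> B"
  shows "run B (compile e \<rho> \<kappa> r) (p, c, w) (p(r := ev x e \<eta> \<alpha>), c, w)"
  using assms
proof (induction e arbitrary: \<eta> \<alpha> \<rho> \<kappa> r p c M)
  case (Vr v)
  note z = fit_zero(1)[OF Vr(1)]
  have v: "\<rho> v < r" "p (\<rho> v) = \<eta> v" "\<eta> v \<le> B" using Vr by (auto simp: fit_def intro: le_trans)
  have "run B (move (\<rho> v) [r, r+1]) (p, c, w) (p(\<rho> v := 0, r := \<eta> v, r+1 := \<eta> v), c, w)"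
    using v by (intro run_move) (auto simp: z fun_eq_iff)
  moreover have "run B (move (r+1) [\<rho> v]) (p(\<rho> v := 0, r := \<eta> v, r+1 := \<eta> v), c, w) (p(r := \<eta> v), c, w)"
    using v by (intro run_move) (auto simp: z fun_eq_iff)
  ultimately show ?case unfolding compile.simps ev.simps by (rule run_Seq)
next
  case (Nm k)
  note z = fit_zero(1)[OF Nm(1)]
  have "j + l \<le> B \<Longrightarrow> run B (incs (replicate l r)) (p(r := j), c, w) (p(r := j + l), c, w)" for j l
  proof (induction l arbitrary: j)
    case 0
    then show ?case by (simp add: run_Skip)
  next
    case (Suc l)
    have "run B (Inc r) (p(r := j), c, w) (p(r := Suc j), c, w)" using Suc.prems by (intro run_Inc') auto
    moreover have "run B (incs (replicate l r)) (p(r := Suc j), c, w) (p(r := j + Suc l), c, w)"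
    proof -
      have "Suc j + l \<le> B" "Suc j + l = j + Suc l" using Suc.prems by simp_all
      then show ?thesis using Suc.IH[of "Suc j"] by (simp only:)
    qed
    ultimately show ?case unfolding replicate_Suc incs.simps by (rule run_Seq)
  qed
  from this[of 0 k] Nm(3) have "run B (incs (replicate k r)) (p(r := 0), c, w) (p(r := k), c, w)"
    by (simp only: add_0 value_bound.simps)
  moreover have "p(r := 0) = p" using z[of r] by (auto simp: fun_eq_iff)
  ultimately show ?case by (simp only: compile.simps ev.simps)
next
  case (Add a b)
  note z = fit_zero(1)[OF Add.prems(1)]
  let ?a = "ev x a \<eta> \<alpha>" and ?b = "ev x b \<eta> \<alpha>"
  have le: "?a \<le> value_bound a M" "?b \<le> value_bound b M" using Add.prems by (auto intro: ev_le)
  have 1: "run B (compile a \<rho> \<kappa> r) (p, c, w) (p(r := ?a), c, w)"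
    using Add.prems by (intro Add.IH(1)) auto
  have "fit x \<eta> \<alpha> \<rho> \<kappa> (r+1) (p(r := ?a)) c" by (rule fit_mono[OF Add.prems(1)]) (auto simp: z)
  then have 2: "run B (compile b \<rho> \<kappa> (r+1)) (p(r := ?a), c, w) (p(r := ?a, r+1 := ?b), c, w)"
    by (rule Add.IH(2)[where M = M]) (use Add.prems in auto)
  have "run B (move (r+1) [r]) (p(r := ?a, r+1 := ?b), c, w) (p(r := ?a + ?b), c, w)"
    using le Add.prems by (intro run_move) (auto simp: z fun_eq_iff)
  with 1 2 show ?case unfolding compile.simps ev.simps by (blast intro: run_Seq)
next
  case (Sub a b)
  note z = fit_zero(1)[OF Sub.prems(1)]
  let ?a = "ev x a \<eta> \<alpha>" and ?b = "ev x b \<eta> \<alpha>"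
  have 1: "run B (compile a \<rho> \<kappa> r) (p, c, w) (p(r := ?a), c, w)"
    using Sub.prems by (intro Sub.IH(1)) auto
  have "fit x \<eta> \<alpha> \<rho> \<kappa> (r+1) (p(r := ?a)) c" by (rule fit_mono[OF Sub.prems(1)]) (auto simp: z)
  then have 2: "run B (compile b \<rho> \<kappa> (r+1)) (p(r := ?a), c, w) (p(r := ?a, r+1 := ?b), c, w)"
    by (rule Sub.IH(2)[where M = M]) (use Sub.prems in auto)
  define P where "P j = p(r := ?a - j, r+1 := ?b - j)" for j
  have "run B (While (Nz (r+1)) (Dec (r+1) ;; Dec r)) (P 0, c, w) (P ?b, c, w)"
    by (rule run_for[where C = "\<lambda>_. c" and D = "\<lambda>_. w"]) (auto simp: P_def fun_eq_iff intro!: run_Dec')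
  moreover have "P ?b = p(r := ?a - ?b)" by (auto simp: P_def z fun_eq_iff)
  moreover have "P 0 = p(r := ?a, r+1 := ?b)" by (simp add: P_def)
  ultimately have "run B (While (Nz (r+1)) (Dec (r+1) ;; Dec r)) (p(r := ?a, r+1 := ?b), c, w) (p(r := ?a - ?b), c, w)"
    by (simp only:)
  with 1 2 show ?case unfolding compile.simps ev.simps by (blast intro: run_Seq)
next
  case (Mul a b)
  note z = fit_zero(1)[OF Mul.prems(1)]
  let ?a = "ev x a \<eta> \<alpha>" and ?b = "ev x b \<eta> \<alpha>"
  have le: "?a \<le> value_bound a M" "?b \<le> value_bound b M" using Mul.prems by (auto intro: ev_le)
  have "fit x \<eta> \<alpha> \<rho> \<kappa> (r+1) p c" by (rule fit_mono[OF Mul.prems(1)]) (auto simp: z)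
  then have 1: "run B (compile a \<rho> \<kappa> (r+1)) (p, c, w) (p(r+1 := ?a), c, w)"
    by (rule Mul.IH(1)[where M = M]) (use Mul.prems in auto)
  have "fit x \<eta> \<alpha> \<rho> \<kappa> (r+2) (p(r+1 := ?a)) c" by (rule fit_mono[OF Mul.prems(1)]) (auto simp: z)
  then have 2: "run B (compile b \<rho> \<kappa> (r+2)) (p(r+1 := ?a), c, w) (p(r+1 := ?a, r+2 := ?b), c, w)"
    by (rule Mul.IH(2)[where M = M]) (use Mul.prems in auto)
  define P where "P j = p(r := j * ?b, r+1 := ?a - j, r+2 := ?b)" for j
  have 3: "run B (While (Nz (r+1)) (Dec (r+1) ;; move (r+2) [r, r+3] ;; move (r+3) [r+2])) (P 0, c, w) (P ?a, c, w)"
  proof (rule run_for[where C = "\<lambda>_. c" and D = "\<lambda>_. w"])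
    fix j assume j: "j < ?a"
    have "Suc j * ?b \<le> ?a * ?b" using j by (intro mult_le_mono1) simp
    also have "\<dots> \<le> value_bound a M * value_bound b M" using le by (rule mult_le_mono)
    finally have b: "j * ?b + ?b \<le> B" "?b \<le> B" using Mul.prems(3) le by simp_all
    have "run B (move (r+2) [r, r+3]) ((P j)(r+1 := ?a - Suc j), c, w)
        (p(r := j * ?b + ?b, r+1 := ?a - Suc j, r+3 := ?b), c, w)"
      using b by (intro run_move) (auto simp: P_def z fun_eq_iff)
    moreover have "run B (move (r+3) [r+2]) (p(r := j * ?b + ?b, r+1 := ?a - Suc j, r+3 := ?b), c, w) (P (Suc j), c, w)"
      using b by (intro run_move) (auto simp: P_def z fun_eq_iff)
    ultimately show "run B (move (r+2) [r, r+3] ;; move (r+3) [r+2]) ((P j)(r+1 := ?a - Suc j), c, w) (P (Suc j), c, w)"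
      by (rule run_Seq)
  qed (simp add: P_def)
  have P0: "P 0 = p(r+1 := ?a, r+2 := ?b)" by (auto simp: P_def z fun_eq_iff)
  have "run B (move (r+2) []) (P ?a, c, w) (p(r := ?a * ?b), c, w)"
    by (rule run_mv0) (auto simp: P_def z fun_eq_iff)
  then show ?case using 1 2 3[unfolded P0] unfolding compile.simps ev.simps by (blast intro: run_Seq)
next
  case (Div a b)
  note z = fit_zero(1)[OF Div.prems(1)]
  let ?a = "ev x a \<eta> \<alpha>" and ?b = "ev x b \<eta> \<alpha>"
  have le: "?a \<le> value_bound a M" "?b \<le> value_bound b M" using Div.prems by (auto intro: ev_le)
  then have lB: "?a \<le> B" "?b \<le> B" using Div.prems(3) by simp_all
  have "fit x \<eta> \<alpha> \<rho> \<kappa> (r+1) p c" by (rule fit_mono[OF Div.prems(1)]) (auto simp: z)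
  then have 1: "run B (compile a \<rho> \<kappa> (r+1)) (p, c, w) (p(r+1 := ?a), c, w)"
    by (rule Div.IH(1)[where M = M]) (use Div.prems in auto)
  have "fit x \<eta> \<alpha> \<rho> \<kappa> (r+2) (p(r+1 := ?a)) c" by (rule fit_mono[OF Div.prems(1)]) (auto simp: z)
  then have 2: "run B (compile b \<rho> \<kappa> (r+2)) (p(r+1 := ?a), c, w) (p(r+1 := ?a, r+2 := ?b), c, w)"
    by (rule Div.IH(2)[where M = M]) (use Div.prems in auto)
  let ?body = "Dec (r+2) ;; Inc (r+3) ;; Cond (Nz (r+2)) Skip (Inc r ;; move (r+3) [r+2])"
  \<comment> \<open>The divisor is counted down in \<open>r + 2\<close> and up in
    \<open>r + 3\<close>. When \<open>r + 2\<close> is exhausted, the quotient grows by one and the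
    divisor is moved back.\<close>
  define P where "P j = p(r := j div ?b, r+1 := ?a - j, r+2 := ?b - j mod ?b, r+3 := j mod ?b)" for j
  have 3: "\<exists>d e. run B (Cond (Nz (r+2)) (While (Nz (r+1)) (Dec (r+1) ;; ?body)) (move (r+1) []))
     (p(r+1 := ?a, r+2 := ?b), c, w) (p(r := ?a div ?b, r+2 := d, r+3 := e), c, w)"
  proof (cases "?b = 0")
    case True
    have "run B (move (r+1) []) (p(r+1 := ?a, r+2 := ?b), c, w) (p(r := ?a div ?b, r+2 := 0, r+3 := 0), c, w)"
      by (rule run_mv0) (auto simp: True z fun_eq_iff)
    then show ?thesis using True by (intro exI run_Cond) simp
  next
    case False
    have "run B (While (Nz (r+1)) (Dec (r+1) ;; ?body)) (P 0, c, w) (P ?a, c, w)"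
    proof (rule run_for[where C = "\<lambda>_. c" and D = "\<lambda>_. w"])
      fix j assume j: "j < ?a"
      let ?p = "(P j)(r+1 := ?a - Suc j)"
      let ?p2 = "?p(r+2 := ?b - Suc (j mod ?b))"
      let ?p3 = "?p2(r+3 := Suc (j mod ?b))"
      have jb: "j mod ?b < ?b" using False by simp
      have a1: "run B (Dec (r+2)) (?p, c, w) (?p2, c, w)"
        by (rule run_Dec') (auto simp: P_def fun_eq_iff)
      have a2: "run B (Inc (r+3)) (?p2, c, w) (?p3, c, w)"
        using jb lB by (intro run_Inc') (auto simp: P_def fun_eq_iff)
      have a3: "run B (Cond (Nz (r+2)) Skip (Inc r ;; move (r+3) [r+2])) (?p3, c, w) (P (Suc j), c, w)"
      proof (cases "Suc (j mod ?b) = ?b")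
        case True
        then have s: "Suc j div ?b = Suc (j div ?b)" "Suc j mod ?b = 0"
          by (simp_all add: div_Suc mod_Suc)
        have "Suc j div ?b \<le> Suc j" by (rule div_le_dividend)
        then have "Suc (j div ?b) \<le> B" using j lB s(1) by linarith
        then have "run B (Inc r) (?p3, c, w) (?p3(r := Suc (j div ?b)), c, w)"
          by (intro run_Inc') (auto simp: P_def fun_eq_iff)
        moreover have "run B (move (r+3) [r+2]) (?p3(r := Suc (j div ?b)), c, w) (P (Suc j), c, w)"
          using lB True by (intro run_move) (auto simp: P_def s fun_eq_iff)
        ultimately show ?thesis using True by (intro run_False) (auto intro: run_Seq)
      next
        case F: False
        then have s: "Suc j div ?b = j div ?b" "Suc j mod ?b = Suc (j mod ?b)"
          by (simp_all add: div_Suc mod_Suc)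
        have "?p3 = P (Suc j)" by (auto simp: P_def s fun_eq_iff)
        moreover have "holds (?p3, c, w) (Nz (r+2))" using F jb by (simp add: less_eq_Suc_le)
        ultimately show ?thesis using run_True[OF _ run_Skip] by (simp only:)
      qed
      show "run B ?body (?p, c, w) (P (Suc j), c, w)" using a1 a2 a3 by (auto intro: run_Seq)
    qed (simp add: P_def)
    moreover have "P 0 = p(r+1 := ?a, r+2 := ?b)" by (auto simp: P_def z fun_eq_iff)
    moreover have "P ?a = p(r := ?a div ?b, r+2 := ?b - ?a mod ?b, r+3 := ?a mod ?b)"
      by (auto simp: P_def z fun_eq_iff)
    ultimately show ?thesis using False by (intro exI run_True) auto
  qed
  then obtain d e where 3: "run B (Cond (Nz (r+2)) (While (Nz (r+1)) (Dec (r+1) ;; ?body)) (move (r+1) []))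
     (p(r+1 := ?a, r+2 := ?b), c, w) (p(r := ?a div ?b, r+2 := d, r+3 := e), c, w)" by blast
  have "run B (move (r+2) []) (p(r := ?a div ?b, r+2 := d, r+3 := e), c, w) (p(r := ?a div ?b, r+3 := e), c, w)"
    by (rule run_mv0) (auto simp: z fun_eq_iff)
  moreover have "run B (move (r+3) []) (p(r := ?a div ?b, r+3 := e), c, w) (p(r := ?a div ?b), c, w)"
    by (rule run_mv0) (auto simp: z fun_eq_iff)
  ultimately show ?case using 1 2 3 unfolding compile.simps ev.simps by (blast intro: run_Seq)
next
  case (Ite e a b)
  note z = fit_zero(1)[OF Ite.prems(1)]
  let ?e = "ev x e \<eta> \<alpha>"
  have 1: "run B (compile e \<rho> \<kappa> r) (p, c, w) (p(r := ?e), c, w)"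
    using Ite.prems by (intro Ite.IH(1)) auto
  have pz: "p(r := 0) = p" using z[of r] by (auto simp: fun_eq_iff)
  have "run B (move r []) (p(r := ?e), c, w) (p, c, w)"
    by (rule run_mv0) (auto simp: z fun_eq_iff)
  moreover have "run B (compile a \<rho> \<kappa> r) (p, c, w) (p(r := ev x a \<eta> \<alpha>), c, w)"
    using Ite.prems by (intro Ite.IH(2)) auto
  moreover have "run B (compile b \<rho> \<kappa> r) (p, c, w) (p(r := ev x b \<eta> \<alpha>), c, w)"
    using Ite.prems by (intro Ite.IH(3)) auto
  ultimately have "run B (Cond (Nz r) (move r [] ;; compile a \<rho> \<kappa> r) (compile b \<rho> \<kappa> r)) (p(r := ?e), c, w)
     (p(r := ev x (Ite e a b) \<eta> \<alpha>), c, w)"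
    by (intro run_Cond) (auto simp: pz intro: run_Seq)
  with 1 show ?case unfolding compile.simps by (blast intro: run_Seq)
next
  case (Bind v a b)
  note z = fit_zero(1)[OF Bind.prems(1)]
  let ?a = "ev x a \<eta> \<alpha>" let ?b = "ev x b (\<eta>(v := ?a)) \<alpha>"
  have le: "?a \<le> value_bound a M" using Bind.prems by (auto intro: ev_le)
  have m: "(\<eta>(v := ?a)) u \<le> M + value_bound a M" for u using le Bind.prems(2)[of u] by simp
  have le2: "?b \<le> value_bound b (M + value_bound a M)" by (rule ev_le[OF m])
  have "fit x \<eta> \<alpha> \<rho> \<kappa> (r+1) p c" by (rule fit_mono[OF Bind.prems(1)]) (auto simp: z)
  then have 1: "run B (compile a \<rho> \<kappa> (r+1)) (p, c, w) (p(r+1 := ?a), c, w)"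
    by (rule Bind.IH(1)[where M = M]) (use Bind.prems in auto)
  have "fit x \<eta> \<alpha> \<rho> \<kappa> (r+2) (p(r+1 := ?a)) c" by (rule fit_mono[OF Bind.prems(1)]) (auto simp: z)
  then have "fit x (\<eta>(v := ?a)) \<alpha> (\<rho>(v := r+1)) \<kappa> (r+2) (p(r+1 := ?a)) c"
    by (rule fit_bind) auto
  then have 2: "run B (compile b (\<rho>(v := r+1)) \<kappa> (r+2)) (p(r+1 := ?a), c, w) (p(r+1 := ?a, r+2 := ?b), c, w)"
    by (rule Bind.IH(2)[OF _ m]) (use Bind.prems(3) in simp)
  have 3: "run B (move (r+1) []) (p(r+1 := ?a, r+2 := ?b), c, w) (p(r+2 := ?b), c, w)"
    by (rule run_mv0) (auto simp: z fun_eq_iff)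
  have "run B (move (r+2) [r]) (p(r+2 := ?b), c, w) (p(r := ?b), c, w)"
    using le2 Bind.prems(3) by (intro run_move) (auto simp: z fun_eq_iff)
  with 1 2 3 show ?case unfolding compile.simps ev.simps by (blast intro: run_Seq)
next
  case (Inp a)
  note z = fit_zero(1)[OF Inp.prems(1)]
  let ?a = "ev x a \<eta> \<alpha>" let ?s = "string_content x (int ?a)"
  have le: "?a \<le> value_bound a M" using Inp.prems by (auto intro: ev_le)
  have f: "p 0 = 0" "0 < r" "c 0 ?a = ?s" using Inp.prems(1) by (auto simp: fit_def)
  have 1: "run B (compile a \<rho> \<kappa> r) (p, c, w) (p(r := ?a), c, w)"
    using Inp.prems by (intro Inp.IH) auto
  have 2: "run B (move r [0]) (p(r := ?a), c, w) (p(0 := ?a), c, w)"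
    using f le Inp.prems(3) by (intro run_move) (auto simp: z fun_eq_iff)
  have i1: "run B (Inc r) (p(0 := ?a), c, w) (p(0 := ?a, r := 1), c, w)"
    using f Inp.prems(3) by (intro run_Inc') (auto simp: z)
  have i2: "run B (Inc r) (p(0 := ?a, r := 1), c, w) (p(0 := ?a, r := 2), c, w)"
    using f Inp.prems(3) by (intro run_Inc') (auto simp: z)
  have i0: "p(0 := ?a, r := 0) = p(0 := ?a)" using f z[of r] by (auto simp: fun_eq_iff)
  have 3: "run B (Cond (Ne 0 1) (Cond (Ne 0 2) Skip (Inc r ;; Inc r)) (Inc r)) (p(0 := ?a), c, w) (p(0 := ?a, r := ?s), c, w)"
    using f(3) i0 by (intro run_Cond) (auto simp: string_content_def intro!: run_Cond run_Skip i1 run_Seq[OF i1 i2]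
      simp del: One_nat_def split: if_splits)
  have "run B (move 0 []) (p(0 := ?a, r := ?s), c, w) (p(r := ?s), c, w)"
    using f by (intro run_mv0) (auto simp: fun_eq_iff)
  with 1 2 3 show ?case unfolding compile.simps ev.simps by (blast intro: run_Seq)
next
  case (Arr A a)
  note z = fit_zero(1)[OF Arr.prems(1)]
  let ?a = "ev x a \<eta> \<alpha>" let ?k = "\<kappa> A"
  have le: "?a \<le> value_bound a M" using Arr.prems by (auto intro: ev_le)
  have f: "p ?k = 0" "?k < r" "c ?k ?a = of_bool (\<alpha> A ?a)" using Arr.prems(1) by (auto simp: fit_def)
  have 1: "run B (compile a \<rho> \<kappa> r) (p, c, w) (p(r := ?a), c, w)"
    using Arr.prems by (intro Arr.IH) auto
  have 2: "run B (move r [?k]) (p(r := ?a), c, w) (p(?k := ?a), c, w)"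
    using f le Arr.prems(3) by (intro run_move) (auto simp: z fun_eq_iff)
  have i1: "run B (Inc r) (p(?k := ?a), c, w) (p(?k := ?a, r := 1), c, w)"
    using f Arr.prems(3) by (intro run_Inc') (auto simp: z)
  have i0: "p(?k := ?a, r := 0) = p(?k := ?a)" using f z[of r] by (auto simp: fun_eq_iff)
  have 3: "run B (Cond (Ne ?k 1) Skip (Inc r)) (p(?k := ?a), c, w) (p(?k := ?a, r := of_bool (\<alpha> A ?a)), c, w)"
    using f(3) i0 i1 by (intro run_Cond) (auto intro: run_Skip)
  have "run B (move ?k []) (p(?k := ?a, r := of_bool (\<alpha> A ?a)), c, w) (p(r := of_bool (\<alpha> A ?a)), c, w)"
    using f by (intro run_mv0) (auto simp: fun_eq_iff)
  with 1 2 3 show ?case unfolding compile.simps ev.simps by (blast intro: run_Seq)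
next
  case (It i y n cap e b)
  note z = fit_zero(1)[OF It.prems(1)]
  let ?n = "ev x n \<eta> \<alpha>" and ?cap = "ev x cap \<eta> \<alpha>" and ?e = "ev x e \<eta> \<alpha>"
  define Y where "Y = rec_nat (min ?e ?cap) (\<lambda>j z. min (ev x b (\<eta>(i := j, y := z)) \<alpha>) ?cap)"
  have le: "?n \<le> value_bound n M" "?cap \<le> value_bound cap M" using It.prems by (auto intro: ev_le)
  have leB: "?n \<le> B" "?cap \<le> B" using le It.prems(3) by simp_all
  have Yc: "Y j \<le> ?cap" for j by (cases j) (auto simp: Y_def)
  have "fit x \<eta> \<alpha> \<rho> \<kappa> (r+2) p c" by (rule fit_mono[OF It.prems(1)]) (auto simp: z)
  then have 1: "run B (compile n \<rho> \<kappa> (r+2)) (p, c, w) (p(r+2 := ?n), c, w)"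
    by (rule It.IH(1)[where M = M]) (use It.prems in auto)
  have "fit x \<eta> \<alpha> \<rho> \<kappa> (r+3) (p(r+2 := ?n)) c" by (rule fit_mono[OF It.prems(1)]) (auto simp: z)
  then have 2: "run B (compile cap \<rho> \<kappa> (r+3)) (p(r+2 := ?n), c, w) (p(r+2 := ?n, r+3 := ?cap), c, w)"
    by (rule It.IH(2)[where M = M]) (use It.prems in auto)
  have "fit x \<eta> \<alpha> \<rho> \<kappa> (r+4) (p(r+2 := ?n, r+3 := ?cap)) c" by (rule fit_mono[OF It.prems(1)]) (auto simp: z)
  then have 3: "run B (compile e \<rho> \<kappa> (r+4)) (p(r+2 := ?n, r+3 := ?cap), c, w) (p(r+2 := ?n, r+3 := ?cap, r+4 := ?e), c, w)"
    by (rule It.IH(3)[where M = M]) (use It.prems in auto)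
  define P where "P j = p(r := Y j, r+1 := j, r+2 := ?n - j, r+3 := ?cap)" for j
  have "(p(r+2 := ?n, r+3 := ?cap, r+4 := ?e))(r := min ?e ?cap, r+4 := 0) = P 0"
    by (auto simp: P_def Y_def z fun_eq_iff)
  then have 4: "run B (min_into r) (p(r+2 := ?n, r+3 := ?cap, r+4 := ?e), c, w) (P 0, c, w)"
    using run_min_into[of "p(r+2 := ?n, r+3 := ?cap, r+4 := ?e)" r B c w] leB by (simp add: z)
  let ?body = "compile b (\<rho>(i := r+1, y := r)) \<kappa> (r+4) ;; move r [] ;; min_into r ;; Inc (r+1)"
  have 5: "run B (While (Nz (r+2)) (Dec (r+2) ;; ?body)) (P 0, c, w) (P ?n, c, w)"
  proof (rule run_for[where C = "\<lambda>_. c" and D = "\<lambda>_. w"])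
    fix j assume j: "j < ?n"
    let ?p = "(P j)(r+2 := ?n - Suc j)" and ?\<eta> = "\<eta>(i := j, y := Y j)"
    let ?b = "ev x b ?\<eta> \<alpha>"
    have m: "?\<eta> u \<le> M + value_bound n M + value_bound cap M" for u
      using It.prems(2)[of u] j le Yc[of j] by simp
    have "fit x \<eta> \<alpha> \<rho> \<kappa> (r+4) ?p c"
      by (rule fit_mono[OF It.prems(1)]) (auto simp: z P_def)
    then have "fit x (\<eta>(i := j)) \<alpha> (\<rho>(i := r+1)) \<kappa> (r+4) ?p c" by (rule fit_bind) (auto simp: P_def)
    then have "fit x ?\<eta> \<alpha> (\<rho>(i := r+1, y := r)) \<kappa> (r+4) ?p c" by (rule fit_bind) (auto simp: P_def)
    then have b1: "run B (compile b (\<rho>(i := r+1, y := r)) \<kappa> (r+4)) (?p, c, w) (?p(r+4 := ?b), c, w)"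
    by (rule It.IH(4)[OF _ m]) (use It.prems(3) in simp)
    have b2: "run B (move r []) (?p(r+4 := ?b), c, w) (?p(r+4 := ?b, r := 0), c, w)" by (rule run_mv0) simp
    have b3: "run B (min_into r) (?p(r+4 := ?b, r := 0), c, w) (?p(r := Y (Suc j)), c, w)"
    proof -
      have "(?p(r+4 := ?b, r := 0))(r := min ?b ?cap, r+4 := 0) = ?p(r := Y (Suc j))"
        by (auto simp: P_def Y_def z fun_eq_iff)
      then show ?thesis using run_min_into[of "?p(r+4 := ?b, r := 0)" r B c w] leB by (simp add: z P_def)
    qed
    have "run B (Inc (r+1)) (?p(r := Y (Suc j)), c, w) (P (Suc j), c, w)"
      using j leB by (intro run_Inc') (auto simp: P_def fun_eq_iff)
    with b1 b2 b3 show "run B ?body (?p, c, w) (P (Suc j), c, w)" by (blast intro: run_Seq)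
  qed (simp add: P_def)
  have 6: "run B (move (r+1) []) (P ?n, c, w) (p(r := Y ?n, r+3 := ?cap), c, w)"
    by (rule run_mv0) (auto simp: P_def z fun_eq_iff)
  have 7: "run B (move (r+3) []) (p(r := Y ?n, r+3 := ?cap), c, w) (p(r := Y ?n), c, w)"
    by (rule run_mv0) (auto simp: z fun_eq_iff)
  have *: "ev x (It i y n cap e b) \<eta> \<alpha> = Y ?n" by (simp add: Y_def)
  show ?case unfolding * compile.simps
    by (rule run_Seq[OF 1 run_Seq[OF 2 run_Seq[OF 3 run_Seq[OF 4 run_Seq[OF 5 run_Seq[OF 6 7]]]]]])
next
  case (Qbf A v len u b)
  note z = fit_zero(1)[OF Qbf.prems(1)] and zc = fit_zero(2)[OF Qbf.prems(1)]
  let ?L = "ev x len \<eta> \<alpha>"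
  define U where "U q \<longleftrightarrow> ev x u (\<eta>(v := q)) \<alpha> \<noteq> 0" for q
  define \<psi> where "\<psi> W \<longleftrightarrow> ev x b \<eta> (\<alpha>(A := W)) \<noteq> 0" for W
  have le: "?L \<le> value_bound len M" using Qbf.prems by (auto intro: ev_le)
  have leB: "?L \<le> B" "1 \<le> B" using le Qbf.prems(3) by simp_all
  have "fit x \<eta> \<alpha> \<rho> \<kappa> (r+2) p c" by (rule fit_mono[OF Qbf.prems(1)]) (auto simp: z)
  then have 1: "run B (compile len \<rho> \<kappa> (r+2)) (p, c, w) (p(r+2 := ?L), c, w)"
    by (rule Qbf.IH(1)[where M = M]) (use Qbf.prems in auto)
  define P where "P t q f g = p(r := of_bool t, r+1 := q, r+2 := ?L, r+3 := f, r+4 := g)" for t q f g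
  define C where "C W = c(r+1 := \<lambda>i. of_bool (W i))" for W
  let ?scan = "scan_com r (compile u (\<rho>(v := r+1)) \<kappa> (r+5))"
  have scan: "\<exists>q'. run B ?scan (P t ?L 1 1, C W, w)
      (P t q' (of_bool (\<not> fst (scan U t ?L W))) 0, C (snd (scan U t ?L W)), w)" for t W
    unfolding P_def C_def
  proof (rule run_scan)
    fix W t q assume q: "q < ?L"
    let ?p = "p(r := of_bool t, r+1 := q, r+2 := ?L, r+3 := 1, r+4 := 1)"
    let ?c = "c(r+1 := \<lambda>i. of_bool (W i))"
    have m: "(\<eta>(v := q)) u \<le> M + value_bound len M" for u using Qbf.prems(2)[of u] q le by simp
    have "fit x \<eta> \<alpha> \<rho> \<kappa> (r+5) ?p ?c" by (rule fit_mono[OF Qbf.prems(1)]) (auto simp: z)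
    then have "fit x (\<eta>(v := q)) \<alpha> (\<rho>(v := r+1)) \<kappa> (r+5) ?p ?c" by (rule fit_bind) auto
    then show "run B (compile u (\<rho>(v := r+1)) \<kappa> (r+5)) (?p, ?c, w)
        (?p(r+5 := ev x u (\<eta>(v := q)) \<alpha>), ?c, w)"
    by (rule Qbf.IH(2)[OF _ m]) (use Qbf.prems(3) in simp)
  qed (auto simp: U_def z)
  let ?body = "move r [] ;; compile b \<rho> (\<kappa>(A := r+1)) (r+4) ;; Cond (Nz (r+4)) (move (r+4) [] ;; Inc r) Skip ;;
       move (r+2) [r+1, r+4] ;; move (r+4) [r+2] ;; Inc (r+4) ;; ?scan ;; move (r+1) []"
  have body: "run B ?body (P t 0 1 0, C W, w)
      (P (\<psi> W) 0 (of_bool (\<not> fst (scan U (\<psi> W) ?L W))) 0, C (snd (scan U (\<psi> W) ?L W)), w)" for t W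
  proof -
    let ?b = "ev x b \<eta> (\<alpha>(A := W))"
    have b1: "run B (move r []) (P t 0 1 0, C W, w) (P False 0 1 0, C W, w)"
      by (rule run_mv0) (auto simp: P_def fun_eq_iff)
    have "fit x \<eta> \<alpha> \<rho> \<kappa> (r+4) (P False 0 1 0) (C W)"
      by (rule fit_mono[OF Qbf.prems(1)]) (auto simp: z P_def C_def)
    then have "fit x \<eta> (\<alpha>(A := W)) \<rho> (\<kappa>(A := r+1)) (r+4) (P False 0 1 0) (C W)"
      by (rule fit_arr) (auto simp: P_def C_def)
    then have b2: "run B (compile b \<rho> (\<kappa>(A := r+1)) (r+4)) (P False 0 1 0, C W, w) ((P False 0 1 0)(r+4 := ?b), C W, w)"
    by (rule Qbf.IH(3)[where M = M]) (use Qbf.prems in auto)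
    have b3: "run B (Cond (Nz (r+4)) (move (r+4) [] ;; Inc r) Skip) ((P False 0 1 0)(r+4 := ?b), C W, w) (P (\<psi> W) 0 1 0, C W, w)"
    proof (cases "?b = 0")
      case True
      then have e: "(P False 0 1 0)(r+4 := ?b) = P (\<psi> W) 0 1 0" by (auto simp: P_def \<psi>_def fun_eq_iff)
      have h: "\<not> holds ((P False 0 1 0)(r+4 := ?b), C W, w) (Nz (r+4))" using True by simp
      show ?thesis using run_False[OF h run_Skip] unfolding e .
    next
      case False
      have "run B (move (r+4) []) ((P False 0 1 0)(r+4 := ?b), C W, w) (P False 0 1 0, C W, w)"
        by (rule run_mv0) (auto simp: P_def fun_eq_iff)
      moreover have "run B (Inc r) (P False 0 1 0, C W, w) (P (\<psi> W) 0 1 0, C W, w)"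
        using False leB by (intro run_Inc') (auto simp: P_def \<psi>_def fun_eq_iff)
      ultimately show ?thesis using False by (intro run_True run_Seq) auto
    qed
    have b4: "run B (move (r+2) [r+1, r+4]) (P (\<psi> W) 0 1 0, C W, w)
        ((P (\<psi> W) ?L 1 ?L)(r+2 := 0), C W, w)"
      using leB by (intro run_move) (auto simp: P_def fun_eq_iff)
    have b5: "run B (move (r+4) [r+2]) ((P (\<psi> W) ?L 1 ?L)(r+2 := 0), C W, w) (P (\<psi> W) ?L 1 0, C W, w)"
      using leB by (intro run_move) (auto simp: P_def fun_eq_iff)
    have b6: "run B (Inc (r+4)) (P (\<psi> W) ?L 1 0, C W, w) (P (\<psi> W) ?L 1 1, C W, w)"
      using leB by (intro run_Inc') (auto simp: P_def fun_eq_iff)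
    obtain q' where b7: "run B ?scan (P (\<psi> W) ?L 1 1, C W, w)
      (P (\<psi> W) q' (of_bool (\<not> fst (scan U (\<psi> W) ?L W))) 0, C (snd (scan U (\<psi> W) ?L W)), w)"
      using scan by blast
    have b8: "run B (move (r+1) []) (P t q' f 0, C W', w) (P t 0 f 0, C W', w)" for t f W'
      by (rule run_mv0) (auto simp: P_def fun_eq_iff)
    show ?thesis
      using run_Seq[OF b1 run_Seq[OF b2 run_Seq[OF b3 run_Seq[OF b4 run_Seq[OF b5 run_Seq[OF b6 run_Seq[OF b7 b8]]]]]]] .
  qed
  have loop: "run B (While (Nz (r+3)) ?body) (P t 0 1 0, C W, w) (P res 0 0 0, C (\<lambda>_. False), w)"
    if "qrun U \<psi> ?L W res" "\<And>i. ?L \<le> i \<Longrightarrow> \<not> W i" for W res t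
    using that
  proof (induction arbitrary: t rule: qrun.induct)
    case (qrun_stop W)
    \<comment> \<open>A scan that runs to the end has cleared every bit, so the tape of the array is
      blank again, as \<open>fit\<close> demands of free registers.\<close>
    then have "snd (scan U (\<psi> W) ?L W) = (\<lambda>_. False)"
      using scan_above[of ?L _ U "\<psi> W" W] scan_finished[of U "\<psi> W" ?L W] by (metis not_le)
    then have "run B ?body (P t 0 1 0, C W, w) (P (\<psi> W) 0 0 0, C (\<lambda>_. False), w)"
      using body[of t W] qrun_stop by simp
    then show ?case by (rule run_Loop[OF _ _ run_Stop, rotated]) (auto simp: P_def)
  next
    case (qrun_go W res)
    have "run B ?body (P t 0 1 0, C W, w) (P (\<psi> W) 0 1 0, C (snd (scan U (\<psi> W) ?L W)), w)"
      using body[of t W] qrun_go by simp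
    moreover have "run B (While (Nz (r+3)) ?body) (P (\<psi> W) 0 1 0, C (snd (scan U (\<psi> W) ?L W)), w)
       (P res 0 0 0, C (\<lambda>_. False), w)"
      using qrun_go.prems by (intro qrun_go.IH) (simp add: scan_above)
    ultimately show ?case by (rule run_Loop[rotated]) (auto simp: P_def)
  qed
  let ?res = "game U \<psi> ?L 0 (\<lambda>_. False)"
  have C0: "C (\<lambda>_. False) = c" using zc[of "r+1"] by (auto simp: C_def fun_eq_iff)
  have P0: "(p(r+2 := ?L))(r+3 := 1) = P False 0 1 0" by (auto simp: P_def z fun_eq_iff)
  have 2: "run B (Inc (r+3)) (p(r+2 := ?L), c, w) (P False 0 1 0, c, w)"
    unfolding P0[symmetric] using leB by (intro run_Inc') (auto simp: z)
  have 3: "run B (While (Nz (r+3)) ?body) (P False 0 1 0, c, w) (P ?res 0 0 0, c, w)"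
    using loop[OF qrun_game, of False] by (simp add: C0)
  have 4: "run B (move (r+2) []) (P ?res 0 0 0, c, w) (p(r := of_bool ?res), c, w)"
    by (rule run_mv0) (auto simp: P_def z fun_eq_iff)
  have "(\<lambda>q. ev x u (\<eta>(v := q)) \<alpha> \<noteq> 0) = U" "(\<lambda>W. ev x b \<eta> (\<alpha>(A := W)) \<noteq> 0) = \<psi>"
    by (simp_all add: U_def \<psi>_def fun_eq_iff)
  then have *: "ev x (Qbf A v len u b) \<eta> \<alpha> = of_bool ?res" by (simp only: ev.simps)
  show ?case unfolding * compile.simps by (rule run_Seq[OF 1 run_Seq[OF 2 run_Seq[OF 3 4]]])
qed

text \<open>A construct itself uses registers up to \<open>r + 5\<close> and places its parts at
  \<open>r + 5\<close> at the latest, so 8 additional tapes are ample.\<close>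

primrec tapes_used :: "exp \<Rightarrow> nat" where
  "tapes_used (Vr v) = 8" | "tapes_used (Nm k) = 8" | "tapes_used (Add a b) = 8 + tapes_used a + tapes_used b"
| "tapes_used (Sub a b) = 8 + tapes_used a + tapes_used b" | "tapes_used (Mul a b) = 8 + tapes_used a + tapes_used b"
| "tapes_used (Div a b) = 8 + tapes_used a + tapes_used b" | "tapes_used (Ite c a b) = 8 + tapes_used c + tapes_used a + tapes_used b"
| "tapes_used (Bind v a b) = 8 + tapes_used a + tapes_used b" | "tapes_used (Inp a) = 8 + tapes_used a" | "tapes_used (Arr A a) = 8 + tapes_used a"
| "tapes_used (It i y n cap e b) = 8 + tapes_used n + tapes_used cap + tapes_used e + tapes_used b"
| "tapes_used (Qbf A v len u b) = 8 + tapes_used len + tapes_used u + tapes_used b"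

lemma com_ok_incs: "com_ok K (incs rs) \<longleftrightarrow> (\<forall>r\<in>set rs. r < K)"
  by (induction rs) auto

lemma com_ok_move: "com_ok K (move s rs) \<longleftrightarrow> s < K \<and> (\<forall>r\<in>set rs. r < K)"
  by (simp add: move_def com_ok_incs)

lemma com_ok_min_into: "r + 5 < K \<Longrightarrow> com_ok K (min_into r)"
  by (simp add: min_into_def com_ok_move)

lemma com_ok_scan_com: "r + 5 < K \<Longrightarrow> com_ok K k \<Longrightarrow> com_ok K (scan_com r k)"
  by (simp add: scan_com_def decide_def Let_def com_ok_move)

lemma tapes_used_ge: "8 \<le> tapes_used e"
  by (cases e) auto

lemma com_ok_comp:
  "r + tapes_used e \<le> K \<Longrightarrow> (\<And>v. \<rho> v < K) \<Longrightarrow> (\<And>A. \<kappa> A < K) \<Longrightarrow> com_ok K (compile e \<rho> \<kappa> r)"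
proof (induction e arbitrary: \<rho> \<kappa> r)
  case (It i y n cap e b)
  then have "(\<rho>(i := r+1, y := r)) v < K" for v by simp
  then have "com_ok K (compile b (\<rho>(i := r+1, y := r)) \<kappa> (r+4))"
    using It.prems by (intro It.IH(4)) auto
  moreover have "com_ok K (compile n \<rho> \<kappa> (r+2))" "com_ok K (compile cap \<rho> \<kappa> (r+3))" "com_ok K (compile e \<rho> \<kappa> (r+4))"
    using It.prems by (intro It.IH; simp)+
  ultimately show ?case using It.prems(1) by (simp add: com_ok_move com_ok_min_into)
next
  case (Qbf A v len u b)
  then have "(\<rho>(v := r+1)) w < K" "(\<kappa>(A := r+1)) w < K" for w by simp_all
  then have "com_ok K (compile u (\<rho>(v := r+1)) \<kappa> (r+5))" "com_ok K (compile b \<rho> (\<kappa>(A := r+1)) (r+4))"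
    using Qbf.prems by (intro Qbf.IH; simp)+
  moreover have "com_ok K (compile len \<rho> \<kappa> (r+2))"
    using Qbf.prems by (intro Qbf.IH; simp)
  ultimately show ?case using Qbf.prems(1) by (simp add: com_ok_move com_ok_scan_com)
next
  case (Bind v a b)
  then have "(\<rho>(v := r+1)) w < K" for w by simp
  then have "com_ok K (compile b (\<rho>(v := r+1)) \<kappa> (r+2))"
    using Bind.prems by (intro Bind.IH; simp)
  moreover have "com_ok K (compile a \<rho> \<kappa> (r+1))" using Bind.prems by (intro Bind.IH; simp)
  ultimately show ?case using Bind.prems(1) by (simp add: com_ok_move)
next
  case (Inp a)
  then show ?case using Inp.prems(2)[of 0] by (simp add: com_ok_move)
qed (auto simp: com_ok_move com_ok_incs)

text \<open>\<open>Put\<close> occurs only in the search for a quantified array. Without it the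
  compiled programs leave all cells unchanged and run in polynomial time.\<close>

primrec qfree :: "exp \<Rightarrow> bool" where
  "qfree (Vr v) \<longleftrightarrow> True" | "qfree (Nm k) \<longleftrightarrow> True" | "qfree (Add a b) \<longleftrightarrow> qfree a \<and> qfree b"
| "qfree (Sub a b) \<longleftrightarrow> qfree a \<and> qfree b" | "qfree (Mul a b) \<longleftrightarrow> qfree a \<and> qfree b"
| "qfree (Div a b) \<longleftrightarrow> qfree a \<and> qfree b" | "qfree (Ite c a b) \<longleftrightarrow> qfree c \<and> qfree a \<and> qfree b"
| "qfree (Bind v a b) \<longleftrightarrow> qfree a \<and> qfree b" | "qfree (Inp a) \<longleftrightarrow> qfree a" | "qfree (Arr A a) \<longleftrightarrow> qfree a"
| "qfree (It i y n cap e b) \<longleftrightarrow> qfree n \<and> qfree cap \<and> qfree e \<and> qfree b"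
| "qfree (Qbf A v len u b) \<longleftrightarrow> False"

lemma noput_incs: "noput (incs rs)"
  by (induction rs) auto

lemma noput_move: "noput (move s rs)"
  by (simp add: move_def noput_incs)

lemma noput_comp: "qfree e \<Longrightarrow> noput (compile e \<rho> \<kappa> r)"
  by (induction e arbitrary: \<rho> \<kappa> r) (auto simp: noput_move noput_incs min_into_def)

section \<open>Evaluation in polynomial space and printing in polynomial time\<close>

definition load_length :: com where
  "load_length = While (Ne 0 0) (Inc 0 ;; Inc 2) ;; move 0 []"

lemma run_load_length:
  assumes "length x \<le> B"
  shows "run B load_length (init_mem x) ((\<lambda>_. 0)(2 := length x), fst (snd (init_mem x)), [])"
proof -
  define c where "c = fst (snd (init_mem x))"
  have c: "c 0 i = string_content x (int i)" for i by (simp add: c_def init_mem_def)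
  define P :: "nat \<Rightarrow> nat \<Rightarrow> nat" where "P j = (\<lambda>_. 0)(0 := j, 2 := j)" for j
  have "run B (While (Ne 0 0) (Inc 0 ;; Inc 2)) (P j, c, []) (P (length x), c, [])" if "j \<le> length x" for j
    using that
  proof (induction rule: inc_induct)
    case base
    show ?case by (rule run_Stop) (simp add: P_def c string_content_def)
  next
    case (step j)
    have "run B (Inc 0) (P j, c, []) ((P j)(0 := Suc j), c, [])"
      using step assms by (intro run_Inc') (auto simp: P_def)
    moreover have "run B (Inc 2) ((P j)(0 := Suc j), c, []) (P (Suc j), c, [])"
      using step assms by (intro run_Inc') (auto simp: P_def fun_eq_iff)
    moreover have "holds (P j, c, []) (Ne 0 0)" using step by (simp add: P_def c string_content_def)
    ultimately show ?case using step.IH by (blast intro: run_Loop run_Seq)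
  qed
  from this[of 0] have 1: "run B (While (Ne 0 0) (Inc 0 ;; Inc 2)) (P 0, c, []) (P (length x), c, [])" by simp
  have i: "init_mem x = (P 0, c, [])" by (simp add: c_def init_mem_def P_def fun_eq_iff)
  have "run B (move 0 []) (P (length x), c, []) ((\<lambda>_. 0)(2 := length x), c, [])"
    by (rule run_mv0) (auto simp: P_def)
  from run_Seq[OF 1 this] show ?thesis unfolding load_length_def i fst_conv snd_conv .
qed

definition env0 :: "bool list \<Rightarrow> nat \<Rightarrow> nat" where "env0 x = (\<lambda>_. 0)(0 := length x)"

definition arr0 :: "nat \<Rightarrow> nat \<Rightarrow> bool" where "arr0 = (\<lambda>_ _. False)"

text \<open>Register 0 is the input tape and register 2 holds the input length. The blank tape 1
  stands for all other variables and for all arrays that are not bound.\<close>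

definition reg0 :: "nat \<Rightarrow> nat" where "reg0 = (\<lambda>_. 1)(0 := 2)"

lemma fit_init:
  "fit x (env0 x) arr0 reg0 (\<lambda>_. 1) 3 ((\<lambda>_. 0)(2 := length x)) (fst (snd (init_mem x)))"
  by (auto simp: fit_def env0_def arr0_def reg0_def init_mem_def fun_eq_iff)

lemma env0_le: "env0 x v \<le> length x"
  by (simp add: env0_def)

lemma com_ok_load_length: "3 \<le> K \<Longrightarrow> com_ok K load_length"
  by (simp add: load_length_def com_ok_move)

theorem PSPACE_ev: "{x. ev x e (env0 x) arr0 \<noteq> 0} \<in> PSPACE"
proof (rule PSPACE_if_run)
  show "com_ok (3 + tapes_used e) (load_length ;; compile e reg0 (\<lambda>_. 1) 3)"
    by (simp add: com_ok_load_length com_ok_comp reg0_def)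
  show "3 < 3 + tapes_used e" using tapes_used_ge[of e] by simp
  show "polyb (\<lambda>n. n + value_bound e n)" by (intro polyb_add polyb_value_bound polyb_id)
  fix x
  let ?c = "fst (snd (init_mem x))" and ?p = "(\<lambda>_. 0)(2 := length x)"
  have 1: "run (length x + value_bound e (length x)) load_length (init_mem x) (?p, ?c, [])"
    by (rule run_load_length) simp
  have 2: "run (length x + value_bound e (length x)) (compile e reg0 (\<lambda>_. 1) 3) (?p, ?c, [])
      (?p(3 := ev x e (env0 x) arr0), ?c, [])"
    by (rule run_comp[OF fit_init env0_le]) simp
  show "\<exists>p c. run (length x + value_bound e (length x)) (load_length ;; compile e reg0 (\<lambda>_. 1) 3) (init_mem x) (p, c, []) \<and>
      (p 3 \<noteq> 0 \<longleftrightarrow> x \<in> {x. ev x e (env0 x) arr0 \<noteq> 0})"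
    by (intro exI conjI, rule run_Seq[OF 1 2]) simp
qed

datatype printer = PBit exp | PSeq printer printer | PFor nat exp printer

primrec pout :: "bool list \<Rightarrow> printer \<Rightarrow> (nat \<Rightarrow> nat) \<Rightarrow> bool list" where
  "pout x (PBit e) \<eta> = [ev x e \<eta> arr0 \<noteq> 0]"
| "pout x (PSeq k l) \<eta> = pout x k \<eta> @ pout x l \<eta>"
| "pout x (PFor i e k) \<eta> = concat (map (\<lambda>j. pout x k (\<eta>(i := j))) [0..<ev x e \<eta> arr0])"

primrec compile_print :: "printer \<Rightarrow> (nat \<Rightarrow> nat) \<Rightarrow> (nat \<Rightarrow> nat) \<Rightarrow> nat \<Rightarrow> com" where
  "compile_print (PBit e) \<rho> \<kappa> r = compile e \<rho> \<kappa> r ;; Cond (Nz r) (move r [] ;; Emit True) (Emit False)"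
| "compile_print (PSeq k l) \<rho> \<kappa> r = compile_print k \<rho> \<kappa> r ;; compile_print l \<rho> \<kappa> r"
| "compile_print (PFor i e k) \<rho> \<kappa> r = compile e \<rho> \<kappa> (r+1) ;;
     While (Nz (r+1)) (Dec (r+1) ;; compile_print k (\<rho>(i := r)) \<kappa> (r+2) ;; Inc r) ;; move r []"

primrec print_bound :: "printer \<Rightarrow> nat \<Rightarrow> nat" where
  "print_bound (PBit e) M = value_bound e M"
| "print_bound (PSeq k l) M = print_bound k M + print_bound l M"
| "print_bound (PFor i e k) M = value_bound e M + print_bound k (M + value_bound e M)"

primrec tapes_used_print :: "printer \<Rightarrow> nat" where
  "tapes_used_print (PBit e) = 2 + tapes_used e" | "tapes_used_print (PSeq k l) = tapes_used_print k + tapes_used_print l" | "tapes_used_print (PFor i e k) = 2 + tapes_used e + tapes_used_print k"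

primrec qfreep :: "printer \<Rightarrow> bool" where
  "qfreep (PBit e) \<longleftrightarrow> qfree e" | "qfreep (PSeq k l) \<longleftrightarrow> qfreep k \<and> qfreep l"
| "qfreep (PFor i e k) \<longleftrightarrow> qfree e \<and> qfreep k"

lemma polyb_print_bound: "polyb g \<Longrightarrow> polyb (\<lambda>n. print_bound k (g n))"
proof (induction k arbitrary: g)
  case (PBit e) then show ?case by (simp add: polyb_value_bound)
next
  case (PSeq k l) show ?case unfolding print_bound.simps by (intro polyb_add PSeq)
next
  case (PFor i e k) show ?case unfolding print_bound.simps by (intro polyb_add polyb_value_bound PFor)
qed

lemma com_ok_compile_print: "r + tapes_used_print k \<le> K \<Longrightarrow> (\<And>v. \<rho> v < K) \<Longrightarrow> (\<And>A. \<kappa> A < K) \<Longrightarrow> com_ok K (compile_print k \<rho> \<kappa> r)"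
proof (induction k arbitrary: \<rho> r)
  case (PFor i e k)
  then have "com_ok K (compile_print k (\<rho>(i := r)) \<kappa> (r+2))" by (intro PFor.IH) auto
  then show ?case using PFor.prems by (auto simp: com_ok_move com_ok_comp)
qed (auto simp: com_ok_move com_ok_comp)

lemma noput_compile_print: "qfreep k \<Longrightarrow> noput (compile_print k \<rho> \<kappa> r)"
  by (induction k arbitrary: \<rho> r) (auto simp: noput_move noput_comp)

lemma run_compile_print:
  assumes "fit x \<eta> arr0 \<rho> \<kappa> r p c" "\<And>v. \<eta> v \<le> M" "print_bound k M \<le> B"
  shows "run B (compile_print k \<rho> \<kappa> r) (p, c, w) (p, c, w @ pout x k \<eta>)"
  using assms
proof (induction k arbitrary: \<eta> \<rho> r p w M)
  case (PBit e)
  note z = fit_zero(1)[OF PBit(1)]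
  have 1: "run B (compile e \<rho> \<kappa> r) (p, c, w) (p(r := ev x e \<eta> arr0), c, w)"
    by (rule run_comp[OF PBit(1,2)]) (use PBit(3) in simp)
  have e: "p(r := 0) = p" using z[of r] by (auto simp: fun_eq_iff)
  have 2: "run B (move r []) (p(r := ev x e \<eta> arr0), c, w) (p, c, w)"
    by (rule run_mv0) (simp add: e)
  have "run B (Cond (Nz r) (move r [] ;; Emit True) (Emit False)) (p(r := ev x e \<eta> arr0), c, w)
     (p, c, w @ pout x (PBit e) \<eta>)"
  proof (cases "ev x e \<eta> arr0 = 0")
    case True
    then show ?thesis using z[of r] by (intro run_False) (auto simp: e intro: run_Emit)
  next
    case False
    then have "pout x (PBit e) \<eta> = [True]" by simp
    then show ?thesis using False run_Emit[of B True p c w]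
      by (intro run_True) (auto intro: run_Seq[OF 2])
  qed
  then show ?case unfolding compile_print.simps by (rule run_Seq[OF 1])
next
  case (PSeq k l)
  have "run B (compile_print k \<rho> \<kappa> r) (p, c, w) (p, c, w @ pout x k \<eta>)"
    by (rule PSeq.IH(1)[OF PSeq.prems(1,2)]) (use PSeq.prems(3) in simp)
  moreover have "run B (compile_print l \<rho> \<kappa> r) (p, c, w @ pout x k \<eta>) (p, c, (w @ pout x k \<eta>) @ pout x l \<eta>)"
    by (rule PSeq.IH(2)[OF PSeq.prems(1,2)]) (use PSeq.prems(3) in simp)
  ultimately show ?case unfolding compile_print.simps pout.simps append_assoc[symmetric] by (rule run_Seq)
next
  case (PFor i e k)
  note z = fit_zero(1)[OF PFor.prems(1)]
  let ?e = "ev x e \<eta> arr0"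
  have le: "?e \<le> value_bound e M" using PFor.prems by (auto intro: ev_le)
  have "fit x \<eta> arr0 \<rho> \<kappa> (r+1) p c" by (rule fit_mono[OF PFor.prems(1)]) (auto simp: z)
  then have 1: "run B (compile e \<rho> \<kappa> (r+1)) (p, c, w) (p(r+1 := ?e), c, w)"
    by (rule run_comp[OF _ PFor.prems(2)]) (use PFor.prems(3) in simp)
  define P where "P j = p(r := j, r+1 := ?e - j)" for j
  define D where "D j = w @ concat (map (\<lambda>j. pout x k (\<eta>(i := j))) [0..<j])" for j
  have 2: "run B (While (Nz (r+1)) (Dec (r+1) ;; compile_print k (\<rho>(i := r)) \<kappa> (r+2) ;; Inc r)) (P 0, c, D 0) (P ?e, c, D ?e)"
  proof (rule run_for[where C = "\<lambda>_. c"])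
    fix j assume j: "j < ?e"
    let ?p = "(P j)(r+1 := ?e - Suc j)"
    have m: "(\<eta>(i := j)) v \<le> M + value_bound e M" for v using PFor.prems(2)[of v] j le by simp
    have "fit x \<eta> arr0 \<rho> \<kappa> (r+2) ?p c" by (rule fit_mono[OF PFor.prems(1)]) (auto simp: z P_def)
    then have "fit x (\<eta>(i := j)) arr0 (\<rho>(i := r)) \<kappa> (r+2) ?p c" by (rule fit_bind) (auto simp: P_def)
    then have "run B (compile_print k (\<rho>(i := r)) \<kappa> (r+2)) (?p, c, D j) (?p, c, D j @ pout x k (\<eta>(i := j)))"
      by (rule PFor.IH[OF _ m]) (use PFor.prems(3) in simp)
    moreover have "D j @ pout x k (\<eta>(i := j)) = D (Suc j)" by (simp add: D_def)
    moreover have "run B (Inc r) (?p, c, D (Suc j)) (P (Suc j), c, D (Suc j))"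
      using j le PFor.prems(3) by (intro run_Inc') (auto simp: P_def fun_eq_iff)
    ultimately show "run B (compile_print k (\<rho>(i := r)) \<kappa> (r+2) ;; Inc r) (?p, c, D j) (P (Suc j), c, D (Suc j))"
      by (simp only:) (rule run_Seq)
  qed (simp add: P_def)
  have e: "P 0 = p(r+1 := ?e)" "D 0 = w" by (auto simp: P_def D_def z fun_eq_iff)
  have 3: "run B (move r []) (P ?e, c, D ?e) (p, c, D ?e)"
    by (rule run_mv0) (auto simp: P_def z fun_eq_iff)
  have d: "w @ pout x (PFor i e k) \<eta> = D ?e" by (simp add: D_def)
  show ?case unfolding compile_print.simps d by (rule run_Seq[OF 1 run_Seq[OF 2[unfolded e] 3]])
qed

theorem poly_time_pout:
  assumes "qfreep k" shows "poly_time_computable (\<lambda>x. pout x k (env0 x))"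
proof (rule poly_time_if_run)
  show "com_ok (3 + tapes_used_print k) (load_length ;; compile_print k reg0 (\<lambda>_. 1) 3)"
    by (simp add: com_ok_load_length com_ok_compile_print reg0_def)
  show "0 < 3 + tapes_used_print k" by simp
  show "polyb (\<lambda>n. n + print_bound k n)" by (intro polyb_add polyb_print_bound polyb_id)
  show "noput (load_length ;; compile_print k reg0 (\<lambda>_. 1) 3)"
    using assms by (simp add: load_length_def noput_move noput_compile_print)
  fix x
  let ?c = "fst (snd (init_mem x))" and ?p = "(\<lambda>_. 0)(2 := length x)"
  have 1: "run (length x + print_bound k (length x)) load_length (init_mem x) (?p, ?c, [])"
    by (rule run_load_length) simp
  have 2: "run (length x + print_bound k (length x)) (compile_print k reg0 (\<lambda>_. 1) 3) (?p, ?c, []) (?p, ?c, [] @ pout x k (env0 x))"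
    by (rule run_compile_print[OF fit_init env0_le]) simp
  show "\<exists>p c. run (length x + print_bound k (length x)) (load_length ;; compile_print k reg0 (\<lambda>_. 1) 3) (init_mem x) (p, c, pout x k (env0 x))"
    using run_Seq[OF 1 2] by auto
qed

section \<open>Chains of words and the Wagner hierarchy\<close>

definition cat :: "(nat \<Rightarrow> nat list) \<Rightarrow> nat list \<Rightarrow> nat list" where
  "cat v js = concat (map v js)"

lemma cat_simps [simp]: "cat v [] = []" "cat v (j # js) = v j @ cat v js" "cat v (js @ is) = cat v js @ cat v is"
  by (simp_all add: cat_def)

text \<open>A chain is described semantically: whichever words among \<open>v 0, \<dots>, v (k - 1)\<close> are repeated
  after \<open>u\<close>, acceptance depends on the parity of the largest index repeated.\<close>

definition chain_words :: "nat \<Rightarrow> nat word set \<Rightarrow> nat \<Rightarrow> bool \<Rightarrow> nat list \<Rightarrow> (nat \<Rightarrow> nat list) \<Rightarrow> bool" where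
  "chain_words m L k b u v \<longleftrightarrow> set u \<subseteq> {..<m} \<and> (\<forall>i<k. v i \<noteq> [] \<and> set (v i) \<subseteq> {..<m}) \<and>
     (\<forall>js is. set js \<subseteq> {..<k} \<and> set is \<subseteq> {..<k} \<and> is \<noteq> [] \<longrightarrow>
        ((u @ cat v js) \<frown> (cat v is)\<^sup>\<omega> \<in> L \<longleftrightarrow> even (Max (set is)) = b))"

definition has_chain :: "nat \<Rightarrow> nat word set \<Rightarrow> nat \<Rightarrow> bool \<Rightarrow> bool" where
  "has_chain m L k b \<longleftrightarrow> (\<exists>u v. chain_words m L k b u v)"

lemma chain_wordsD:
  assumes "chain_words m L k b u v"
  shows "set u \<subseteq> {..<m}" "i < k \<Longrightarrow> v i \<noteq> []" "i < k \<Longrightarrow> set (v i) \<subseteq> {..<m}"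
    "set js \<subseteq> {..<k} \<Longrightarrow> set is \<subseteq> {..<k} \<Longrightarrow> is \<noteq> [] \<Longrightarrow>
      (u @ cat v js) \<frown> (cat v is)\<^sup>\<omega> \<in> L \<longleftrightarrow> even (Max (set is)) = b"
proof -
  note d = assms[unfolded chain_words_def]
  note a = d[THEN conjunct1] and b = d[THEN conjunct2, THEN conjunct1] and c = d[THEN conjunct2, THEN conjunct2]
  show "set u \<subseteq> {..<m}" by (rule a)
  show "i < k \<Longrightarrow> v i \<noteq> []" "i < k \<Longrightarrow> set (v i) \<subseteq> {..<m}" using b by simp_all
  show "set js \<subseteq> {..<k} \<Longrightarrow> set is \<subseteq> {..<k} \<Longrightarrow> is \<noteq> [] \<Longrightarrow>
      (u @ cat v js) \<frown> (cat v is)\<^sup>\<omega> \<in> L \<longleftrightarrow> even (Max (set is)) = b"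
    by (rule c[rule_format, of js "is"]) simp
qed

lemma schainI:
  assumes "set u \<subseteq> {..<m}" "\<And>i. i < k \<Longrightarrow> v i \<noteq> []" "\<And>i. i < k \<Longrightarrow> set (v i) \<subseteq> {..<m}"
    "\<And>js is. set js \<subseteq> {..<k} \<Longrightarrow> set is \<subseteq> {..<k} \<Longrightarrow> is \<noteq> [] \<Longrightarrow>
      (u @ cat v js) \<frown> (cat v is)\<^sup>\<omega> \<in> L \<longleftrightarrow> even (Max (set is)) = b"
  shows "has_chain m L k b"
proof -
  have "chain_words m L k b u v" unfolding chain_words_def using assms by (intro conjI allI impI) auto
  then show ?thesis unfolding has_chain_def by (intro exI)
qed

lemma has_chain_0: "has_chain m L 0 b"
  by (rule schainI[of "[]"]) auto

text \<open>Without \<open>v 0\<close> all indices drop by one, which flips the parity.\<close>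

lemma has_chain_shift:
  assumes "has_chain m L (Suc k) b" shows "has_chain m L k (\<not> b)"
proof -
  obtain u v where uv: "chain_words m L (Suc k) b u v" using assms(1) unfolding has_chain_def by (elim exE)
  let ?v = "\<lambda>i. v (Suc i)"
  have c: "cat ?v js = cat v (map Suc js)" for js by (simp add: cat_def comp_def)
  show ?thesis
  proof (rule schainI)
    fix js "is" assume a: "set js \<subseteq> {..<k}" "set is \<subseteq> {..<k}" "is \<noteq> []"
    then have "set (map Suc js) \<subseteq> {..<Suc k}" "set (map Suc is) \<subseteq> {..<Suc k}" "map Suc is \<noteq> []"
      by auto
    from chain_wordsD(4)[OF uv this]
    have "((u @ cat ?v js) \<frown> (cat ?v is)\<^sup>\<omega> \<in> L \<longleftrightarrow> even (Max (set (map Suc is))) = b)"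
      unfolding c .
    moreover have "Max (set (map Suc is)) = Suc (Max (set is))"
      using a(3) by (simp add: mono_Max_commute[symmetric] mono_Suc)
    ultimately show "(u @ cat ?v js) \<frown> (cat ?v is)\<^sup>\<omega> \<in> L \<longleftrightarrow> even (Max (set is)) = (\<not> b)"
      by (simp only: even_Suc) blast
  qed (use chain_wordsD(1-3)[OF uv] in auto)
qed

section \<open>Loops of Muller automata and their SCCs\<close>

definition visits :: "'z dts_scheme \<Rightarrow> nat \<Rightarrow> nat list \<Rightarrow> nat set" where
  "visits A s w = (\<lambda>i. foldl (step A) s (take i w)) ` {..<length w}"

lemma visits_Cons: "visits A s (a # w) = insert s (visits A (step A s a) w)"
proof -
  have "{..<length (a # w)} = insert 0 (Suc ` {..<length w})" by (auto simp: image_iff less_Suc_eq_0_disj)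
  then show ?thesis unfolding visits_def by (simp add: image_image)
qed

lemma visits_Nil [simp]: "visits A s [] = {}"
  by (simp add: visits_def)

lemma visits_append: "visits A s (x @ y) = visits A s x \<union> visits A (foldl (step A) s x) y"
  by (induction x arbitrary: s) (auto simp: visits_Cons)

lemma foldl_in: "wf_dts m A \<Longrightarrow> s < nstates A \<Longrightarrow> set w \<subseteq> {..<m} \<Longrightarrow> foldl (step A) s w < nstates A"
  by (induction w arbitrary: s) (auto simp: wf_dts_def)

lemma reach_in: "wf_dts m A \<Longrightarrow> set w \<subseteq> {..<m} \<Longrightarrow> reach A w < nstates A"
  by (auto simp: reach_def wf_dts_def intro: foldl_in)

lemma visits_in: "wf_dts m A \<Longrightarrow> s < nstates A \<Longrightarrow> set w \<subseteq> {..<m} \<Longrightarrow> visits A s w \<subseteq> {..<nstates A}"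
  by (auto simp: visits_def intro!: foldl_in dest: in_set_takeD)

lemma reach_append: "reach A (u @ w) = foldl (step A) (reach A u) w"
  by (simp add: reach_def)

lemma foldl_cat:
  assumes "\<forall>i\<in>set js. foldl f s (v i) = s" shows "foldl f s (cat v js) = s"
  using assms by (induction js) auto

lemma visits_cat:
  assumes "\<forall>i\<in>set js. foldl (step A) s (v i) = s" shows "visits A s (cat v js) = (\<Union>i\<in>set js. visits A s (v i))"
  using assms by (induction js) (auto simp: visits_append)

lemma foldl_prefix_iter:
  assumes "foldl f s w = s" "w \<noteq> []"
  shows "foldl f s (prefix n w\<^sup>\<omega>) = foldl f s (take (n mod length w) w)"
proof (induction n)
  case (Suc n)
  let ?r = "n mod length w"
  have r: "?r < length w" using assms(2) by simp
  have "prefix (Suc n) w\<^sup>\<omega> = prefix n w\<^sup>\<omega> @ [w ! ?r]" using assms(2) by simp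
  then have "foldl f s (prefix (Suc n) w\<^sup>\<omega>) = f (foldl f s (take ?r w)) (w ! ?r)"
    using Suc by (simp only: foldl_append foldl.simps)
  also have "\<dots> = foldl f s (take (Suc ?r) w)" using r by (simp add: take_Suc_conv_app_nth)
  also have "\<dots> = foldl f s (take (Suc n mod length w) w)"
    using assms(1) r by (cases "Suc ?r = length w") (auto simp: mod_Suc)
  finally show ?case .
qed simp

lemma dma_run_prefix: "dma_run M w n = reach M (prefix n w)"
  by (simp add: dma_run_def subsequence_def)

lemma limit_run:
  assumes "foldl (step M) (reach M u) w = reach M u" "w \<noteq> []"
  shows "limit (dma_run M (u \<frown> w\<^sup>\<omega>)) = visits M (reach M u) w"
proof -
  let ?f = "map (\<lambda>i. foldl (step M) (reach M u) (take i w)) [0..<length w]"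
  have "suffix (length u) (dma_run M (u \<frown> w\<^sup>\<omega>)) = ?f\<^sup>\<omega>"
    using assms by (auto simp: fun_eq_iff dma_run_prefix reach_append foldl_prefix_iter)
  then have "limit (dma_run M (u \<frown> w\<^sup>\<omega>)) = limit (?f\<^sup>\<omega>)"
    using limit_suffix by metis
  also have "\<dots> = set ?f" using assms(2) by (intro limit_iter) simp
  finally show ?thesis by (auto simp: visits_def)
qed

lemma scc_visits:
  assumes "wf_dts m A" "s < nstates A" "set w \<subseteq> {..<m}" "w \<noteq> []" "foldl (step A) s w = s"
  shows "scc m A (visits A s w)"
proof -
  let ?S = "visits A s w"
  let ?E = "edges_within m A ?S"
  define f where "f i = foldl (step A) s (take i w)" for i
  have fl: "f (length w) = f 0" by (simp add: f_def assms(5))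
  have fS: "f i \<in> ?S" if "i \<le> length w" for i
  proof (cases "i = length w")
    case True
    then show ?thesis using assms(4) fl by (auto simp: visits_def f_def intro: rev_image_eqI[of 0])
  qed (use that in \<open>auto simp: visits_def f_def\<close>)
  have e: "(f i, f (Suc i)) \<in> ?E" if "i < length w" for i
  proof -
    have "f (Suc i) = step A (f i) (w ! i)" using that by (simp add: f_def take_Suc_conv_app_nth)
    moreover have "w ! i < m" using that assms(3) by (meson lessThan_iff nth_mem subsetD)
    ultimately show ?thesis using fS[of i] fS[of "Suc i"] that by (auto simp: edges_within_def)
  qed
  have p: "(f i, f j) \<in> ?E\<^sup>*" if "i \<le> j" "j \<le> length w" for i j
    using that by (induction j rule: dec_induct) (auto intro: rtrancl_into_rtrancl e simp: Suc_le_eq)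
  have "(f i, f j) \<in> ?E\<^sup>+" if "i < length w" "j < length w" for i j
  proof -
    have "(f i, f 0) \<in> ?E\<^sup>+" using rtrancl_into_trancl2[OF e[OF that(1)] p[of "Suc i" "length w"]] that fl by simp
    then show ?thesis using p[of 0 j] that by (simp add: trancl_rtrancl_trancl)
  qed
  then show ?thesis unfolding scc_def using assms visits_in[OF assms(1-3)]
    by (auto simp: visits_def f_def[symmetric])
qed

lemma scc_loop:
  assumes "scc m A S" "s \<in> S"
  obtains w where "w \<noteq> []" "set w \<subseteq> {..<m}" "foldl (step A) s w = s" "visits A s w = S"
proof -
  let ?P = "\<lambda>p q w. w \<noteq> [] \<and> set w \<subseteq> {..<m} \<and> foldl (step A) p w = q \<and> visits A p w \<subseteq> S"
  have path: "\<exists>w. ?P p q w" if "(p, q) \<in> (edges_within m A S)\<^sup>+" for p q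
    using that
  proof (induction rule: trancl_induct)
    case (base y)
    then obtain a where "a < m" "step A p a = y" "p \<in> S" by (auto simp: edges_within_def)
    then show ?case by (intro exI[of _ "[a]"]) (auto simp: visits_Cons)
  next
    case (step y z)
    then obtain w a where "?P p y w" "a < m" "step A y a = z" "y \<in> S" by (auto simp: edges_within_def)
    then show ?case by (intro exI[of _ "w @ [a]"]) (auto simp: visits_append visits_Cons)
  qed
  have p: "\<exists>w. ?P p q w" if "p \<in> S" "q \<in> S" for p q
    using that assms(1) by (intro path) (auto simp: scc_def)
  have fin: "finite S" using assms(1) by (auto simp: scc_def intro: finite_subset)
  \<comment> \<open>For each further state of \<open>T\<close>, a detour from \<open>s\<close>
    through it is appended to the loop.\<close>
  have "\<exists>w. ?P s s w \<and> T \<subseteq> visits A s w" if "T \<subseteq> S" for T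
    using finite_subset[OF that fin] that
  proof (induction T)
    case empty
    then show ?case using p[OF assms(2) assms(2)] by blast
  next
    case (insert t T)
    then obtain w where w: "?P s s w" "T \<subseteq> visits A s w" by blast
    obtain x where x: "?P s t x" using p[OF assms(2)] insert by blast
    obtain y where y: "?P t s y" using p[OF _ assms(2)] insert by blast
    have "t \<in> visits A t y" using y by (cases y) (auto simp: visits_Cons)
    then show ?case using w x y by (intro exI[of _ "w @ x @ y"]) (auto simp: visits_append)
  qed
  from this[of S] show thesis using that by blast
qed

lemma range_iter: "w \<noteq> [] \<Longrightarrow> range (w\<^sup>\<omega>) \<subseteq> set w"
  by auto

text \<open>All words are loops at \<open>s\<close>, so the states visited forever are the union
  over the indices repeated. By inclusion this is the set of the largest index.\<close>

lemma loops_has_chain: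
  assumes M: "wf_dma m M" and s: "set u \<subseteq> {..<m}" "reach M u = s"
    and v: "\<And>i. i < k \<Longrightarrow> v i \<noteq> []" "\<And>i. i < k \<Longrightarrow> set (v i) \<subseteq> {..<m}"
      "\<And>i. i < k \<Longrightarrow> foldl (step M) s (v i) = s"
    and V: "\<And>i j. i \<le> j \<Longrightarrow> j < k \<Longrightarrow> visits M s (v i) \<subseteq> visits M s (v j)"
      "\<And>i. i < k \<Longrightarrow> visits M s (v i) \<in> acc M \<longleftrightarrow> even i = b"
  shows "has_chain m (dma_language m M) k b"
proof (rule schainI)
  fix js "is" assume a: "set js \<subseteq> {..<k}" "set is \<subseteq> {..<k}" "is \<noteq> []"
  have M: "Max (set is) \<in> set is" "Max (set is) < k" using a by (auto simp: subset_iff)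
  have vis: "visits M s (cat v is) = visits M s (v (Max (set is)))"
  proof -
    have "visits M s (cat v is) = (\<Union>i\<in>set is. visits M s (v i))"
      using a v(3) by (intro visits_cat) auto
    also have "\<dots> = visits M s (v (Max (set is)))"
      using M V(1)[OF _ M(2)] by (auto intro: Max_ge)
    finally show ?thesis .
  qed
  have ne: "cat v is \<noteq> []" using a v(1) by (cases "is") auto
  have r: "reach M (u @ cat v js) = s"
    using a v(3) s by (simp add: reach_append) (intro foldl_cat, auto)
  have l: "foldl (step M) s (cat v is) = s" using a v(3) by (intro foldl_cat) auto
  have "limit (dma_run M ((u @ cat v js) \<frown> (cat v is)\<^sup>\<omega>)) = visits M s (v (Max (set is)))"
    using limit_run[of M "u @ cat v js" "cat v is"] r l ne vis by simp
  moreover have "range ((u @ cat v js) \<frown> (cat v is)\<^sup>\<omega>) \<subseteq> {..<m}"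
  proof -
    have "set (cat v js) \<subseteq> {..<m}" "set (cat v is) \<subseteq> {..<m}"
      using a v(2) by (fastforce simp: cat_def)+
    then show ?thesis using s range_iter[OF ne] by auto
  qed
  ultimately show "(u @ cat v js) \<frown> (cat v is)\<^sup>\<omega> \<in> dma_language m M \<longleftrightarrow> even (Max (set is)) = b"
    using V(2)[OF M(2)] by (simp add: dma_language_def)
qed (use s v in auto)

text \<open>A state of the smallest SCC lies in all the others, so all loops can be taken at this
  state. It has to be reachable for a prefix \<open>u\<close> to exist.\<close>

lemma chain_has_chain:
  assumes M: "wf_dma m M" and r: "\<And>q. q < nstates M \<Longrightarrow> \<exists>u. set u \<subseteq> {..<m} \<and> reach M u = q"
    and ch: "alternating_chain m M b Ss"
  shows "has_chain m (dma_language m M) (length Ss) b"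
proof (cases "Ss = []")
  case True
  then show ?thesis by (simp add: has_chain_0)
next
  case False
  then have "scc m M (Ss ! 0)" using ch by (auto simp: alternating_chain_def)
  then obtain s where s: "s \<in> Ss ! 0" "s < nstates M" by (fastforce simp: scc_def)
  have sub: "Ss ! i \<subseteq> Ss ! j" if "i \<le> j" "j < length Ss" for i j
  proof (cases "i = j")
    case False
    then have "Ss ! i \<subset> Ss ! j" using ch that by (simp add: alternating_chain_def sorted_wrt_iff_nth_less)
    then show ?thesis by blast
  qed simp
  obtain u where u: "set u \<subseteq> {..<m}" "reach M u = s" using r[OF s(2)] by blast
  have "\<exists>w. w \<noteq> [] \<and> set w \<subseteq> {..<m} \<and> foldl (step M) s w = s \<and> visits M s w = Ss ! i"
    if "i < length Ss" for i
  proof -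
    have "scc m M (Ss ! i)" "s \<in> Ss ! i" using ch that s(1) sub[of 0 i] by (auto simp: alternating_chain_def)
    then show ?thesis by (metis scc_loop)
  qed
  then obtain v where v: "\<And>i. i < length Ss \<Longrightarrow> v i \<noteq> [] \<and> set (v i) \<subseteq> {..<m} \<and>
      foldl (step M) s (v i) = s \<and> visits M s (v i) = Ss ! i"
    by metis
  show ?thesis
    by (rule loops_has_chain[OF M u, where v = v]) (use v sub ch in \<open>auto simp: alternating_chain_def\<close>)
qed

section \<open>Idempotent powers and chains of idempotents\<close>

definition rep :: "nat \<Rightarrow> 'a list \<Rightarrow> 'a list" where
  "rep n x = concat (replicate n x)"

lemma rep_simps [simp]: "rep 0 x = []" "rep (Suc n) x = x @ rep n x"
  by (simp_all add: rep_def)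

lemma rep_add: "rep (n + k) x = rep n x @ rep k x"
  by (induction n) auto

lemma set_rep: "n \<noteq> 0 \<Longrightarrow> set (rep n x) = set x"
  by (auto simp: rep_def)

lemma idempotent_power:
  fixes H :: "'a list \<Rightarrow> 'h"
  assumes fin: "finite (range H)"
    and cong: "\<And>x x' y y'. H x = H x' \<Longrightarrow> H y = H y' \<Longrightarrow> H (x @ y) = H (x' @ y')"
  shows "\<exists>n. 0 < n \<and> H (rep n x @ rep n x) = H (rep n x)"
proof -
  have "finite (range (\<lambda>n. H (rep (Suc n) x)))" by (rule finite_subset[OF _ fin]) auto
  then have "\<not> inj (\<lambda>n. H (rep (Suc n) x))" by (metis finite_imageD infinite_UNIV_nat)
  then obtain i j where "i < j" "H (rep (Suc i) x) = H (rep (Suc j) x)"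
    unfolding inj_def by (metis linorder_neqE_nat)
  then obtain i d where id: "0 < i" "0 < d" "H (rep (i + d) x) = H (rep i x)"
    by (metis add_Suc less_imp_add_positive zero_less_Suc)
  have 1: "H (rep (i + t + d) x) = H (rep (i + t) x)" for t
    using cong[OF id(3) refl, of "rep t x"] by (simp add: rep_add[symmetric] add.commute add.left_commute)
  have 2: "H (rep (i + t + q * d) x) = H (rep (i + t) x)" for t q
  proof (induction q)
    case (Suc q)
    then show ?case using 1[of "t + q * d"] by (simp add: add.assoc add.commute add.left_commute)
  qed simp
  \<comment> \<open>From exponent \<open>i\<close> on the powers have period \<open>d\<close>.
    Doubling the exponent \<open>i * d\<close>, a multiple of the period that is at least
    \<open>i\<close>, therefore changes nothing.\<close>
  have "i \<le> i * d" using id by simp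
  then have "H (rep (i * d + i * d) x) = H (rep (i * d) x)" using 2[of "i * d - i" i] by simp
  then show ?thesis using id by (intro exI[of _ "i * d"]) (simp add: rep_add)
qed

text \<open>\<open>E (Suc i)\<close> is an idempotent power of \<open>E i @ [Suc i] @ E i\<close>.
  It begins and ends with the idempotent \<open>E i\<close>, which it therefore absorbs on both
  sides, and by transitivity it absorbs every smaller \<open>E j\<close>.\<close>

lemma idempotent_chain:
  fixes H :: "nat list \<Rightarrow> 'h"
  assumes fin: "finite (range H)"
    and cong: "\<And>x x' y y'. H x = H x' \<Longrightarrow> H y = H y' \<Longrightarrow> H (x @ y) = H (x' @ y')"
  obtains E where "\<And>i. set (E i) = {..i}"
    "\<And>i j. j \<le> i \<Longrightarrow> H (E i @ E j) = H (E i)" "\<And>i j. j \<le> i \<Longrightarrow> H (E j @ E i) = H (E i)"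
proof -
  define pw where "pw x = rep (SOME n. 0 < n \<and> H (rep n x @ rep n x) = H (rep n x)) x" for x
  have pw: "\<exists>n. 0 < n \<and> pw x = rep n x" "H (pw x @ pw x) = H (pw x)" for x
  proof -
    have "\<exists>n. 0 < n \<and> H (rep n x @ rep n x) = H (rep n x)" by (rule idempotent_power[of H x, OF fin cong])
    from someI_ex[OF this] show "\<exists>n. 0 < n \<and> pw x = rep n x" "H (pw x @ pw x) = H (pw x)"
      unfolding pw_def by blast+
  qed
  define E where "E = rec_nat (pw [0]) (\<lambda>i e. pw (e @ [Suc i] @ e))"
  have E: "E 0 = pw [0]" "E (Suc i) = pw (E i @ [Suc i] @ E i)" for i by (simp_all add: E_def)
  have set: "set (E i) = {..i}" for i
  proof (induction i)
    case 0
    then show ?case using pw(1)[of "[0]"] by (auto simp: E set_rep)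
  next
    case (Suc i)
    then show ?case using pw(1)[of "E i @ [Suc i] @ E i"] by (auto simp: E set_rep)
  qed
  have idem: "H (E i @ E i) = H (E i)" for i by (cases i) (simp_all add: E pw(2))
  have nb: "H (E i @ E (Suc i)) = H (E (Suc i)) \<and> H (E (Suc i) @ E i) = H (E (Suc i))" for i
  proof -
    obtain n where n: "0 < n" "E (Suc i) = rep n (E i @ [Suc i] @ E i)" using pw(1) E(2) by metis
    obtain k where k: "n = Suc k" using n(1) by (cases n) auto
    let ?x = "E i @ [Suc i] @ E i"
    have 1: "H ((E i @ E i) @ [Suc i] @ E i @ rep k ?x) = H (E i @ [Suc i] @ E i @ rep k ?x)"
      by (rule cong[OF idem refl])
    have e: "E (Suc i) = rep k ?x @ ?x" using n(2) k rep_add[of k 1 ?x] by simp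
    have "H ((rep k ?x @ E i @ [Suc i]) @ (E i @ E i)) = H ((rep k ?x @ E i @ [Suc i]) @ E i)"
      by (rule cong[OF refl idem])
    then have 2: "H (E (Suc i) @ E i) = H (E (Suc i))" unfolding e by simp
    have e': "E (Suc i) = E i @ [Suc i] @ E i @ rep k ?x" using n(2) k by simp
    from 1 have "H (E i @ E (Suc i)) = H (E (Suc i))" by (simp only: e' append_assoc)
    with 2 show ?thesis by blast
  qed
  have "H (E i @ E j) = H (E i) \<and> H (E j @ E i) = H (E i)" if "j \<le> i" for i j
    using that
  proof (induction i rule: dec_induct)
    case base
    then show ?case by (simp add: idem)
  next
    case (step i)
    note s = nb[of i]
    have "H (E (Suc i) @ E j) = H ((E (Suc i) @ E i) @ E j)" using cong s by metis
    also have "\<dots> = H (E (Suc i) @ E i)" using step.IH cong by (metis append_assoc)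
    also have "\<dots> = H (E (Suc i))" using s by blast
    finally have 1: "H (E (Suc i) @ E j) = H (E (Suc i))" .
    have "H (E j @ E (Suc i)) = H (E j @ E i @ E (Suc i))" using cong s by metis
    also have "\<dots> = H (E i @ E (Suc i))" using step.IH cong by (metis append_assoc)
    also have "\<dots> = H (E (Suc i))" using s by blast
    finally show ?case using 1 by blast
  qed
  then show thesis using that[of E] set by blast
qed

text \<open>The words of a chain need not be loops of \<open>M\<close>. The products
  \<open>cat v (E i)\<close> are, once the largest of them has been read, and absorption makes the
  sets visited along them increase. As \<open>i\<close> is the largest index in \<open>E i\<close>,
  acceptance alternates.\<close>

lemma has_chain_chain:
  assumes M: "wf_dma m M" and sc: "has_chain m (dma_language m M) k b"
  shows "\<exists>Ss. alternating_chain m M b Ss \<and> length Ss = k"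
proof (cases k)
  case 0
  then show ?thesis by (intro exI[of _ "[]"]) (simp add: alternating_chain_def)
next
  case (Suc k')
  obtain u v0 where uv0: "chain_words m (dma_language m M) k b u v0" using sc unfolding has_chain_def by (elim exE)
  \<comment> \<open>Indices from \<open>k\<close> on are sent to the empty word, so that all lists
    of indices yield words over the alphabet and \<open>H\<close> below has a finite range.\<close>
  define v where "v i = (if i < k then v0 i else [])" for i
  have v: "set (v i) \<subseteq> {..<m}" "i < k \<Longrightarrow> v i \<noteq> []" for i
    using chain_wordsD(2,3)[OF uv0, of i] by (auto simp: v_def)
  have catm: "set (cat v js) \<subseteq> {..<m}" for js using v(1) by (fastforce simp: cat_def)
  have catv: "cat v js = cat v0 js" if "set js \<subseteq> {..<k}" for js
    using that by (induction js) (auto simp: v_def)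
  have wf: "wf_dts m M" using M by (simp add: wf_dma_def)
  \<comment> \<open>Both the transformation of the states and the sets visited are recorded: the
    first yields loops, the second inclusions.\<close>
  define H where "H js = map (\<lambda>s. (foldl (step M) s (cat v js), visits M s (cat v js))) [0..<nstates M]" for js
  have Hd: "foldl (step M) s (cat v x) = foldl (step M) s (cat v y)" "visits M s (cat v x) = visits M s (cat v y)"
    if "H x = H y" "s < nstates M" for x y s
    using that by (auto simp: H_def map_eq_conv)
  have fin: "finite (range H)"
  proof (rule finite_subset)
    show "range H \<subseteq> {xs. set xs \<subseteq> {..<nstates M} \<times> Pow {..<nstates M} \<and> length xs = nstates M}"
      using foldl_in[OF wf _ catm] by (auto simp: H_def) (metis lessThan_iff subsetD visits_in[OF wf _ catm])
    show "finite {xs. set xs \<subseteq> {..<nstates M} \<times> Pow {..<nstates M} \<and> length xs = nstates M}"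
      by (rule finite_lists_length_eq) auto
  qed
  have cong: "H (x @ y) = H (x' @ y')" if "H x = H x'" "H y = H y'" for x x' y y'
  proof -
    have "foldl (step M) s (cat v (x @ y)) = foldl (step M) s (cat v (x' @ y')) \<and>
      visits M s (cat v (x @ y)) = visits M s (cat v (x' @ y'))" if s: "s < nstates M" for s
      using Hd[OF \<open>H x = H x'\<close> s] Hd[OF \<open>H y = H y'\<close> foldl_in[OF wf s catm[of x]]]
      by (simp add: visits_append)
    then show ?thesis by (simp add: H_def)
  qed
  obtain E where E: "\<And>i. set (E i) = {..i}" "\<And>i j. j \<le> i \<Longrightarrow> H (E i @ E j) = H (E i)"
    "\<And>i j. j \<le> i \<Longrightarrow> H (E j @ E i) = H (E i)"
    using idempotent_chain[OF fin cong] by metis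
  define s where "s = reach M (u @ cat v (E k'))"
  have um: "set u \<subseteq> {..<m}" by (rule chain_wordsD(1)[OF uv0])
  have s_in: "s < nstates M" unfolding s_def using um catm by (intro reach_in[OF wf]) auto
  have fix_s: "foldl (step M) s (cat v (E i)) = s" if "i < k" for i
    using Hd(1)[OF E(2)[of i k'] reach_in[OF wf um]] that Suc by (simp add: s_def reach_append)
  have ne: "cat v (E i) \<noteq> []" if "i < k" for i
  proof -
    have "i \<in> set (E i)" using E(1) by simp
    then show ?thesis using v(2)[OF that] by (auto simp: cat_def)
  qed
  define V where "V i = visits M s (cat v (E i))" for i
  have mono: "V j \<subseteq> V i" if "j \<le> i" "i < k" for i j
  proof -
    have "V i = visits M s (cat v (E j @ E i))" using Hd(2)[OF E(3)[OF that(1)] s_in] by (simp add: V_def)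
    then show ?thesis using fix_s[of j] that by (auto simp: V_def visits_append)
  qed
  have acc: "V i \<in> acc M \<longleftrightarrow> even i = b" if i: "i < k" for i
  proof -
    have sub: "set (E k') \<subseteq> {..<k}" "set (E i) \<subseteq> {..<k}" "E i \<noteq> []" using E(1)[of k'] E(1)[of i] i Suc by auto
    from chain_wordsD(4)[OF uv0 sub]
    have "(u @ cat v (E k')) \<frown> (cat v (E i))\<^sup>\<omega> \<in> dma_language m M \<longleftrightarrow> even i = b"
      using E(1)[of i] catv[OF sub(1)] catv[OF sub(2)] Max_eqI[of "{..i}" i] by simp
    moreover have "limit (dma_run M ((u @ cat v (E k')) \<frown> (cat v (E i))\<^sup>\<omega>)) = V i"
      unfolding V_def s_def using fix_s[OF i] by (intro limit_run ne[OF i]) (simp add: s_def)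
    moreover have "range ((u @ cat v (E k')) \<frown> (cat v (E i))\<^sup>\<omega>) \<subseteq> {..<m}"
      using um catm range_iter[OF ne[OF i]] by (auto dest!: subsetD)
    ultimately show ?thesis by (simp add: dma_language_def)
  qed
  have strict: "V i \<subset> V j" if "i < j" "j < k" for i j
  proof -
    have "V i \<noteq> V (Suc i)" using acc[of i] acc[of "Suc i"] that by auto
    then show ?thesis using mono[of i "Suc i"] mono[of "Suc i" j] that by auto
  qed
  have "scc m M (V i)" if "i < k" for i
    unfolding V_def by (rule scc_visits[OF wf s_in catm ne[OF that] fix_s[OF that]])
  then have "alternating_chain m M b (map V [0..<k])"
    using acc strict by (simp add: alternating_chain_def sorted_wrt_iff_nth_less)
  then show ?thesis by (intro exI[of _ "map V [0..<k]"]) simp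
qed

section \<open>Measures of an automaton\<close>

lemma alternating_chain_take:
  "alternating_chain m M b Ss \<Longrightarrow> alternating_chain m M b (take k Ss)"
  by (simp add: alternating_chain_def sorted_wrt_take)

lemma alternating_chain_length:
  assumes "alternating_chain m M b Ss" shows "length Ss \<le> 2 ^ nstates M"
proof -
  have "distinct Ss"
    using assms by (auto simp: alternating_chain_def sorted_wrt_iff_nth_less distinct_conv_nth) (metis linorder_neqE_nat psubsetE order_refl)
  then have "length Ss = card (set Ss)" by (simp add: distinct_card)
  also have "\<dots> \<le> card (Pow {..<nstates M})"
    using assms by (intro card_mono) (fastforce simp: alternating_chain_def scc_def in_set_conv_nth)+
  finally show ?thesis by (simp add: card_Pow)
qed

lemma inclusion_measure_ge:
  "k \<le> inclusion_measure m M b \<longleftrightarrow> (\<exists>Ss. alternating_chain m M b Ss \<and> length Ss = k)"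
proof -
  let ?A = "{length Ss | Ss. alternating_chain m M b Ss}"
  have fin: "finite ?A"
    by (rule finite_subset[of _ "{..2 ^ nstates M}"]) (auto dest: alternating_chain_length)
  have "alternating_chain m M b []" by (simp add: alternating_chain_def)
  then have ne: "?A \<noteq> {}" by blast
  show ?thesis
  proof
    assume k: "k \<le> inclusion_measure m M b"
    have "inclusion_measure m M b \<in> ?A" unfolding inclusion_measure_def by (rule Max_in[OF fin ne])
    then obtain Ss where "alternating_chain m M b Ss" "length Ss = inclusion_measure m M b" by auto
    then show "\<exists>Ss. alternating_chain m M b Ss \<and> length Ss = k"
      using k by (intro exI[of _ "take k Ss"]) (simp add: alternating_chain_take)
  next
    assume "\<exists>Ss. alternating_chain m M b Ss \<and> length Ss = k"
    then have "k \<in> ?A" by auto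
    then show "k \<le> inclusion_measure m M b" unfolding inclusion_measure_def by (rule Max_ge[OF fin])
  qed
qed

section \<open>Automata whose states are classes of words\<close>

lemma limit_image:
  assumes "finite (range x)" shows "limit (\<lambda>n. f (x n)) = f ` limit x"
proof
  obtain k where k: "limit x = range (suffix k x)" using limit_is_suffix[OF assms] by blast
  have "limit (\<lambda>n. f (x n)) = limit (suffix k (\<lambda>n. f (x n)))" by simp
  also have "\<dots> \<subseteq> range (suffix k (\<lambda>n. f (x n)))" by (rule limit_in_range)
  finally show "limit (\<lambda>n. f (x n)) \<subseteq> f ` limit x" unfolding k by auto
  show "f ` limit x \<subseteq> limit (\<lambda>n. f (x n))" using limit_o[of _ x f] by (auto simp: comp_def)
qed

text \<open>Classes of words serve as states, so every state is reachable. With \<open>reach\<close>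
  for \<phi> this trims an automaton; with \<open>stat\<close> it gives McNaughton's
  theorem.\<close>

lemma dma_of_congruence:
  fixes \<phi> :: "nat list \<Rightarrow> 's"
  assumes fin: "finite (\<phi> ` {w. set w \<subseteq> {..<m}})"
    and cong: "\<And>w w' a. set w \<subseteq> {..<m} \<Longrightarrow> set w' \<subseteq> {..<m} \<Longrightarrow> \<phi> w = \<phi> w' \<Longrightarrow> a < m \<Longrightarrow> \<phi> (w @ [a]) = \<phi> (w' @ [a])"
  obtains M where "wf_dma m M"
    "dma_language m M = {w. range w \<subseteq> {..<m} \<and> limit (\<lambda>n. \<phi> (prefix n w)) \<in> ACC}"
    "\<And>q. q < nstates M \<Longrightarrow> \<exists>u. set u \<subseteq> {..<m} \<and> reach M u = q"
proof -
  define S where "S = \<phi> ` {w. set w \<subseteq> {..<m}}"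
  have SI: "set w \<subseteq> {..<m} \<Longrightarrow> \<phi> w \<in> S" for w by (auto simp: S_def)
  obtain f where "bij_betw f S {0..<card S}" using ex_bij_betw_finite_nat fin unfolding S_def by blast
  then have inj: "inj_on f S" and im: "f ` S = {..<card S}" by (auto simp: bij_betw_def)
  define r where "r q = (SOME w. set w \<subseteq> {..<m} \<and> f (\<phi> w) = q)" for q
  have r: "set (r (f (\<phi> w))) \<subseteq> {..<m} \<and> \<phi> (r (f (\<phi> w))) = \<phi> w" if "set w \<subseteq> {..<m}" for w
  proof -
    have "set (r (f (\<phi> w))) \<subseteq> {..<m} \<and> f (\<phi> (r (f (\<phi> w)))) = f (\<phi> w)"
      unfolding r_def by (rule someI[of _ w]) (simp add: that)
    then show ?thesis using inj SI that by (auto dest: inj_onD)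
  qed
  define M where "M = \<lparr>nstates = card S, init = f (\<phi> []), step = \<lambda>q a. f (\<phi> (r q @ [a])),
    acc = (\<lambda>I. f ` I) ` {I. I \<in> ACC \<and> I \<subseteq> S}\<rparr>"
  have fS: "f (\<phi> w) < card S" if "set w \<subseteq> {..<m}" for w using im SI[OF that] by auto
  have reach: "reach M w = f (\<phi> w)" if "set w \<subseteq> {..<m}" for w
    using that
  proof (induction w rule: rev_induct)
    case Nil
    then show ?case by (simp add: reach_def M_def)
  next
    case (snoc a w)
    then have "\<phi> (r (f (\<phi> w)) @ [a]) = \<phi> (w @ [a])" using r[of w] by (intro cong) auto
    then show ?case using snoc by (simp add: reach_def M_def)
  qed
  have ex: "\<exists>u. set u \<subseteq> {..<m} \<and> reach M u = q" if "q < nstates M" for q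
  proof -
    have "q \<in> f ` S" using that im by (simp add: M_def)
    then obtain w where "set w \<subseteq> {..<m}" "q = f (\<phi> w)" by (auto simp: S_def)
    then show ?thesis using reach by blast
  qed
  have "wf_dma m M"
  proof -
    have "step M q a < nstates M" if qa: "q < nstates M" "a < m" for q a
    proof -
      obtain u where "set u \<subseteq> {..<m}" "reach M u = q" using ex[OF qa(1)] by blast
      then have "set (r q) \<subseteq> {..<m}" using r[of u] reach[of u] by simp
      then show ?thesis using qa fS[of "r q @ [a]"] by (simp add: M_def)
    qed
    moreover have "init M < nstates M" using fS[of "[]"] by (simp add: M_def)
    moreover have "acc M \<subseteq> Pow {..<nstates M}" using im by (auto simp: M_def)
    ultimately show ?thesis by (simp add: wf_dma_def wf_dts_def)
  qed
  moreover have "dma_language m M = {w. range w \<subseteq> {..<m} \<and> limit (\<lambda>n. \<phi> (prefix n w)) \<in> ACC}"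
  proof -
    have "limit (dma_run M w) \<in> acc M \<longleftrightarrow> limit (\<lambda>n. \<phi> (prefix n w)) \<in> ACC" if w: "range w \<subseteq> {..<m}" for w
    proof -
      let ?x = "\<lambda>n. \<phi> (prefix n w)"
      have pm: "set (prefix n w) \<subseteq> {..<m}" for n using w by auto
      have xS: "range ?x \<subseteq> S" using SI[OF pm] by auto
      have "limit (dma_run M w) = limit (\<lambda>n. f (?x n))"
        by (simp add: dma_run_prefix[abs_def] reach[OF pm])
      also have "\<dots> = f ` limit ?x"
        by (rule limit_image) (use xS fin S_def in \<open>auto intro: finite_subset\<close>)
      finally have l: "limit (dma_run M w) = f ` limit ?x" .
      have lS: "limit ?x \<subseteq> S" using limit_in_range[of ?x] xS by auto
      show ?thesis unfolding l using lS inj by (auto simp: M_def inj_on_image_eq_iff)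
    qed
    then show ?thesis by (auto simp: dma_language_def)
  qed
  ultimately show thesis using that ex by blast
qed

text \<open>\<open>inclusion_measure\<close> also counts SCCs that cannot be reached, although they
  do not affect the language. For trimmed automata it agrees with the measure of the
  language.\<close>

lemma trimmed_dma:
  assumes "omega_regular m L"
  obtains M where "wf_dma m M" "L = dma_language m M"
    "\<And>q. q < nstates M \<Longrightarrow> \<exists>u. set u \<subseteq> {..<m} \<and> reach M u = q"
proof -
  obtain M where M: "wf_dma m M" "L = dma_language m M" using assms by (auto simp: omega_regular_def)
  then have wf: "wf_dts m M" by (simp add: wf_dma_def)
  obtain M' where "wf_dma m M'" "dma_language m M' = {w. range w \<subseteq> {..<m} \<and> limit (\<lambda>n. reach M (prefix n w)) \<in> acc M}"
    "\<And>q. q < nstates M' \<Longrightarrow> \<exists>u. set u \<subseteq> {..<m} \<and> reach M' u = q"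
  proof (rule dma_of_congruence[of "reach M" m "acc M"])
    show "finite (reach M ` {w. set w \<subseteq> {..<m}})"
      by (rule finite_subset[of _ "{..<nstates M}"]) (auto intro: reach_in[OF wf])
  qed (auto simp: reach_append)
  then show thesis using M(2) that[of M'] by (simp add: dma_language_def dma_run_prefix[abs_def])
qed

section \<open>Measures of a language and the classes of the hierarchy\<close>

definition chain_measure :: "nat \<Rightarrow> nat word set \<Rightarrow> bool \<Rightarrow> nat" where
  "chain_measure m L b = Max {k. has_chain m L k b}"

lemma chain_measure_trimmed:
  assumes "wf_dma m M" "\<And>q. q < nstates M \<Longrightarrow> \<exists>u. set u \<subseteq> {..<m} \<and> reach M u = q"
  shows "k \<le> inclusion_measure m M b \<longleftrightarrow> has_chain m (dma_language m M) k b"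
  unfolding inclusion_measure_ge
  using chain_has_chain[OF assms] has_chain_chain[OF assms(1)] by blast

lemma chain_measure_ge:
  assumes "omega_regular m L" shows "k \<le> chain_measure m L b \<longleftrightarrow> has_chain m L k b"
proof -
  obtain M where M: "wf_dma m M" "L = dma_language m M"
    "\<And>q. q < nstates M \<Longrightarrow> \<exists>u. set u \<subseteq> {..<m} \<and> reach M u = q"
    using trimmed_dma[OF assms] by metis
  have iff: "has_chain m L k b \<longleftrightarrow> k \<le> inclusion_measure m M b" for k
    unfolding M(2) using chain_measure_trimmed[OF M(1,3)] by simp
  then have "{k. has_chain m L k b} = {..inclusion_measure m M b}" by auto
  then have "chain_measure m L b = inclusion_measure m M b" unfolding chain_measure_def by (auto intro: Max_eqI)
  then show ?thesis using iff by simp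
qed

text \<open>The measures of any automaton for \<open>L\<close> are at least those of
  \<open>L\<close>, and a trimmed automaton attains them.\<close>

lemma wagner_class_iff:
  assumes "omega_regular m L"
  shows "L \<in> wagner_class m s k \<longleftrightarrow> within_bounds s k (chain_measure m L True) (chain_measure m L False)"
proof
  assume "L \<in> wagner_class m s k"
  then obtain M where M: "wf_dma m M" "L = dma_language m M"
    "within_bounds s k (inclusion_measure m M True) (inclusion_measure m M False)"
    by (auto simp: wagner_class_def)
  have "chain_measure m L b \<le> inclusion_measure m M b" for b
  proof -
    have "has_chain m L (chain_measure m L b) b" using chain_measure_ge[OF assms] by blast
    then show ?thesis using has_chain_chain[OF M(1)] M(2) by (simp add: inclusion_measure_ge)
  qed
  from this[of True] this[of False]
  show "within_bounds s k (chain_measure m L True) (chain_measure m L False)" using M(3) by (cases s) auto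
next
  assume w: "within_bounds s k (chain_measure m L True) (chain_measure m L False)"
  obtain M where M: "wf_dma m M" "L = dma_language m M"
    "\<And>q. q < nstates M \<Longrightarrow> \<exists>u. set u \<subseteq> {..<m} \<and> reach M u = q"
    using trimmed_dma[OF assms] by metis
  have "inclusion_measure m M b = chain_measure m L b" for b
  proof (rule antisym)
    show "inclusion_measure m M b \<le> chain_measure m L b"
      using chain_measure_trimmed[OF M(1,3), of "inclusion_measure m M b" b] chain_measure_ge[OF assms, of "inclusion_measure m M b" b] M(2) by simp
    show "chain_measure m L b \<le> inclusion_measure m M b"
      using chain_measure_trimmed[OF M(1,3), of "chain_measure m L b" b] chain_measure_ge[OF assms, of "chain_measure m L b" b] M(2) by simp
  qed
  then show "L \<in> wagner_class m s k" using M(1,2) w by (auto simp: wagner_class_def)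
qed

lemma wagner_class_regular: "L \<in> wagner_class m s k \<Longrightarrow> omega_regular m L"
  by (auto simp: wagner_class_def omega_regular_def)

lemma has_chain_limit:
  assumes "omega_regular m L" shows "chain_measure m L b \<le> Suc (chain_measure m L (\<not> b))"
proof (cases "chain_measure m L b")
  case (Suc k)
  then have "has_chain m L (Suc k) b" using chain_measure_ge[OF assms, of "Suc k" b] by simp
  from has_chain_shift[OF this] show ?thesis using Suc chain_measure_ge[OF assms] by simp
qed simp

lemma chain_measure_pos:
  assumes "omega_regular m L" "0 < m" shows "0 < chain_measure m L True \<or> 0 < chain_measure m L False"
proof -
  define b where "b \<longleftrightarrow> [0]\<^sup>\<omega> \<in> L"
  have c: "cat (\<lambda>_. [0]) js = replicate (length js) 0" for js by (induction js) auto
  have w: "(replicate n 0)\<^sup>\<omega> = [0::nat]\<^sup>\<omega>" if "0 < n" for n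
    using that by (auto simp: fun_eq_iff)
  have e: "replicate l 0 \<frown> [0::nat]\<^sup>\<omega> = [0]\<^sup>\<omega>" for l
    by (auto simp: fun_eq_iff conc_def)
  have "has_chain m L 1 b"
  proof (rule schainI[of "[]" m 1 "\<lambda>_. [0]"])
    fix js "is" :: "nat list" assume a: "set js \<subseteq> {..<1}" "set is \<subseteq> {..<1}" "is \<noteq> []"
    then have "set is = {0}" by (cases "is") auto
    then show "([] @ cat (\<lambda>_. [0]) js) \<frown> (cat (\<lambda>_. [0]) is)\<^sup>\<omega> \<in> L \<longleftrightarrow> even (Max (set is)) = b"
      using a(3) by (simp add: c w e b_def)
  qed (use assms(2) in auto)
  then have "1 \<le> chain_measure m L b" using chain_measure_ge[OF assms(1)] by blast
  then show ?thesis by (cases b) auto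
qed

text \<open>There is only one \<omega>-word over a single letter. The case is treated separately
  because ladders with \<open>0 < K\<close> need two letters.\<close>

lemma chain_measure_unary:
  assumes "omega_regular 1 L" shows "chain_measure 1 L b \<le> 1" "chain_measure 1 L True = 0 \<or> chain_measure 1 L False = 0"
proof -
  have eq: "u \<frown> w\<^sup>\<omega> = (\<lambda>_. 0)" if "set u \<subseteq> {..<1}" "set w \<subseteq> {..<1}" "w \<noteq> []" for u w :: "nat list"
  proof -
    have "range (u \<frown> w\<^sup>\<omega>) \<subseteq> {..<1}" using that range_iter[of w] by auto
    then have "(u \<frown> w\<^sup>\<omega>) x \<in> {..<1}" for x by (rule subsetD) (rule rangeI)
    then show ?thesis by (intro ext) simp
  qed
  have A: "(\<lambda>_. 0) \<in> L \<longleftrightarrow> even i = b" if sc: "has_chain 1 L k b" "i < k" for k i b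
  proof -
    obtain u v where uv: "chain_words 1 L k b u v" using sc unfolding has_chain_def by (elim exE)
    have "(u @ cat v []) \<frown> (cat v [i])\<^sup>\<omega> \<in> L \<longleftrightarrow> even (Max (set [i])) = b"
      by (rule chain_wordsD(4)[OF uv]) (use sc in auto)
    moreover have "(u @ cat v []) \<frown> (cat v [i])\<^sup>\<omega> = (\<lambda>_. 0)"
      using chain_wordsD(1)[OF uv] chain_wordsD(2,3)[OF uv sc(2)] by (intro eq) auto
    ultimately show ?thesis by simp
  qed
  show "chain_measure 1 L b \<le> 1"
  proof (rule ccontr)
    assume "\<not> ?thesis"
    then have "has_chain 1 L 2 b" using chain_measure_ge[OF assms, of 2 b] by simp
    from A[OF this, of 0] A[OF this, of 1] show False by auto
  qed
  show "chain_measure 1 L True = 0 \<or> chain_measure 1 L False = 0"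
  proof (rule ccontr)
    assume "\<not> ?thesis"
    then have "has_chain 1 L 1 True" "has_chain 1 L 1 False" using chain_measure_ge[OF assms, of 1 True] chain_measure_ge[OF assms, of 1 False] by simp_all
    from A[OF this(1), of 0] A[OF this(2), of 0] show False by auto
  qed
qed

text \<open>On this automaton the SCCs are exactly the sets \<open>{..j}\<close>.\<close>

definition ladder :: "nat \<Rightarrow> bool \<Rightarrow> dma" where
  "ladder K b = \<lparr>nstates = Suc K, init = 0, step = (\<lambda>q a. if a = 0 \<and> q < K then Suc q else 0),
     acc = {{..j} | j. j \<le> K \<and> even j = b}\<rparr>"

lemma wf_ladder: "wf_dma m (ladder K b)"
  by (auto simp: wf_dma_def wf_dts_def ladder_def)

lemma atMost_acc_ladder: "j \<le> K \<Longrightarrow> {..j} \<in> acc (ladder K b) \<longleftrightarrow> even j = b"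
  by (auto simp: ladder_def)

lemma scc_ladder:
  assumes "scc m (ladder K b) S" shows "\<exists>j\<le>K. S = {..j}"
proof -
  have S: "S \<noteq> {}" "S \<subseteq> {..K}" "finite S" and E: "S \<times> S \<subseteq> (edges_within m (ladder K b) S)\<^sup>+"
    using assms by (auto simp: scc_def ladder_def intro: finite_subset)
  have down: "q \<in> S" if "Suc q \<in> S" for q
  proof -
    have "(Suc q, Suc q) \<in> (edges_within m (ladder K b) S)\<^sup>+" using E that by blast
    then obtain p where "(p, Suc q) \<in> edges_within m (ladder K b) S" by (meson tranclD2)
    then show ?thesis by (auto simp: edges_within_def ladder_def split: if_splits)
  qed
  have "{..q} \<subseteq> S" if "q \<in> S" for q using that
  proof (induction q)
    case (Suc q)
    then show ?case using down[of q] by (auto simp: le_Suc_eq)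
  qed auto
  from this[OF Max_in[OF S(3,1)]] have "S = {..Max S}" using S(3) by auto
  then show ?thesis using S Max_in[OF S(3,1)] by blast
qed

text \<open>These languages separate the classes: given two letters, the measures
  \<open>Suc K\<close> and \<open>K\<close> occur in either order for every
  \<open>K\<close>.\<close>

lemma chain_measure_ladder:
  fixes b :: bool and m K :: nat
  assumes "0 < m" "K = 0 \<or> 2 \<le> m"
  defines "L \<equiv> dma_language m (ladder K b)"
  shows "omega_regular m L" "chain_measure m L b = Suc K" "chain_measure m L (\<not> b) = K"
proof -
  let ?M = "ladder K b"
  show reg: "omega_regular m L" unfolding omega_regular_def L_def using wf_ladder by blast
  \<comment> \<open>The word climbs to \<open>i\<close> and falls back by the letter
    \<open>m - 1\<close>. This is the letter 0 only if \<open>m = 1\<close>; then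
    \<open>K = 0\<close>, and letter 0 falls back as well.\<close>
  define v where "v i = replicate i 0 @ [m - 1]" for i :: nat
  have up: "foldl (step ?M) j (replicate i 0) = i + j \<and> visits ?M j (replicate i 0) = {j..<i+j}" if "i + j \<le> K" for i j
    using that
  proof (induction i arbitrary: j)
    case (Suc i)
    then have "step ?M j 0 = Suc j" by (simp add: ladder_def)
    then show ?case using Suc by (auto simp: visits_Cons)
  qed simp
  have lv: "foldl (step ?M) 0 (v i) = 0 \<and> visits ?M 0 (v i) = {..i}" if "i \<le> K" for i
  proof -
    have "step ?M i (m - 1) = 0" using assms that by (auto simp: ladder_def)
    then show ?thesis using up[of i 0] that by (auto simp: v_def visits_append visits_Cons)
  qed
  have "has_chain m (dma_language m ?M) (Suc K) b"
  proof (rule loops_has_chain[OF wf_ladder, where u = "[]" and s = 0 and v = v])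
    show "reach ?M [] = 0" by (simp add: reach_def ladder_def)
    show "v i \<noteq> []" "set (v i) \<subseteq> {..<m}" for i using assms by (auto simp: v_def)
  qed (use lv in \<open>auto simp: atMost_acc_ladder\<close>)
  then have ge: "Suc K \<le> chain_measure m L b" using chain_measure_ge[OF reg] by (simp add: L_def)
  have le: "(if b' = b then k \<le> Suc K else k \<le> K)" if sc: "has_chain m L k b'" for k b'
  proof (cases k)
    case (Suc k')
    obtain Ss where Ss: "alternating_chain m ?M b' Ss" "length Ss = k"
      using has_chain_chain[OF wf_ladder sc[unfolded L_def]] by blast
    have "\<exists>j\<le>K. Ss ! i = {..j}" if "i < k" for i
    proof -
      have "scc m ?M (Ss ! i)" using Ss that by (simp add: alternating_chain_def)
      then show ?thesis by (rule scc_ladder)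
    qed
    then obtain j where j: "\<And>i. i < k \<Longrightarrow> j i \<le> K \<and> Ss ! i = {..j i}" by metis
    have lt: "j i < j (Suc i)" if "Suc i < k" for i
    proof -
      have "Ss ! i \<subset> Ss ! Suc i" using Ss that by (simp add: alternating_chain_def sorted_wrt_iff_nth_less)
      then show ?thesis using j[of i] j[of "Suc i"] that by auto
    qed
    have "even (j 0) = (b' = b)" using Ss j[of 0] Suc atMost_acc_ladder[of "j 0" K b]
      by (auto simp: alternating_chain_def)
    then have j0: "b' \<noteq> b \<longrightarrow> 1 \<le> j 0" by (cases "j 0") auto
    have "i + (if b' = b then 0 else 1) \<le> j i" if "i < k" for i
      using that
    proof (induction i)
      case 0
      then show ?case using j0 by simp
    next
      case (Suc i)
      then show ?case using lt[of i] by simp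
    qed
    from this[of k'] j[of k'] Suc show ?thesis by (auto split: if_splits)
  qed simp
  have "has_chain m L (chain_measure m L c) c" for c using chain_measure_ge[OF reg] by blast
  from le[OF this[of b]] le[OF this[of "\<not> b"]] have "chain_measure m L b \<le> Suc K" "chain_measure m L (\<not> b) \<le> K" by auto
  moreover have "K \<le> chain_measure m L (\<not> b)" using has_chain_limit[OF reg, of b] ge by simp
  ultimately show "chain_measure m L b = Suc K" "chain_measure m L (\<not> b) = K" using ge by auto
qed

text \<open>The measures of \<open>L\<close> are adjacent. If the bounds of the least class were not
  tight, it would contain a ladder language outside some other class that contains
  \<open>L\<close>.\<close>

theorem wagner_position_iff:
  assumes m: "0 < m" and reg: "omega_regular m L" and k: "0 < k"
  shows "wagner_position m L s k \<longleftrightarrow> (case s of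
      Plus \<Rightarrow> chain_measure m L True = k \<and> Suc (chain_measure m L False) = k
    | Minus \<Rightarrow> chain_measure m L False = k \<and> Suc (chain_measure m L True) = k
    | PlusMinus \<Rightarrow> chain_measure m L True = k \<and> chain_measure m L False = k)" (is "_ \<longleftrightarrow> ?R")
proof
  assume R: ?R
  have "L \<in> wagner_class m s k" using R by (auto simp: wagner_class_iff[OF reg] split: wsign.splits)
  moreover have "wagner_class m s k \<subseteq> wagner_class m s' k'" if L: "L \<in> wagner_class m s' k'" for s' k'
  proof
    fix X assume X: "X \<in> wagner_class m s k"
    then have rX: "omega_regular m X" by (rule wagner_class_regular)
    have "within_bounds s' k' (chain_measure m L True) (chain_measure m L False)" using L wagner_class_iff[OF reg] by blast
    moreover have "within_bounds s k (chain_measure m X True) (chain_measure m X False)" using X wagner_class_iff[OF rX] by blast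
    ultimately have "within_bounds s' k' (chain_measure m X True) (chain_measure m X False)"
      using R by (cases s; cases s') auto
    then show "X \<in> wagner_class m s' k'" using wagner_class_iff[OF rX] by blast
  qed
  ultimately show "wagner_position m L s k" using k by (auto simp: wagner_position_def)
next
  assume W: "wagner_position m L s k"
  define P N where "P = chain_measure m L True" and "N = chain_measure m L False"
  have near: "P \<le> Suc N" "N \<le> Suc P" using has_chain_limit[OF reg, of True] has_chain_limit[OF reg, of False] by (auto simp: P_def N_def)
  have pos: "0 < P \<or> 0 < N" using chain_measure_pos[OF reg m] by (auto simp: P_def N_def)
  have one: "2 \<le> m \<or> (P + N = 1)"
  proof (cases "2 \<le> m")
    case False
    then have "m = 1" using m by simp
    then have "P \<le> 1" "N \<le> 1" "P = 0 \<or> N = 0" using chain_measure_unary[of L] reg by (auto simp: P_def N_def)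
    then show ?thesis using pos by auto
  qed simp
  have bd: "within_bounds s k P N" using W wagner_class_iff[OF reg] by (auto simp: wagner_position_def P_def N_def)
  have sub: "within_bounds s' k' (chain_measure m X True) (chain_measure m X False)"
    if "0 < k'" "within_bounds s' k' P N" "omega_regular m X" "within_bounds s k (chain_measure m X True) (chain_measure m X False)" for s' k' X
  proof -
    have "X \<in> wagner_class m s k" using that wagner_class_iff[OF that(3)] by blast
    moreover have "L \<in> wagner_class m s' k'"
      using that wagner_class_iff[OF reg] by (simp add: P_def N_def)
    then have "wagner_class m s k \<subseteq> wagner_class m s' k'"
      using W that(1) unfolding wagner_position_def by blast
    ultimately show ?thesis using wagner_class_iff[OF that(3)] by blast
  qed
  have wit: "\<exists>X. omega_regular m X \<and> chain_measure m X b = Suc K \<and> chain_measure m X (\<not> b) = K" if "K = 0 \<or> 2 \<le> m" for K b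
    using chain_measure_ladder[OF m that] by blast
  consider "P = N" | "P = Suc N" | "N = Suc P" using near by linarith
  then have "(case s of Plus \<Rightarrow> P = k \<and> Suc N = k | Minus \<Rightarrow> N = k \<and> Suc P = k | PlusMinus \<Rightarrow> P = k \<and> N = k)"
  proof cases
    case 1
    then have m2: "2 \<le> m" using one by presburger
    \<comment> \<open>Both ladders lie outside the class \<open>PlusMinus\<close> of index
      \<open>P\<close>, which contains \<open>L\<close>. So the least class has to exclude them,
      too.\<close>
    obtain X Y where "omega_regular m X" "chain_measure m X True = Suc P" "chain_measure m X False = P"
      "omega_regular m Y" "chain_measure m Y False = Suc P" "chain_measure m Y True = P"
      using wit[of P True] wit[of P False] m2 by auto
    then have "\<not> within_bounds s k (Suc P) P" "\<not> within_bounds s k P (Suc P)"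
      using sub[of P PlusMinus X] sub[of P PlusMinus Y] 1 pos by auto
    then show ?thesis using bd 1 by (cases s) auto
  next
    case 2
    then have "N = 0 \<or> 2 \<le> m" using one by auto
    then obtain X where "omega_regular m X" "chain_measure m X False = Suc N" "chain_measure m X True = N"
      using wit[of N False] by auto
    then have "\<not> within_bounds s k N (Suc N)" using sub[of P Plus X] 2 by auto
    then show ?thesis using bd 2 by (cases s) auto
  next
    case 3
    then have "P = 0 \<or> 2 \<le> m" using one by auto
    then obtain X where "omega_regular m X" "chain_measure m X True = Suc P" "chain_measure m X False = P"
      using wit[of P True] by auto
    then have "\<not> within_bounds s k (Suc P) P" using sub[of N Minus X] 3 by auto
    then show ?thesis using bd 3 by (cases s) auto
  qed
  then show ?R unfolding P_def N_def .
qed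

text \<open>Cut out a segment between two positions of equal value in which only limit values occur,
  and all of them do. Repeating this segment forever gives the same limit.\<close>

lemma up_word_with_limit:
  assumes fin: "finite (\<phi> ` {w. set w \<subseteq> {..<m}})" and w: "range w \<subseteq> {..<m}"
    and cong: "\<And>w w' a. \<phi> w = \<phi> w' \<Longrightarrow> \<phi> (w @ [a]) = \<phi> (w' @ [a])"
  obtains u v where "set u \<subseteq> {..<m}" "set v \<subseteq> {..<m}" "v \<noteq> []"
    "limit (\<lambda>n. \<phi> (prefix n (u \<frown> v\<^sup>\<omega>))) = limit (\<lambda>n. \<phi> (prefix n w))"
proof -
  let ?x = "\<lambda>n. \<phi> (prefix n w)"
  have pm: "set (prefix n w) \<subseteq> {..<m}" for n using w by auto
  have finx: "finite (range ?x)" by (rule finite_subset[OF _ fin]) (use pm in auto)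
  obtain k where k: "limit ?x = range (suffix k ?x)" using limit_is_suffix[OF finx] by blast
  have inf: "\<exists>n>l. ?x n = y" if "y \<in> limit ?x" for l y
    using that by (auto simp: limit_iff_frequent INFM_nat)
  have "\<exists>l\<ge>k. T \<subseteq> ?x ` {k..<l}" if "T \<subseteq> limit ?x" for T
  proof -
    have "finite T" using that finx limit_in_range[of ?x] by (meson finite_subset)
    then show ?thesis using that
    proof (induction T)
      case (insert y T)
      then obtain l where l: "k \<le> l" "T \<subseteq> ?x ` {k..<l}" by auto
      obtain n where n: "l < n" "?x n = y" using inf[of y l] insert by auto
      have "?x ` {k..<l} \<subseteq> ?x ` {k..<Suc n}" using n by (intro image_mono) auto
      moreover have "y \<in> ?x ` {k..<Suc n}" using n l by (intro image_eqI[of _ _ n]) auto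
      ultimately have "insert y T \<subseteq> ?x ` {k..<Suc n}" using l(2) by blast
      then show ?case using l n by (intro exI[of _ "Suc n"]) simp
    qed auto
  qed
  then obtain l0 where l0: "k \<le> l0" "limit ?x \<subseteq> ?x ` {k..<l0}" by blast
  have "?x k \<in> limit ?x" unfolding k by (auto intro: image_eqI[of _ _ 0])
  then obtain l where l: "l0 < l" "?x l = ?x k" using inf by blast
  have eq: "?x ` {k..<l} = limit ?x"
  proof
    show "?x ` {k..<l} \<subseteq> limit ?x"
    proof clarify
      fix n assume "n \<in> {k..<l}"
      then have "?x n = suffix k ?x (n - k)" by simp
      then show "?x n \<in> limit ?x" unfolding k by (metis rangeI)
    qed
    show "limit ?x \<subseteq> ?x ` {k..<l}" using l0(2) l(1) by fastforce
  qed
  let ?u = "prefix k w" and ?v = "w [k \<rightarrow> l]"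
  have kl: "k < l" using l0 l by simp
  have app: "\<phi> (a @ c) = \<phi> (b @ c)" if "\<phi> a = \<phi> b" for a b c
    using that
  proof (induction c rule: rev_induct)
    case (snoc z c)
    then show ?case using cong[of "a @ c" "b @ c" z] by simp
  qed simp
  have uv: "?u @ ?v = prefix l w" using kl subsequence_append[of w k "l - k"] by simp
  have loop: "\<phi> (?u @ prefix n ?v\<^sup>\<omega>) = ?x (k + n mod (l - k))" for n
  proof (induction n)
    case 0
    then show ?case by simp
  next
    case (Suc n)
    let ?r = "n mod (l - k)"
    have r: "?r < l - k" using kl by simp
    have "prefix (Suc n) ?v\<^sup>\<omega> = prefix n ?v\<^sup>\<omega> @ [w (k + ?r)]" using kl r by simp
    then have "\<phi> (?u @ prefix (Suc n) ?v\<^sup>\<omega>) = \<phi> ((?u @ prefix n ?v\<^sup>\<omega>) @ [w (k + ?r)])"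
      by (simp only: append_assoc)
    also have "\<dots> = \<phi> (prefix (k + ?r) w @ [w (k + ?r)])" by (rule cong[OF Suc])
    also have "\<dots> = ?x (Suc (k + ?r))" by simp
    also have "\<dots> = ?x (k + Suc n mod (l - k))"
    proof (cases "Suc ?r = l - k")
      case True
      then have "Suc (k + ?r) = l" "Suc n mod (l - k) = 0" using kl by (auto simp: mod_Suc)
      then show ?thesis using l(2) by (simp only: add_0_right)
    next
      case False
      then have "Suc n mod (l - k) = Suc ?r" by (simp add: mod_Suc)
      then show ?thesis by (simp only: add_Suc_right)
    qed
    finally show ?case .
  qed
  have "suffix k (\<lambda>n. \<phi> (prefix n (?u \<frown> ?v\<^sup>\<omega>))) = (map ?x [k..<l])\<^sup>\<omega>"
  proof
    fix x
    have "k + x mod (l - k) < l" using mod_less_divisor[of "l - k" x] kl by linarith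
    then show "suffix k (\<lambda>n. \<phi> (prefix n (?u \<frown> ?v\<^sup>\<omega>))) x = (map ?x [k..<l])\<^sup>\<omega> x"
      using kl loop[of x] by simp
  qed
  then have "limit (\<lambda>n. \<phi> (prefix n (?u \<frown> ?v\<^sup>\<omega>))) = limit ((map ?x [k..<l])\<^sup>\<omega>)"
    using limit_suffix by metis
  also have "\<dots> = set (map ?x [k..<l])" using kl by (intro limit_iter) simp
  also have "\<dots> = limit ?x" using eq by simp
  finally have "limit (\<lambda>n. \<phi> (prefix n (?u \<frown> ?v\<^sup>\<omega>))) = limit ?x" .
  moreover have "set ?v \<subseteq> {..<m}" "?v \<noteq> []" using w kl by auto
  ultimately show thesis using that[of ?u ?v] pm by blast
qed

text \<open>On pairs of states, a single ultimately periodic word imitates \<open>w\<close> for both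
  automata at once.\<close>

lemma omega_regular_eqI:
  assumes "omega_regular m L" "omega_regular m L'"
    and up: "\<And>u v. set u \<subseteq> {..<m} \<Longrightarrow> set v \<subseteq> {..<m} \<Longrightarrow> v \<noteq> [] \<Longrightarrow> u \<frown> v\<^sup>\<omega> \<in> L \<longleftrightarrow> u \<frown> v\<^sup>\<omega> \<in> L'"
  shows "L = L'"
proof -
  obtain M M' where M: "wf_dma m M" "L = dma_language m M" "wf_dma m M'" "L' = dma_language m M'"
    using assms by (auto simp: omega_regular_def)
  have wf: "wf_dts m M" "wf_dts m M'" using M by (auto simp: wf_dma_def)
  define \<phi> where "\<phi> w = (reach M w, reach M' w)" for w
  have fin: "finite (\<phi> ` {w. set w \<subseteq> {..<m}})"
    by (rule finite_subset[of _ "{..<nstates M} \<times> {..<nstates M'}"])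
      (auto simp: \<phi>_def intro: reach_in[OF wf(1)] reach_in[OF wf(2)])
  have proj: "limit (dma_run M w) = fst ` limit (\<lambda>n. \<phi> (prefix n w))"
    "limit (dma_run M' w) = snd ` limit (\<lambda>n. \<phi> (prefix n w))" if "range w \<subseteq> {..<m}" for w
  proof -
    have "finite (range (\<lambda>n. \<phi> (prefix n w)))"
    proof (rule finite_subset[OF _ fin])
      have "\<phi> (prefix n w) \<in> \<phi> ` {w. set w \<subseteq> {..<m}}" for n using that by (intro imageI) auto
      then show "range (\<lambda>n. \<phi> (prefix n w)) \<subseteq> \<phi> ` {w. set w \<subseteq> {..<m}}" by blast
    qed
    from limit_image[OF this, of fst] limit_image[OF this, of snd]
    show "limit (dma_run M w) = fst ` limit (\<lambda>n. \<phi> (prefix n w))"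
      "limit (dma_run M' w) = snd ` limit (\<lambda>n. \<phi> (prefix n w))"
      by (simp_all add: \<phi>_def dma_run_prefix[abs_def])
  qed
  have "w \<in> L \<longleftrightarrow> w \<in> L'" if w: "range w \<subseteq> {..<m}" for w
  proof -
    obtain u v where uv: "set u \<subseteq> {..<m}" "set v \<subseteq> {..<m}" "v \<noteq> []"
      "limit (\<lambda>n. \<phi> (prefix n (u \<frown> v\<^sup>\<omega>))) = limit (\<lambda>n. \<phi> (prefix n w))"
      by (rule up_word_with_limit[OF fin w]) (auto simp: \<phi>_def reach_append)
    have r: "range (u \<frown> v\<^sup>\<omega>) \<subseteq> {..<m}" using uv range_iter[OF uv(3)] by auto
    show ?thesis using up[OF uv(1-3)] w r proj[OF w] proj[OF r] uv(4)
      by (simp add: M(2,4) dma_language_def)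
  qed
  then show ?thesis by (auto simp: M(2,4) dma_language_def)
qed

section \<open>McNaughton's theorem for a finite congruence\<close>

definition del :: "nat \<Rightarrow> 'a list \<Rightarrow> 'a list" where
  "del j xs = take j xs @ drop (Suc j) xs"

lemma length_del: "j < length xs \<Longrightarrow> length (del j xs) = length xs - 1"
  by (simp add: del_def)

lemma nth_del: "j < length xs \<Longrightarrow> i < length xs - 1 \<Longrightarrow> del j xs ! i = xs ! (if i < j then i else Suc i)"
  by (auto simp: del_def nth_append min_def)

lemma set_del: "set (del j xs) \<subseteq> set xs"
  by (auto simp: del_def dest: in_set_takeD in_set_dropD)

lemma sorted_del: "sorted_wrt (<) xs \<Longrightarrow> sorted_wrt (<) (del j xs)" for xs :: "nat list"
proof -
  assume "sorted_wrt (<) xs"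
  then have "sorted_wrt (<) (take j xs @ drop j xs)" by simp
  then have "sorted_wrt (<) (take j xs)" "sorted_wrt (<) (drop j xs)" "\<forall>a\<in>set (take j xs). \<forall>b\<in>set (drop j xs). a < b"
    unfolding sorted_wrt_append by auto
  moreover have "drop (Suc j) xs = drop 1 (drop j xs)" by simp
  ultimately show ?thesis unfolding del_def sorted_wrt_append
    by (metis sorted_wrt_drop in_set_dropD)
qed

lemma not_in_del: "sorted_wrt (<) xs \<Longrightarrow> j < length xs \<Longrightarrow> xs ! j \<notin> set (del j xs)" for xs :: "nat list"
proof
  assume s: "sorted_wrt (<) xs" and j: "j < length xs" and "xs ! j \<in> set (del j xs)"
  then obtain i where i: "i < length xs - 1" "del j xs ! i = xs ! j"
    by (metis in_set_conv_nth length_del)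
  define i' where "i' = (if i < j then i else Suc i)"
  have "xs ! i' = xs ! j" "i' < length xs" "i' \<noteq> j" using i nth_del[OF j i(1)] by (auto simp: i'_def)
  then show False using s j by (metis linorder_neqE_nat sorted_wrt_nth_less less_irrefl)
qed

definition has_dup :: "'h list \<Rightarrow> bool" where
  "has_dup v \<longleftrightarrow> (\<exists>j<length v. \<exists>i<j. v ! i = v ! j)"

definition dup2 :: "'h list \<Rightarrow> nat" where
  "dup2 v = (LEAST j. j < length v \<and> (\<exists>i<j. v ! i = v ! j))"

definition dup1 :: "'h list \<Rightarrow> nat" where
  "dup1 v = (LEAST i. i < dup2 v \<and> v ! i = v ! dup2 v)"

lemma dup: assumes "has_dup v" shows "dup2 v < length v" "dup1 v < dup2 v" "v ! dup1 v = v ! dup2 v"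
proof -
  have 1: "dup2 v < length v \<and> (\<exists>i<dup2 v. v ! i = v ! dup2 v)"
    unfolding dup2_def by (rule LeastI_ex) (use assms has_dup_def in blast)
  then have "\<exists>i. i < dup2 v \<and> v ! i = v ! dup2 v" by blast
  from LeastI_ex[OF this] have "dup1 v < dup2 v \<and> v ! dup1 v = v ! dup2 v"
    unfolding dup1_def .
  with 1 show "dup2 v < length v" "dup1 v < dup2 v" "v ! dup1 v = v ! dup2 v" by simp_all
qed

lemma no_dup: "\<not> has_dup v \<Longrightarrow> distinct v"
  by (auto simp: has_dup_def distinct_conv_nth) (metis linorder_neqE_nat)

text \<open>
  The automaton keeps a list of positions of the word read so far. Two positions are equivalent if the
  factors of the word from them on have the same value; they stay equivalent forever, and the later one is
  discarded in favour of the earlier one. Since every new position is added to the list, which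
  stays short, positions are discarded infinitely often. The smallest index at which this happens
  infinitely often yields a factorization of the word into factors of equal idempotent value.
\<close>

locale finite_congruence =
  fixes H :: "nat list \<Rightarrow> 'h"
  assumes fin: "finite (range H)"
    and cong: "H x = H x' \<Longrightarrow> H y = H y' \<Longrightarrow> H (x @ y) = H (x' @ y')"
begin

definition vals :: "nat list \<Rightarrow> nat list \<Rightarrow> 'h list" where
  "vals W u = map (\<lambda>t. H (drop t W)) u"

definition prune :: "nat list \<Rightarrow> nat list \<Rightarrow> nat list" where
  "prune W u = (if has_dup (vals W u) then del (dup2 (vals W u)) u else u)"

primrec tsr :: "nat list \<Rightarrow> nat list" where
  "tsr [] = [0]"
| "tsr (a # x) = prune (rev x @ [a]) (tsr x @ [Suc (length x)])"

definition ts :: "nat list \<Rightarrow> nat list" where "ts W = tsr (rev W)"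

lemma ts_simps: "ts [] = [0]" "ts (W @ [a]) = prune (W @ [a]) (ts W @ [Suc (length W)])"
  by (simp_all add: ts_def)

text \<open>The value of the factor from a position to the end detects equivalent positions. The
  values of the prefix before the position and of the factor between two positions are what an event
  reports.\<close>

definition entry :: "nat list \<Rightarrow> nat list \<Rightarrow> nat \<Rightarrow> nat \<Rightarrow> 'h \<times> 'h \<times> 'h" where
  "entry W u i j = (H (drop (u ! i) W), H (take (u ! i) W), H (take (u ! j - u ! i) (drop (u ! i) W)))"

definition dat :: "nat list \<Rightarrow> nat list \<Rightarrow> 'h \<times> ('h \<times> 'h \<times> 'h) list list" where
  "dat W u = (H W, map (\<lambda>i. map (entry W u i) [0..<length u]) [0..<length u])"

definition event :: "nat list \<Rightarrow> nat list \<Rightarrow> (nat \<times> nat \<times> 'h \<times> 'h) option" where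
  "event W u = (let v = vals W u; i = dup1 v; j = dup2 v in
     if has_dup v then Some (i, j, H (take (u ! i) W), H (take (u ! j - u ! i) (drop (u ! i) W))) else None)"

text \<open>The event of the last letter is part of the value, so that the limit tells which events
  recur.\<close>

definition stat where
  "stat W = (dat W (ts W), if W = [] then None else event W (ts (butlast W) @ [length W]))"

lemma dat_eq_iff: "dat W u = dat W' u' \<longleftrightarrow> H W = H W' \<and> length u = length u' \<and>
    (\<forall>i<length u. \<forall>j<length u. entry W u i j = entry W' u' i j)" (is "?l \<longleftrightarrow> ?r")
proof
  let ?m = "\<lambda>W u. map (\<lambda>i. map (entry W u i) [0..<length u]) [0..<length u]"
  assume ?l
  then have h: "H W = H W'" and m: "?m W u = ?m W' u'" by (simp_all only: dat_def prod.inject)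
  have l: "length u = length u'" using arg_cong[OF m, of length] by simp
  have "entry W u i j = entry W' u' i j" if "i < length u" "j < length u" for i j
    using arg_cong[OF m, of "\<lambda>x. x ! i ! j"] that l by simp
  with h l show ?r by blast
next
  assume ?r
  then show ?l unfolding dat_def by (intro arg_cong2[of _ _ _ _ Pair] map_cong) auto
qed

lemma dat_vals: "dat W u = dat W' u' \<Longrightarrow> vals W u = vals W' u'"
  unfolding dat_eq_iff vals_def by (intro nth_equalityI) (auto simp: entry_def)

lemma dat_del:
  assumes "dat W u = dat W' u'" "k < length u" shows "dat W (del k u) = dat W' (del k u')"
proof -
  have l: "length u' = length u" using assms by (simp add: dat_eq_iff)
  have "entry W (del k u) i j = entry W (u) (if i < k then i else Suc i) (if j < k then j else Suc j)"
    if "i < length u - 1" "j < length u - 1" for i j using that assms(2) by (simp add: entry_def nth_del)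
  moreover have "entry W' (del k u') i j = entry W' u' (if i < k then i else Suc i) (if j < k then j else Suc j)"
    if "i < length u - 1" "j < length u - 1" for i j using that assms(2) l by (simp add: entry_def nth_del)
  ultimately show ?thesis using assms l by (auto simp: dat_eq_iff length_del)
qed

lemma dat_event: "dat W u = dat W' u' \<Longrightarrow> event W u = event W' u'"
proof -
  assume d: "dat W u = dat W' u'"
  have v: "vals W u = vals W' u'" by (rule dat_vals[OF d])
  show ?thesis
  proof (cases "has_dup (vals W u)")
    case True
    have "length (vals W u) = length u" by (simp add: vals_def)
    then have "entry W u (dup1 (vals W u)) (dup2 (vals W u)) = entry W' u' (dup1 (vals W u)) (dup2 (vals W u))"
      using d dup[OF True] by (simp add: dat_eq_iff)
    then show ?thesis by (simp add: event_def Let_def v[symmetric] entry_def)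
  next
    case False
    then show ?thesis by (simp add: event_def Let_def v[symmetric])
  qed
qed

lemma ts_le: "t \<in> set (ts W) \<Longrightarrow> t \<le> length W"
proof (induction W rule: rev_induct)
  case (snoc a W)
  then have "t \<in> set (ts W @ [Suc (length W)])"
    by (auto simp: ts_simps prune_def dest!: subsetD[OF set_del] split: if_splits)
  then show ?case using snoc by auto
qed (simp add: ts_simps)

lemma ts_sorted: "sorted_wrt (<) (ts W)"
proof (induction W rule: rev_induct)
  case (snoc a W)
  then have "sorted_wrt (<) (ts W @ [Suc (length W)])"
    using ts_le by (fastforce simp: sorted_wrt_append less_Suc_eq_le)
  then show ?case by (simp add: ts_simps prune_def sorted_del)
qed (simp add: ts_simps)

text \<open>The new data depend only on the old ones and the letter: factors up to the end grow by
  the letter, factors between old positions stay, and the new position contributes the whole word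
  and the empty one.\<close>

lemma dat_ext:
  assumes "dat W (ts W) = dat W' (ts W')"
  shows "dat (W @ [a]) (ts W @ [Suc (length W)]) = dat (W' @ [a]) (ts W' @ [Suc (length W')])"
proof -
  let ?u = "ts W @ [Suc (length W)]" and ?u' = "ts W' @ [Suc (length W')]"
  have l: "length (ts W) = length (ts W')" and h: "H W = H W'"
    and e: "\<And>i j. i < length (ts W) \<Longrightarrow> j < length (ts W) \<Longrightarrow> entry W (ts W) i j = entry W' (ts W') i j"
    using assms by (auto simp: dat_eq_iff)
  have hd: "H (drop (ts W ! i) (W @ [a])) = H (drop (ts W' ! i) (W' @ [a]))" if "i < length (ts W)" for i
  proof -
    have "ts W ! i \<le> length W" "ts W' ! i \<le> length W'" using that l ts_le by simp_all
    moreover have "H (drop (ts W ! i) W) = H (drop (ts W' ! i) W')"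
      using e[OF that that] by (simp add: entry_def)
    then have "H (drop (ts W ! i) W @ [a]) = H (drop (ts W' ! i) W' @ [a])"
      by (rule cong[OF _ refl])
    ultimately show ?thesis by simp
  qed
  have ha: "H (W @ [a]) = H (W' @ [a])" using cong[OF h refl] .
  have new: "?u ! length (ts W) = Suc (length W)" "?u' ! length (ts W) = Suc (length W')"
    by (simp, simp add: l)
  have old: "?u ! i = ts W ! i" "?u' ! i = ts W' ! i" "ts W ! i \<le> length W" "ts W' ! i \<le> length W'"
    if "i < length (ts W)" for i
    using that l ts_le by (simp_all add: nth_append)
  have "entry (W @ [a]) ?u i j = entry (W' @ [a]) ?u' i j" if ij: "i < length ?u" "j < length ?u" for i j
  proof -
    consider "i = length (ts W)" "j = length (ts W)" | "i = length (ts W)" "j < length (ts W)"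
      | "i < length (ts W)" "j = length (ts W)" | "i < length (ts W)" "j < length (ts W)"
      using ij by fastforce
    then show ?thesis
    proof cases
      case 1
      then show ?thesis using ha by (simp add: entry_def new)
    next
      case 2
      then show ?thesis using ha old[OF 2(2)] by (simp add: entry_def new)
    next
      case 3
      then show ?thesis using hd[OF 3(1)] e[OF 3(1) 3(1)] old[OF 3(1)] by (simp add: entry_def new)
    next
      case 4
      have "take t (drop s (V @ [a])) = take t (drop s V)" if "s + t \<le> length V" for s t and V :: "nat list"
        using that by simp
      then show ?thesis using hd[OF 4(1)] e[OF 4] old[OF 4(1)] old[OF 4(2)]
        by (cases "ts W ! i \<le> ts W ! j"; cases "ts W' ! i \<le> ts W' ! j") (simp_all add: entry_def)
    qed
  qed
  then show ?thesis using ha l by (simp add: dat_eq_iff)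
qed

lemma stat_cong:
  assumes "stat W = stat W'" shows "stat (W @ [a]) = stat (W' @ [a])"
proof -
  have "dat W (ts W) = dat W' (ts W')" using assms by (simp add: stat_def)
  from dat_ext[OF this] have d: "dat (W @ [a]) (ts W @ [Suc (length W)]) = dat (W' @ [a]) (ts W' @ [Suc (length W')])" .
  note v = dat_vals[OF d]
  have "dat (W @ [a]) (ts (W @ [a])) = dat (W' @ [a]) (ts (W' @ [a]))"
  proof (cases "has_dup (vals (W @ [a]) (ts W @ [Suc (length W)]))")
    case True
    have "length (vals (W @ [a]) (ts W @ [Suc (length W)])) = length (ts W @ [Suc (length W)])" by (simp add: vals_def)
    then show ?thesis using True dat_del[OF d] dup(1)[OF True] by (simp add: ts_simps prune_def v[symmetric])
  next
    case False
    then show ?thesis using d by (simp add: ts_simps prune_def v[symmetric])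
  qed
  then show ?thesis using dat_event[OF d] by (simp add: stat_def)
qed

text \<open>Either a position is discarded and the length stays the same, or the values of all
  positions are distinct.\<close>

lemma length_ts: "length (ts W) \<le> card (range H)"
proof (induction W rule: rev_induct)
  case Nil
  have "0 < card (range H)" using fin by (simp add: card_gt_0_iff)
  then show ?case by (simp add: ts_simps)
next
  case (snoc a W)
  let ?v = "vals (W @ [a]) (ts W @ [Suc (length W)])"
  show ?case
  proof (cases "has_dup ?v")
    case True
    have "length ?v = Suc (length (ts W))" by (simp add: vals_def)
    then show ?thesis using True dup(1)[OF True] snoc by (simp add: ts_simps prune_def length_del)
  next
    case False
    then have "length ?v = card (set ?v)" by (simp add: no_dup distinct_card)
    also have "\<dots> \<le> card (range H)" by (rule card_mono[OF fin]) (auto simp: vals_def)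
    finally show ?thesis using False by (simp add: ts_simps prune_def vals_def)
  qed
qed

lemma finite_stat: "finite (range stat)"
proof -
  let ?N = "card (range H)" and ?R = "range H"
  let ?E = "{xs. set xs \<subseteq> ?R \<times> ?R \<times> ?R \<and> length xs \<le> ?N}"
  let ?D = "?R \<times> {xs. set xs \<subseteq> ?E \<and> length xs \<le> ?N}"
  let ?O = "insert None (Some ` ({..?N} \<times> {..?N} \<times> ?R \<times> ?R))"
  have "finite ?E" by (intro finite_lists_length_le finite_cartesian_product fin)
  then have "finite ?D" using fin by (intro finite_cartesian_product finite_lists_length_le)
  moreover have "finite ?O" by (simp add: fin)
  ultimately have "finite (?D \<times> ?O)" by (rule finite_cartesian_product)
  moreover have "range stat \<subseteq> ?D \<times> ?O"
  proof (rule image_subsetI)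
    fix W
    have "dat W (ts W) \<in> ?D" using length_ts[of W] by (auto simp: dat_def entry_def)
    moreover have "event W (ts (butlast W) @ [length W]) \<in> ?O"
    proof (cases "has_dup (vals W (ts (butlast W) @ [length W]))")
      case True
      from dup(1,2)[OF True] show ?thesis using True length_ts[of "butlast W"]
        by (auto simp: event_def Let_def vals_def)
    qed (simp add: event_def Let_def)
    ultimately show "stat W \<in> ?D \<times> ?O" unfolding stat_def by (intro SigmaI) simp_all
  qed
  ultimately show ?thesis by (rule rev_finite_subset)
qed

text \<open>A Ramsey factorization. In particular \<open>e\<close> is idempotent, since the factor
  from \<open>k 0\<close> to \<open>k 2\<close> is composed of two factors of value
  \<open>e\<close>.\<close>

definition factorizes :: "nat word \<Rightarrow> 'h \<Rightarrow> 'h \<Rightarrow> bool" where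
  "factorizes w a e \<longleftrightarrow> (\<exists>T (k :: nat \<Rightarrow> nat). strict_mono k \<and> T \<le> k 0 \<and> H (prefix T w) = a \<and>
     (\<forall>n. H (w [T \<rightarrow> k n]) = e) \<and> (\<forall>n n'. n < n' \<longrightarrow> H (w [k n \<rightarrow> k n']) = e))"

declare subseq_to_Suc [simp del]

abbreviation tsn :: "nat word \<Rightarrow> nat \<Rightarrow> nat list" where
  "tsn w n \<equiv> ts (prefix n w)"

lemma tsn_Suc: "tsn w (Suc n) = prune (prefix (Suc n) w) (tsn w n @ [Suc n])"
  using ts_simps(2)[of "prefix n w" "w n"] by (simp add: subseq_to_Suc)

lemma stat_prefix: "stat (prefix (Suc n) w) = (dat (prefix (Suc n) w) (tsn w (Suc n)), event (prefix (Suc n) w) (tsn w n @ [Suc n]))"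
  by (simp add: stat_def subseq_to_Suc)

lemma sub_append: "a \<le> b \<Longrightarrow> b \<le> c \<Longrightarrow> w [a \<rightarrow> c] = (w [a \<rightarrow> b]) @ (w [b \<rightarrow> c])"
  unfolding subsequence_def map_append[symmetric] by (metis le_Suc_ex upt_add_eq_append add_leD1 le_add_diff_inverse)

text \<open>Eventually no position is discarded below the minimal index \<open>j\<close>, so entry
  \<open>i\<close> of the list is a fixed position \<open>T\<close>. When the event discards a
  position \<open>kk n\<close>, the factor from \<open>T\<close> to \<open>kk n\<close> has value
  \<open>e\<close>, and from then on \<open>T\<close> and \<open>kk n\<close> are equivalent. For
  another such position beyond that moment, the factor from \<open>kk n\<close> to it thus has the
  same value as the factor from \<open>T\<close>, namely \<open>e\<close>.\<close>

lemma factorize: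
  assumes I: "I = limit (\<lambda>n. stat (prefix n w))"
    and E: "(\<sigma>, Some (i, j, a, e)) \<in> I"
    and min: "\<And>\<sigma> i' j' a' e'. (\<sigma>, Some (i', j', a', e')) \<in> I \<Longrightarrow> j \<le> j'"
  shows "factorizes w a e"
proof -
  let ?x = "\<lambda>n. stat (prefix n w)"
  have "finite (range ?x)" by (rule finite_subset[OF _ finite_stat]) auto
  then obtain n0 where n0: "limit ?x = range (suffix n0 ?x)" using limit_is_suffix by blast
  have inI: "?x n \<in> I" if "n0 \<le> n" for n
  proof -
    have "?x n = suffix n0 ?x (n - n0)" using that by simp
    then show ?thesis unfolding I n0 by (metis rangeI)
  qed
  have often: "\<exists>n>c. ?x n = (\<sigma>, Some (i, j, a, e))" for c
    using E unfolding I by (auto simp: limit_iff_frequent INFM_nat)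
  define u where "u n = tsn w n @ [Suc n]" for n
  define v where "v n = vals (prefix (Suc n) w) (u n)" for n
  have lv: "length (v n) = Suc (length (tsn w n))" for n by (simp add: v_def vals_def u_def)
  have ev: "has_dup (v n) \<and> dup1 (v n) = i \<and> dup2 (v n) = j \<and> H (take (u n ! i) (prefix (Suc n) w)) = a \<and>
      H (take (u n ! j - u n ! i) (drop (u n ! i) (prefix (Suc n) w))) = e"
    if "?x (Suc n) = (\<sigma>, Some (i, j, a, e))" for n
    using that by (auto simp: stat_prefix event_def Let_def u_def[symmetric] v_def[symmetric] split: if_splits)
  have jmin: "j \<le> dup2 (v n)" if "n0 \<le> n" "has_dup (v n)" for n
    using inI[of "Suc n"] that
    by (auto simp: stat_prefix event_def Let_def u_def[symmetric] v_def[symmetric] intro: min)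
  have next_ts: "tsn w (Suc n) = (if has_dup (v n) then del (dup2 (v n)) (u n) else u n)" for n
    by (simp add: tsn_Suc prune_def v_def u_def)
  obtain n1 where n1: "n0 < n1" "?x (Suc n1) = (\<sigma>, Some (i, j, a, e))"
  proof -
    obtain n where "Suc n0 < n" "?x n = (\<sigma>, Some (i, j, a, e))" using often by blast
    then show thesis using that[of "n - 1"] by (cases n) auto
  qed
  have ij: "i < j" using dup(2) ev[OF n1(2)] by metis
  define P where "P = take j (u n1)"
  have lu: "j < length (u n1)" using dup(1) ev[OF n1(2)] lv by (metis length_append_singleton u_def)
  \<comment> \<open>All deletions after \<open>n1\<close> happen at index \<open>j\<close> or later,
    so the first \<open>j\<close> entries are frozen.\<close>
  have stable: "j \<le> length (tsn w n) \<and> take j (tsn w n) = P" if "Suc n1 \<le> n" for n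
    using that
  proof (induction n rule: dec_induct)
    case base
    have "has_dup (v n1)" "dup2 (v n1) = j" using ev[OF n1(2)] by auto
    then show ?case using lu by (auto simp: next_ts length_del P_def del_def min_def)
  next
    case (step n)
    then have ln: "j \<le> length (tsn w n)" and tn: "take j (u n) = P" by (auto simp: u_def)
    show ?case
    proof (cases "has_dup (v n)")
      case True
      then have "j \<le> dup2 (v n)" using jmin[of n] step n1 by simp
      moreover have "dup2 (v n) < length (u n)" using dup(1)[OF True] lv by (simp add: u_def)
      ultimately show ?thesis using True tn ln by (auto simp: next_ts length_del del_def min_def u_def)
    next
      case False
      then show ?thesis using tn ln by (simp add: next_ts) (simp add: u_def)
    qed
  qed
  have lP: "length P = j" using lu by (simp add: P_def)
  define T where "T = P ! i"
  define X where "X = {n. n1 < n \<and> ?x (Suc n) = (\<sigma>, Some (i, j, a, e))}"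
  define kk where "kk n = u n ! j" for n
  have su: "sorted_wrt (<) (u n)" for n
  proof -
    have "\<forall>t\<in>set (tsn w n). t < Suc n" using ts_le[of _ "prefix n w"] by fastforce
    then show ?thesis using ts_sorted by (simp add: u_def sorted_wrt_append)
  qed
  have X: "T < kk n" "kk n \<le> Suc n" "H (prefix T w) = a" "H (w [T \<rightarrow> kk n]) = e"
      "H (w [T \<rightarrow> Suc n]) = H (w [kk n \<rightarrow> Suc n])" "kk n \<notin> set (tsn w (Suc n))" "kk n \<in> set (u n)" if "n \<in> X" for n
  proof -
    have n: "n1 < n" and e: "has_dup (v n)" "dup1 (v n) = i" "dup2 (v n) = j" "H (take (u n ! i) (prefix (Suc n) w)) = a"
      "H (take (u n ! j - u n ! i) (drop (u n ! i) (prefix (Suc n) w))) = e"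
      using that ev[of n] by (auto simp: X_def)
    have jl: "j < length (u n)" using dup(1)[OF e(1)] lv e by (simp add: u_def)
    have "take j (u n) = P" using stable[of n] n by (simp add: u_def)
    then have T: "u n ! i = T" using ij by (metis T_def nth_take)
    show lt: "T < kk n" using su[of n] ij jl by (auto simp: T[symmetric] kk_def sorted_wrt_iff_nth_less)
    have "kk n \<in> set (u n)" using jl by (simp add: kk_def)
    then show "kk n \<in> set (u n)" and kn: "kk n \<le> Suc n" using ts_le[of _ "prefix n w"] by (fastforce simp: u_def)+
    show "H (prefix T w) = a" using e(4) lt kn by (simp add: T min_def)
    show "H (w [T \<rightarrow> kk n]) = e" using e(5) lt kn by (simp add: T kk_def[symmetric] min_def)
    have "v n ! i = v n ! j" using dup(3)[OF e(1)] e by simp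
    then show "H (w [T \<rightarrow> Suc n]) = H (w [kk n \<rightarrow> Suc n])"
      using ij jl by (simp add: v_def vals_def T kk_def[symmetric])
    show "kk n \<notin> set (tsn w (Suc n))"
      using e jl not_in_del[OF su jl] by (simp add: next_ts kk_def)
  qed
  \<comment> \<open>Only the current position is ever added, so a discarded one does not
    return.\<close>
  have gone: "t \<notin> set (tsn w l)" if "t \<notin> set (tsn w n)" "t \<le> n" "n \<le> l" for t n l
    using that(3)
  proof (induction l rule: dec_induct)
    case (step l)
    then have "t \<notin> set (u l)" using that(2) by (simp add: u_def)
    then show ?case using set_del[of "dup2 (v l)" "u l"] by (auto simp: next_ts)
  qed (rule that)
  \<comment> \<open>Each event discards a position of its own. Infinitely many events thus provide
    arbitrarily late cuts.\<close>
  have inj: "inj_on kk X"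
  proof (rule linorder_inj_onI')
    fix n l assume nl: "n \<in> X" "l \<in> X" "n < l"
    have "kk n \<notin> set (tsn w l)" by (rule gone[OF X(6)[OF nl(1)] X(2)[OF nl(1)]]) (use nl in simp)
    then have "kk n \<notin> set (u l)" using X(2)[OF nl(1)] nl by (simp add: u_def)
    then show "kk n \<noteq> kk l" using X(7)[OF nl(2)] by metis
  qed
  have Xinf: "infinite X"
    unfolding infinite_nat_iff_unbounded
  proof
    fix c
    obtain n where "Suc (max c n1) < n" "?x n = (\<sigma>, Some (i, j, a, e))" using often by blast
    then show "\<exists>n>c. n \<in> X" by (intro exI[of _ "n - 1"]) (cases n, auto simp: X_def)
  qed
  have later: "\<exists>n. n \<in> X \<and> c < kk n" for c
  proof (rule ccontr)
    assume "\<not> ?thesis"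
    then have "kk ` X \<subseteq> {..c}" by (auto simp: not_less)
    then have "finite (kk ` X)" by (rule finite_subset) simp
    then show False using Xinf finite_imageD[OF _ inj] by blast
  qed
  obtain g where g: "\<And>c. g c \<in> X \<and> c < kk (g c)" using later by metis
  \<comment> \<open>The next cut has to lie beyond the time at which the previous one was discarded,
    since only from then on is the latter known to be equivalent to \<open>T\<close>.\<close>
  define s where "s = rec_nat (g 0) (\<lambda>_ n. g (Suc n))"
  have s: "s n \<in> X" "Suc (s n) < kk (s (Suc n))" for n
    using g by (cases n; simp add: s_def)+
  define k where "k n = kk (s n)" for n
  have k_Suc: "Suc (s n) < k (Suc n)" for n using s(2) by (simp add: k_def)
  have "k n < k (Suc n)" for n using k_Suc[of n] X(2)[OF s(1)[of n]] by (simp add: k_def)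
  then have mono: "strict_mono k" by (simp add: strict_mono_Suc_iff)
  have "H (w [k n \<rightarrow> k n']) = e" if "n < n'" for n n'
  proof -
    have le: "Suc (s n) \<le> k n'" using k_Suc[of n] strict_mono_less_eq[OF mono, of "Suc n" n'] that by simp
    note Xs = X[OF s(1)[of n]]
    have "H (w [k n \<rightarrow> k n']) = H ((w [kk (s n) \<rightarrow> Suc (s n)]) @ (w [Suc (s n) \<rightarrow> k n']))"
      using sub_append[OF Xs(2) le, of w] by (simp add: k_def)
    also have "\<dots> = H ((w [T \<rightarrow> Suc (s n)]) @ (w [Suc (s n) \<rightarrow> k n']))"
      using Xs(5) by (intro cong refl) simp
    also have "\<dots> = H (w [T \<rightarrow> k n'])" using sub_append[OF _ le, of T w] Xs(1,2) by simp
    also have "\<dots> = e" using X(4)[OF s(1)[of n']] by (simp add: k_def)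
    finally show ?thesis .
  qed
  moreover have "H (w [T \<rightarrow> k n]) = e" for n using X(4)[OF s(1)[of n]] by (simp add: k_def)
  moreover have "T \<le> k 0" using X(1)[OF s(1)[of 0]] by (simp add: k_def)
  moreover have "H (prefix T w) = a" using X(3)[OF s(1)[of 0]] .
  ultimately show ?thesis unfolding factorizes_def using mono by blast
qed

text \<open>Without recurring events the list would grow with every letter from some time on,
  against \<open>length_ts\<close>.\<close>

lemma some_event:
  assumes "I = limit (\<lambda>n. stat (prefix n w))" shows "\<exists>\<sigma> z. (\<sigma>, Some z) \<in> I"
proof (rule ccontr)
  assume no: "\<not> ?thesis"
  let ?x = "\<lambda>n. stat (prefix n w)"
  have "finite (range ?x)" by (rule finite_subset[OF _ finite_stat]) auto
  then obtain n0 where n0: "limit ?x = range (suffix n0 ?x)" using limit_is_suffix by blast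
  have inI: "?x n \<in> I" if "n0 \<le> n" for n
  proof -
    have "?x n = suffix n0 ?x (n - n0)" using that by simp
    then show ?thesis unfolding assms n0 by (metis rangeI)
  qed
  have "length (tsn w (Suc n)) = Suc (length (tsn w n))" if "n0 \<le> n" for n
  proof -
    have "(dat (prefix (Suc n) w) (tsn w (Suc n)), event (prefix (Suc n) w) (tsn w n @ [Suc n])) \<in> I"
      using inI[of "Suc n"] that by (simp add: stat_prefix)
    then have "event (prefix (Suc n) w) (tsn w n @ [Suc n]) \<noteq> Some z" for z
      using no by metis
    then have "event (prefix (Suc n) w) (tsn w n @ [Suc n]) = None"
      using option.exhaust by blast
    then have "\<not> has_dup (vals (prefix (Suc n) w) (tsn w n @ [Suc n]))"
      by (simp add: event_def Let_def split: if_splits)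
    then show ?thesis by (simp add: tsn_Suc prune_def)
  qed
  then have "c \<le> length (tsn w (n0 + c))" for c by (induction c) auto
  from this[of "Suc (card (range H))"] length_ts[of "prefix (n0 + Suc (card (range H))) w"]
  show False by (simp)
qed

declare subseq_to_Suc [simp]

text \<open>The automaton decides by one factorization of \<open>w\<close>, and \<open>V\<close> may
  judge others differently. In the application saturation makes all of them agree.\<close>

theorem factorization_dma:
  fixes V :: "'h \<Rightarrow> 'h \<Rightarrow> bool"
  obtains L where "omega_regular m L"
    "\<And>w. range w \<subseteq> {..<m} \<Longrightarrow> \<exists>a e. factorizes w a e \<and> (w \<in> L \<longleftrightarrow> V a e)"
proof -
  define minimal where "minimal I j \<longleftrightarrow> (\<forall>\<sigma> i' j' a' e'. (\<sigma>, Some (i', j', a', e')) \<in> I \<longrightarrow> j \<le> j')"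
    for I :: "((('h \<times> ('h \<times> 'h \<times> 'h) list list) \<times> (nat \<times> nat \<times> 'h \<times> 'h) option) set)" and j :: nat
  define ACC where "ACC = {I. \<exists>\<sigma> i j a e. (\<sigma>, Some (i, j, a, e)) \<in> I \<and> minimal I j \<and> V a e}"
  have fs: "finite (stat ` {w. set w \<subseteq> {..<m}})" by (rule finite_subset[OF _ finite_stat]) auto
  obtain M where M: "wf_dma m M"
    "dma_language m M = {w. range w \<subseteq> {..<m} \<and> limit (\<lambda>n. stat (prefix n w)) \<in> ACC}"
    by (rule dma_of_congruence[OF fs, of ACC]) (rule stat_cong, assumption, blast)
  have "\<exists>a e. factorizes w a e \<and> (w \<in> dma_language m M \<longleftrightarrow> V a e)" if w: "range w \<subseteq> {..<m}" for w
  proof -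
    define I where "I = limit (\<lambda>n. stat (prefix n w))"
    have fact: "factorizes w a e" if "(\<sigma>, Some (i, j, a, e)) \<in> I" "minimal I j" for \<sigma> i j a e
      using factorize[OF I_def that(1)] that(2) unfolding minimal_def by blast
    have iff: "w \<in> dma_language m M \<longleftrightarrow> I \<in> ACC" using w by (simp add: M(2) I_def)
    show ?thesis
    proof (cases "I \<in> ACC")
      case True
      then show ?thesis using fact iff unfolding ACC_def by blast
    next
      case False
      let ?J = "\<lambda>j. \<exists>\<sigma> i a e. (\<sigma>, Some (i, j, a, e)) \<in> I"
      have "\<exists>j. ?J j" using some_event[OF I_def] by (metis prod.collapse)
      then have "?J (LEAST j. ?J j)" by (rule LeastI_ex)
      then obtain \<sigma> i a e where E: "(\<sigma>, Some (i, (LEAST j. ?J j), a, e)) \<in> I" by blast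
      have m: "minimal I (LEAST j. ?J j)" unfolding minimal_def by (blast intro: Least_le)
      then have "\<not> V a e" using False E unfolding ACC_def by blast
      then show ?thesis using fact[OF E m] iff False by blast
    qed
  qed
  moreover have "omega_regular m (dma_language m M)" using M(1) by (auto simp: omega_regular_def)
  ultimately show thesis using that by blast
qed

end

section \<open>Chains of saturated families\<close>

lemma length_rep: "length (rep n x) = n * length x"
  by (induction n) auto

lemma nth_rep: "i < n * length x \<Longrightarrow> rep n x ! i = x ! (i mod length x)"
proof (induction n arbitrary: i)
  case (Suc n)
  then show ?case by (cases "i < length x") (auto simp: nth_append mod_if)
qed simp

lemma iter_rep:
  assumes "0 < n" "v \<noteq> []" shows "(rep n v)\<^sup>\<omega> = v\<^sup>\<omega>"
proof
  fix i
  have l: "0 < length (rep n v)" using assms by (simp add: length_rep)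
  have "i mod (n * length v) < n * length v" using assms by simp
  then have "(rep n v)\<^sup>\<omega> i = v ! (i mod (n * length v) mod length v)"
    using l by (simp add: length_rep nth_rep)
  then show "(rep n v)\<^sup>\<omega> i = v\<^sup>\<omega> i" using assms by (simp add: mod_mod_cancel)
qed

text \<open>Letters outside the alphabet are dropped, since \<open>step\<close> is arbitrary there and the range should be finite.\<close>

definition hom :: "fdfa \<Rightarrow> nat list \<Rightarrow> (nat \<times> nat list) list" where
  "hom F w = (let w' = filter (\<lambda>a. a < alph F) w in
     map (\<lambda>q. (foldl (step (leading F)) q w',
       map (\<lambda>p. foldl (step (progress F q)) p w') [0..<nstates (progress F q)])) [0..<nstates (leading F)])"

lemma filter_alph: "set w \<subseteq> {..<m} \<Longrightarrow> filter (\<lambda>a. a < m) w = w"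
  by (induction w) auto

lemma set_filter_alph: "set (filter (\<lambda>a. a < m) w) \<subseteq> {..<m}"
  by auto

context
  fixes F :: fdfa
  assumes wf: "wf_fdfa F"
begin

lemma wf_leading: "wf_dts (alph F) (leading F)"
  using wf by (simp add: wf_fdfa_def)

lemma wf_progress: "q < nstates (leading F) \<Longrightarrow> wf_dts (alph F) (progress F q)"
  using wf by (simp add: wf_fdfa_def wf_dfa_def)

lemma hom_eq_iff:
  "hom F x = hom F y \<longleftrightarrow> (\<forall>q<nstates (leading F).
     foldl (step (leading F)) q (filter (\<lambda>a. a < alph F) x) = foldl (step (leading F)) q (filter (\<lambda>a. a < alph F) y) \<and>
     (\<forall>p<nstates (progress F q). foldl (step (progress F q)) p (filter (\<lambda>a. a < alph F) x)
        = foldl (step (progress F q)) p (filter (\<lambda>a. a < alph F) y)))"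
  by (simp add: hom_def Let_def) (simp add: Ball_def)

lemma hom_lead:
  "hom F x = hom F y \<Longrightarrow> set x \<subseteq> {..<alph F} \<Longrightarrow> set y \<subseteq> {..<alph F} \<Longrightarrow> q < nstates (leading F) \<Longrightarrow>
    foldl (step (leading F)) q x = foldl (step (leading F)) q y"
  by (simp add: hom_eq_iff filter_alph)

lemma hom_prog:
  "hom F x = hom F y \<Longrightarrow> set x \<subseteq> {..<alph F} \<Longrightarrow> set y \<subseteq> {..<alph F} \<Longrightarrow> q < nstates (leading F) \<Longrightarrow>
    p < nstates (progress F q) \<Longrightarrow> foldl (step (progress F q)) p x = foldl (step (progress F q)) p y"
  by (simp add: hom_eq_iff filter_alph)

lemma finite_hom: "finite (range (hom F))"
proof -
  let ?n = "nstates (leading F)"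
  define N where "N = Suc (\<Sum>q<?n. nstates (progress F q))"
  have N: "nstates (progress F q) \<le> N" if "q < ?n" for q
    using that member_le_sum[of q "{..<?n}" "\<lambda>q. nstates (progress F q)"] by (simp add: N_def)
  let ?B = "{ps. set ps \<subseteq> {..<N} \<and> length ps \<le> N}"
  have "range (hom F) \<subseteq> {xs. set xs \<subseteq> {..<?n} \<times> ?B \<and> length xs = ?n}"
  proof (rule image_subsetI)
    fix w
    let ?w = "filter (\<lambda>a. a < alph F) w"
    have "foldl (step (leading F)) q ?w < ?n \<and>
        (\<forall>p<nstates (progress F q). foldl (step (progress F q)) p ?w < N)" if q: "q < ?n" for q
      using foldl_in[OF wf_leading q set_filter_alph, of w]
        foldl_in[OF wf_progress[OF q] _ set_filter_alph, of _ w] N[OF q] by (auto intro: order.strict_trans2)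
    then show "hom F w \<in> {xs. set xs \<subseteq> {..<?n} \<times> ?B \<and> length xs = ?n}"
      using N by (auto simp: hom_def Let_def)
  qed
  moreover have "finite ?B" by (rule finite_lists_length_le) simp
  then have "finite {xs. set xs \<subseteq> {..<?n} \<times> ?B \<and> length xs = ?n}"
    by (intro finite_lists_length_eq finite_cartesian_product) auto
  ultimately show ?thesis by (rule finite_subset)
qed

lemma hom_cong:
  assumes "hom F x = hom F x'" "hom F y = hom F y'" shows "hom F (x @ y) = hom F (x' @ y')"
  unfolding hom_eq_iff
proof (intro allI impI conjI)
  fix q assume q: "q < nstates (leading F)"
  show "foldl (step (leading F)) q (filter (\<lambda>a. a < alph F) (x @ y)) = foldl (step (leading F)) q (filter (\<lambda>a. a < alph F) (x' @ y'))"
    using assms q foldl_in[OF wf_leading q set_filter_alph, of x'] by (simp add: hom_eq_iff)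
  fix p assume p: "p < nstates (progress F q)"
  show "foldl (step (progress F q)) p (filter (\<lambda>a. a < alph F) (x @ y)) = foldl (step (progress F q)) p (filter (\<lambda>a. a < alph F) (x' @ y'))"
    using assms q p foldl_in[OF wf_progress[OF q] p set_filter_alph, of x'] by (simp add: hom_eq_iff)
qed

lemma reach_leading_in: "set u \<subseteq> {..<alph F} \<Longrightarrow> reach (leading F) u < nstates (leading F)"
  by (rule reach_in[OF wf_leading])

lemma init_progress_in: "q < nstates (leading F) \<Longrightarrow> init (progress F q) < nstates (progress F q)"
  using wf_progress by (simp add: wf_dts_def)

text \<open>A power that is idempotent for the transition congruence leads the progress DFA to a
  state fixed by it, and powers of a normalized word remain normalized.\<close>

lemma duo_power:
  assumes "set u \<subseteq> {..<alph F}" "set v \<subseteq> {..<alph F}" "normalized F u v"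
  obtains n where "0 < n" "duo_normalized F u (rep n v)"
proof -
  obtain n where n: "0 < n" "hom F (rep n v @ rep n v) = hom F (rep n v)"
    using idempotent_power[of "hom F" v, OF finite_hom hom_cong] by blast
  have s: "set (rep n v) \<subseteq> {..<alph F}" using assms(2) n by (simp add: set_rep)
  have "foldl (step (leading F)) (reach (leading F) u) (rep n v) = reach (leading F) u" for n
    using assms(3) by (induction n) (simp_all add: normalized_def reach_append)
  then have "normalized F u (rep n v)" by (simp add: normalized_def reach_append)
  moreover have "reach (progress_at F u) (rep n v @ rep n v) = reach (progress_at F u) (rep n v)"
    unfolding reach_def progress_at_def
    using hom_prog[OF n(2) _ s reach_leading_in[OF assms(1)] init_progress_in[OF reach_leading_in[OF assms(1)]]] s
    by (simp add: reach_def)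
  ultimately show thesis using that n(1) by (simp add: duo_normalized_def)
qed

text \<open>Take a Ramsey factorization of the word for the transition congruence. Two cuts beyond
  \<open>u\<close> whose distance is a multiple of \<open>length v\<close> give a decomposition with
  an idempotent period. It is duo-normalized, so by saturation its acceptance is that of the
  word.\<close>

lemma fdfa_regular:
  assumes sat: "saturated F"
  shows "\<exists>L. omega_regular (alph F) L \<and> (\<forall>u v. set u \<subseteq> {..<alph F} \<and> set v \<subseteq> {..<alph F} \<and> v \<noteq> [] \<longrightarrow>
     (u \<frown> v\<^sup>\<omega> \<in> L \<longleftrightarrow> duo_accepts F u v))"
proof -
  let ?m = "alph F"
  interpret finite_congruence "hom F" by unfold_locales (rule finite_hom, rule hom_cong)
  \<comment> \<open>The leading state is taken after \<open>x @ y\<close>, because a cut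
    \<open>k n\<close> is reached by a prefix of value \<open>a\<close> followed by a factor of
    value \<open>e\<close>.\<close>
  define V where "V a e \<longleftrightarrow> (\<exists>x y. set x \<subseteq> {..<?m} \<and> set y \<subseteq> {..<?m} \<and> hom F x = a \<and> hom F y = e \<and>
     dfa_accepts (progress_at F (x @ y)) y)" for a e
  have V: "V (hom F x) (hom F y) \<longleftrightarrow> dfa_accepts (progress_at F (x @ y)) y"
    if xy: "set x \<subseteq> {..<?m}" "set y \<subseteq> {..<?m}" for x y
  proof -
    have "dfa_accepts (progress_at F (x @ y)) y \<longleftrightarrow> dfa_accepts (progress_at F (x' @ y')) y'"
      if a: "set x' \<subseteq> {..<?m}" "set y' \<subseteq> {..<?m}" "hom F x' = hom F x" "hom F y' = hom F y" for x' y'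
    proof -
      have q: "reach (leading F) (x @ y) = reach (leading F) (x' @ y')"
        unfolding reach_def using a xy wf_leading
        by (intro hom_lead) (auto simp: wf_dts_def intro!: hom_cong)
      have qi: "reach (leading F) (x' @ y') < nstates (leading F)" using a by (intro reach_leading_in) auto
      show ?thesis unfolding dfa_accepts_def progress_at_def q
        using hom_prog[OF a(4) a(2) xy(2) qi init_progress_in[OF qi]] by (simp add: reach_def)
    qed
    then show ?thesis using xy unfolding V_def by blast
  qed
  obtain L where L: "omega_regular ?m L"
    "\<And>w. range w \<subseteq> {..<?m} \<Longrightarrow> \<exists>a e. factorizes w a e \<and> (w \<in> L \<longleftrightarrow> V a e)"
    using factorization_dma[of ?m V] by metis
  have "u \<frown> v\<^sup>\<omega> \<in> L \<longleftrightarrow> duo_accepts F u v"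
    if uv: "set u \<subseteq> {..<?m}" "set v \<subseteq> {..<?m}" "v \<noteq> []" for u v
  proof -
    define w where "w = u \<frown> v\<^sup>\<omega>"
    have rw: "range w \<subseteq> {..<?m}" using uv range_iter[OF uv(3)] by (auto simp: w_def)
    obtain a e where ae: "factorizes w a e" "w \<in> L \<longleftrightarrow> V a e" using L(2)[OF rw] by blast
    then obtain T and k :: "nat \<Rightarrow> nat" where Tk: "strict_mono k" "T \<le> k 0" "hom F (prefix T w) = a"
      "\<And>n. hom F (w [T \<rightarrow> k n]) = e" "\<And>n n'. n < n' \<Longrightarrow> hom F (w [k n \<rightarrow> k n']) = e"
      unfolding factorizes_def by blast
    have Tkn: "T \<le> k n" for n using Tk(1,2) strict_mono_less_eq[OF Tk(1), of 0 n] by simp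
    \<comment> \<open>Among \<open>length v + 1\<close> cuts two are congruent modulo
      \<open>length v\<close>. As \<open>n \<le> k n\<close>, they lie beyond
      \<open>u\<close>.\<close>
    have "\<exists>n n'. length u \<le> n \<and> n < n' \<and> k n mod length v = k n' mod length v"
    proof -
      have "\<not> inj_on (\<lambda>n. k n mod length v) {length u..length u + length v}"
      proof
        assume "inj_on (\<lambda>n. k n mod length v) {length u..length u + length v}"
        then have "card {length u..length u + length v} \<le> card {..<length v}"
          by (rule card_inj_on_le) (use uv in auto)
        then show False by simp
      qed
      then obtain n n' where "n \<in> {length u..length u + length v}" "n' \<in> {length u..length u + length v}"
        "n \<noteq> n'" "k n mod length v = k n' mod length v" by (auto simp: inj_on_def)
      then show ?thesis by (metis atLeastAtMost_iff linorder_neqE_nat)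
    qed
    then obtain n n' where nn: "length u \<le> n" "n < n'" "k n mod length v = k n' mod length v" by blast
    let ?X = "prefix (k n) w" and ?Y = "w [k n \<rightarrow> k n']"
    have lt: "k n < k n'" using Tk(1) nn(2) by (simp add: strict_monoD)
    have "n \<le> k n" using Tk(1) by (rule strict_mono_imp_increasing)
    then have un: "length u \<le> k n" using nn(1) by simp
    have dv: "length v dvd k n' - k n" using nn(3) lt by (metis less_imp_le mod_eq_dvd_iff_nat)
    have per: "w i = v ! ((i - length u) mod length v)" if "length u \<le> i" for i
      using that uv by (simp add: w_def)
    have sX: "set ?X \<subseteq> {..<?m}" "set ?Y \<subseteq> {..<?m}" "set (prefix T w) \<subseteq> {..<?m}" "set (w [T \<rightarrow> k n]) \<subseteq> {..<?m}" for n
      using rw by auto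
    have dec: "decomposition ?m ?X ?Y w"
      unfolding decomposition_def
    proof (intro conjI)
      show "?X \<frown> ?Y\<^sup>\<omega> = w"
      proof -
        have "suffix (k n) w = ?Y\<^sup>\<omega>"
        proof
          fix i
          let ?d = "k n' - k n"
          have "i mod ?d < ?d" using lt by simp
          then have "?Y\<^sup>\<omega> i = w (k n + i mod ?d)" using lt by simp
          also have "\<dots> = v ! ((k n - length u + i mod ?d) mod length v)" using un per[of "k n + i mod ?d"] by simp
          also have "(k n - length u + i mod ?d) mod length v = (k n - length u + i) mod length v"
            using dv by (metis mod_add_right_eq mod_mod_cancel)
          also have "v ! \<dots> = w (k n + i)" using un per[of "k n + i"] by simp
          finally show "suffix (k n) w i = ?Y\<^sup>\<omega> i" by simp
        qed
        then show ?thesis by (metis prefix_suffix)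
      qed
    qed (use sX lt in simp_all)
    have XT: "?X = prefix T w @ (w [T \<rightarrow> k n])" "?X @ ?Y = prefix T w @ (w [T \<rightarrow> k n'])"
      using sub_append[of 0 T "k n" w] sub_append[of T "k n" "k n'" w] Tkn[of n] lt by simp_all
    have homXY: "hom F (?X @ ?Y) = hom F ?X"
    proof -
      have "hom F (?X @ ?Y) = hom F (prefix T w @ (w [T \<rightarrow> k n']))" by (simp only: XT(2))
      also have "\<dots> = hom F (prefix T w @ (w [T \<rightarrow> k n]))" by (rule hom_cong[OF refl]) (simp add: Tk(4))
      also have "\<dots> = hom F ?X" by (simp only: XT(1))
      finally show ?thesis .
    qed
    have homY: "hom F ?Y = e" using Tk(5)[OF nn(2)] .
    have idem: "hom F (?Y @ ?Y) = hom F ?Y"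
    proof -
      have "k n' < k (Suc n')" using Tk(1) by (simp add: strict_monoD)
      then have "hom F (?Y @ (w [k n' \<rightarrow> k (Suc n')])) = e"
        using sub_append[of "k n" "k n'" "k (Suc n')" w] lt Tk(5)[of n "Suc n'"] nn(2) by simp
      moreover have "hom F (?Y @ ?Y) = hom F (?Y @ (w [k n' \<rightarrow> k (Suc n')]))"
        by (rule hom_cong) (simp_all add: homY Tk(5))
      ultimately show ?thesis by (simp add: homY)
    qed
    have norm: "reach (leading F) (?X @ ?Y) = reach (leading F) ?X"
      unfolding reach_def using wf_leading sX rw
      by (intro hom_lead[OF homXY]) (auto simp: wf_dts_def)
    have qi: "reach (leading F) ?X < nstates (leading F)" by (rule reach_leading_in[OF sX(1)])
    have duo: "duo_normalized F ?X ?Y"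
      unfolding duo_normalized_def normalized_def progress_at_def
    proof
      show "reach (progress F (reach (leading F) ?X)) (?Y @ ?Y) = reach (progress F (reach (leading F) ?X)) ?Y"
        unfolding reach_def[of "progress F _"]
        by (rule hom_prog[OF idem _ sX(2) qi init_progress_in[OF qi]]) (use sX(2) in simp)
    qed (rule norm)
    have "V a e \<longleftrightarrow> dfa_accepts (progress_at F ?X) (w [T \<rightarrow> k n])"
      using V[OF sX(3,4), of n] Tk(3) Tk(4)[of n] XT(1) by simp
    also have "\<dots> \<longleftrightarrow> dfa_accepts (progress_at F ?X) ?Y"
      unfolding dfa_accepts_def progress_at_def reach_def[of "progress F _"]
      using hom_prog[OF _ sX(4) sX(2) qi init_progress_in[OF qi], of n] Tk(4)[of n] homY by simp
    also have "\<dots> \<longleftrightarrow> duo_accepts F u v"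
    proof
      assume "dfa_accepts (progress_at F ?X) ?Y"
      then show "duo_accepts F u v" unfolding duo_accepts_def using dec duo by (auto simp: w_def)
    next
      assume "duo_accepts F u v"
      then obtain x y where "decomposition ?m x y w" "duo_normalized F x y" "dfa_accepts (progress_at F x) y"
        unfolding duo_accepts_def w_def by blast
      then show "dfa_accepts (progress_at F ?X) ?Y" using sat dec duo unfolding saturated_def by blast
    qed
    finally show ?thesis using ae(2) by (simp add: w_def)
  qed
  then show ?thesis using L(1) by blast
qed

lemma fdfa_language:
  assumes sat: "saturated F"
  shows "omega_regular (alph F) (fdfa_language F)"
    "set u \<subseteq> {..<alph F} \<Longrightarrow> set v \<subseteq> {..<alph F} \<Longrightarrow> v \<noteq> [] \<Longrightarrow> u \<frown> v\<^sup>\<omega> \<in> fdfa_language F \<longleftrightarrow> duo_accepts F u v"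
proof -
  let ?P = "\<lambda>L. omega_regular (alph F) L \<and> (\<forall>u v. set u \<subseteq> {..<alph F} \<and> set v \<subseteq> {..<alph F} \<and> v \<noteq> [] \<longrightarrow>
     (u \<frown> v\<^sup>\<omega> \<in> L \<longleftrightarrow> duo_accepts F u v))"
  obtain L where L: "?P L" using fdfa_regular[OF sat] by blast
  have "L' = L" if "?P L'" for L'
    by (rule omega_regular_eqI[of "alph F"]) (use that L in auto)
  then have "fdfa_language F = L" unfolding fdfa_language_def using L by (intro the_equality) blast+
  then show "omega_regular (alph F) (fdfa_language F)"
    "set u \<subseteq> {..<alph F} \<Longrightarrow> set v \<subseteq> {..<alph F} \<Longrightarrow> v \<noteq> [] \<Longrightarrow> u \<frown> v\<^sup>\<omega> \<in> fdfa_language F \<longleftrightarrow> duo_accepts F u v"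
    using L by auto
qed

lemma fdfa_language_duo:
  assumes sat: "saturated F" and "set u \<subseteq> {..<alph F}" "set v \<subseteq> {..<alph F}" "v \<noteq> []" "duo_normalized F u v"
  shows "u \<frown> v\<^sup>\<omega> \<in> fdfa_language F \<longleftrightarrow> dfa_accepts (progress_at F u) v"
proof -
  have "decomposition (alph F) u v (u \<frown> v\<^sup>\<omega>)" using assms by (simp add: decomposition_def)
  then have "duo_accepts F u v \<longleftrightarrow> dfa_accepts (progress_at F u) v"
    using assms unfolding duo_accepts_def saturated_def by blast
  then show ?thesis using fdfa_language(2)[OF sat] assms by blast
qed

end

text \<open>In contrast to \<open>chain_words\<close> this is a condition on finitely many words in
  a single progress DFA. The equation for \<open>i = j\<close> makes \<open>e i\<close>
  duo-normalized.\<close>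

definition fdfa_chain :: "fdfa \<Rightarrow> nat \<Rightarrow> bool \<Rightarrow> nat list \<Rightarrow> (nat \<Rightarrow> nat list) \<Rightarrow> bool" where
  "fdfa_chain F k b u e \<longleftrightarrow> set u \<subseteq> {..<alph F} \<and> (\<forall>i<k. e i \<noteq> [] \<and> set (e i) \<subseteq> {..<alph F} \<and> normalized F u (e i) \<and>
     (dfa_accepts (progress_at F u) (e i) \<longleftrightarrow> even i = b)) \<and>
     (\<forall>i<k. \<forall>j<k. reach (progress_at F u) (e i @ e j) = reach (progress_at F u) (e (max i j)))"

text \<open>The index lists of \<open>idempotent_chain\<close> are used for the transition
  congruence. Absorption on both sides gives the equation with \<open>max i j\<close> in either
  order, and reading the largest block first makes all words normalized.\<close>

lemma has_chain_fdfa_chain: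
  assumes wf: "wf_fdfa F" and sat: "saturated F" and sc: "has_chain (alph F) (fdfa_language F) k b"
  shows "\<exists>u e. fdfa_chain F k b u e"
proof (cases k)
  case 0
  then show ?thesis by (intro exI[of _ "[]"]) (simp add: fdfa_chain_def)
next
  case (Suc k')
  let ?m = "alph F"
  obtain u v0 where uv0: "chain_words ?m (fdfa_language F) k b u v0" using sc unfolding has_chain_def by (elim exE)
  define v where "v i = (if i < k then v0 i else [])" for i
  have v: "set (v i) \<subseteq> {..<?m}" "i < k \<Longrightarrow> v i \<noteq> []" for i
    using chain_wordsD(2,3)[OF uv0, of i] by (auto simp: v_def)
  have catm: "set (cat v js) \<subseteq> {..<?m}" for js using v(1) by (fastforce simp: cat_def)
  have catv: "cat v js = cat v0 js" if "set js \<subseteq> {..<k}" for js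
    using that by (induction js) (auto simp: v_def)
  define H where "H js = hom F (cat v js)" for js
  have fin: "finite (range H)" by (rule finite_subset[OF _ finite_hom[OF wf]]) (auto simp: H_def)
  have cong: "H (x @ y) = H (x' @ y')" if "H x = H x'" "H y = H y'" for x x' y y'
    unfolding H_def cat_simps by (rule hom_cong[OF wf]) (use that in \<open>simp_all add: H_def\<close>)
  obtain E where E: "\<And>i. set (E i) = {..i}" "\<And>i j. j \<le> i \<Longrightarrow> H (E i @ E j) = H (E i)"
    "\<And>i j. j \<le> i \<Longrightarrow> H (E j @ E i) = H (E i)"
    using idempotent_chain[OF fin cong] by metis
  define u' where "u' = u @ cat v (E k')"
  define e where "e i = cat v (E i)" for i
  have um: "set u \<subseteq> {..<?m}" by (rule chain_wordsD(1)[OF uv0])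
  have u'm: "set u' \<subseteq> {..<?m}" using um catm by (auto simp: u'_def)
  have ne: "e i \<noteq> []" if "i < k" for i
  proof -
    have "i \<in> set (E i)" using E(1) by simp
    then show ?thesis using v(2)[OF that] by (auto simp: cat_def e_def)
  qed
  have norm: "normalized F u' (e i)" if "i < k" for i
  proof -
    have "hom F (cat v (E k' @ E i)) = hom F (cat v (E k'))" using E(2)[of i k'] that Suc by (simp add: H_def)
    from hom_lead[OF wf this catm catm reach_leading_in[OF wf um]]
    show ?thesis by (simp add: normalized_def u'_def e_def reach_append)
  qed
  let ?q = "reach (leading F) u'"
  have qi: "?q < nstates (leading F)" by (rule reach_leading_in[OF wf u'm])
  have printer: "reach (progress_at F u') (e i @ e j) = reach (progress_at F u') (e (max i j))" for i j
  proof -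
    have "hom F (cat v (E i @ E j)) = hom F (cat v (E (max i j)))"
      using E(2)[of j i] E(3)[of i j] by (cases "i \<le> j") (simp_all add: H_def max_def)
    from hom_prog[OF wf this catm catm qi init_progress_in[OF wf qi]]
    show ?thesis by (simp add: reach_def[of "progress F (reach (leading F) u')"] progress_at_def e_def)
  qed
  have "dfa_accepts (progress_at F u') (e i) \<longleftrightarrow> even i = b" if i: "i < k" for i
  proof -
    have sub: "set (E k') \<subseteq> {..<k}" "set (E i) \<subseteq> {..<k}" "E i \<noteq> []" using E(1)[of k'] E(1)[of i] i Suc by auto
    have "u' \<frown> (e i)\<^sup>\<omega> \<in> fdfa_language F \<longleftrightarrow> even i = b"
      using chain_wordsD(4)[OF uv0 sub] E(1)[of i] catv[OF sub(1)] catv[OF sub(2)] Max_eqI[of "{..i}" i]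
      by (simp add: u'_def e_def)
    moreover have "duo_normalized F u' (e i)" using norm[OF i] printer[of i i] by (simp add: duo_normalized_def)
    then have "u' \<frown> (e i)\<^sup>\<omega> \<in> fdfa_language F \<longleftrightarrow> dfa_accepts (progress_at F u') (e i)"
      using fdfa_language_duo[OF wf sat u'm _ ne[OF i]] catm by (simp add: e_def)
    ultimately show ?thesis by simp
  qed
  then have "fdfa_chain F k b u' e"
    unfolding fdfa_chain_def using u'm ne norm printer catm by (simp add: e_def)
  then show ?thesis by blast
qed

text \<open>The states \<open>p i\<close> are distinct: if \<open>p i = p j\<close> for
  \<open>i < j\<close>, then \<open>e (Suc i)\<close> leads from this state both to
  \<open>p (Suc i)\<close> and to \<open>p j\<close>, so \<open>p (Suc i) = p i\<close> although
  their acceptance differs.\<close>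

lemma fdfa_chain_length:
  assumes wf: "wf_fdfa F" and ch: "fdfa_chain F k b u e"
  shows "k \<le> nstates (progress_at F u)" "set u \<subseteq> {..<alph F}"
proof -
  define p where "p i = reach (progress_at F u) (e i)" for i
  show um: "set u \<subseteq> {..<alph F}" using ch by (simp add: fdfa_chain_def)
  have eq: "foldl (step (progress_at F u)) (p i) (e j) = p (max i j)" if "i < k" "j < k" for i j
    using ch that by (simp add: fdfa_chain_def p_def reach_append)
  have acc: "p i \<in> final (progress_at F u) \<longleftrightarrow> even i = b" if "i < k" for i
    using ch that by (simp add: fdfa_chain_def p_def dfa_accepts_def)
  have "inj_on p {..<k}"
  proof (rule linorder_inj_onI')
    fix i j assume ij: "i \<in> {..<k}" "j \<in> {..<k}" "i < j"
    show "p i \<noteq> p j"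
    proof
      assume p: "p i = p j"
      have m: "max i (Suc i) = Suc i" "max j (Suc i) = j" and k: "i < k" "j < k" "Suc i < k"
        using ij by auto
      have "p (Suc i) = p j" using eq[OF k(1,3)] eq[OF k(2,3)] unfolding m p by simp
      then have "p (Suc i) = p i" using p by simp
      then show False using acc[of i] acc[of "Suc i"] ij by auto
    qed
  qed
  moreover have "p ` {..<k} \<subseteq> {..<nstates (progress_at F u)}"
    unfolding p_def progress_at_def using ch
    by (auto simp: fdfa_chain_def intro!: reach_in[OF wf_progress[OF wf reach_leading_in[OF wf um]]])
  ultimately have "card {..<k} \<le> card {..<nstates (progress_at F u)}" by (rule card_inj_on_le) simp
  then show "k \<le> nstates (progress_at F u)" by simp
qed

definition pair_step :: "fdfa \<Rightarrow> nat \<Rightarrow> nat \<Rightarrow> nat \<Rightarrow> nat" where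
  "pair_step F q z a = (if z < nstates (leading F) then step (leading F) z a
     else nstates (leading F) + step (progress F q) (z - nstates (leading F)) a)"

text \<open>
  \<open>T j\<close> contains the states reached by words all of whose chain indices are smaller than \<open>j\<close>, a state \<open>p\<close> of the
  progress DFA being represented by \<open>nstates (leading F) + p\<close>.
\<close>

definition fdfa_sets :: "fdfa \<Rightarrow> nat \<Rightarrow> bool \<Rightarrow> nat \<Rightarrow> (nat \<Rightarrow> nat set) \<Rightarrow> bool" where
  "fdfa_sets F k b q T \<longleftrightarrow> (\<exists>u. set u \<subseteq> {..<alph F} \<and> reach (leading F) u = q) \<and>
     (\<forall>j\<le>k. T j \<subseteq> {..<nstates (leading F) + nstates (progress F q)}) \<and>
     q \<in> T 0 \<and> nstates (leading F) + init (progress F q) \<in> T 0 \<and>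
     (\<forall>i<k. \<forall>z\<in>T (Suc i). (z < nstates (leading F) \<longrightarrow> z = q) \<and>
        (\<not> z < nstates (leading F) \<longrightarrow> (z - nstates (leading F) \<in> final (progress F q) \<longleftrightarrow> even i = b))) \<and>
     (\<forall>i<k. \<exists>v. v \<noteq> [] \<and> set v \<subseteq> {..<alph F} \<and> (\<forall>j\<le>k. \<forall>z\<in>T j. foldl (pair_step F q) z v \<in> T (max (Suc i) j)))"

lemma foldl_pair_step_leading:
  assumes "wf_fdfa F" "z < nstates (leading F)" "set v \<subseteq> {..<alph F}"
  shows "foldl (pair_step F q) z v = foldl (step (leading F)) z v"
  using assms(2,3)
proof (induction v arbitrary: z)
  case (Cons a v)
  then have "step (leading F) z a < nstates (leading F)"
    using wf_leading[OF assms(1)] by (simp add: wf_dts_def)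
  then show ?case using Cons by (simp add: pair_step_def)
qed simp

lemma foldl_pair_step_progress:
  "foldl (pair_step F q) (nstates (leading F) + p) v = nstates (leading F) + foldl (step (progress F q)) p v"
  by (induction v arbitrary: p) (simp_all add: pair_step_def)

lemma fdfa_chain_fdfa_sets:
  assumes wf: "wf_fdfa F" and ch: "fdfa_chain F k b u e"
  shows "\<exists>q T. fdfa_sets F k b q T"
proof -
  define q where "q = reach (leading F) u"
  let ?n = "nstates (leading F)"
  let ?P = "progress F q"
  have um: "set u \<subseteq> {..<alph F}" using ch by (simp add: fdfa_chain_def)
  have qi: "q < ?n" unfolding q_def by (rule reach_leading_in[OF wf um])
  have pat: "progress_at F u = ?P" by (simp add: progress_at_def q_def)
  have e: "e i \<noteq> []" "set (e i) \<subseteq> {..<alph F}" "foldl (step (leading F)) q (e i) = q"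
     "reach ?P (e i) \<in> final ?P \<longleftrightarrow> even i = b" if "i < k" for i
    using ch that by (auto simp: fdfa_chain_def normalized_def reach_append q_def[symmetric] pat dfa_accepts_def)
  have ee: "foldl (step ?P) (reach ?P (e i)) (e j) = reach ?P (e (max i j))" if "i < k" "j < k" for i j
    using ch that by (simp add: fdfa_chain_def reach_append pat)
  define T where "T j = {q, ?n + (case j of 0 \<Rightarrow> init ?P | Suc i \<Rightarrow> reach ?P (e i))}" for j
  have pin: "reach ?P (e i) < nstates ?P" if "i < k" for i
    using e[OF that] by (intro reach_in[OF wf_progress[OF wf qi]])
  have "\<forall>j\<le>k. T j \<subseteq> {..<?n + nstates ?P}"
    using qi init_progress_in[OF wf qi] pin by (auto simp: T_def split: nat.splits)
  moreover have "\<exists>v. v \<noteq> [] \<and> set v \<subseteq> {..<alph F} \<and> (\<forall>j\<le>k. \<forall>z\<in>T j. foldl (pair_step F q) z v \<in> T (max (Suc i) j))"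
    if i: "i < k" for i
  proof (intro exI[of _ "e i"] conjI allI impI ballI)
    fix j z assume j: "j \<le> k" and z: "z \<in> T j"
    show "foldl (pair_step F q) z (e i) \<in> T (max (Suc i) j)"
    proof (cases "z = q")
      case True
      then show ?thesis using foldl_pair_step_leading[OF wf qi e(2)[OF i]] e(3)[OF i] by (simp add: T_def)
    next
      case False
      show ?thesis
      proof (cases j)
        case 0
        then show ?thesis using False z by (simp add: T_def foldl_pair_step_progress reach_def)
      next
        case (Suc j')
        then have "foldl (pair_step F q) z (e i) = ?n + reach ?P (e (max j' i))"
          using False z j ee[of j' i] i by (simp add: T_def foldl_pair_step_progress)
        moreover have "max (Suc i) j = Suc (max j' i)" using Suc by simp
        ultimately show ?thesis by (simp add: T_def)
      qed
    qed
  qed (use e[OF i] in auto)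
  moreover have "\<forall>i<k. \<forall>z\<in>T (Suc i). (z < ?n \<longrightarrow> z = q) \<and> (\<not> z < ?n \<longrightarrow> (z - ?n \<in> final ?P \<longleftrightarrow> even i = b))"
    using e(4) qi by (auto simp: T_def)
  ultimately have "fdfa_sets F k b q T" unfolding fdfa_sets_def using um
    by (intro conjI) (auto simp: T_def q_def)
  then show ?thesis by blast
qed

text \<open>A word with largest index \<open>i\<close> leads from \<open>T 0\<close> into
  \<open>T (Suc i)\<close>, where the leading state is \<open>q\<close> again and all progress
  states agree on acceptance. The word need not be duo-normalized, but a power of it is, has the
  same indices and represents the same \<omega>-word.\<close>

lemma fdfa_sets_has_chain:
  assumes wf: "wf_fdfa F" and sat: "saturated F" and T: "fdfa_sets F k b q T"
  shows "has_chain (alph F) (fdfa_language F) k b"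
proof -
  let ?n = "nstates (leading F)" and ?P = "progress F q"
  obtain u where u: "set u \<subseteq> {..<alph F}" "reach (leading F) u = q" using T by (auto simp: fdfa_sets_def)
  have qi: "q < ?n" using reach_leading_in[OF wf u(1)] u(2) by simp
  have T0: "q \<in> T 0" "?n + init ?P \<in> T 0" using T by (auto simp: fdfa_sets_def)
  have good: "z < ?n \<longrightarrow> z = q" "\<not> z < ?n \<longrightarrow> (z - ?n \<in> final ?P \<longleftrightarrow> even i = b)" if "i < k" "z \<in> T (Suc i)" for i z
    using T that by (auto simp: fdfa_sets_def)
  have "\<forall>i<k. \<exists>v. v \<noteq> [] \<and> set v \<subseteq> {..<alph F} \<and> (\<forall>j\<le>k. \<forall>z\<in>T j. foldl (pair_step F q) z v \<in> T (max (Suc i) j))"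
    using T by (simp add: fdfa_sets_def)
  then obtain v where v: "\<And>i. i < k \<Longrightarrow> v i \<noteq> [] \<and> set (v i) \<subseteq> {..<alph F} \<and>
      (\<forall>j\<le>k. \<forall>z\<in>T j. foldl (pair_step F q) z (v i) \<in> T (max (Suc i) j))" by metis
  have catm: "set (cat v js) \<subseteq> {..<alph F}" if "set js \<subseteq> {..<k}" for js
    using that v by (fastforce simp: cat_def)
  \<comment> \<open>Reading the blocks of \<open>js\<close> leads from \<open>T j\<close> into
    \<open>T (mx js j)\<close>.\<close>
  define mx where "mx js = fold (\<lambda>i. max (Suc i)) js" for js :: "nat list"
  have run: "foldl (pair_step F q) z (cat v js) \<in> T (mx js j) \<and> mx js j \<le> k" if "set js \<subseteq> {..<k}" "j \<le> k" "z \<in> T j" for js j z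
    using that
  proof (induction js arbitrary: j z)
    case (Cons i js)
    then have "foldl (pair_step F q) z (v i) \<in> T (max (Suc i) j)" using v[of i] by auto
    then show ?case using Cons.IH[of "max (Suc i) j"] Cons.prems by (simp add: mx_def)
  qed (simp add: mx_def)
  have mxM: "mx js j = max (Suc (Max (set js))) j" if "js \<noteq> []" for js j
    using that
  proof (induction js arbitrary: j)
    case (Cons i js)
    show ?case
    proof (cases "js = []")
      case True
      then show ?thesis by (simp add: mx_def)
    next
      case False
      obtain M where M: "M = Max (set js)" by blast
      have "Max (set (i # js)) = max i M" using False by (simp add: M)
      then show ?thesis using Cons.IH[OF False, of "max (Suc i) j"] M by (simp add: mx_def)
    qed
  qed simp
  have stay: "foldl (step (leading F)) q (cat v js) = q" if "set js \<subseteq> {..<k}" for js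
  proof (cases "js = []")
    case False
    have M: "Max (set js) < k" using that False by (meson List.finite_set Max_in lessThan_iff set_empty subsetD)
    have "foldl (pair_step F q) q (cat v js) \<in> T (Suc (Max (set js)))" using run[OF that _ T0(1)] mxM[OF False] by simp
    then have "foldl (step (leading F)) q (cat v js) \<in> T (Suc (Max (set js)))"
      using foldl_pair_step_leading[OF wf qi catm[OF that]] by simp
    then show ?thesis using good(1)[OF M] foldl_in[OF wf_leading[OF wf] qi catm[OF that]] by blast
  qed simp
  show ?thesis
  proof (rule schainI[OF u(1), where v = v])
    fix js "is" assume a: "set js \<subseteq> {..<k}" "set is \<subseteq> {..<k}" "is \<noteq> []"
    have M: "Max (set is) < k" using a by (meson List.finite_set Max_in lessThan_iff set_empty subsetD)
    let ?x = "u @ cat v js" and ?y = "cat v is"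
    have xm: "set ?x \<subseteq> {..<alph F}" and ym: "set ?y \<subseteq> {..<alph F}" using u catm a by auto
    have ne: "?y \<noteq> []" using a v by (cases "is") auto
    have qx: "reach (leading F) ?x = q" using u stay[OF a(1)] by (simp add: reach_append)
    have "normalized F ?x ?y" unfolding normalized_def using qx stay[OF a(2)] by (simp add: reach_append)
    then obtain n where n: "0 < n" "duo_normalized F ?x (rep n ?y)" using duo_power[OF wf xm ym] by blast
    have ry: "rep n ?y = cat v (rep n is)" for n by (induction n) auto
    have sr: "set (rep n is) = set is" using n by (simp add: set_rep)
    have rne: "rep n is \<noteq> []" using sr a(3) by (metis set_empty)
    have ym': "set (rep n ?y) \<subseteq> {..<alph F}" "rep n ?y \<noteq> []" using ym n ne set_rep[of n ?y] by (simp, metis set_empty less_not_refl)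
    have inT: "foldl (pair_step F q) (?n + init ?P) (cat v (rep n is)) \<in> T (Suc (Max (set is)))"
      using run[OF _ _ T0(2), of "rep n is"] mxM[OF rne] sr a by simp
    have "reach ?P (rep n ?y) \<in> final ?P \<longleftrightarrow> even (Max (set is)) = b"
      using good(2)[OF M inT] by (simp add: foldl_pair_step_progress ry reach_def)
    then have "dfa_accepts (progress_at F ?x) (rep n ?y) \<longleftrightarrow> even (Max (set is)) = b"
      by (simp add: dfa_accepts_def progress_at_def qx)
    moreover have "?x \<frown> ?y\<^sup>\<omega> = ?x \<frown> (rep n ?y)\<^sup>\<omega>" using iter_rep[OF n(1) ne] by simp
    ultimately show "?x \<frown> ?y\<^sup>\<omega> \<in> fdfa_language F \<longleftrightarrow> even (Max (set is)) = b"
      using fdfa_language_duo[OF wf sat xm ym' n(2)] by simp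
  qed (use v in auto)
qed

theorem has_chain_iff_fdfa_sets:
  "wf_fdfa F \<Longrightarrow> saturated F \<Longrightarrow> has_chain (alph F) (fdfa_language F) k b \<longleftrightarrow> (\<exists>q T. fdfa_sets F k b q T)"
  using has_chain_fdfa_chain fdfa_chain_fdfa_sets fdfa_sets_has_chain by metis

theorem has_chain_iff_fdfa_chain:
  "wf_fdfa F \<Longrightarrow> saturated F \<Longrightarrow> has_chain (alph F) (fdfa_language F) k b \<longleftrightarrow> (\<exists>u e. fdfa_chain F k b u e)"
  using has_chain_fdfa_chain fdfa_chain_fdfa_sets fdfa_sets_has_chain by metis

text \<open>The two measures differ by at most one, so the existence or absence of chains of lengths
  \<open>k\<close> and \<open>Suc k\<close> determines both.\<close>

theorem fdfa_position_iff:
  assumes "wf_fdfa F" "saturated F" "0 < k"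
  defines "C \<equiv> has_chain (alph F) (fdfa_language F)"
  shows "wagner_position (alph F) (fdfa_language F) s k \<longleftrightarrow> (case s of
      Plus \<Rightarrow> C k True \<and> \<not> C k False
    | Minus \<Rightarrow> C k False \<and> \<not> C k True
    | PlusMinus \<Rightarrow> C k True \<and> C k False \<and> \<not> C (Suc k) True \<and> \<not> C (Suc k) False)"
proof -
  let ?s = "chain_measure (alph F) (fdfa_language F)"
  have m: "0 < alph F" using assms by (simp add: wf_fdfa_def)
  note reg = fdfa_language(1)[OF assms(1,2)]
  have C: "C k b \<longleftrightarrow> k \<le> ?s b" for k b using chain_measure_ge[OF reg] by (simp add: C_def)
  show ?thesis unfolding wagner_position_iff[OF m reg assms(3)] C
    using has_chain_limit[OF reg, of True] has_chain_limit[OF reg, of False] assms(3)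
    by (cases s) auto
qed

section \<open>Membership in PSPACE\<close>

lemma game_dual: "game U \<psi> d q W \<longleftrightarrow> \<not> game (\<lambda>q. \<not> U q) (\<lambda>W. \<not> \<psi> W) d q W"
  by (induction d arbitrary: q W) auto

definition override_block :: "nat \<Rightarrow> nat \<Rightarrow> nat set \<Rightarrow> (nat \<Rightarrow> bool) \<Rightarrow> nat \<Rightarrow> bool" where
  "override_block q l Z W = (\<lambda>i. if q \<le> i \<and> i < q + l then i - q \<in> Z else W i)"

lemma ex_subset_Suc:
  "(\<exists>Z\<subseteq>{..<Suc l}. P Z) \<longleftrightarrow> (\<exists>Z\<subseteq>{..<l}. P (Suc ` Z)) \<or> (\<exists>Z\<subseteq>{..<l}. P (insert 0 (Suc ` Z)))"
proof
  assume "\<exists>Z\<subseteq>{..<Suc l}. P Z"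
  then obtain Z where Z: "Z \<subseteq> {..<Suc l}" "P Z" by blast
  let ?Z = "{i. Suc i \<in> Z}"
  have s: "?Z \<subseteq> {..<l}" using Z(1) by auto
  have e: "Z = (if 0 \<in> Z then insert 0 (Suc ` ?Z) else Suc ` ?Z)"
    by (auto simp: image_iff) (metis not0_implies_Suc)+
  show "(\<exists>Z\<subseteq>{..<l}. P (Suc ` Z)) \<or> (\<exists>Z\<subseteq>{..<l}. P (insert 0 (Suc ` Z)))"
    using Z(2) s e by (metis (no_types))
next
  assume "(\<exists>Z\<subseteq>{..<l}. P (Suc ` Z)) \<or> (\<exists>Z\<subseteq>{..<l}. P (insert 0 (Suc ` Z)))"
  then obtain Z Z' where "Z \<subseteq> {..<l}" "Z' = Suc ` Z \<or> Z' = insert 0 (Suc ` Z)" "P Z'" by blast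
  then show "\<exists>Z\<subseteq>{..<Suc l}. P Z" by (intro exI[of _ Z']) auto
qed

lemma game_block:
  assumes "\<And>i. q \<le> i \<Longrightarrow> i < q + l \<Longrightarrow> \<not> U i"
  shows "game U \<psi> (l + d) q W \<longleftrightarrow> (\<exists>Z\<subseteq>{..<l}. game U \<psi> d (q + l) (override_block q l Z W))"
  using assms
proof (induction l arbitrary: q W)
  case 0
  have "override_block q 0 Z W = W" for Z by (auto simp: override_block_def)
  then show ?case by auto
next
  case (Suc l)
  have o: "override_block (Suc q) l Z (W(q := False)) = override_block q (Suc l) (Suc ` Z) W"
     "override_block (Suc q) l Z (W(q := True)) = override_block q (Suc l) (insert 0 (Suc ` Z)) W" for Z
  proof -
    have *: "i < q \<or> i = q \<or> (\<exists>d. i = q + Suc d)" for i using less_imp_add_positive[of q i] by (metis Suc_pred' linorder_neqE_nat)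
    show "override_block (Suc q) l Z (W(q := False)) = override_block q (Suc l) (Suc ` Z) W"
      "override_block (Suc q) l Z (W(q := True)) = override_block q (Suc l) (insert 0 (Suc ` Z)) W"
    proof (rule_tac [!] ext)
      fix i
      consider "i < q" | "i = q" | d where "i = q + Suc d" using * by blast
      then show "override_block (Suc q) l Z (W(q := False)) i = override_block q (Suc l) (Suc ` Z) W i"
        "override_block (Suc q) l Z (W(q := True)) i = override_block q (Suc l) (insert 0 (Suc ` Z)) W i"
        by (cases; force simp: override_block_def)+
    qed
  qed
  have IH: "game U \<psi> (l + d) (Suc q) V \<longleftrightarrow> (\<exists>Z\<subseteq>{..<l}. game U \<psi> d (q + Suc l) (override_block (Suc q) l Z V))" for V
    using Suc.IH[of "Suc q" V] Suc.prems by simp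
  have "game U \<psi> (Suc l + d) q W \<longleftrightarrow> game U \<psi> (l + d) (Suc q) (W(q := False)) \<or> game U \<psi> (l + d) (Suc q) (W(q := True))"
    using Suc.prems[of q] by simp
  also have "\<dots> \<longleftrightarrow> (\<exists>Z\<subseteq>{..<Suc l}. game U \<psi> d (q + Suc l) (override_block q (Suc l) Z W))"
    unfolding IH o ex_subset_Suc ..
  finally show ?case .
qed

lemma game_exists: "game (\<lambda>_. False) \<psi> l 0 (\<lambda>_. False) \<longleftrightarrow> (\<exists>Z\<subseteq>{..<l}. \<psi> (\<lambda>i. i \<in> Z))"
proof -
  have "override_block 0 l Z (\<lambda>_. False) = (\<lambda>i. i \<in> Z)" if "Z \<subseteq> {..<l}" for Z
    using that by (auto simp: override_block_def fun_eq_iff)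
  then show ?thesis using game_block[of 0 l "\<lambda>_. False" \<psi> 0 "\<lambda>_. False"] by auto
qed

lemma game_forall: "game (\<lambda>_. True) \<psi> l 0 (\<lambda>_. False) \<longleftrightarrow> (\<forall>Z\<subseteq>{..<l}. \<psi> (\<lambda>i. i \<in> Z))"
  using game_dual[of "\<lambda>_. True" \<psi> l 0] game_exists[of "\<lambda>W. \<not> \<psi> W" l] by simp

text \<open>
  Savitch's theorem as a quantified Boolean formula. On each level \<open>L\<close> existential bits choose a
  midpoint and one universal bit chooses the half of the path that is considered next: the second half,
  starting at the midpoint, if the bit is set. The endpoints that are left in the end are
  therefore the midpoints of the last levels with and without the bit set.
\<close>

fun last_level :: "bool \<Rightarrow> nat \<Rightarrow> nat \<Rightarrow> (nat \<Rightarrow> bool) \<Rightarrow> nat" where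
  "last_level b L 0 W = 0"
| "last_level b L (Suc c) W = (if W (c * (L + 1) + L) = b then Suc c else last_level b L c W)"

definition endpoint :: "bool \<Rightarrow> nat \<Rightarrow> nat set \<Rightarrow> nat \<Rightarrow> (nat \<Rightarrow> bool) \<Rightarrow> nat set" where
  "endpoint b L S c W = {y. y < L \<and> (if last_level b L c W = 0 then y \<in> S else W ((last_level b L c W - 1) * (L + 1) + y))}"

fun halving :: "('a set \<Rightarrow> 'a set \<Rightarrow> bool) \<Rightarrow> 'a set \<Rightarrow> nat \<Rightarrow> 'a set \<Rightarrow> 'a set \<Rightarrow> bool" where
  "halving R V 0 X Y \<longleftrightarrow> R X Y"
| "halving R V (Suc d) X Y \<longleftrightarrow> (\<exists>Z\<subseteq>V. halving R V d X Z \<and> halving R V d Z Y)"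

lemma last_level_le: "last_level b L c W \<le> c"
  by (induction c) auto

lemma last_level_cong:
  "(\<And>i. i < c * (L + 1) \<Longrightarrow> W i = W' i) \<Longrightarrow> last_level b L c W = last_level b L c W'"
proof (induction c)
  case (Suc c)
  have "W (c * (L + 1) + L) = W' (c * (L + 1) + L)" by (rule Suc.prems) simp
  moreover have "last_level b L c W = last_level b L c W'" by (rule Suc.IH) (use Suc.prems in simp)
  ultimately show ?case by simp
qed simp

lemma endpoint_cong:
  assumes "\<And>i. i < c * (L + 1) \<Longrightarrow> W i = W' i" shows "endpoint b L S c W = endpoint b L S c W'"
proof -
  have l: "last_level b L c W = last_level b L c W'" by (rule last_level_cong[OF assms])
  have "W ((last_level b L c W - 1) * (L + 1) + y) = W' ((last_level b L c W - 1) * (L + 1) + y)"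
    if "y < L" "last_level b L c W \<noteq> 0" for y
  proof (rule assms)
    obtain l where l: "last_level b L c W = Suc l" using \<open>last_level b L c W \<noteq> 0\<close> not0_implies_Suc by blast
    have "Suc l * (L + 1) \<le> c * (L + 1)" using last_level_le[of b L c W] l by (intro mult_le_mono1) simp
    then show "(last_level b L c W - 1) * (L + 1) + y < c * (L + 1)" unfolding l using \<open>y < L\<close> by simp
  qed
  then show ?thesis by (auto simp: endpoint_def l)
qed

text \<open>Setting the universal bit of level \<open>c\<close> to \<open>b\<close> makes the
  midpoint the new endpoint of kind \<open>b\<close> and leaves the other endpoint as it
  was.\<close>

lemma game_halving:
  "game (\<lambda>q. q mod (L + 1) = L) (\<lambda>W. R (endpoint True L S (c + d) W) (endpoint False L T (c + d) W))
      (d * (L + 1)) (c * (L + 1)) W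
    \<longleftrightarrow> halving R {..<L} d (endpoint True L S c W) (endpoint False L T c W)"
proof (induction d arbitrary: c W)
  case (Suc d)
  let ?U = "\<lambda>q. q mod (L + 1) = L"
  let ?\<psi> = "\<lambda>W. R (endpoint True L S (c + Suc d) W) (endpoint False L T (c + Suc d) W)"
  let ?q = "c * (L + 1)"
  have U: "\<not> ?U i" if "?q \<le> i" "i < ?q + L" for i
  proof -
    have "i = (i - ?q) + c * (L + 1)" using that by simp
    then have "i mod (L + 1) = (i - ?q) mod (L + 1)" by (metis mod_mult_self1)
    then show ?thesis using that by simp
  qed
  have UL: "?U (?q + L)" using mod_mult_self3[of c "L + 1" L] by (simp add: add.commute)
  have IH: "game ?U ?\<psi> (d * (L + 1)) (Suc c * (L + 1)) V \<longleftrightarrow>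
      halving R {..<L} d (endpoint True L S (Suc c) V) (endpoint False L T (Suc c) V)" for V
    using Suc.IH[of "Suc c" V] by simp
  have "game ?U ?\<psi> (Suc d * (L + 1)) ?q W \<longleftrightarrow> game ?U ?\<psi> (L + Suc (d * (L + 1))) ?q W"
    by (simp add: algebra_simps)
  also have "\<dots> \<longleftrightarrow> (\<exists>Z\<subseteq>{..<L}. game ?U ?\<psi> (Suc (d * (L + 1))) (?q + L) (override_block ?q L Z W))"
    by (rule game_block[OF U])
  also have "\<dots> \<longleftrightarrow> (\<exists>Z\<subseteq>{..<L}. halving R {..<L} d (endpoint True L S c W) Z \<and> halving R {..<L} d Z (endpoint False L T c W))"
  proof -
    have "game ?U ?\<psi> (Suc (d * (L + 1))) (?q + L) (override_block ?q L Z W) \<longleftrightarrow>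
      halving R {..<L} d (endpoint True L S c W) Z \<and> halving R {..<L} d Z (endpoint False L T c W)" if Z: "Z \<subseteq> {..<L}" for Z
    proof -
      let ?V = "\<lambda>b. (override_block ?q L Z W)(?q + L := b)"
      have low: "?V b i = W i" if "i < ?q" for b i using that by (simp add: override_block_def)
      have mid: "?V b (?q + y) = (y \<in> Z)" if "y < L" for b y using that by (simp add: override_block_def)
      have 1: "endpoint b L A (Suc c) (?V b) = Z" for b A
        using Z mid by (auto simp: endpoint_def)
      have 2: "endpoint b L A (Suc c) (?V (\<not> b)) = endpoint b L A c W" for b A
      proof -
        have "endpoint b L A (Suc c) (?V (\<not> b)) = endpoint b L A c (?V (\<not> b))" by (simp add: endpoint_def)
        also have "\<dots> = endpoint b L A c W" by (rule endpoint_cong[OF low])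
        finally show ?thesis .
      qed
      have "Suc (?q + L) = Suc c * (L + 1)" by simp
      then have "game ?U ?\<psi> (Suc (d * (L + 1))) (?q + L) (override_block ?q L Z W) \<longleftrightarrow>
        game ?U ?\<psi> (d * (L + 1)) (Suc c * (L + 1)) (?V False) \<and> game ?U ?\<psi> (d * (L + 1)) (Suc c * (L + 1)) (?V True)"
        unfolding game.simps if_P[OF UL] by (simp only:)
      then show ?thesis unfolding IH using 1[of True S] 1[of False T] 2[of True S] 2[of False T] by simp
    qed
    then show ?thesis by blast
  qed
  finally show ?case by simp
qed simp

lemma halving_relpow:
  assumes "X \<subseteq> V" "Y \<subseteq> V"
  shows "halving R V d X Y \<longleftrightarrow> (X, Y) \<in> {(X, Y). X \<subseteq> V \<and> Y \<subseteq> V \<and> R X Y} ^^ (2 ^ d)"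
  using assms
proof (induction d arbitrary: X Y)
  case (Suc d)
  let ?R = "{(X, Y). X \<subseteq> V \<and> Y \<subseteq> V \<and> R X Y}"
  have V: "Z \<subseteq> V" if "(X, Z) \<in> ?R ^^ n" "X \<subseteq> V" for n X Z using that by (cases n) auto
  have "(X, Y) \<in> ?R ^^ (2 ^ Suc d) \<longleftrightarrow> (\<exists>Z. (X, Z) \<in> ?R ^^ (2 ^ d) \<and> (Z, Y) \<in> ?R ^^ (2 ^ d))"
    by (simp add: mult_2 relpow_add relcomp_unfold)
  also have "\<dots> \<longleftrightarrow> (\<exists>Z\<subseteq>V. (X, Z) \<in> ?R ^^ (2 ^ d) \<and> (Z, Y) \<in> ?R ^^ (2 ^ d))"
    using V Suc.prems(1) by blast
  finally show ?case using Suc by auto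
qed auto

text \<open>There are \<open>2 ^ (2 * L)\<close> pairs of subsets, so this length suffices for every
  path; reflexivity pads shorter ones.\<close>

lemma savitch:
  assumes refl: "\<And>X. R X X" and ST: "S \<subseteq> {..<L}" "T \<subseteq> {..<L}"
  shows "game (\<lambda>q. q mod (L + 1) = L) (\<lambda>W. R (endpoint True L S (2 * L) W) (endpoint False L T (2 * L) W))
      (2 * L * (L + 1)) 0 (\<lambda>_. False) \<longleftrightarrow> (S, T) \<in> {(X, Y). X \<subseteq> {..<L} \<and> Y \<subseteq> {..<L} \<and> R X Y}\<^sup>*"
proof -
  let ?V = "{..<L}" let ?R = "{(X, Y). X \<subseteq> ?V \<and> Y \<subseteq> ?V \<and> R X Y}"
  have fin: "finite ?R" by (rule finite_subset[of _ "Pow ?V \<times> Pow ?V"]) auto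
  have "card ?R \<le> card (Pow ?V \<times> Pow ?V)" by (rule card_mono) auto
  also have "\<dots> = 2 ^ (2 * L)" by (simp add: card_cartesian_product card_Pow mult_2 power_add)
  finally have c: "card ?R \<le> 2 ^ (2 * L)" .
  have more: "(X, Y) \<in> ?R ^^ n'" if le: "n \<le> n'" and XY: "(X, Y) \<in> ?R ^^ n" "X \<subseteq> ?V" for X Y n n'
    using le
  proof (induction n' rule: dec_induct)
    case base show ?case by (rule XY(1))
  next
    case (step k)
    have "Y \<subseteq> ?V" using step.IH XY(2) by (cases k) auto
    then have "(Y, Y) \<in> ?R" using refl by simp
    with step.IH show ?case by (rule relpow_Suc_I)
  qed
  have "(S, T) \<in> ?R ^^ (2 ^ (2 * L)) \<longleftrightarrow> (S, T) \<in> ?R\<^sup>*"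
  proof
    assume "(S, T) \<in> ?R\<^sup>*"
    then obtain n where "n \<le> card ?R" "(S, T) \<in> ?R ^^ n" using rtrancl_finite_eq_relpow[OF fin] by auto
    then show "(S, T) \<in> ?R ^^ (2 ^ (2 * L))" using more ST(1) c by (meson le_trans)
  qed (meson relpow_imp_rtrancl)
  moreover have "endpoint True L S 0 (\<lambda>_. False) = S" "endpoint False L T 0 (\<lambda>_. False) = T"
    using ST by (auto simp: endpoint_def)
  ultimately show ?thesis
    using game_halving[of L R S 0 "2 * L" T "\<lambda>_. False"] halving_relpow[OF ST, of R "2 * L"] by simp
qed

text \<open>
  In an encoded instance, \<open>at_data_bit x q\<close> tells whether position \<open>q\<close> follows a \<open>True\<close> that announces a bit,
  and \<open>numbers_before x q\<close> counts the numbers closed before \<open>q\<close>. Number \<open>e\<close> is read from the end of the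
  instance, as its most significant bit comes last. Values are cut off at \<open>length x + 1\<close>. All three are
  stated as the iterations that evaluate them.
\<close>

definition at_data_bit :: "bool list \<Rightarrow> nat \<Rightarrow> nat" where
  "at_data_bit x q = rec_nat (min 0 1) (\<lambda>j z. min (if z \<noteq> 0 then 0 else string_content x (int j) - 1) 1) q"

definition numbers_before :: "bool list \<Rightarrow> nat \<Rightarrow> nat" where
  "numbers_before x q = rec_nat (min 0 (length x))
     (\<lambda>j z. min (z + (if at_data_bit x j \<noteq> 0 then 0 else 2 - string_content x (int j))) (length x)) q"

definition input_number :: "bool list \<Rightarrow> nat \<Rightarrow> nat" where
  "input_number x e = rec_nat (min 0 (length x + 1)) (\<lambda>j z. min
     (if at_data_bit x (length x - 1 - j) \<noteq> 0 then
        if numbers_before x (length x - 1 - j) = e then z + z + (string_content x (int (length x - 1 - j)) - 1) else z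
      else z) (length x + 1)) (length x)"

text \<open>The same computation as a recursion on the remaining input, where \<open>s\<close> and
  \<open>c\<close> are the values of \<open>at_data_bit\<close> and \<open>numbers_before\<close> at
  its beginning. The rest is evaluated first, as it holds the more significant bits.\<close>

fun decode_from :: "nat \<Rightarrow> nat \<Rightarrow> bool list \<Rightarrow> nat \<Rightarrow> nat \<Rightarrow> nat" where
  "decode_from K e [] s c = 0"
| "decode_from K e (b # bs) s c =
    (let z = decode_from K e bs (if s = 0 \<and> b then 1 else 0) (if s = 0 \<and> \<not> b then c + 1 else c)
     in min (if s \<noteq> 0 \<and> c = e then z + z + of_bool b else z) K)"

lemma at_data_bit_Suc: "q < length x \<Longrightarrow> at_data_bit x (Suc q) = (if at_data_bit x q = 0 \<and> x ! q then 1 else 0)"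
  by (simp add: at_data_bit_def string_content_def)

lemma numbers_before_Suc:
  assumes "q < length x" shows "numbers_before x (Suc q) = (if at_data_bit x q = 0 \<and> \<not> x ! q then numbers_before x q + 1 else numbers_before x q)"
proof -
  have "numbers_before x q \<le> q" for q
  proof (induction q)
    case (Suc q)
    have "2 - string_content x (int q) \<le> 1 \<or> \<not> q < length x" by (simp add: string_content_def)
    then show ?case using Suc by (auto simp: numbers_before_def min_def)
  qed (simp add: numbers_before_def)
  from this[of q] assms show ?thesis by (simp add: numbers_before_def string_content_def)
qed

lemma input_number_decode: "input_number x e = decode_from (length x + 1) e x 0 0"
proof -
  let ?n = "length x"
  let ?step = "\<lambda>j z. min
     (if at_data_bit x (?n - 1 - j) \<noteq> 0 then
        if numbers_before x (?n - 1 - j) = e then z + z + (string_content x (int (?n - 1 - j)) - 1) else z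
      else z) (?n + 1)"
  have "rec_nat (min 0 (?n + 1)) ?step j = decode_from (?n + 1) e (drop (?n - j) x) (at_data_bit x (?n - j)) (numbers_before x (?n - j))"
    if "j \<le> ?n" for j
    using that
  proof (induction j)
    case (Suc j)
    obtain q where q: "q < ?n" "Suc q = ?n - j" "?n - 1 - j = q" "?n - Suc j = q" using Suc.prems by fastforce
    have d: "drop q x = x ! q # drop (Suc q) x" using Cons_nth_drop_Suc[OF q(1)] by simp
    have s: "string_content x (int q) - 1 = of_bool (x ! q)" using q(1) by (simp add: string_content_def)
    have IH: "rec_nat (min 0 (?n + 1)) ?step j = decode_from (?n + 1) e (drop (Suc q) x) (at_data_bit x (Suc q)) (numbers_before x (Suc q))"
      unfolding q(2) using Suc by simp
    have "rec_nat (min 0 (?n + 1)) ?step (Suc j) = ?step j (rec_nat (min 0 (?n + 1)) ?step j)" by simp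
    then show ?case unfolding IH q(3,4) d s at_data_bit_Suc[OF q(1)] numbers_before_Suc[OF q(1)] decode_from.simps Let_def
      by (cases "at_data_bit x q = 0"; cases "numbers_before x q = e") (simp_all only: if_True if_False simp_thms)
  qed simp
  from this[of ?n] show ?thesis by (simp add: input_number_def at_data_bit_def numbers_before_def)
qed

lemma decode_from_le: "decode_from K e bs s c \<le> K"
  by (cases bs) (auto simp: Let_def)

lemma decode_from_gt: "e < c \<Longrightarrow> decode_from K e bs s c = 0"
  by (induction bs arbitrary: s c) (auto simp: Let_def)

fun bits_val :: "bool list \<Rightarrow> nat" where
  "bits_val [] = 0"
| "bits_val (b # bs) = 2 * bits_val bs + of_bool b"

lemma bits_val_nat_bits: "bits_val (nat_bits n) = n"
proof (induction n rule: nat_bits.induct)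
  case (1 n)
  show ?case
  proof (cases "n = 0")
    case False
    then show ?thesis using 1 by (subst nat_bits.simps) simp
  qed (simp add: nat_bits.simps[of 0])
qed

lemma decode_from_bits:
  "decode_from K e (concat (map (\<lambda>b. [True, b]) bits) @ False # rest) 0 c =
    (if c = e then min (bits_val bits) K else decode_from K e rest 0 (c + 1))"
proof (induction bits)
  case Nil
  then show ?case using decode_from_gt[of e "c + 1" K rest 0] decode_from_le[of K e rest 0 "c + 1"] by (auto simp: Let_def)
next
  case (Cons b bits)
  \<comment> \<open>Cutting off after each doubling gives the same as cutting off once at the
    end.\<close>
  have "min (min (min v K + min v K + of_bool b) K) K = min (2 * v + of_bool b) K" for v by auto
  then show ?case using Cons decode_from_le[of K e rest 0 "c + 1"] by (auto simp: Let_def)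
qed

lemma decode_from_list:
  "e < length ns \<Longrightarrow> decode_from K (c + e) (concat (map encode_nat ns)) 0 c = min (ns ! e) K"
proof (induction ns arbitrary: c e)
  case (Cons a ns)
  show ?case
  proof (cases e)
    case 0
    then show ?thesis using decode_from_bits[of K c "nat_bits a" "concat (map encode_nat ns)" c]
      by (simp add: encode_nat_def[of a] bits_val_nat_bits)
  next
    case (Suc e')
    then show ?thesis using Cons.IH[of e' "Suc c"] Cons.prems
      decode_from_bits[of K "c + e" "nat_bits a" "concat (map encode_nat ns)" c]
      by (simp add: encode_nat_def[of a])
  qed
qed simp

lemma input_number_encode:
  assumes "x = concat (map encode_nat ns)" "e < length ns"
  shows "input_number x e = min (ns ! e) (length x + 1)"
  using decode_from_list[OF assms(2), of "length x + 1" 0] by (simp add: input_number_decode assms(1))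

lemma length_encode: "length ns \<le> length (concat (map encode_nat ns))"
  by (induction ns) (auto simp: encode_nat_def)

text \<open>Variable \<open>99\<close> is the accumulator of the bounded quantifiers and variable \<open>0\<close> the length of the input.\<close>

definition Conj where "Conj a b = Ite a b (Nm 0)"
definition Neg where "Neg a = Ite a (Nm 0) (Nm 1)"
definition Imp where "Imp a b = Ite a b (Nm 1)"
definition Eq where "Eq a b = Ite (Sub a b) (Nm 0) (Ite (Sub b a) (Nm 0) (Nm 1))"
definition Lt where "Lt a b = Sub b a"
definition Md where "Md a b = Sub a (Mul b (Div a b))"
definition Forall where "Forall i n b = It i 99 n (Nm 1) (Nm 1) (Ite (Vr 99) b (Nm 0))"
definition Exists where "Exists i n b = It i 99 n (Nm 1) (Nm 0) (Ite (Vr 99) (Nm 1) b)"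

definition holds_in :: "bool list \<Rightarrow> exp \<Rightarrow> (nat \<Rightarrow> nat) \<Rightarrow> (nat \<Rightarrow> nat \<Rightarrow> bool) \<Rightarrow> bool" where
  "holds_in x e \<eta> \<alpha> \<longleftrightarrow> ev x e \<eta> \<alpha> \<noteq> 0"

lemma holds_in_simps:
  "holds_in x (Conj a b) \<eta> \<alpha> \<longleftrightarrow> holds_in x a \<eta> \<alpha> \<and> holds_in x b \<eta> \<alpha>"
  "holds_in x (Neg a) \<eta> \<alpha> \<longleftrightarrow> \<not> holds_in x a \<eta> \<alpha>"
  "holds_in x (Imp a b) \<eta> \<alpha> \<longleftrightarrow> (holds_in x a \<eta> \<alpha> \<longrightarrow> holds_in x b \<eta> \<alpha>)"
  "holds_in x (Eq a b) \<eta> \<alpha> \<longleftrightarrow> ev x a \<eta> \<alpha> = ev x b \<eta> \<alpha>"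
  "holds_in x (Lt a b) \<eta> \<alpha> \<longleftrightarrow> ev x a \<eta> \<alpha> < ev x b \<eta> \<alpha>"
  "holds_in x (Bind v a b) \<eta> \<alpha> \<longleftrightarrow> holds_in x b (\<eta>(v := ev x a \<eta> \<alpha>)) \<alpha>"
  "holds_in x (Arr A a) \<eta> \<alpha> \<longleftrightarrow> \<alpha> A (ev x a \<eta> \<alpha>)"
  "holds_in x (Ite c a b) \<eta> \<alpha> \<longleftrightarrow> (if holds_in x c \<eta> \<alpha> then holds_in x a \<eta> \<alpha> else holds_in x b \<eta> \<alpha>)"
  "holds_in x (Vr v) \<eta> \<alpha> \<longleftrightarrow> \<eta> v \<noteq> 0"
  "holds_in x (Nm k) \<eta> \<alpha> \<longleftrightarrow> k \<noteq> 0"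
  "holds_in x (Qbf A v len u b) \<eta> \<alpha> \<longleftrightarrow> game (\<lambda>q. holds_in x u (\<eta>(v := q)) \<alpha>) (\<lambda>W. holds_in x b \<eta> (\<alpha>(A := W)))
     (ev x len \<eta> \<alpha>) 0 (\<lambda>_. False)"
  by (auto simp: holds_in_def Conj_def Neg_def Imp_def Eq_def Lt_def)

lemma ev_Ite: "ev x (Ite c a b) \<eta> \<alpha> = (if holds_in x c \<eta> \<alpha> then ev x a \<eta> \<alpha> else ev x b \<eta> \<alpha>)"
  by (simp add: holds_in_def)

lemma ev_Md: "ev x (Md a b) \<eta> \<alpha> = ev x a \<eta> \<alpha> mod ev x b \<eta> \<alpha>"
  by (simp add: Md_def minus_mult_div_eq_mod)

lemma rec_nat_conj:
  "rec_nat 1 (\<lambda>j z. min (if z \<noteq> 0 then g j z else 0) 1) k = of_bool (\<forall>j<k. g j 1 \<noteq> (0 :: nat))"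
  by (induction k) (auto simp: less_Suc_eq)

lemma rec_nat_disj:
  "rec_nat 0 (\<lambda>j z. min (if z \<noteq> 0 then 1 else g j z) 1) k = of_bool (\<exists>j<k. g j 0 \<noteq> (0 :: nat))"
  by (induction k) (auto simp: less_Suc_eq)

lemma holds_in_Forall: "holds_in x (Forall i n b) \<eta> \<alpha> \<longleftrightarrow> (\<forall>j<ev x n \<eta> \<alpha>. holds_in x b (\<eta>(i := j, 99 := 1)) \<alpha>)"
  using rec_nat_conj[of "\<lambda>j z. ev x b (\<eta>(i := j, 99 := z)) \<alpha>" "ev x n \<eta> \<alpha>"]
  by (simp add: Forall_def holds_in_def cong: if_cong)

lemma holds_in_Exists: "holds_in x (Exists i n b) \<eta> \<alpha> \<longleftrightarrow> (\<exists>j<ev x n \<eta> \<alpha>. holds_in x b (\<eta>(i := j, 99 := 0)) \<alpha>)"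
  using rec_nat_disj[of "\<lambda>j z. ev x b (\<eta>(i := j, 99 := z)) \<alpha>" "ev x n \<eta> \<alpha>"]
  by (simp add: Exists_def holds_in_def cong: if_cong)

lemma ev_macros:
  "ev x (Vr v) \<eta> \<alpha> = \<eta> v" "ev x (Nm k) \<eta> \<alpha> = k"
  "ev x (Add a b) \<eta> \<alpha> = ev x a \<eta> \<alpha> + ev x b \<eta> \<alpha>"
  "ev x (Sub a b) \<eta> \<alpha> = ev x a \<eta> \<alpha> - ev x b \<eta> \<alpha>"
  "ev x (Mul a b) \<eta> \<alpha> = ev x a \<eta> \<alpha> * ev x b \<eta> \<alpha>"
  "ev x (Div a b) \<eta> \<alpha> = ev x a \<eta> \<alpha> div ev x b \<eta> \<alpha>"
  "ev x (Bind v a b) \<eta> \<alpha> = ev x b (\<eta>(v := ev x a \<eta> \<alpha>)) \<alpha>"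
  by simp_all

lemmas holds_in_ev = holds_in_simps holds_in_Forall holds_in_Exists ev_Ite ev_Md ev_macros

definition AtDataBit where
  "AtDataBit e = It 60 61 e (Nm 1) (Nm 0) (Ite (Vr 61) (Nm 0) (Sub (Inp (Vr 60)) (Nm 1)))"
definition NumbersBefore where
  "NumbersBefore e = It 62 63 e (Vr 0) (Nm 0) (Add (Vr 63) (Ite (AtDataBit (Vr 62)) (Nm 0) (Sub (Nm 2) (Inp (Vr 62)))))"
text \<open>The argument is bound first, so that it is evaluated outside the scope of the iteration
  variables.\<close>

definition InputNumber where
  "InputNumber e = Bind 50 e (It 52 53 (Vr 0) (Add (Vr 0) (Nm 1)) (Nm 0)
     (Bind 51 (Sub (Sub (Vr 0) (Nm 1)) (Vr 52))
       (Ite (AtDataBit (Vr 51)) (Ite (Eq (NumbersBefore (Vr 51)) (Vr 50)) (Add (Add (Vr 53) (Vr 53)) (Sub (Inp (Vr 51)) (Nm 1))) (Vr 53))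
         (Vr 53))))"

lemma ev_AtDataBit: "ev x (AtDataBit e) \<eta> \<alpha> = at_data_bit x (ev x e \<eta> \<alpha>)"
  by (simp add: AtDataBit_def at_data_bit_def cong: if_cong)

lemma ev_NumbersBefore: "\<eta> 0 = length x \<Longrightarrow> ev x (NumbersBefore e) \<eta> \<alpha> = numbers_before x (ev x e \<eta> \<alpha>)"
  by (simp add: NumbersBefore_def numbers_before_def ev_AtDataBit cong: if_cong)

lemma ev_Eq: "ev x (Eq a b) \<eta> \<alpha> = of_bool (ev x a \<eta> \<alpha> = ev x b \<eta> \<alpha>)"
  by (auto simp: Eq_def)

lemma ev_InputNumber: "\<eta> 0 = length x \<Longrightarrow> ev x (InputNumber e) \<eta> \<alpha> = input_number x (ev x e \<eta> \<alpha>)"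
  by (simp add: InputNumber_def input_number_def ev_AtDataBit ev_NumbersBefore ev_Eq cong: if_cong)

section \<open>Positions of the numbers that describe a family\<close>

lemma nth_concat_blocks:
  assumes "q < n" "e < length (g q)"
  shows "concat (map g [0..<n]) ! ((\<Sum>i<q. length (g i)) + e) = g q ! e"
    "(\<Sum>i<q. length (g i)) + e < length (concat (map g [0..<n]))"
proof -
  have s: "[0..<n] = [0..<q] @ q # [Suc q..<n]"
    using assms(1) upt_add_eq_append[of 0 q "n - q"] by (simp add: upt_conv_Cons)
  have l: "length (concat (map g [0..<q])) = (\<Sum>i<q. length (g i))"
    by (simp add: length_concat interv_sum_list_conv_sum_set_nat o_def atLeast0LessThan)
  show "concat (map g [0..<n]) ! ((\<Sum>i<q. length (g i)) + e) = g q ! e"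
    using assms(2) unfolding s by (simp add: l[symmetric] nth_append)
  show "(\<Sum>i<q. length (g i)) + e < length (concat (map g [0..<n]))"
    using assms(2) unfolding s by (simp add: l[symmetric])
qed

lemma dts_numbers_nth:
  "length (dts_numbers m A) = 2 + nstates A * m"
  "dts_numbers m A ! 0 = nstates A" "dts_numbers m A ! 1 = init A"
  "q < nstates A \<Longrightarrow> a < m \<Longrightarrow> dts_numbers m A ! (2 + q * m + a) = step A q a"
proof -
  show "length (dts_numbers m A) = 2 + nstates A * m"
    by (simp add: dts_numbers_def length_concat o_def sum_list_triv)
  show "dts_numbers m A ! (2 + q * m + a) = step A q a" if "q < nstates A" "a < m"
    using nth_concat_blocks(1)[of q "nstates A" a "\<lambda>q. map (step A q) [0..<m]"] that
    by (simp add: dts_numbers_def)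
qed (simp_all add: dts_numbers_def)

lemma dfa_numbers_nth:
  "length (dfa_numbers m A) = 2 + nstates A * m + nstates A"
  "dfa_numbers m A ! 0 = nstates A" "dfa_numbers m A ! 1 = init A"
  "p < nstates A \<Longrightarrow> a < m \<Longrightarrow> dfa_numbers m A ! (2 + p * m + a) = step A p a"
  "p < nstates A \<Longrightarrow> dfa_numbers m A ! (2 + nstates A * m + p) = of_bool (p \<in> final A)"
proof -
  show "dfa_numbers m A ! (2 + p * m + a) = step A p a" if "p < nstates A" "a < m"
  proof -
    have "Suc p * m \<le> nstates A * m" using that by (intro mult_le_mono1) simp
    then have "2 + p * m + a < length (dts_numbers m A)" using that by (simp add: dts_numbers_nth(1))
    then show ?thesis using dts_numbers_nth(4)[OF that] by (simp add: dfa_numbers_def nth_append)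
  qed
  show "dfa_numbers m A ! (2 + nstates A * m + p) = of_bool (p \<in> final A)" if "p < nstates A"
    using that by (simp add: dfa_numbers_def nth_append dts_numbers_nth(1))
qed (simp_all add: dfa_numbers_def dts_numbers_nth nth_append dts_numbers_nth[simplified])

lemma dts_numbers_le:
  assumes "wf_dts m A" "0 < m" "v \<in> set (dts_numbers m A)"
  shows "v \<le> length (dts_numbers m A)" "v \<le> nstates A"
proof -
  show "v \<le> nstates A" using assms by (fastforce simp: dts_numbers_def wf_dts_def)
  also have "\<dots> \<le> nstates A * m" using assms by simp
  finally show "v \<le> length (dts_numbers m A)" by (simp add: dts_numbers_nth(1))
qed

text \<open>So no number of the family is affected by the cutoff of \<open>input_number\<close>;
  only \<open>k\<close> can be.\<close>

lemma fdfa_numbers_le: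
  assumes wf: "wf_fdfa F" and v: "v \<in> set (fdfa_numbers F)"
  shows "v \<le> length (fdfa_numbers F)"
proof -
  let ?m = "alph F"
  have m: "0 < ?m" and l: "wf_dts ?m (leading F)" using wf by (auto simp: wf_fdfa_def)
  have "length (dts_numbers ?m (leading F)) \<le> length (fdfa_numbers F)" by (simp add: fdfa_numbers_def)
  moreover have "?m \<le> length (dts_numbers ?m (leading F))" using l by (cases "nstates (leading F)") (auto simp: dts_numbers_nth(1) wf_dts_def)
  moreover have "v \<le> length (fdfa_numbers F)" if "q < nstates (leading F)" "v \<in> set (dfa_numbers ?m (progress F q))" for q
  proof -
    let ?A = "progress F q"
    have w: "wf_dts ?m ?A" using wf that by (auto simp: wf_fdfa_def wf_dfa_def)
    have "v \<le> nstates ?A" using dts_numbers_le(2)[OF w m] that(2) w by (auto simp: dfa_numbers_def wf_dts_def)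
    also have "\<dots> \<le> length (dfa_numbers ?m ?A)" by (simp add: dfa_numbers_nth(1))
    also have "\<dots> = length (map id (dfa_numbers ?m ?A))" by simp
    also have "\<dots> \<le> length (concat (map (\<lambda>q. dfa_numbers ?m (progress F q)) [0..<nstates (leading F)]))"
      using that(1) by (auto simp: length_concat intro!: member_le_sum_list)
    finally show ?thesis by (simp add: fdfa_numbers_def)
  qed
  ultimately show ?thesis using v dts_numbers_le(1)[OF l m, of v] by (auto simp: fdfa_numbers_def)
qed

text \<open>The 3 counts the alphabet size and the two numbers in front of the transitions of the
  leading automaton.\<close>

definition prog_off :: "fdfa \<Rightarrow> nat \<Rightarrow> nat" where
  "prog_off F q = 3 + nstates (leading F) * alph F + (\<Sum>i<q. length (dfa_numbers (alph F) (progress F i)))"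

lemma fdfa_numbers_nth:
  "length (fdfa_numbers F) = prog_off F (nstates (leading F))"
  "fdfa_numbers F ! 0 = alph F"
  "e < 2 + nstates (leading F) * alph F \<Longrightarrow> fdfa_numbers F ! (1 + e) = dts_numbers (alph F) (leading F) ! e"
  "q < nstates (leading F) \<Longrightarrow> e < length (dfa_numbers (alph F) (progress F q)) \<Longrightarrow>
     fdfa_numbers F ! (prog_off F q + e) = dfa_numbers (alph F) (progress F q) ! e \<and>
     prog_off F q + e < prog_off F (nstates (leading F))"
proof -
  let ?g = "\<lambda>q. dfa_numbers (alph F) (progress F q)" and ?n = "nstates (leading F)"
  have l: "length (concat (map ?g [0..<n])) = (\<Sum>i<n. length (?g i))" for n
    by (simp add: length_concat interv_sum_list_conv_sum_set_nat o_def atLeast0LessThan)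
  show len: "length (fdfa_numbers F) = prog_off F ?n"
    by (simp add: fdfa_numbers_def l prog_off_def dts_numbers_nth(1))
  show "fdfa_numbers F ! 0 = alph F" by (simp add: fdfa_numbers_def)
  show "fdfa_numbers F ! (1 + e) = dts_numbers (alph F) (leading F) ! e" if "e < 2 + ?n * alph F"
    using that by (simp add: fdfa_numbers_def nth_append dts_numbers_nth(1))
  assume q: "q < ?n" "e < length (?g q)"
  show "fdfa_numbers F ! (prog_off F q + e) = ?g q ! e \<and> prog_off F q + e < prog_off F ?n"
    using nth_concat_blocks[where g = ?g, OF q]
    by (simp add: fdfa_numbers_def nth_append dts_numbers_nth(1) prog_off_def l)
qed

text \<open>The additional letter \<open>m\<close> does not move. It makes \<open>R\<close>
  reflexive, as \<open>savitch\<close> requires.\<close>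

lemma rtrancl_word_relation:
  fixes L m :: nat and \<delta> :: "nat \<Rightarrow> nat \<Rightarrow> nat"
  assumes \<delta>: "\<And>y a. y < L \<Longrightarrow> a < m \<Longrightarrow> \<delta> y a < L" and XY: "X \<subseteq> {..<L}" "Y \<subseteq> {..<L}"
  defines "R \<equiv> \<lambda>X Y. \<exists>a<m + 1. \<forall>y<L. y \<in> X \<longrightarrow> (if a < m then \<delta> y a else y) \<in> Y"
  shows "(X, Y) \<in> {(X, Y). X \<subseteq> {..<L} \<and> Y \<subseteq> {..<L} \<and> R X Y}\<^sup>* \<longleftrightarrow>
    (\<exists>v. set v \<subseteq> {..<m} \<and> (\<forall>y\<in>X. foldl \<delta> y v \<in> Y))"
proof
  let ?R = "{(X, Y). X \<subseteq> {..<L} \<and> Y \<subseteq> {..<L} \<and> R X Y}"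
  show "\<exists>v. set v \<subseteq> {..<m} \<and> (\<forall>y\<in>X. foldl \<delta> y v \<in> Y)" if "(X, Y) \<in> ?R\<^sup>*"
    using that
  proof (induction rule: converse_rtrancl_induct)
    case base
    show ?case by (intro exI[of _ "[]"]) simp
  next
    case (step X X')
    obtain v where v: "set v \<subseteq> {..<m}" "\<And>y. y \<in> X' \<Longrightarrow> foldl \<delta> y v \<in> Y" using step.IH by blast
    obtain a where a: "a < m + 1" "\<And>y. y \<in> X \<Longrightarrow> (if a < m then \<delta> y a else y) \<in> X'"
      using step.hyps(1) unfolding R_def by blast
    show ?case
    proof (cases "a < m")
      case True
      then show ?thesis using a v by (intro exI[of _ "a # v"]) simp
    next
      case False
      then show ?thesis using a v by (intro exI[of _ v]) simp
    qed
  qed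
  show "(X, Y) \<in> ?R\<^sup>*" if "\<exists>v. set v \<subseteq> {..<m} \<and> (\<forall>y\<in>X. foldl \<delta> y v \<in> Y)"
  proof -
    have "set v \<subseteq> {..<m} \<Longrightarrow> X \<subseteq> {..<L} \<Longrightarrow> (\<forall>y\<in>X. foldl \<delta> y v \<in> Y) \<Longrightarrow> (X, Y) \<in> ?R\<^sup>*" for v
    proof (induction v arbitrary: X)
      case Nil
      then have "R X Y" unfolding R_def by (intro exI[of _ m]) auto
      then show ?case using Nil XY by blast
    next
      case (Cons a v)
      let ?X = "(\<lambda>y. \<delta> y a) ` X"
      have a: "a < m" using Cons.prems by simp
      have X': "?X \<subseteq> {..<L}" using \<delta> a Cons.prems(2) by auto
      have "R X ?X" unfolding R_def using a by (intro exI[of _ a]) auto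
      then have "(X, ?X) \<in> ?R" using Cons.prems(2) X' by simp
      moreover have "(?X, Y) \<in> ?R\<^sup>*" by (rule Cons.IH) (use Cons.prems X' in auto)
      ultimately show ?case by (rule converse_rtrancl_into_rtrancl)
    qed
    then show ?thesis using that XY(1) by blast
  qed
qed

lemma pair_step_in:
  assumes "wf_fdfa F" "q < nstates (leading F)" "z < nstates (leading F) + nstates (progress F q)" "a < alph F"
  shows "pair_step F q z a < nstates (leading F) + nstates (progress F q)"
  using wf_leading[OF assms(1)] wf_progress[OF assms(1,2)] assms(3,4)
  by (auto simp: pair_step_def wf_dts_def trans_less_add1)

text \<open>\<open>k + 1\<close> subsets of \<open>{..<Z}\<close> are packed into one subset of \<open>{..<(k + 1) * Z}\<close>.\<close>

lemma fdfa_sets_packed: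
  fixes F k q b
  assumes wf: "wf_fdfa F" and q: "q < nstates (leading F)"
  defines "Z \<equiv> nstates (leading F) + nstates (progress F q)"
  defines "L \<equiv> (k + 1) * Z" and "\<delta> \<equiv> \<lambda>y a. y div Z * Z + pair_step F q (y mod Z) a"
  defines "R \<equiv> \<lambda>X Y. \<exists>a<alph F + 1. \<forall>y<L. y \<in> X \<longrightarrow> (if a < alph F then \<delta> y a else y) \<in> Y"
  shows "(\<exists>T. fdfa_sets F k b q T) \<longleftrightarrow> (\<exists>u. set u \<subseteq> {..<alph F} \<and> reach (leading F) u = q) \<and>
    (\<exists>W\<subseteq>{..<L}. q \<in> W \<and> nstates (leading F) + init (progress F q) \<in> W \<and>
      (\<forall>i<k. \<forall>z<Z. (i + 1) * Z + z \<in> W \<longrightarrow> (if z < nstates (leading F) then z = q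
         else z - nstates (leading F) \<in> final (progress F q) \<longleftrightarrow> even i = b)) \<and>
      (\<forall>i<k. \<exists>a<alph F. ({y. y < L \<and> (\<exists>y'<L. y' \<in> W \<and> \<delta> y' a = y)},
          {y. y < L \<and> (if i < y div Z then y div Z else i + 1) * Z + y mod Z \<in> W})
        \<in> {(X, Y). X \<subseteq> {..<L} \<and> Y \<subseteq> {..<L} \<and> R X Y}\<^sup>*))"
proof -
  let ?n = "nstates (leading F)" and ?m = "alph F"
  define pack where "pack T = {y. y < L \<and> y mod Z \<in> T (y div Z)}" for T :: "nat \<Rightarrow> nat set"
  define unpack where "unpack W j = {z. z < Z \<and> j * Z + z \<in> W}" for W :: "nat set" and j
  have Z: "0 < Z" using q by (simp add: Z_def)
  have jz: "(j * Z + z) div Z = j" "(j * Z + z) mod Z = z" if "z < Z" for j z using that by auto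
  have jzL: "j * Z + z < L \<longleftrightarrow> j \<le> k" if "z < Z" for j z
  proof -
    have "j * Z + z < (k + 1) * Z \<longleftrightarrow> (j * Z + z) div Z < k + 1" using less_mult_imp_div_less div_less_iff_less_mult[OF Z] by blast
    then show ?thesis using jz(1)[OF that] by (auto simp: L_def)
  qed
  have cz: "pair_step F q z a < Z" if "z < Z" "a < ?m" for z a using pair_step_in[OF wf q] that by (simp add: Z_def)
  have fz: "foldl (pair_step F q) z v < Z" "foldl \<delta> (j * Z + z) v = j * Z + foldl (pair_step F q) z v"
    if "z < Z" "set v \<subseteq> {..<?m}" for j z v
    using that by (induction v arbitrary: z) (auto simp: \<delta>_def cz)
  have dec: "y = y div Z * Z + y mod Z" "y mod Z < Z" for y using Z by auto
  have dk: "y div Z \<le> k" if "y < L" for y using jzL[OF dec(2), of "y div Z" y] that by simp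
  have \<delta>L: "\<delta> y a < L" if "y < L" "a < ?m" for y a
    using jzL[OF cz[OF dec(2) that(2)], of "y div Z" y] dk[OF that(1)] by (simp add: \<delta>_def)
  have words: "(\<exists>v. v \<noteq> [] \<and> set v \<subseteq> {..<?m} \<and> (\<forall>j\<le>k. \<forall>z\<in>unpack W j. foldl (pair_step F q) z v \<in> unpack W (max (Suc i) j))) \<longleftrightarrow>
      (\<exists>a<?m. ({y. y < L \<and> (\<exists>y'<L. y' \<in> W \<and> \<delta> y' a = y)},
          {y. y < L \<and> (if i < y div Z then y div Z else i + 1) * Z + y mod Z \<in> W})
        \<in> {(X, Y). X \<subseteq> {..<L} \<and> Y \<subseteq> {..<L} \<and> R X Y}\<^sup>*)" (is "?l \<longleftrightarrow> ?r") for W i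
  proof -
    let ?S = "\<lambda>a. {y. y < L \<and> (\<exists>y'<L. y' \<in> W \<and> \<delta> y' a = y)}"
    define TT where "TT = {y. y < L \<and> (if i < y div Z then y div Z else i + 1) * Z + y mod Z \<in> W}"
    \<comment> \<open>The source is already one letter \<open>a\<close> ahead of \<open>W\<close>,
      which makes the word nonempty.\<close>
    have "(\<exists>a<?m. (?S a, TT) \<in> {(X, Y). X \<subseteq> {..<L} \<and> Y \<subseteq> {..<L} \<and> R X Y}\<^sup>*) \<longleftrightarrow> (\<exists>a<?m. \<exists>v. set v \<subseteq> {..<?m} \<and> (\<forall>y\<in>?S a. foldl \<delta> y v \<in> TT))"
      unfolding R_def by (intro ex_cong1 conj_cong refl rtrancl_word_relation \<delta>L) (auto simp: TT_def)
    also have "\<dots> \<longleftrightarrow> (\<exists>v. v \<noteq> [] \<and> set v \<subseteq> {..<?m} \<and> (\<forall>y<L. y \<in> W \<longrightarrow> foldl \<delta> y v \<in> TT))" (is "?a \<longleftrightarrow> ?b")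
    proof
      assume ?a
      then obtain a v where "a < ?m" "set v \<subseteq> {..<?m}" "\<And>y. y \<in> ?S a \<Longrightarrow> foldl \<delta> y v \<in> TT" by blast
      then show ?b using \<delta>L by (intro exI[of _ "a # v"]) auto
    next
      assume ?b
      then obtain v where v: "v \<noteq> []" "set v \<subseteq> {..<?m}" "\<And>y. y < L \<Longrightarrow> y \<in> W \<Longrightarrow> foldl \<delta> y v \<in> TT" by blast
      then obtain a v' where "v = a # v'" by (cases v) auto
      then show ?a using v by (intro exI[of _ a] conjI exI[of _ v']) auto
    qed
    also have "\<dots> \<longleftrightarrow> ?l"
    proof (intro ex_cong1 conj_cong refl)
      fix v assume v: "set v \<subseteq> {..<?m}"
      have T: "j * Z + z \<in> TT \<longleftrightarrow> j \<le> k \<and> z \<in> unpack W (max (Suc i) j)" if "z < Z" for j z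
        using jz[OF that] jzL[OF that] that by (auto simp: unpack_def TT_def max_def Suc_le_eq)
      have "(\<forall>y<L. y \<in> W \<longrightarrow> foldl \<delta> y v \<in> TT) \<longleftrightarrow> (\<forall>j z. j * Z + z < L \<and> z < Z \<longrightarrow> j * Z + z \<in> W \<longrightarrow> foldl \<delta> (j * Z + z) v \<in> TT)"
        using dec by metis
      also have "\<dots> \<longleftrightarrow> (\<forall>j z. j \<le> k \<and> z < Z \<longrightarrow> j * Z + z \<in> W \<longrightarrow> j * Z + foldl (pair_step F q) z v \<in> TT)"
        using jzL fz(2)[OF _ v] by metis
      also have "\<dots> \<longleftrightarrow> (\<forall>j z. j \<le> k \<and> z < Z \<longrightarrow> j * Z + z \<in> W \<longrightarrow> foldl (pair_step F q) z v \<in> unpack W (max (Suc i) j))"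
        using T[OF fz(1)[OF _ v]] by blast
      finally show "(\<forall>y<L. y \<in> W \<longrightarrow> foldl \<delta> y v \<in> TT) \<longleftrightarrow>
          (\<forall>j\<le>k. \<forall>z\<in>unpack W j. foldl (pair_step F q) z v \<in> unpack W (max (Suc i) j))"
        by (auto simp: unpack_def)
    qed
    finally show ?thesis unfolding TT_def by blast
  qed
  have up: "unpack (pack T) j = T j" if "\<forall>j\<le>k. T j \<subseteq> {..<Z}" "j \<le> k" for T j
  proof (rule set_eqI)
    fix z
    show "z \<in> unpack (pack T) j \<longleftrightarrow> z \<in> T j"
    proof (cases "z < Z")
      case True
      then show ?thesis using that(2) jzL[OF True, of j]
        unfolding unpack_def pack_def mem_Collect_eq jz[OF True] by (simp only: simp_thms)
    qed (use that in \<open>auto simp: unpack_def\<close>)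
  qed
  have un0: "z \<in> unpack W 0 \<longleftrightarrow> z \<in> W" if "z < Z" for W z using that by (simp add: unpack_def)
  let ?P = "\<lambda>T. q \<in> T 0 \<and> ?n + init (progress F q) \<in> T 0 \<and>
     (\<forall>i<k. \<forall>z\<in>T (Suc i). (z < ?n \<longrightarrow> z = q) \<and>
        (\<not> z < ?n \<longrightarrow> (z - ?n \<in> final (progress F q) \<longleftrightarrow> even i = b))) \<and>
     (\<forall>i<k. \<exists>v. v \<noteq> [] \<and> set v \<subseteq> {..<alph F} \<and> (\<forall>j\<le>k. \<forall>z\<in>T j. foldl (pair_step F q) z v \<in> T (max (Suc i) j)))"
  have "(\<exists>T. fdfa_sets F k b q T) \<longleftrightarrow> (\<exists>u. set u \<subseteq> {..<alph F} \<and> reach (leading F) u = q) \<and>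
    (\<exists>T. (\<forall>j\<le>k. T j \<subseteq> {..<Z}) \<and> ?P T)"
    unfolding fdfa_sets_def Z_def by blast
  also have "(\<exists>T. (\<forall>j\<le>k. T j \<subseteq> {..<Z}) \<and> ?P T) \<longleftrightarrow> (\<exists>W\<subseteq>{..<L}. ?P (unpack W))"
  proof
    assume "\<exists>T. (\<forall>j\<le>k. T j \<subseteq> {..<Z}) \<and> ?P T"
    then obtain T where T: "\<forall>j\<le>k. T j \<subseteq> {..<Z}" "?P T" by blast
    note u = up[OF T(1)]
    have "?P (unpack (pack T))" using T(2) u[of 0] u[of "Suc _"] u[of "max _ _"] u by (simp add: Suc_le_eq)
    moreover have "pack T \<subseteq> {..<L}" by (auto simp: pack_def)
    ultimately show "\<exists>W\<subseteq>{..<L}. ?P (unpack W)" by blast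
  next
    assume "\<exists>W\<subseteq>{..<L}. ?P (unpack W)"
    then obtain W where "?P (unpack W)" by blast
    moreover have "\<forall>j\<le>k. unpack W j \<subseteq> {..<Z}" by (auto simp: unpack_def)
    ultimately show "\<exists>T. (\<forall>j\<le>k. T j \<subseteq> {..<Z}) \<and> ?P T" by blast
  qed
  also have "\<dots> \<longleftrightarrow> (\<exists>W\<subseteq>{..<L}. q \<in> W \<and> ?n + init (progress F q) \<in> W \<and>
      (\<forall>i<k. \<forall>z<Z. (i + 1) * Z + z \<in> W \<longrightarrow> (if z < ?n then z = q
         else z - ?n \<in> final (progress F q) \<longleftrightarrow> even i = b)) \<and>
      (\<forall>i<k. \<exists>a<?m. ({y. y < L \<and> (\<exists>y'<L. y' \<in> W \<and> \<delta> y' a = y)},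
          {y. y < L \<and> (if i < y div Z then y div Z else i + 1) * Z + y mod Z \<in> W})
        \<in> {(X, Y). X \<subseteq> {..<L} \<and> Y \<subseteq> {..<L} \<and> R X Y}\<^sup>*))"
  proof -
    have i: "q < Z" "?n + init (progress F q) < Z"
      using q init_progress_in[OF wf q] by (auto simp: Z_def)
    show ?thesis unfolding words un0[OF i(1)] un0[OF i(2)]
      by (intro ex_cong1 conj_cong refl) (auto simp: unpack_def)
  qed
  finally show ?thesis .
qed

declare ev.simps [simp del]

text \<open>
  The variables of the following formulas hold: \<open>10\<close> the state \<open>q\<close>, \<open>11\<close> the length \<open>k\<close> of the chain, \<open>12\<close> the
  acceptance \<open>b\<close> of its first element, \<open>13\<close> the index \<open>i\<close>, \<open>14\<close> the first letter of the word for \<open>i\<close>,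
  \<open>16\<close> the size \<open>L = (k + 1) * Z\<close> of the packed sets and \<open>17\<close> the number \<open>Z\<close> of states.
  Array \<open>0\<close> is a set of leading states, array \<open>1\<close> the packed sets \<open>T\<close>, and array \<open>2\<close> the
  play of Savitch's formula, which has \<open>2 * L\<close> levels since there are \<open>2 ^ (2 * L)\<close> pairs of sets.
\<close>

definition AlphSize where "AlphSize = InputNumber (Nm 0)"
definition LeadingSize where "LeadingSize = InputNumber (Nm 1)"
definition ProgOffset where
  "ProgOffset e = It 64 65 e (Vr 0) (Add (Nm 3) (Mul LeadingSize AlphSize))
     (Add (Vr 65) (Add (Nm 2) (Add (Mul (InputNumber (Vr 65)) AlphSize) (InputNumber (Vr 65)))))"
definition ProgSize where "ProgSize q = InputNumber (ProgOffset q)"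
definition ProgInit where "ProgInit q = InputNumber (Add (ProgOffset q) (Nm 1))"
definition ProgStep where "ProgStep q p a = InputNumber (Add (ProgOffset q) (Add (Nm 2) (Add (Mul p AlphSize) a)))"
definition ProgFinal where "ProgFinal q p = InputNumber (Add (ProgOffset q) (Add (Nm 2) (Add (Mul (ProgSize q) AlphSize) p)))"
definition LeadStep where "LeadStep q a = InputNumber (Add (Nm 1) (Add (Nm 2) (Add (Mul q AlphSize) a)))"
definition PairStep where "PairStep q z a = Ite (Lt z LeadingSize) (LeadStep z a) (Add LeadingSize (ProgStep q (Sub z LeadingSize) a))"

text \<open>Reachability as membership in every closed set that contains the initial state: one
  block of universal bits replaces the search for a word.\<close>

definition Reachable where
  "Reachable = Qbf 0 30 LeadingSize (Nm 1) (Imp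
     (Conj (Arr 0 (InputNumber (Nm 2)))
       (Forall 31 LeadingSize (Imp (Arr 0 (Vr 31)) (Forall 32 AlphSize (Arr 0 (LeadStep (Vr 31) (Vr 32)))))))
     (Arr 0 (Vr 10)))"

definition PackedStep where
  "PackedStep y a = Add (Mul (Div y (Vr 17)) (Vr 17)) (PairStep (Vr 10) (Md y (Vr 17)) a)"
definition Source where
  "Source y = Exists 40 (Vr 16) (Conj (Arr 1 (Vr 40)) (Eq (PackedStep (Vr 40) (Vr 14)) y))"
definition Target where
  "Target y = Arr 1 (Add (Mul (Ite (Lt (Vr 13) (Div y (Vr 17))) (Div y (Vr 17)) (Add (Vr 13) (Nm 1))) (Vr 17)) (Md y (Vr 17)))"
definition LastLevel where
  "LastLevel b = It 21 22 (Add (Vr 16) (Vr 16)) (Add (Vr 16) (Vr 16)) (Nm 0)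
     (Ite (Eq (Arr 2 (Add (Mul (Vr 21) (Add (Vr 16) (Nm 1))) (Vr 16))) (Nm (of_bool b))) (Add (Vr 21) (Nm 1)) (Vr 22))"
definition Endpoint where
  "Endpoint b S y = Bind 20 (LastLevel b)
     (Ite (Vr 20) (Arr 2 (Add (Mul (Sub (Vr 20) (Nm 1)) (Add (Vr 16) (Nm 1))) y)) S)"
definition Savitch where
  "Savitch = Qbf 2 41 (Mul (Add (Vr 16) (Vr 16)) (Add (Vr 16) (Nm 1)))
     (Eq (Md (Vr 41) (Add (Vr 16) (Nm 1))) (Vr 16))
     (Exists 23 (Add AlphSize (Nm 1)) (Forall 24 (Vr 16) (Imp (Endpoint True (Source (Vr 24)) (Vr 24))
        (Bind 25 (Ite (Lt (Vr 23) AlphSize) (PackedStep (Vr 24) (Vr 23)) (Vr 24)) (Endpoint False (Target (Vr 25)) (Vr 25))))))"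
text \<open>\<open>even i = b\<close> is expressed by \<open>i + of_bool b\<close> being
  odd.\<close>

definition GoodSets where
  "GoodSets = Conj (Conj (Arr 1 (Vr 10)) (Arr 1 (Add LeadingSize (ProgInit (Vr 10)))))
     (Forall 33 (Vr 11) (Forall 34 (Vr 17)
       (Imp (Arr 1 (Add (Mul (Add (Vr 33) (Nm 1)) (Vr 17)) (Vr 34)))
         (Ite (Lt (Vr 34) LeadingSize) (Eq (Vr 34) (Vr 10))
           (Eq (ProgFinal (Vr 10) (Sub (Vr 34) LeadingSize)) (Md (Add (Vr 33) (Vr 12)) (Nm 2)))))))"
definition Chain where
  "Chain k b = Bind 11 k (Bind 12 (Nm (of_bool b)) (Exists 10 LeadingSize
     (Bind 17 (Add LeadingSize (ProgSize (Vr 10))) (Bind 16 (Mul (Add (Vr 11) (Nm 1)) (Vr 17))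
       (Conj Reachable (Qbf 1 42 (Vr 16) (Nm 0) (Conj GoodSets (Forall 13 (Vr 11) (Exists 14 AlphSize Savitch)))))))))"
text \<open>The number \<open>k\<close> is read with cutoff \<open>length x + 1\<close>. If it
  exceeds the length of the input, the answer is negative, since there are no chains of that
  length.\<close>

definition Position where
  "Position = Bind 8 (InputNumber (ProgOffset LeadingSize)) (Bind 9 (InputNumber (Add (ProgOffset LeadingSize) (Nm 1)))
     (Ite (Lt (Vr 0) (Vr 9)) (Nm 0)
       (Ite (Eq (Vr 8) (Nm 0)) (Conj (Chain (Vr 9) True) (Neg (Chain (Vr 9) False)))
         (Ite (Eq (Vr 8) (Nm 1)) (Conj (Chain (Vr 9) False) (Neg (Chain (Vr 9) True)))
           (Conj (Conj (Chain (Vr 9) True) (Chain (Vr 9) False))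
             (Conj (Neg (Chain (Add (Vr 9) (Nm 1)) True)) (Neg (Chain (Add (Vr 9) (Nm 1)) False))))))))"

section \<open>Evaluation of the formulas on an encoded instance\<close>

locale instance_word =
  fixes F :: fdfa and s :: wsign and k :: nat and x :: "bool list"
  assumes wf: "wf_fdfa F" and x: "x = encode_instance F s k"
begin

abbreviation "N \<equiv> nstates (leading F)"
abbreviation "m \<equiv> alph F"
abbreviation "\<L> \<equiv> leading F"
abbreviation "\<P> \<equiv> progress F"

lemma length_x: "prog_off F N + 2 \<le> length x"
  using length_encode[of "fdfa_numbers F @ [wsign_number s, k]"]
  by (simp add: x encode_instance_def fdfa_numbers_nth(1) del: map_append concat_append)

lemma input_number_x:
  assumes "e < prog_off F N" shows "input_number x e = fdfa_numbers F ! e"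
proof -
  have "input_number x e = min ((fdfa_numbers F @ [wsign_number s, k]) ! e) (length x + 1)"
    using assms by (intro input_number_encode) (simp_all add: x encode_instance_def fdfa_numbers_nth(1))
  moreover have "fdfa_numbers F ! e \<le> length (fdfa_numbers F)"
    using assms by (intro fdfa_numbers_le[OF wf] nth_mem) (simp add: fdfa_numbers_nth(1))
  ultimately show ?thesis using assms length_x by (simp add: nth_append fdfa_numbers_nth(1))
qed

lemma input_number_sign: "input_number x (prog_off F N) = wsign_number s"
proof -
  have "input_number x (prog_off F N) = min ((fdfa_numbers F @ [wsign_number s, k]) ! (prog_off F N)) (length x + 1)"
    by (intro input_number_encode) (simp_all add: x encode_instance_def fdfa_numbers_nth(1))
  then show ?thesis using length_x by (cases s) (simp_all add: nth_append fdfa_numbers_nth(1))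
qed

lemma input_number_position: "input_number x (prog_off F N + 1) = min k (length x + 1)"
proof -
  have "input_number x (prog_off F N + 1) = min ((fdfa_numbers F @ [wsign_number s, k]) ! (prog_off F N + 1)) (length x + 1)"
    by (intro input_number_encode) (simp_all add: x encode_instance_def fdfa_numbers_nth(1))
  then show ?thesis by (simp add: nth_append fdfa_numbers_nth(1))
qed

lemma prog_off_ge: "3 + N * m \<le> prog_off F q"
  by (simp add: prog_off_def)

lemma prog_off_mono: "q \<le> q' \<Longrightarrow> prog_off F q \<le> prog_off F q'"
  by (auto simp: prog_off_def intro!: sum_mono2)

lemma input_number_m: "input_number x 0 = m"
  using input_number_x[of 0] fdfa_numbers_nth(2)[of F] prog_off_ge[of N] by simp

lemma input_number_leading: "e < 2 + N * m \<Longrightarrow> input_number x (1 + e) = dts_numbers m \<L> ! e"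
  using input_number_x[of "1 + e"] fdfa_numbers_nth(3)[of e F] prog_off_ge[of N] by simp

lemma input_number_progress: "q < N \<Longrightarrow> e < length (dfa_numbers m (\<P> q)) \<Longrightarrow> input_number x (prog_off F q + e) = dfa_numbers m (\<P> q) ! e"
  using input_number_x[of "prog_off F q + e"] fdfa_numbers_nth(4)[of q F e] by simp

lemma input_number_N: "input_number x 1 = N" and num_init: "input_number x 2 = init \<L>"
  using input_number_leading[of 0] input_number_leading[of 1] dts_numbers_nth(2,3)[of m \<L>] by (simp_all add: numeral_2_eq_2)

lemma ev_AlphSize: "\<eta> 0 = length x \<Longrightarrow> ev x AlphSize \<eta> \<alpha> = m"
  and ev_LeadingSize: "\<eta> 0 = length x \<Longrightarrow> ev x LeadingSize \<eta> \<alpha> = N"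
  using input_number_m input_number_N by (simp_all add: AlphSize_def LeadingSize_def ev_InputNumber ev_macros)

lemma ev_LeadStep:
  assumes "\<eta> 0 = length x" "ev x q \<eta> \<alpha> < N" "ev x a \<eta> \<alpha> < m"
  shows "ev x (LeadStep q a) \<eta> \<alpha> = step \<L> (ev x q \<eta> \<alpha>) (ev x a \<eta> \<alpha>)"
proof -
  have "Suc (ev x q \<eta> \<alpha>) * m \<le> N * m" using assms by (intro mult_le_mono1) simp
  then have "2 + ev x q \<eta> \<alpha> * m + ev x a \<eta> \<alpha> < 2 + N * m" using assms by simp
  from input_number_leading[OF this] show ?thesis using dts_numbers_nth(4)[OF assms(2,3)] assms(1)
    by (simp add: LeadStep_def ev_InputNumber ev_AlphSize ev_macros add.assoc)
qed

lemma ev_ProgOffset: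
  assumes \<eta>: "\<eta> 0 = length x" and q: "ev x q \<eta> \<alpha> \<le> N" shows "ev x (ProgOffset q) \<eta> \<alpha> = prog_off F (ev x q \<eta> \<alpha>)"
proof -
  have cap: "prog_off F q \<le> length x" if "q \<le> N" for q using prog_off_mono[OF that] length_x by simp
  let ?f = "\<lambda>j z. min (z + (2 + (input_number x z * m + input_number x z))) (length x)"
  have "rec_nat (min (3 + N * m) (length x)) ?f q = prog_off F q" if "q \<le> N" for q
    using that
  proof (induction q)
    case 0
    then show ?case using cap[of 0] by (simp add: prog_off_def)
  next
    case (Suc q)
    have "input_number x (prog_off F q) = nstates (\<P> q)"
      using input_number_progress[of q 0] Suc.prems by (simp add: dfa_numbers_nth)
    then have "prog_off F q + (2 + (input_number x (prog_off F q) * m + input_number x (prog_off F q))) = prog_off F (Suc q)"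
      by (simp add: prog_off_def dfa_numbers_nth)
    then show ?case using Suc cap[of "Suc q"] by simp
  qed
  then show ?thesis using q \<eta> by (simp add: ProgOffset_def ev.simps(11) ev_macros ev_AlphSize ev_LeadingSize ev_InputNumber)
qed

lemma ev_ProgSize: "\<eta> 0 = length x \<Longrightarrow> ev x q \<eta> \<alpha> < N \<Longrightarrow> ev x (ProgSize q) \<eta> \<alpha> = nstates (\<P> (ev x q \<eta> \<alpha>))"
  and ev_ProgInit: "\<eta> 0 = length x \<Longrightarrow> ev x q \<eta> \<alpha> < N \<Longrightarrow> ev x (ProgInit q) \<eta> \<alpha> = init (\<P> (ev x q \<eta> \<alpha>))"
  using input_number_progress[of "ev x q \<eta> \<alpha>" 0] input_number_progress[of "ev x q \<eta> \<alpha>" 1]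
    dfa_numbers_nth(1-3)[of m "\<P> (ev x q \<eta> \<alpha>)"]
  by (simp_all add: ProgSize_def ProgInit_def ev_InputNumber ev_macros ev_ProgOffset)

lemma ev_ProgStep:
  assumes \<eta>: "\<eta> 0 = length x" and "ev x q \<eta> \<alpha> < N" "ev x p \<eta> \<alpha> < nstates (\<P> (ev x q \<eta> \<alpha>))" "ev x a \<eta> \<alpha> < m"
  shows "ev x (ProgStep q p a) \<eta> \<alpha> = step (\<P> (ev x q \<eta> \<alpha>)) (ev x p \<eta> \<alpha>) (ev x a \<eta> \<alpha>)"
proof -
  have "Suc (ev x p \<eta> \<alpha>) * m \<le> nstates (\<P> (ev x q \<eta> \<alpha>)) * m" using assms by (intro mult_le_mono1) simp
  then have "2 + ev x p \<eta> \<alpha> * m + ev x a \<eta> \<alpha> < length (dfa_numbers m (\<P> (ev x q \<eta> \<alpha>)))"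
    using assms by (simp add: dfa_numbers_nth)
  from input_number_progress[OF assms(2) this] show ?thesis using dfa_numbers_nth(4)[OF assms(3,4)] assms
    by (simp add: ProgStep_def ev_InputNumber ev_AlphSize ev_ProgOffset ev_macros add.assoc)
qed

lemma ev_ProgFinal:
  assumes \<eta>: "\<eta> 0 = length x" and "ev x q \<eta> \<alpha> < N" "ev x p \<eta> \<alpha> < nstates (\<P> (ev x q \<eta> \<alpha>))"
  shows "ev x (ProgFinal q p) \<eta> \<alpha> = of_bool (ev x p \<eta> \<alpha> \<in> final (\<P> (ev x q \<eta> \<alpha>)))"
  using input_number_progress[OF assms(2), of "2 + nstates (\<P> (ev x q \<eta> \<alpha>)) * m + ev x p \<eta> \<alpha>"] dfa_numbers_nth(5)[OF assms(3)] assms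
  by (simp add: ProgFinal_def ev_InputNumber ev_AlphSize ev_ProgOffset ev_ProgSize ev_macros dfa_numbers_nth(1) add.assoc)

lemma ev_PairStep:
  assumes \<eta>: "\<eta> 0 = length x" and "ev x q \<eta> \<alpha> < N" "ev x z \<eta> \<alpha> < N + nstates (\<P> (ev x q \<eta> \<alpha>))" "ev x a \<eta> \<alpha> < m"
  shows "ev x (PairStep q z a) \<eta> \<alpha> = pair_step F (ev x q \<eta> \<alpha>) (ev x z \<eta> \<alpha>) (ev x a \<eta> \<alpha>)"
  using assms by (simp add: PairStep_def pair_step_def holds_in_ev ev_LeadingSize ev_LeadStep ev_ProgStep)

lemma holds_in_Reachable:
  assumes \<eta>: "\<eta> 0 = length x" and q: "\<eta> 10 < N"
  shows "holds_in x Reachable \<eta> \<alpha> \<longleftrightarrow> (\<exists>u. set u \<subseteq> {..<m} \<and> reach \<L> u = \<eta> 10)" (is "_ \<longleftrightarrow> ?reach")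
proof -
  have init: "init \<L> < N" and step: "\<And>p a. p < N \<Longrightarrow> a < m \<Longrightarrow> step \<L> p a < N"
    using wf_leading[OF wf] by (auto simp: wf_dts_def)
  have "holds_in x Reachable \<eta> \<alpha> \<longleftrightarrow> (\<forall>R\<subseteq>{..<N}. init \<L> \<in> R \<and> (\<forall>p<N. p \<in> R \<longrightarrow> (\<forall>a<m. step \<L> p a \<in> R)) \<longrightarrow> \<eta> 10 \<in> R)"
    by (simp add: Reachable_def holds_in_ev ev_LeadingSize ev_AlphSize ev_LeadStep ev_InputNumber \<eta> num_init game_forall)
  also have "\<dots> \<longleftrightarrow> ?reach"
  proof
    define R where "R = {reach \<L> u | u. set u \<subseteq> {..<m}}"
    assume *: "\<forall>R\<subseteq>{..<N}. init \<L> \<in> R \<and> (\<forall>p<N. p \<in> R \<longrightarrow> (\<forall>a<m. step \<L> p a \<in> R)) \<longrightarrow> \<eta> 10 \<in> R"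
    have "R \<subseteq> {..<N}" using reach_leading_in[OF wf] by (auto simp: R_def)
    moreover have "init \<L> \<in> R" by (auto simp: R_def reach_def intro!: exI[of _ "[]"])
    moreover have "step \<L> p a \<in> R" if p: "p \<in> R" and a: "a < m" for p a
    proof -
      obtain u where "p = reach \<L> u" "set u \<subseteq> {..<m}" using p by (auto simp: R_def)
      then show ?thesis using a by (auto simp: R_def reach_def intro!: exI[of _ "u @ [a]"])
    qed
    ultimately have "\<eta> 10 \<in> R" using * by simp
    then show ?reach by (auto simp: R_def)
  next
    assume ?reach
    then obtain u where u: "set u \<subseteq> {..<m}" "reach \<L> u = \<eta> 10" by blast
    show "\<forall>R\<subseteq>{..<N}. init \<L> \<in> R \<and> (\<forall>p<N. p \<in> R \<longrightarrow> (\<forall>a<m. step \<L> p a \<in> R)) \<longrightarrow> \<eta> 10 \<in> R"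
    proof (intro allI impI, elim conjE)
      fix R assume R: "R \<subseteq> {..<N}" "init \<L> \<in> R" "\<forall>p<N. p \<in> R \<longrightarrow> (\<forall>a<m. step \<L> p a \<in> R)"
      have fl: "foldl (step \<L>) p u \<in> R" if "p \<in> R" for p
        using that u(1) R(1,3) by (induction u arbitrary: p) auto
      show "\<eta> 10 \<in> R" using fl[OF R(2)] u(2) by (simp add: reach_def)
    qed
  qed
  finally show ?thesis .
qed

lemma holds_in_Chain:
  assumes \<eta>: "\<eta> 0 = length x"
  shows "holds_in x (Chain e b) \<eta> \<alpha> \<longleftrightarrow> (\<exists>q T. fdfa_sets F (ev x e \<eta> \<alpha>) b q T)"
proof -
  have main: "holds_in x (Conj Reachable (Qbf 1 42 (Vr 16) (Nm 0) (Conj GoodSets (Forall 13 (Vr 11) (Exists 14 AlphSize Savitch))))) \<eta> \<alpha>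
      \<longleftrightarrow> (\<exists>T. fdfa_sets F k b q T)"
    if e: "\<eta> 0 = length x" "\<eta> 10 = q" "\<eta> 11 = k" "\<eta> 12 = of_bool b" "\<eta> 17 = Z" "\<eta> 16 = L"
      and d: "Z = N + nstates (\<P> q)" "L = (k + 1) * Z" and q: "q < N" for \<eta> \<alpha> q k Z L
  proof -
    define \<delta> where "\<delta> = (\<lambda>y a. y div Z * Z + pair_step F q (y mod Z) a)"
    have Z: "0 < Z" using q d by simp
    have mZ: "y mod Z < N + nstates (\<P> q)" for y using mod_less_divisor[OF Z, of y] unfolding d(1) .
    have ev_Dlt: "ev x (PackedStep y a) \<eta> \<alpha> = \<delta> (ev x y \<eta> \<alpha>) (ev x a \<eta> \<alpha>)"
      if "\<eta> 0 = length x" "\<eta> 10 = q" "\<eta> 17 = Z" "ev x a \<eta> \<alpha> < m" for y a \<eta> \<alpha>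
      using that q mZ by (simp add: PackedStep_def \<delta>_def ev_PairStep holds_in_ev)
    have Last: "ev x (LastLevel c) \<eta> \<alpha> = last_level c L (2 * L) (\<alpha> 2)" if "\<eta> 16 = L" for c \<eta> \<alpha>
    proof -
      let ?f = "\<lambda>j z. min (if (\<alpha> 2 (j * (L + 1) + L)) = c then j + 1 else z) (2 * L)"
      have "rec_nat 0 ?f j = last_level c L j (\<alpha> 2)" if "j \<le> 2 * L" for j
        using that
      proof (induction j)
        case (Suc j)
        then show ?case using last_level_le[of c L j "\<alpha> 2"] by simp
      qed simp
      moreover have "ev x (LastLevel c) \<eta> \<alpha> = rec_nat 0 ?f (2 * L)"
        using \<open>\<eta> 16 = L\<close> by (simp add: LastLevel_def ev.simps(11) holds_in_ev ev.simps(10) of_bool_eq_iff mult_2 cong: if_cong)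
      ultimately show ?thesis by simp
    qed
    define S where "S a W = {y. y < L \<and> (\<exists>y'<L. y' \<in> W \<and> \<delta> y' a = y)}" for a W
    define T where "T i W = {y. y < L \<and> (if i < y div Z then y div Z else i + 1) * Z + y mod Z \<in> W}" for i W
    define R where "R = (\<lambda>X Y. \<exists>a<m + 1. \<forall>y<L. y \<in> X \<longrightarrow> (if a < m then \<delta> y a else y) \<in> Y)"
    have EndS: "holds_in x (Endpoint True (Source (Vr 24)) (Vr 24)) \<eta> \<alpha> \<longleftrightarrow> \<eta> 24 \<in> endpoint True L (S a W) (2 * L) (\<alpha> 2)"
      if "\<eta> 16 = L" "\<eta> 0 = length x" "\<eta> 10 = q" "\<eta> 17 = Z" "\<eta> 14 = a" "a < m" "\<eta> 24 < L" "\<alpha> 1 = (\<lambda>i. i \<in> W)" for \<eta> \<alpha> a W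
      using that by (simp add: Endpoint_def holds_in_ev endpoint_def Last S_def Source_def ev_Dlt)
    have EndT: "holds_in x (Endpoint False (Target (Vr 25)) (Vr 25)) \<eta> \<alpha> \<longleftrightarrow> \<eta> 25 \<in> endpoint False L (T i W) (2 * L) (\<alpha> 2)"
      if "\<eta> 16 = L" "\<eta> 17 = Z" "\<eta> 13 = i" "\<eta> 25 < L" "\<alpha> 1 = (\<lambda>i. i \<in> W)" for \<eta> \<alpha> i W
      using that by (simp add: Endpoint_def holds_in_ev endpoint_def Last T_def Target_def)
    have \<delta>L: "\<delta> y a < L" if "y < L" "a < m" for y a
    proof -
      have "pair_step F q (y mod Z) a < Z" using pair_step_in[OF wf q mZ that(2)] d(1) by simp
      moreover have "y div Z < k + 1" using that(1) unfolding d(2) by (rule less_mult_imp_div_less)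
      then have "Suc (y div Z) * Z \<le> (k + 1) * Z" by (intro mult_le_mono1) simp
      ultimately show ?thesis unfolding \<delta>_def d(2) mult_Suc by linarith
    qed
    have Savitch: "holds_in x Savitch \<eta> \<alpha> \<longleftrightarrow> (S a W, T i W) \<in> {(X, Y). X \<subseteq> {..<L} \<and> Y \<subseteq> {..<L} \<and> R X Y}\<^sup>*"
      if \<eta>: "a < m" "\<eta> 0 = length x" "\<eta> 10 = q" "\<eta> 17 = Z" "\<eta> 16 = L" "\<eta> 13 = i" "\<eta> 14 = a" "\<alpha> 1 = (\<lambda>i. i \<in> W)" for i a W \<eta> \<alpha>
    proof -
      have "holds_in x Savitch \<eta> \<alpha> \<longleftrightarrow> game (\<lambda>q. q mod (L + 1) = L)
          (\<lambda>V. R (endpoint True L (S a W) (2 * L) V) (endpoint False L (T i W) (2 * L) V)) (2 * L * (L + 1)) 0 (\<lambda>_. False)"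
        using \<eta> by (simp add: Savitch_def holds_in_ev EndS EndT ev_AlphSize ev_Dlt \<delta>L R_def mult_2 cong: conj_cong if_cong)
      also have "\<dots> \<longleftrightarrow> (S a W, T i W) \<in> {(X, Y). X \<subseteq> {..<L} \<and> Y \<subseteq> {..<L} \<and> R X Y}\<^sup>*"
        by (rule savitch) (auto simp: R_def S_def T_def)
      finally show ?thesis .
    qed
    have GoodSets: "holds_in x GoodSets \<eta> \<alpha> \<longleftrightarrow> q \<in> W \<and> N + init (\<P> q) \<in> W \<and> (\<forall>i<k. \<forall>z<Z. (i + 1) * Z + z \<in> W \<longrightarrow>
        (if z < N then z = q else z - N \<in> final (\<P> q) \<longleftrightarrow> even i = b))"
      if \<eta>: "\<eta> 0 = length x" "\<eta> 10 = q" "\<eta> 11 = k" "\<eta> 12 = of_bool b" "\<eta> 17 = Z" "\<alpha> 1 = (\<lambda>i. i \<in> W)" for W \<eta> \<alpha>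
    proof -
      have p: "(of_bool P = (i + of_bool b) mod 2) \<longleftrightarrow> (P \<longleftrightarrow> even i = b)" for P and i :: nat
        by (cases "even i"; cases b; cases P) (auto elim!: evenE oddE)
      have f: "z - N < nstates (\<P> q)" if "z < Z" "\<not> z < N" for z using that d(1) by simp
      show ?thesis using \<eta> q by (simp add: GoodSets_def holds_in_ev ev_LeadingSize ev_ProgInit ev_ProgFinal f p cong: if_cong)
    qed
    have "holds_in x (Conj Reachable (Qbf 1 42 (Vr 16) (Nm 0) (Conj GoodSets (Forall 13 (Vr 11) (Exists 14 AlphSize Savitch))))) \<eta> \<alpha> \<longleftrightarrow>
      (\<exists>u. set u \<subseteq> {..<m} \<and> reach \<L> u = q) \<and> (\<exists>W\<subseteq>{..<L}. q \<in> W \<and> N + init (\<P> q) \<in> W \<and>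
        (\<forall>i<k. \<forall>z<Z. (i + 1) * Z + z \<in> W \<longrightarrow> (if z < N then z = q else z - N \<in> final (\<P> q) \<longleftrightarrow> even i = b)) \<and>
        (\<forall>i<k. \<exists>a<m. (S a W, T i W) \<in> {(X, Y). X \<subseteq> {..<L} \<and> Y \<subseteq> {..<L} \<and> R X Y}\<^sup>*))"
      using e q by (simp add: holds_in_ev holds_in_Reachable game_exists ev_AlphSize Savitch GoodSets cong: conj_cong)
    then show ?thesis
      unfolding fdfa_sets_packed[OF wf q, of k b] S_def T_def R_def \<delta>_def d .
  qed
  have "holds_in x (Chain e b) \<eta> \<alpha> \<longleftrightarrow> (\<exists>q<N. \<exists>T. fdfa_sets F (ev x e \<eta> \<alpha>) b q T)"
  proof -
    let ?k = "ev x e \<eta> \<alpha>"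
    have "holds_in x (Conj Reachable (Qbf 1 42 (Vr 16) (Nm 0) (Conj GoodSets (Forall 13 (Vr 11) (Exists 14 AlphSize Savitch)))))
       (\<eta>(11 := ?k, 12 := of_bool b, 10 := q, 99 := 0, 17 := N + nstates (\<P> q), 16 := (?k + 1) * (N + nstates (\<P> q)))) \<alpha>
       \<longleftrightarrow> (\<exists>T. fdfa_sets F ?k b q T)" if "q < N" for q
      by (rule main[OF _ _ _ _ _ _ refl refl that]) (use \<eta> in auto)
    then show ?thesis unfolding Chain_def using \<eta>
      by (simp add: holds_in_simps(6) holds_in_Exists ev_macros ev_LeadingSize ev_ProgSize del: One_nat_def mult_Suc cong: conj_cong)
  qed
  also have "\<dots> \<longleftrightarrow> (\<exists>q T. fdfa_sets F (ev x e \<eta> \<alpha>) b q T)"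
    using reach_leading_in[OF wf] by (auto simp: fdfa_sets_def)
  finally show ?thesis .
qed

lemma holds_in_Position:
  assumes sat: "saturated F" and k: "0 < k"
  shows "holds_in x Position (env0 x) arr0 \<longleftrightarrow> wagner_position m (fdfa_language F) s k"
proof -
  let ?C = "\<lambda>k b. \<exists>q T. fdfa_sets F k b q T"
  note C = has_chain_iff_fdfa_sets[OF wf sat]
  \<comment> \<open>The block of a progress DFA in the input contains more numbers than the DFA has
    states, and each number takes at least one bit.\<close>
  have bound: "\<not> ?C k b" if "length x < k" for b
  proof
    assume "?C k b"
    then obtain u e where f: "fdfa_chain F k b u e" using has_chain_iff_fdfa_chain[OF wf sat] C by blast
    let ?q = "reach \<L> u"
    have q: "?q < N" by (rule reach_leading_in[OF wf fdfa_chain_length(2)[OF wf f]])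
    have "nstates (\<P> ?q) < prog_off F N"
      using fdfa_numbers_nth(4)[OF q, of "nstates (\<P> ?q)"] by (simp add: dfa_numbers_nth)
    then show False using fdfa_chain_length(1)[OF wf f] length_x that by (simp add: progress_at_def)
  qed
  have e: "env0 x 0 = length x" by (simp add: env0_def)
  have pos: "holds_in x Position (env0 x) arr0 \<longleftrightarrow> \<not> length x < k \<and> (case s of
      Plus \<Rightarrow> ?C k True \<and> \<not> ?C k False
    | Minus \<Rightarrow> ?C k False \<and> \<not> ?C k True
    | PlusMinus \<Rightarrow> ?C k True \<and> ?C k False \<and> \<not> ?C (Suc k) True \<and> \<not> ?C (Suc k) False)"
    using e input_number_position[simplified]
    by (cases "length x < k"; cases s) (simp_all add: Position_def holds_in_ev holds_in_Chain ev_InputNumber ev_ProgOffset ev_LeadingSize input_number_sign)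
  show ?thesis unfolding pos fdfa_position_iff[OF wf sat k] C using bound by (cases s) auto
qed

end

theorem position_in_PSPACE: "promise_in_PSPACE position_yes position_no"
proof -
  have "x \<in> position_yes \<Longrightarrow> holds_in x Position (env0 x) arr0" "x \<in> position_no \<Longrightarrow> \<not> holds_in x Position (env0 x) arr0" for x
    using instance_word.holds_in_Position by (fastforce simp: position_yes_def position_no_def instance_word_def)+
  then show ?thesis
    unfolding promise_in_PSPACE_def
    by (intro bexI[OF _ PSPACE_ev[of Position]]) (auto simp: holds_in_def)
qed

section \<open>Families with levelled monitors\<close>

lemma iter_rotate:
  assumes eq: "x \<frown> y\<^sup>\<omega> = x' \<frown> y'\<^sup>\<omega>" and len: "length y = length y'" "y \<noteq> []"
  shows "\<exists>\<alpha> \<beta>. y = \<alpha> @ \<beta> \<and> y' = \<beta> @ \<alpha>"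
proof -
  let ?n = "length y"
  \<comment> \<open>This index lies beyond both prefixes, and a copy of \<open>y\<close> begins
    there.\<close>
  let ?N = "length x + length x' * ?n"
  define s where "s = (?N - length x') mod ?n"
  have n: "0 < ?n" "y' \<noteq> []" using len by auto
  have N: "length x' \<le> ?N" using n by (cases ?n) simp_all
  have "y = rotate s y'"
  proof (rule nth_equalityI)
    fix k assume k: "k < ?n"
    have "(x \<frown> y\<^sup>\<omega>) (?N + k) = y ! k"
      using k n by (simp add: conc_def iter_def)
    moreover have "(x' \<frown> y'\<^sup>\<omega>) (?N + k) = y' ! ((?N - length x' + k) mod ?n)"
      using N n len(1) by (simp add: conc_def iter_def)
    moreover have "(?N - length x' + k) mod ?n = (s + k) mod ?n" by (simp add: s_def mod_add_left_eq)
    ultimately show "y ! k = rotate s y' ! k" using eq k len(1) by (simp add: nth_rotate add.commute)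
  qed (simp add: len)
  then show ?thesis by (intro exI[of _ "drop (s mod length y') y'"] exI[of _ "take (s mod length y') y'"]) (simp add: rotate_drop_take)
qed

locale monitors =
  fixes m D G :: nat and ini :: "nat \<Rightarrow> nat" and acc :: "nat \<Rightarrow> bool" and mon :: "nat \<Rightarrow> nat \<Rightarrow> nat \<Rightarrow> nat"
  assumes ini: "\<And>c. c < m \<Longrightarrow> ini c < D" and mon: "\<And>c d a. c < m \<Longrightarrow> d < D \<Longrightarrow> a < G \<Longrightarrow> mon c d a \<le> D"
begin

text \<open>
  Monitor \<open>c\<close> has the states \<open>{..<D}\<close> and letters \<open>{..<G}\<close>; \<open>mon c d a\<close> is \<open>0\<close> if it fails and \<open>d' + 1\<close> if
  it moves to \<open>d'\<close>. A progress state \<open>(l, r)\<close> consists of a level \<open>l\<close> and \<open>r\<close>, which on level \<open>2 * c + 1\<close>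
  is \<open>0\<close> before the first separator \<open>G\<close> and a successor of a state of monitor \<open>c\<close> afterwards.
  The letter \<open>G + 1 + l\<close> raises the level to \<open>l\<close>.
\<close>

definition level_step :: "nat \<times> nat \<Rightarrow> nat \<Rightarrow> nat \<times> nat" where
  "level_step p a = (if G < a then (if fst p < a - (G + 1) then (a - (G + 1), 0) else p)
     else if even (fst p) then p
     else if a = G then (if snd p = 0 \<or> acc (snd p - 1) then (fst p, Suc (ini (fst p div 2))) else (fst p + 1, 0))
     else if snd p = 0 then p
     else if mon (fst p div 2) (snd p - 1) a = 0 then (fst p + 1, 0)
     else (fst p, mon (fst p div 2) (snd p - 1) a))"

definition mrun :: "nat \<Rightarrow> nat \<Rightarrow> nat list \<Rightarrow> nat" where
  "mrun c = foldl (\<lambda>z a. if z = 0 then 0 else mon c (z - 1) a)"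

definition macc :: "nat \<Rightarrow> nat list \<Rightarrow> bool" where
  "macc c w \<longleftrightarrow> mrun c (Suc (ini c)) w \<noteq> 0 \<and> acc (mrun c (Suc (ini c)) w - 1)"

definition pair_code :: "nat \<times> nat \<Rightarrow> nat" where "pair_code p = fst p * (D + 1) + snd p"

definition prog :: dfa where
  "prog = \<lparr>nstates = (2 * m + 1) * (D + 1), init = 0,
     step = (\<lambda>z a. pair_code (level_step (z div (D + 1), z mod (D + 1)) a)),
     final = {z. z < (2 * m + 1) * (D + 1) \<and> odd (z div (D + 1)) \<and> z mod (D + 1) \<noteq> 0}\<rparr>"

text \<open>With one leading state every decomposition is normalized. The letters are those of the
  monitors, the separator, and one for each of the levels from 0 to \<open>2 * m\<close>.\<close>

definition level_fdfa :: fdfa where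
  "level_fdfa = \<lparr>alph = G + 2 + 2 * m, leading = \<lparr>nstates = 1, init = 0, step = (\<lambda>_ _. 0)\<rparr>, progress = (\<lambda>_. prog)\<rparr>"

definition good :: "nat \<times> nat \<Rightarrow> bool" where "good p \<longleftrightarrow> odd (fst p) \<and> snd p \<noteq> 0"

abbreviation "level_run \<equiv> foldl level_step"

lemma level_mono: "fst p \<le> fst (level_step p a)" by (simp add: level_step_def)

lemma run_level_mono: "fst p \<le> fst (level_run p w)"
proof (induction w arbitrary: p)
  case (Cons a w)
  show ?case using le_trans[OF level_mono[of p a] Cons.IH] by simp
qed simp

lemma stay_cases:
  assumes "good p" "fst (level_step p a) = fst p"
  obtains "G < a" "a - (G + 1) \<le> fst p" "level_step p a = p"
  | "a = G" "level_step p a = (fst p, Suc (ini (fst p div 2)))" "acc (snd p - 1)"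
  | "a < G" "level_step p a = (fst p, mon (fst p div 2) (snd p - 1) a)" "mon (fst p div 2) (snd p - 1) a \<noteq> 0"
  using assms by (cases p; cases a G rule: linorder_cases) (auto simp: level_step_def good_def split: if_splits)

lemma good_step: "good p \<Longrightarrow> fst (level_step p a) = fst p \<Longrightarrow> good (level_step p a)"
  by (rule stay_cases) (auto simp: good_def)

lemma run_step_level: "fst (level_run p (a # w)) = fst p \<Longrightarrow> fst (level_step p a) = fst p \<and> fst (level_run (level_step p a) w) = fst (level_step p a)"
  using level_mono[of p a] run_level_mono[of "level_step p a" w] by simp

lemma good_run: "good p \<Longrightarrow> fst (level_run p w) = fst p \<Longrightarrow> good (level_run p w)"
proof (induction w arbitrary: p)
  case (Cons a w)
  note l = run_step_level[OF Cons.prems(2)]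
  show ?case unfolding foldl_Cons
    by (rule Cons.IH[OF good_step[OF Cons.prems(1) conjunct1[OF l]] conjunct2[OF l]])
qed simp

text \<open>The states from which a run may still join the accepting loop through \<open>B\<close>:
  \<open>B\<close> itself, lower levels, and the same level while it waits for a separator.\<close>

definition below :: "nat \<times> nat \<Rightarrow> nat \<times> nat \<Rightarrow> bool" where
  "below B A \<longleftrightarrow> A = B \<or> fst A < fst B \<or> fst A = fst B \<and> snd A = 0"

text \<open>\<open>A\<close> is at least as far on its way to \<open>B\<close> as \<open>C\<close>
  is.\<close>

definition ahead :: "nat \<times> nat \<Rightarrow> nat \<times> nat \<Rightarrow> nat \<times> nat \<Rightarrow> bool" where
  "ahead B C A \<longleftrightarrow> (C = B \<longrightarrow> A = B) \<and> (fst C = fst B \<longrightarrow> fst A = fst B)"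

text \<open>Level \<open>fst B\<close> is odd and so can only be entered by its letter, as no monitor fails on an even level.\<close>

lemma low_step:
  assumes "good B" "fst (level_step B a) = fst B" "fst A < fst B"
  shows "fst (level_step A a) \<le> fst B" "fst (level_step A a) = fst B \<longleftrightarrow> a = G + 1 + fst B"
    "fst (level_step A a) = fst B \<Longrightarrow> snd (level_step A a) = 0"
proof -
  have o: "odd (fst B)" using assms(1) by (simp add: good_def)
  show "fst (level_step A a) \<le> fst B"
    using assms(1,2)
  proof (cases rule: stay_cases)
    case 1
    then show ?thesis using assms(3) by (simp add: level_step_def)
  qed (use assms(3) in \<open>simp_all add: level_step_def\<close>)
  have e: "fst A + 1 \<noteq> fst B" if "odd (fst A)" using that o by presburger
  show "fst (level_step A a) = fst B \<longleftrightarrow> a = G + 1 + fst B" using assms(3) e by (auto simp: level_step_def)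
  then show "snd (level_step A a) = 0" if "fst (level_step A a) = fst B" using that assms(3) by (simp add: level_step_def)
qed

text \<open>On the level of \<open>B\<close> a waiting run ignores all letters except the separator,
  which restarts the monitor and thereby makes both runs equal.\<close>

lemma zero_step:
  assumes "good B" "fst (level_step B a) = fst B" "fst A = fst B" "snd A = 0"
  shows "level_step A a = (if a = G then level_step B a else A)"
  using assms(1,2)
proof (cases rule: stay_cases)
  case 1
  then show ?thesis using assms(3) by (simp add: level_step_def)
next
  case 2
  then show ?thesis using assms by (simp add: level_step_def good_def)
next
  case 3
  then show ?thesis using assms by (simp add: level_step_def)
qed

lemma below_step:
  assumes g: "good B" and s: "fst (level_step B a) = fst B" and b: "below B A"
  shows "below (level_step B a) (level_step A a)"
  using b low_step[OF g s, of A] zero_step[OF g s, of A] s by (auto simp: below_def)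

lemma ahead_step:
  assumes g: "good B" and s: "fst (level_step B a) = fst B" and b: "below B A" "below B C" "ahead B C A"
  shows "ahead (level_step B a) (level_step C a) (level_step A a)"
proof -
  have g': "snd (level_step B a) \<noteq> 0" using good_step[OF g s] by (simp add: good_def)
  consider "A = B" | "fst C < fst B" "A \<noteq> B" | "fst A = fst B" "snd A = 0" "fst C = fst B" "snd C = 0"
    using b by (auto simp: below_def ahead_def)
  then show ?thesis
  proof cases
    case 1
    then show ?thesis by (simp add: ahead_def)
  next
    case 2
    then consider "fst A < fst B" | "fst A = fst B" "snd A = 0" using b(1) by (auto simp: below_def)
    then show ?thesis
    proof cases
      case A: 1
      show ?thesis using low_step[OF g s 2(1)] low_step[OF g s A] g' s by (auto simp: ahead_def)
    next
      case A: 2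
      show ?thesis using low_step[OF g s 2(1)] zero_step[OF g s A] A(1) g' s by (auto simp: ahead_def)
    qed
  next
    case 3
    show ?thesis using zero_step[OF g s 3(1,2)] zero_step[OF g s 3(3,4)] 3 g' s by (auto simp: ahead_def)
  qed
qed

lemma ahead_run:
  "good B \<Longrightarrow> fst (level_run B w) = fst B \<Longrightarrow> below B A \<Longrightarrow> below B C \<Longrightarrow> ahead B C A \<Longrightarrow>
    below (level_run B w) (level_run A w) \<and> below (level_run B w) (level_run C w) \<and> ahead (level_run B w) (level_run C w) (level_run A w)"
proof (induction w arbitrary: A B C)
  case (Cons a w)
  note l = run_step_level[OF Cons.prems(2)]
  have s: "fst (level_step B a) = fst B" and r: "fst (level_run (level_step B a) w) = fst (level_step B a)" using l by blast+
  show ?case unfolding foldl_Cons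
    by (rule Cons.IH[OF good_step[OF Cons.prems(1) s] r below_step[OF Cons.prems(1) s Cons.prems(3)]
      below_step[OF Cons.prems(1) s Cons.prems(4)] ahead_step[OF Cons.prems(1) s Cons.prems(3-5)]])
qed simp

text \<open>
  Started in the initial state, \<open>\<alpha> @ \<beta>\<close> cannot end anywhere but in the state \<open>s\<close> of the accepting loop of
  \<open>\<beta> @ \<alpha>\<close>, since the run from \<open>(0, 0)\<close> over \<open>\<alpha>\<close> is at least as advanced as the one that has read nothing.
\<close>

lemma good_rotate:
  assumes p: "level_run (0, 0) (\<alpha> @ \<beta>) = p" "level_run p (\<alpha> @ \<beta>) = p"
    and p': "level_run (0, 0) (\<beta> @ \<alpha>) = p'" "level_run p' (\<beta> @ \<alpha>) = p'" and g: "good p'"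
  shows "good p"
proof -
  define s where "s = level_run p' \<beta>"
  have s\<alpha>: "level_run s \<alpha> = p'" using p'(2) by (simp add: s_def)
  have lev: "fst s = fst p'"
    using run_level_mono[of p' \<beta>] run_level_mono[of s \<alpha>] s\<alpha> by (simp add: s_def)
  have gs: "good s" unfolding s_def by (rule good_run[OF g]) (use lev s_def in simp)
  have b0: "below B (0, 0)" "ahead B (0, 0) (0, 0)" if "good B" for B
    using that by (cases B; auto simp: below_def good_def ahead_def)+
  let ?z = "level_run (0, 0) \<alpha>"
  have z: "below p' ?z" using ahead_run[OF gs _ b0(1)[OF gs] b0(1)[OF gs] b0(2)[OF gs], of \<alpha>] s\<alpha> lev by simp
  have "ahead p' (0, 0) ?z" using g by (auto simp: ahead_def good_def)
  then have "ahead p' p' (level_run ?z (\<beta> @ \<alpha>))"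
    using ahead_run[OF g _ z b0(1)[OF g], of "\<beta> @ \<alpha>"] p' by simp
  then have "level_run ?z (\<beta> @ \<alpha>) = p'" by (simp add: ahead_def)
  then have "level_run (0, 0) (\<alpha> @ \<beta> @ \<alpha> @ \<beta>) = s" by (simp add: s_def)
  then have "p = s" using p by simp
  then show ?thesis using gs by simp
qed

lemma level_step_ok:
  assumes "fst p \<le> 2 * m" "snd p \<le> D" "a < G + 2 + 2 * m"
  shows "fst (level_step p a) \<le> 2 * m" "snd (level_step p a) \<le> D"
proof -
  have c: "fst p div 2 < m" "fst p + 1 \<le> 2 * m" if "odd (fst p)" using that assms(1) by presburger+
  show "fst (level_step p a) \<le> 2 * m" using assms c by (auto simp: level_step_def)
  have "snd p - 1 < D" if "snd p \<noteq> 0" using that assms(2) by simp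
  then show "snd (level_step p a) \<le> D" using assms c mon[of "fst p div 2" "snd p - 1" a] ini[of "fst p div 2"]
    by (auto simp: level_step_def Suc_le_eq)
qed

lemma pair_code_dest: "snd p \<le> D \<Longrightarrow> pair_code p div (D + 1) = fst p" "snd p \<le> D \<Longrightarrow> pair_code p mod (D + 1) = snd p"
  by (simp_all add: pair_code_def div_mult_self3 del: div_mult_self1 mod_mult_self1 add_Suc_right)

lemma pair_code_less:
  assumes "fst p \<le> 2 * m" "snd p \<le> D" shows "pair_code p < (2 * m + 1) * (D + 1)"
proof -
  have "Suc (fst p) * (D + 1) \<le> (2 * m + 1) * (D + 1)" using assms by (intro mult_le_mono1) simp
  then show ?thesis using assms unfolding pair_code_def mult_Suc by linarith
qed

lemma run_ok:
  "fst p \<le> 2 * m \<Longrightarrow> snd p \<le> D \<Longrightarrow> set w \<subseteq> {..<G + 2 + 2 * m} \<Longrightarrow> fst (level_run p w) \<le> 2 * m \<and> snd (level_run p w) \<le> D"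
  by (induction w arbitrary: p) (auto simp: level_step_ok)

lemma prog_run:
  "fst p \<le> 2 * m \<Longrightarrow> snd p \<le> D \<Longrightarrow> set w \<subseteq> {..<G + 2 + 2 * m} \<Longrightarrow> foldl (step prog) (pair_code p) w = pair_code (level_run p w)"
proof (induction w arbitrary: p)
  case (Cons a w)
  have "step prog (pair_code p) a = pair_code (level_step p a)"
    using pair_code_dest[OF Cons.prems(2)] by (simp add: prog_def)
  then show ?case using Cons.IH[of "level_step p a"] Cons.prems level_step_ok[OF Cons.prems(1,2), of a] by simp
qed simp

lemma prog_reach: "set w \<subseteq> {..<G + 2 + 2 * m} \<Longrightarrow> reach prog w = pair_code (level_run (0, 0) w)"
  using prog_run[of "(0, 0)" w] by (simp add: reach_def prog_def pair_code_def)

lemma pair_code_eq_iff: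
  assumes "snd p \<le> D" "snd p' \<le> D" shows "pair_code p = pair_code p' \<longleftrightarrow> p = p'"
  using pair_code_dest[OF assms(1)] pair_code_dest[OF assms(2)] by (metis prod.expand)

lemma prog_accepts: "set w \<subseteq> {..<G + 2 + 2 * m} \<Longrightarrow> dfa_accepts prog w \<longleftrightarrow> good (level_run (0, 0) w)"
  using prog_reach[of w] run_ok[of "(0, 0)" w] pair_code_less[of "level_run (0, 0) w"] pair_code_dest[of "level_run (0, 0) w"]
  by (simp add: dfa_accepts_def prog_def good_def)

lemma level_fdfa_simps [simp]:
  "alph level_fdfa = G + 2 + 2 * m" "progress_at level_fdfa u = prog" "progress level_fdfa q = prog"
  "nstates (leading level_fdfa) = 1" "init (leading level_fdfa) = 0" "step (leading level_fdfa) q a = 0"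
  by (simp_all add: level_fdfa_def progress_at_def)

lemma level_normalized: "normalized level_fdfa u v"
proof -
  have "reach (leading level_fdfa) w = 0" for w by (induction w rule: rev_induct) (simp_all add: reach_def)
  then show ?thesis by (simp add: normalized_def)
qed

lemma wf_level_fdfa: "wf_fdfa level_fdfa"
proof -
  have "step prog z a < (2 * m + 1) * (D + 1)" if "z < (2 * m + 1) * (D + 1)" "a < G + 2 + 2 * m" for z a
  proof -
    have "z div (D + 1) < 2 * m + 1" using that(1) by (rule less_mult_imp_div_less)
    moreover have "z mod (D + 1) < D + 1" by simp
    ultimately have "fst (z div (D + 1), z mod (D + 1)) \<le> 2 * m" "snd (z div (D + 1), z mod (D + 1)) \<le> D"
      by (simp_all only: fst_conv snd_conv)
    from pair_code_less[OF level_step_ok[OF this that(2)]] show ?thesis by (simp add: prog_def)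
  qed
  then show ?thesis by (auto simp: wf_fdfa_def wf_dts_def wf_dfa_def prog_def)
qed

text \<open>Powers of equal length of two periods of the same word are rotations of each other.
  Taking powers does not change the states reached, because both decompositions are duo-normalized,
  and \<open>good_rotate\<close> transfers acceptance.\<close>

lemma saturated_level_fdfa: "saturated level_fdfa"
proof -
  have core: "dfa_accepts prog y'" if
    d: "decomposition (G + 2 + 2 * m) x y w" "reach prog (y @ y) = reach prog y"
       "decomposition (G + 2 + 2 * m) x' y' w" "reach prog (y' @ y') = reach prog y'" and acc: "dfa_accepts prog y"
    for w x y x' y'
  proof -
    have m: "set y \<subseteq> {..<G + 2 + 2 * m}" "set y' \<subseteq> {..<G + 2 + 2 * m}" "y \<noteq> []" "y' \<noteq> []"
      using d by (auto simp: decomposition_def)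
    have idem: "level_run (level_run (0, 0) v) v = level_run (0, 0) v"
      if "set v \<subseteq> {..<G + 2 + 2 * m}" "reach prog (v @ v) = reach prog v" for v
    proof -
      have "pair_code (level_run (0, 0) (v @ v)) = pair_code (level_run (0, 0) v)"
        using prog_reach[of "v @ v"] prog_reach[of v] that by simp
      moreover have "snd (level_run (0, 0) (v @ v)) \<le> D" "snd (level_run (0, 0) v) \<le> D"
        using run_ok[of "(0, 0)" "v @ v"] run_ok[of "(0, 0)" v] that(1) by simp_all
      ultimately show ?thesis using pair_code_eq_iff by (metis foldl_append)
    qed
    have pow: "level_run (0, 0) (rep n v) = level_run (0, 0) v \<and> level_run (level_run (0, 0) v) (rep n v) = level_run (0, 0) v"
      if "level_run (level_run (0, 0) v) v = level_run (0, 0) v" "0 < n" for n v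
    proof -
      have "level_run (level_run (0, 0) v) (rep k v) = level_run (0, 0) v" for k by (induction k) (simp_all add: that(1))
      then show ?thesis using that by (cases n) simp_all
    qed
    let ?y = "rep (length y') y" and ?y' = "rep (length y) y'"
    have 1: "level_run (0, 0) ?y = level_run (0, 0) y \<and> level_run (level_run (0, 0) y) ?y = level_run (0, 0) y"
      by (rule pow[OF idem[OF m(1) d(2)]]) (use m in simp)
    have 2: "level_run (0, 0) ?y' = level_run (0, 0) y' \<and> level_run (level_run (0, 0) y') ?y' = level_run (0, 0) y'"
      by (rule pow[OF idem[OF m(2) d(4)]]) (use m in simp)
    have "x \<frown> ?y\<^sup>\<omega> = x' \<frown> ?y'\<^sup>\<omega>"
      using d(1,3) m iter_rep[of "length y'" y] iter_rep[of "length y" y'] by (simp add: decomposition_def)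
    moreover have "length ?y = length ?y'" by (simp add: length_rep mult.commute)
    moreover have "?y \<noteq> []" using m length_rep[of "length y'" y] by fastforce
    ultimately obtain \<alpha> \<beta> where "?y = \<alpha> @ \<beta>" "?y' = \<beta> @ \<alpha>" using iter_rotate by blast
    then have "good (level_run (0, 0) y')"
      using 1 2 acc prog_accepts[OF m(1)] good_rotate[of \<beta> \<alpha> "level_run (0, 0) y'" "level_run (0, 0) y"] by simp
    then show ?thesis using prog_accepts[OF m(2)] by simp
  qed
  show ?thesis unfolding saturated_def duo_normalized_def level_fdfa_simps using core by blast
qed

end

context monitors begin

section \<open>Chains of the levelled family\<close>

lemma mrun_simps [simp]: "mrun c z [] = z" "mrun c z (a # w) = mrun c (if z = 0 then 0 else mon c (z - 1) a) w"
  by (simp_all add: mrun_def)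

lemma mrun_0 [simp]: "mrun c 0 w = 0"
  by (induction w) simp_all

lemma level_run_monitor:
  "odd l \<Longrightarrow> set w \<subseteq> {..<G} \<Longrightarrow> mrun (l div 2) r w \<noteq> 0 \<Longrightarrow> level_run (l, r) w = (l, mrun (l div 2) r w)"
proof (induction w arbitrary: r)
  case (Cons a w)
  let ?r = "mon (l div 2) (r - 1) a"
  have r: "r \<noteq> 0" "mrun (l div 2) ?r w \<noteq> 0" using Cons.prems(3) by (auto split: if_splits)
  then have "?r \<noteq> 0" by (metis mrun_0)
  then have "level_step (l, r) a = (l, ?r)" using Cons.prems r by (simp add: level_step_def)
  then show ?case using Cons.IH[of ?r] Cons.prems r by simp
qed simp

lemma level_run_separator:
  assumes "odd l" "set w \<subseteq> {..<G}" "macc (l div 2) w" "r = 0 \<or> acc (r - 1)"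
  shows "level_run (l, r) (G # w) = (l, mrun (l div 2) (Suc (ini (l div 2))) w)"
proof -
  have "level_step (l, r) G = (l, Suc (ini (l div 2)))" using assms by (simp add: level_step_def)
  then show ?thesis using level_run_monitor[OF assms(1,2)] assms(3) by (simp add: macc_def)
qed

lemma fdfa_chain_if_macc:
  assumes w: "set w \<subseteq> {..<G}" "\<And>c. c < m \<Longrightarrow> macc c w"
  shows "\<exists>u e. fdfa_chain level_fdfa (2 * m + 1) False u e"
proof -
  \<comment> \<open>Word \<open>i\<close> raises the level to \<open>i\<close> and, for odd
    \<open>i\<close>, runs one check. On a higher level only the check has an effect, and it
    succeeds there as well, since all monitors accept the same \<open>w\<close>.\<close>
  define e where "e i = (G + 1 + i) # (if odd i then G # w else [])" for i
  define s where "s i = (i, if odd i then mrun (i div 2) (Suc (ini (i div 2))) w else 0)" for i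
  have c: "macc (i div 2) w" if "odd i" "i < 2 * m + 1" for i using that by (intro w(2)) (auto elim!: oddE)
  have up: "level_run (j, r) (e i) = s i" if "j < i" "i < 2 * m + 1" for i j r
  proof -
    have "level_step (j, r) (G + 1 + i) = (i, 0)" using that by (simp add: level_step_def)
    then show ?thesis using level_run_separator[OF _ w(1) c[OF _ that(2)], of 0] that by (simp add: e_def s_def)
  qed
  have stay: "level_run (s j) (e i) = s j" if "i \<le> j" "j < 2 * m + 1" for i j
  proof -
    have l: "level_step (s j) (G + 1 + i) = s j" using that by (simp add: level_step_def s_def)
    show ?thesis
    proof (cases "odd j")
      case True
      have "level_run (s j) (G # w) = s j"
        using level_run_separator[OF True w(1) c[OF True that(2)], of "snd (s j)"] c[OF True that(2)] True
        by (simp add: s_def macc_def)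
      then show ?thesis using l by (simp add: e_def)
    next
      case False
      have all: "level_run (s j) v = s j" if "set v \<subseteq> {..G}" for v
        using that False by (induction v) (auto simp: s_def level_step_def)
      have "level_run (s j) (G # w) = s j" by (rule all) (use w(1) in auto)
      then show ?thesis using l by (simp add: e_def)
    qed
  qed
  have s0: "s 0 = (0, 0)" by (simp add: s_def)
  have start: "level_run (0, 0) (e i) = s i" if "i < 2 * m + 1" for i
    using up[of 0 i 0] stay[of 0 0] that s0 by (cases "i = 0") simp_all
  have m: "set (e i) \<subseteq> {..<G + 2 + 2 * m}" if "i < 2 * m + 1" for i
    using that w(1) by (auto simp: e_def)
  have acc: "dfa_accepts prog (e i) \<longleftrightarrow> odd i" if i: "i < 2 * m + 1" for i
    using prog_accepts[OF m[OF i]] start[OF i] c[OF _ i] by (auto simp: good_def s_def macc_def)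
  have "level_run (0, 0) (e i @ e j) = level_run (0, 0) (e (max i j))" if i: "i < 2 * m + 1" and j: "j < 2 * m + 1" for i j
  proof (cases "i < j")
    case True
    then show ?thesis using start[OF i] start[OF j] up[OF True j] by (simp add: s_def max_def)
  next
    case False
    then show ?thesis using start[OF i] stay[of j i] i by (simp add: max_def)
  qed
  then have "reach prog (e i @ e j) = reach prog (e (max i j))" if "i < 2 * m + 1" "j < 2 * m + 1" for i j
    using prog_reach m that by (simp add: max_def)
  moreover have "e i \<noteq> []" for i by (simp add: e_def)
  ultimately have "fdfa_chain level_fdfa (2 * m + 1) False [] e"
    unfolding fdfa_chain_def using m acc level_normalized by simp
  then show ?thesis by blast
qed

lemma level_run_unsynced: "snd p = 0 \<Longrightarrow> G \<notin> set v \<Longrightarrow> snd (level_run p v) = 0"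
proof (induction v arbitrary: p)
  case (Cons a v)
  then have "snd (level_step p a) = 0" by (simp add: level_step_def)
  then show ?case using Cons by simp
qed simp

lemma level_run_synced:
  "good z \<Longrightarrow> fst (level_run z v) = fst z \<Longrightarrow> G \<notin> set v \<Longrightarrow>
    level_run z v = (fst z, mrun (fst z div 2) (snd z) (filter (\<lambda>a. a < G) v))"
proof (induction v arbitrary: z)
  case (Cons a v)
  note l = run_step_level[OF Cons.prems(2)]
  have s: "fst (level_step z a) = fst z" and r: "fst (level_run (level_step z a) v) = fst (level_step z a)" using l by blast+
  have IH: "level_run (level_step z a) v = (fst (level_step z a), mrun (fst (level_step z a) div 2) (snd (level_step z a)) (filter (\<lambda>a. a < G) v))"
    by (rule Cons.IH[OF good_step[OF Cons.prems(1) s] r]) (use Cons.prems(3) in simp)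
  have z: "snd z \<noteq> 0" using Cons.prems(1) by (simp add: good_def)
  show ?case using Cons.prems(1) s
  proof (cases rule: stay_cases)
    case 1
    then show ?thesis using IH by simp
  next
    case 2
    then show ?thesis using Cons.prems(3) by simp
  next
    case 3
    then show ?thesis using IH z by simp
  qed
qed simp

text \<open>A good state stays good as long as its level does, so the element between two good ones
  costs a level. The levels of both good elements being odd, their halves differ.\<close>

lemma fdfa_chain_levels:
  assumes ch: "fdfa_chain level_fdfa k b u e"
  defines "p \<equiv> \<lambda>i. level_run (0, 0) (e i)"
  shows "\<And>i. i < k \<Longrightarrow> good (p i) \<longleftrightarrow> even i = b" "\<And>i j. i < k \<Longrightarrow> j < k \<Longrightarrow> level_run (p i) (e j) = p (max i j)"
    "\<And>i. i < k \<Longrightarrow> fst (p i) \<le> 2 * m"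
    "\<And>i. i + 2 < k \<Longrightarrow> even i = b \<Longrightarrow> fst (p i) div 2 < fst (p (i + 2)) div 2"
proof -
  have e: "set (e i) \<subseteq> {..<G + 2 + 2 * m}" "dfa_accepts prog (e i) \<longleftrightarrow> even i = b" if "i < k" for i
    using ch that by (auto simp: fdfa_chain_def)
  show g: "good (p i) \<longleftrightarrow> even i = b" if "i < k" for i
    using prog_accepts[OF e(1)[OF that]] e(2)[OF that] by (simp add: p_def)
  show pp: "level_run (p i) (e j) = p (max i j)" if "i < k" "j < k" for i j
  proof -
    have m: "set (e i @ e j) \<subseteq> {..<G + 2 + 2 * m}" "set (e (max i j)) \<subseteq> {..<G + 2 + 2 * m}"
      using e(1)[OF that(1)] e(1)[OF that(2)] by (auto simp: max_def)
    have "reach prog (e i @ e j) = reach prog (e (max i j))" using ch that by (simp add: fdfa_chain_def)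
    then have "pair_code (level_run (0, 0) (e i @ e j)) = pair_code (level_run (0, 0) (e (max i j)))"
      unfolding prog_reach[OF m(1)] prog_reach[OF m(2)] .
    then show ?thesis
      using pair_code_eq_iff[of "level_run (0, 0) (e i @ e j)" "level_run (0, 0) (e (max i j))"]
        run_ok[of "(0, 0)", OF _ _ m(1)] run_ok[of "(0, 0)", OF _ _ m(2)] by (simp add: p_def)
  qed
  show "fst (p i) \<le> 2 * m" if "i < k" for i
    using run_ok[of "(0, 0)", OF _ _ e(1)[OF that]] by (simp add: p_def)
  show "fst (p i) div 2 < fst (p (i + 2)) div 2" if i: "i + 2 < k" "even i = b" for i
  proof -
    have gi: "good (p i)" "\<not> good (p (i + 1))" "good (p (i + 2))" using g[of i] g[of "i + 1"] g[of "i + 2"] i by auto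
    have 1: "level_run (p i) (e (i + 1)) = p (i + 1)" "level_run (p (i + 1)) (e (i + 2)) = p (i + 2)"
      using pp[of i "i + 1"] pp[of "i + 1" "i + 2"] i by (simp_all add: max_def)
    have "fst (p i) \<noteq> fst (p (i + 1))" using good_run[OF gi(1), of "e (i + 1)"] 1(1) gi(2) by auto
    then have "fst (p i) < fst (p (i + 2))"
      using run_level_mono[of "p i" "e (i + 1)"] run_level_mono[of "p (i + 1)" "e (i + 2)"] 1 by simp
    moreover have "odd (fst (p i))" "odd (fst (p (i + 2)))" using gi by (simp_all add: good_def)
    ultimately show ?thesis by (auto elim!: oddE)
  qed
qed

text \<open>The chain would have \<open>m + 1\<close> accepting elements on different odd levels,
  but there are only \<open>m\<close> odd levels.\<close>

lemma no_fdfa_chain_True: "\<not> fdfa_chain level_fdfa (2 * m + 1) True u e"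
proof
  assume ch: "fdfa_chain level_fdfa (2 * m + 1) True u e"
  note p = fdfa_chain_levels[OF ch]
  have "c \<le> fst (level_run (0, 0) (e (2 * c))) div 2" if "c \<le> m" for c
    using that
  proof (induction c)
    case (Suc c)
    then show ?case using p(4)[of "2 * c"] by simp
  qed simp
  then have "m \<le> fst (level_run (0, 0) (e (2 * m))) div 2" by simp
  moreover have "odd (fst (level_run (0, 0) (e (2 * m))))" using p(1)[of "2 * m"] by (simp add: good_def)
  ultimately show False using p(3)[of "2 * m"] by (auto elim!: oddE)
qed

text \<open>The \<open>m\<close> accepting elements occupy the \<open>m\<close> odd levels, one
  each. By the chain equation the single word \<open>e 1\<close> loops on all of them, so every
  monitor accepts what stands between two consecutive separators of its repetition.\<close>

lemma macc_if_fdfa_chain: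
  assumes ch: "fdfa_chain level_fdfa (2 * m + 1) False u e"
  shows "\<exists>w. set w \<subseteq> {..<G} \<and> (\<forall>c<m. macc c w)"
proof (cases "m = 0")
  case False
  note p = fdfa_chain_levels[OF ch]
  let ?p = "\<lambda>i. level_run (0, 0) (e i)"
  have lower: "fst (?p (2 * c + 1)) div 2 + (c' - c) \<le> fst (?p (2 * c' + 1)) div 2" if "c \<le> c'" "c' < m" for c c'
    using that
  proof (induction c' rule: dec_induct)
    case (step n)
    then show ?case using p(4)[of "2 * n + 1"] by simp
  qed simp
  have odd: "odd (fst (?p (2 * c + 1)))" and g: "good (?p (2 * c + 1))" if "c < m" for c
    using p(1)[of "2 * c + 1"] that by (auto simp: good_def)
  have "fst (?p (2 * c + 1)) div 2 = c" if c: "c < m" for c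
  proof -
    have "x div 2 \<le> m - 1" if "x \<le> 2 * m" "odd x" for x
      using that by (auto elim!: oddE)
    from this[OF p(3) odd] have "fst (?p (2 * (m - 1) + 1)) div 2 \<le> m - 1" using False by simp
    moreover have "c \<le> m - 1" "m - 1 < m" using c by auto
    ultimately show ?thesis using lower[of 0 c] lower[of c "m - 1"] c by linarith
  qed
  then have lev: "fst (?p (2 * c + 1)) = 2 * c + 1" if "c < m" for c using odd[OF that] that by (metis odd_two_times_div_two_succ)
  let ?e = "e 1"
  \<comment> \<open>Without a separator the run would still be waiting, and its state would not be
    accepting.\<close>
  have "G \<in> set ?e"
  proof (rule ccontr)
    assume "G \<notin> set ?e"
    then have "snd (?p 1) = 0" by (intro level_run_unsynced) simp_all
    then show False using g[of 0] False by (simp add: good_def)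
  qed
  then obtain f h where fh: "?e = f @ G # h" by (meson split_list)
  have "G \<in> set (h @ f @ G # h)" by simp
  \<comment> \<open>\<open>v\<close> lies between two consecutive separators of
    \<open>e 1 @ e 1\<close> and may span the seam of the two copies.\<close>
  then obtain v b where vb: "h @ f @ G # h = v @ G # b" "G \<notin> set v" by (meson split_list_first)
  have ee: "?e @ ?e = f @ G # v @ G # b" using fh vb(1) by simp
  define w where "w = filter (\<lambda>a. a < G) v"
  have "macc c w" if c: "c < m" for c
  proof -
    let ?z = "?p (2 * c + 1)"
    have "level_run ?z ?e = ?z" using p(2)[of "2 * c + 1" 1] c by (simp add: max_def)
    then have loop: "level_run ?z (f @ G # v @ G # b) = ?z" unfolding ee[symmetric] by simp
    define z1 where "z1 = level_run ?z f"
    define z2 where "z2 = level_step z1 G"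
    define z3 where "z3 = level_run z2 v"
    define z4 where "z4 = level_step z3 G"
    have z5: "level_run z4 b = ?z" using loop by (simp add: z1_def z2_def z3_def z4_def)
    have le: "fst ?z \<le> fst z1" "fst z1 \<le> fst z2" "fst z2 \<le> fst z3" "fst z3 \<le> fst z4" "fst z4 \<le> fst ?z"
      using run_level_mono[of ?z f] level_mono[of z1 G] run_level_mono[of z2 v] level_mono[of z3 G] run_level_mono[of z4 b] z5
      by (simp_all only: z1_def z2_def z3_def z4_def)
    then have f: "fst z1 = fst ?z" "fst z2 = fst z1" "fst z3 = fst z2" "fst z4 = fst z3" by linarith+
    have g1: "good z1" unfolding z1_def by (rule good_run[OF g[OF c]]) (use f(1) z1_def in simp)
    have z2: "z2 = (2 * c + 1, Suc (ini c))" unfolding z2_def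
      using g1 f(2)[unfolded z2_def] by (cases rule: stay_cases) (use f(1) lev[OF c] in simp_all)
    have g2: "good z2" unfolding z2 by (simp add: good_def)
    have z3: "z3 = (2 * c + 1, mrun c (Suc (ini c)) w)"
      using level_run_synced[OF g2 f(3)[unfolded z3_def] vb(2)] unfolding z3_def[symmetric] by (simp add: z2 w_def)
    have g3: "good z3" unfolding z3_def by (rule good_run[OF g2]) (use f(3) z3_def in simp)
    have "acc (snd z3 - 1)"
      using g3 f(4)[unfolded z4_def] by (cases rule: stay_cases) simp_all
    then show ?thesis using g3 unfolding z3 by (simp add: macc_def good_def)
  qed
  moreover have "set w \<subseteq> {..<G}" by (auto simp: w_def)
  ultimately show ?thesis by blast
qed (auto intro: exI[of _ "[]"])

theorem level_fdfa_position:
  "wagner_position (alph level_fdfa) (fdfa_language level_fdfa) Minus (2 * m + 1) \<longleftrightarrow>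
    (\<exists>w. set w \<subseteq> {..<G} \<and> (\<forall>c<m. macc c w))"
proof -
  have k: "0 < 2 * m + 1" by simp
  show ?thesis
    unfolding fdfa_position_iff[OF wf_level_fdfa saturated_level_fdfa k]
      has_chain_iff_fdfa_chain[OF wf_level_fdfa saturated_level_fdfa] wsign.case
    using no_fdfa_chain_True fdfa_chain_if_macc macc_if_fdfa_chain by blast
qed

end

section \<open>Monitors for a computation in bounded space\<close>

lemma digits_exist:
  fixes S :: nat
  assumes "\<And>i. i < K \<Longrightarrow> f i < S"
  shows "\<exists>g. g div S ^ K = q \<and> (\<forall>i<K. g div S ^ i mod S = f i)"
  using assms
proof (induction K arbitrary: q)
  case (Suc K)
  obtain g where g: "g div S ^ K = q * S + f K" "\<forall>i<K. g div S ^ i mod S = f i"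
    using Suc.IH[of "q * S + f K"] Suc.prems by auto
  have "g div S ^ Suc K = g div S ^ K div S" by (simp add: div_mult2_eq[symmetric] mult.commute)
  then have "g div S ^ Suc K = q" using g(1) Suc.prems[of K] by simp
  moreover have "g div S ^ i mod S = f i" if "i < Suc K" for i
    using that g Suc.prems[of K] by (cases "i = K") simp_all
  ultimately show ?case by blast
qed simp

text \<open>Halting states get idle transitions, so that every step, also after halting, is
  described by one letter.\<close>

definition tdelta :: "tm \<Rightarrow> nat \<Rightarrow> nat list \<Rightarrow> nat \<times> (nat \<times> int) list" where
  "tdelta M q ss = (if q = 1 \<or> q = 2 then (q, map (\<lambda>s. (s, 0)) ss) else tm_delta M q ss)"

definition let_state :: "tm \<Rightarrow> nat \<Rightarrow> nat" where "let_state M g = g div tm_symbols M ^ tm_tapes M"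
definition let_sym :: "tm \<Rightarrow> nat \<Rightarrow> nat \<Rightarrow> nat" where "let_sym M g i = g div tm_symbols M ^ i mod tm_symbols M"
definition let_delta :: "tm \<Rightarrow> nat \<Rightarrow> nat \<times> (nat \<times> int) list" where
  "let_delta M g = tdelta M (let_state M g) (map (let_sym M g) [0..<tm_tapes M])"
definition let_next :: "tm \<Rightarrow> nat \<Rightarrow> nat" where "let_next M g = fst (let_delta M g)"
definition let_write :: "tm \<Rightarrow> nat \<Rightarrow> nat \<Rightarrow> nat" where "let_write M g i = fst (snd (let_delta M g) ! i)"
definition let_move :: "tm \<Rightarrow> nat \<Rightarrow> nat \<Rightarrow> nat" where "let_move M g i = nat (snd (snd (let_delta M g) ! i) + 1)"

text \<open>
  Monitor \<open>i * (2 * B + 1) + j\<close> watches cell \<open>j - B\<close> of tape \<open>i\<close>: it knows the machine state, the position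
  of the head on tape \<open>i\<close> and the content of the cell. A letter announces the machine state and the
  symbols read on all tapes; \<open>let_move\<close> is the head movement plus \<open>1\<close>.
\<close>

definition cell_mon :: "tm \<Rightarrow> nat \<Rightarrow> nat \<Rightarrow> nat \<Rightarrow> nat \<Rightarrow> nat" where
  "cell_mon M B c d g = (let S = tm_symbols M; H = 2 * B + 1; i = c div H; j = c mod H;
     y = d mod S; h = d div S mod H; q = d div S div H; h' = h + let_move M g i in
     if q = let_state M g \<and> (h = j \<longrightarrow> y = let_sym M g i) \<and> 0 < h' \<and> h' \<le> H
     then Suc ((let_next M g * H + (h' - 1)) * S + (if h = j then let_write M g i else y)) else 0)"

definition cell_ini :: "tm \<Rightarrow> nat \<Rightarrow> bool list \<Rightarrow> nat \<Rightarrow> nat" where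
  "cell_ini M B x c = B * tm_symbols M + (if c div (2 * B + 1) = 0 \<and> B \<le> c mod (2 * B + 1)
     then string_content x (int (c mod (2 * B + 1) - B)) else 0)"

definition cell_acc :: "tm \<Rightarrow> nat \<Rightarrow> nat \<Rightarrow> bool" where
  "cell_acc M B d \<longleftrightarrow> d div tm_symbols M div (2 * B + 1) = 1"

locale tm_monitors =
  fixes M :: tm and B :: nat and x :: "bool list"
  assumes wfM: "wf_tm M" and heads: "\<And>t c h. (c, h) \<in> set (snd (tm_conf M x t)) \<Longrightarrow> \<bar>h\<bar> \<le> int B"
begin

abbreviation "K \<equiv> tm_tapes M"
abbreviation "Q \<equiv> tm_states M"
abbreviation "S \<equiv> tm_symbols M"
abbreviation "H \<equiv> 2 * B + 1"
abbreviation "N \<equiv> K * H"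
abbreviation "D \<equiv> Q * H * S"
abbreviation "G \<equiv> Q * S ^ K"

definition enc :: "nat \<Rightarrow> nat \<Rightarrow> nat \<Rightarrow> nat" where "enc q h y = (q * H + h) * S + y"

lemma sizes: "0 < K" "3 \<le> Q" "3 \<le> S"
  using wfM by (simp_all add: wf_tm_def)

lemma enc_dest:
  assumes "h < H" "y < S"
  shows "enc q h y mod S = y" "enc q h y div S mod H = h" "enc q h y div S div H = q"
proof -
  have d: "enc q h y div S = q * H + h" "enc q h y mod S = y"
    using assms(2) unfolding enc_def by simp_all
  have "(q * h' + h) mod h' = h \<and> (q * h' + h) div h' = q" if "h < h'" for h' :: nat using that by simp
  from this[OF assms(1)] d show "enc q h y mod S = y" "enc q h y div S mod H = h" "enc q h y div S div H = q"
    by (simp_all only:)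
qed

lemma enc_less:
  assumes "q < Q" "h < H" "y < S" shows "enc q h y < D"
proof -
  have "Suc q * H \<le> Q * H" using assms(1) by (intro mult_le_mono1) simp
  then have "Suc (q * H + h) * S \<le> Q * H * S" using assms(2) by (intro mult_le_mono1) simp
  then show ?thesis using assms(3) unfolding enc_def mult_Suc by linarith
qed

lemma tdelta_props:
  assumes "q < Q" "length ss = K" "set ss \<subseteq> {..<S}"
  shows "fst (tdelta M q ss) < Q" "length (snd (tdelta M q ss)) = K"
    "set (snd (tdelta M q ss)) \<subseteq> {..<S} \<times> {-1, 0, 1}"
  using assms wfM by (auto simp: tdelta_def wf_tm_def)

definition valid :: "config \<Rightarrow> bool" where
  "valid C \<longleftrightarrow> fst C < Q \<and> length (snd C) = K \<and> (\<forall>(c, h)\<in>set (snd C). (\<forall>p. c p < S))"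

lemma valid_read: "valid (q, ts) \<Longrightarrow> length (map read_tape ts) = K \<and> set (map read_tape ts) \<subseteq> {..<S}"
  by (force simp: valid_def)

lemma step_tdelta:
  "tm_step M (q, ts) = (fst (tdelta M q (map read_tape ts)), map2 act_tape ts (snd (tdelta M q (map read_tape ts))))"
proof -
  have "map2 act_tape ts (map (\<lambda>s. (s, 0)) (map read_tape ts)) = ts"
  proof (rule nth_equalityI)
    fix i assume "i < length (map2 act_tape ts (map (\<lambda>s. (s, 0)) (map read_tape ts)))"
    then show "map2 act_tape ts (map (\<lambda>s. (s, 0)) (map read_tape ts)) ! i = ts ! i"
      by (cases "ts ! i") simp
  qed simp
  then show ?thesis by (auto simp: tdelta_def split_beta)
qed

lemma valid_step: "valid C \<Longrightarrow> valid (tm_step M C)"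
proof -
  assume v: "valid C"
  obtain q ts where C: "C = (q, ts)" by (cases C)
  note r = valid_read[OF v[unfolded C]]
  have q: "q < Q" using v by (simp add: C valid_def)
  note p = tdelta_props[OF q conjunct1[OF r] conjunct2[OF r]]
  let ?as = "snd (tdelta M q (map read_tape ts))"
  have st: "\<forall>p. c' p < S" if m: "(c', h') \<in> set (map2 act_tape ts ?as)" for c' h'
  proof -
    obtain c h s d where tp: "(c, h) \<in> set ts" "(s, d) \<in> set ?as" "c' = c(h := s)"
      using m by (fastforce dest: set_zip_leftD set_zip_rightD)
    have "\<forall>p. c p < S" using v tp(1) by (auto simp: C valid_def)
    moreover have "s < S" using p(3) tp(2) by auto
    ultimately show ?thesis by (simp add: tp(3))
  qed
  have "length ts = K" using v by (simp add: C valid_def)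
  moreover have "\<forall>y\<in>set (map2 act_tape ts ?as). case y of (c, h) \<Rightarrow> \<forall>p. c p < S"
  proof (intro ballI, split prod.split, intro allI impI)
    fix y c h assume "y \<in> set (map2 act_tape ts ?as)" "y = (c, h)"
    then show "c p < S" for p using st[of c h] by simp
  qed
  ultimately show ?thesis unfolding C step_tdelta valid_def fst_conv snd_conv using p(1,2) by simp
qed

lemma valid_conf: "valid (tm_conf M x t)"
proof (induction t)
  case 0
  show ?case using sizes by (auto simp: tm_conf_def tm_init_def valid_def string_content_def)
next
  case (Suc t)
  then show ?case using valid_step by (simp add: tm_conf_def)
qed

lemma let_props:
  assumes "g < G"
  shows "let_next M g < Q" "\<And>i. i < K \<Longrightarrow> let_write M g i < S"
proof -
  have "let_state M g < Q" unfolding let_state_def using assms by (rule less_mult_imp_div_less)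
  moreover have "set (map (let_sym M g) [0..<K]) \<subseteq> {..<S}" using sizes by (auto simp: let_sym_def)
  ultimately have p: "fst (let_delta M g) < Q" "length (snd (let_delta M g)) = K"
    "set (snd (let_delta M g)) \<subseteq> {..<S} \<times> {-1, 0, 1}"
    unfolding let_delta_def by (simp_all add: tdelta_props)
  show "let_next M g < Q" using p(1) by (simp add: let_next_def)
  show "let_write M g i < S" if "i < K" for i
  proof -
    have "snd (let_delta M g) ! i \<in> {..<S} \<times> {-1, 0, 1}" using p(2,3) that nth_mem by (metis subsetD)
    then show ?thesis by (auto simp: let_write_def)
  qed
qed

lemma letter_exists:
  assumes "q < Q" "length ss = K" "set ss \<subseteq> {..<S}"
  shows "\<exists>g<G. let_state M g = q \<and> map (let_sym M g) [0..<K] = ss"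
proof -
  obtain g where g: "g div S ^ K = q" "\<forall>i<K. g div S ^ i mod S = ss ! i"
    using digits_exist[of K "\<lambda>i. ss ! i" S q] assms(2,3) by (auto simp: subset_iff)
  have "g < G" using g(1) assms(1) sizes by (simp add: div_less_iff_less_mult[symmetric])
  moreover have "map (let_sym M g) [0..<K] = ss" using g(2) assms(2) by (intro nth_equalityI) (simp_all add: let_sym_def)
  ultimately show ?thesis using g(1) by (auto simp: let_state_def)
qed

sublocale monitors N D G "cell_ini M B x" "cell_acc M B" "cell_mon M B"
proof
  have s: "string_content x i < S" "0 < S" for i using sizes by (simp_all add: string_content_def)
  show "cell_ini M B x c < D" for c
    using enc_less[of 0 B] s sizes by (simp add: cell_ini_def enc_def)
  fix c d g assume c: "c < N" and d: "d < D" and g: "g < G"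
  have "c div H < K" using c by (rule less_mult_imp_div_less)
  note let_props(2)[OF g this]
  moreover have "d mod S < S" using sizes by simp
  moreover have "(let_next M g * H + (h' - 1)) * S + y < D" if "0 < h'" "h' \<le> H" "y < S" for h' y
    using enc_less[OF let_props(1)[OF g], of "h' - 1" y] that by (simp add: enc_def)
  ultimately show "cell_mon M B c d g \<le> D" by (auto simp: cell_mon_def Let_def Suc_le_eq)
qed

definition proj :: "config \<Rightarrow> nat \<Rightarrow> nat" where
  "proj C c = (case snd C ! (c div H) of (ct, h) \<Rightarrow> enc (fst C) (nat (h + int B)) (ct (int (c mod H) - int B)))"

lemma proj_dest:
  assumes v: "valid C" and c: "c < N" and h: "\<forall>(ct, h)\<in>set (snd C). \<bar>h\<bar> \<le> int B" and i: "snd C ! (c div H) = (ct, h)"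
  shows "proj C c mod S = ct (int (c mod H) - int B)" "proj C c div S mod H = nat (h + int B)"
    "proj C c div S div H = fst C" "\<bar>h\<bar> \<le> int B" "read_tape (snd C ! (c div H)) = ct h"
proof -
  have "c div H < K" using c by (rule less_mult_imp_div_less)
  then have m: "(ct, h) \<in> set (snd C)" using v i nth_mem[of "c div H" "snd C"] by (simp add: valid_def)
  show hB: "\<bar>h\<bar> \<le> int B" using h m by auto
  have "ct p < S" for p using v m by (auto simp: valid_def)
  moreover have "nat (h + int B) < H" using hB by auto
  ultimately show "proj C c mod S = ct (int (c mod H) - int B)" "proj C c div S mod H = nat (h + int B)"
    "proj C c div S div H = fst C"
    unfolding proj_def i prod.case by (simp_all only: enc_dest)
  show "read_tape (snd C ! (c div H)) = ct h" unfolding i by simp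
qed

lemma proj_step:
  assumes C: "C = tm_conf M x t" and g: "let_state M g = fst C" "map (let_sym M g) [0..<K] = map read_tape (snd C)" and c: "c < N"
  shows "cell_mon M B c (proj C c) g = Suc (proj (tm_conf M x (Suc t)) c)"
proof -
  let ?i = "c div H" and ?j = "c mod H" and ?C' = "tm_conf M x (Suc t)"
  have v: "valid C" "valid ?C'" using valid_conf by (simp_all add: C)
  have i: "?i < K" using c by (rule less_mult_imp_div_less)
  obtain ct h where ch: "snd C ! ?i = (ct, h)" by fastforce
  have hd: "\<forall>(ct, h)\<in>set (snd C). \<bar>h\<bar> \<le> int B" using heads[of _ _ t] by (auto simp: C)
  have hd': "\<forall>(ct, h)\<in>set (snd ?C'). \<bar>h\<bar> \<le> int B" using heads[of _ _ "Suc t"] by auto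
  note p = proj_dest[OF v(1) c hd ch]
  have td: "let_delta M g = tdelta M (fst C) (map read_tape (snd C))" by (simp add: let_delta_def g)
  have C': "?C' = (let_next M g, map2 act_tape (snd C) (snd (let_delta M g)))"
    using step_tdelta[of "fst C" "snd C"] by (simp add: tm_conf_def C td let_next_def)
  have l: "length (snd C) = K" "length (snd (let_delta M g)) = K" "set (snd (let_delta M g)) \<subseteq> {..<S} \<times> {-1, 0, 1}"
    using v(1) tdelta_props[of "fst C" "map read_tape (snd C)"] valid_read[of "fst C" "snd C"] by (auto simp: valid_def td)
  obtain s d where sd: "snd (let_delta M g) ! ?i = (s, d)" by fastforce
  have "(s, d) \<in> {..<S} \<times> {-1, 0, 1}" using l(2,3) i sd nth_mem by (metis subsetD)
  then have d: "d \<in> {-1, 0, 1}" by blast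
  have ch': "snd ?C' ! ?i = (ct(h := s), h + d)" unfolding C' using l(1,2) i ch sd by simp
  note p' = proj_dest[OF v(2) c hd' ch']
  have move: "let_move M g ?i = nat (d + 1)" "let_write M g ?i = s" unfolding let_move_def let_write_def sd by simp_all
  have sy: "let_sym M g ?i = ct h"
  proof -
    have "map (let_sym M g) [0..<K] ! ?i = map read_tape (snd C) ! ?i" by (simp only: g(2))
    then show ?thesis using i l(1) ch by simp
  qed
  have "0 \<le> h + int B" using p(4) by linarith
  then have hj: "nat (h + int B) = ?j \<longleftrightarrow> int ?j - int B = h" by linarith
  have h': "nat (h + int B) + nat (d + 1) - 1 = nat (h + d + int B)" "0 < nat (h + int B) + nat (d + 1)"
    "nat (h + int B) + nat (d + 1) \<le> H"
    using p(4) p'(4) d by auto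
  have "proj ?C' c = enc (let_next M g) (nat (h + d + int B)) (if nat (h + int B) = ?j then s else ct (int ?j - int B))"
    unfolding proj_def ch' using hj by (auto simp: C')
  then show ?thesis
    unfolding cell_mon_def Let_def p(1-3) move sy h'(1) using g(1) hj h'(2,3) by (auto simp: enc_def)
qed

lemma cell_monD:
  assumes "cell_mon M B c d g \<noteq> 0"
  shows "d div S div H = let_state M g" "d div S mod H = c mod H \<Longrightarrow> d mod S = let_sym M g (c div H)"
  using assms unfolding cell_mon_def Let_def by (auto split: if_splits)

text \<open>Together the monitors determine the letter: each of them knows the machine state, and
  for every tape the monitor of the cell under the head knows the symbol read.\<close>

lemma mon_letter:
  assumes C: "C = tm_conf M x t" and g: "\<And>c. c < N \<Longrightarrow> cell_mon M B c (proj C c) g \<noteq> 0"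
  shows "let_state M g = fst C" "map (let_sym M g) [0..<K] = map read_tape (snd C)"
proof -
  have v: "valid C" using valid_conf by (simp add: C)
  have hd: "\<forall>(ct, h)\<in>set (snd C). \<bar>h\<bar> \<le> int B" using heads[of _ _ t] by (auto simp: C)
  have "0 < N" using sizes by simp
  then show "let_state M g = fst C"
    using cell_monD(1)[OF g[of 0]] proj_dest(3)[OF v _ hd, of 0] by (cases "snd C ! 0") simp
  show "map (let_sym M g) [0..<K] = map read_tape (snd C)"
  proof (rule nth_equalityI)
    fix i assume "i < length (map (let_sym M g) [0..<K])"
    then have i: "i < K" by simp
    obtain ct h where ch: "snd C ! i = (ct, h)" by fastforce
    have l: "length (snd C) = K" using v by (simp add: valid_def)
    have hB: "\<bar>h\<bar> \<le> int B" using hd nth_mem[of i "snd C"] i l ch by auto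
    let ?c = "i * H + nat (h + int B)"
    have n: "nat (h + int B) < H" using hB by auto
    have "(i * h' + b) mod h' = b \<and> (i * h' + b) div h' = i" if "b < h'" for b h' :: nat using that by simp
    from this[OF n] have dm: "?c div H = i" "?c mod H = nat (h + int B)" by blast+
    have "Suc i * H \<le> K * H" using i by (intro mult_le_mono1) simp
    then have c: "?c < N" using n unfolding mult_Suc by linarith
    have ch': "snd C ! (?c div H) = (ct, h)" using ch dm(1) by simp
    note p = proj_dest[OF v c hd ch']
    have "proj C ?c div S mod H = ?c mod H" unfolding p(2) dm ..
    from cell_monD(2)[OF g[OF c] this] have "proj C ?c mod S = let_sym M g i" unfolding dm .
    moreover have "int (?c mod H) - int B = h" unfolding dm(2) using hB by simp
    ultimately show "map (let_sym M g) [0..<K] ! i = map read_tape (snd C) ! i" using p(1) i l ch by simp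
  qed (use v in \<open>simp add: valid_def\<close>)
qed

lemma proj_init: "c < N \<Longrightarrow> cell_ini M B x c = proj (tm_conf M x 0) c"
proof -
  assume "c < N"
  then have "c div H < K" by (rule less_mult_imp_div_less)
  then show ?thesis
    by (cases "c div H") (auto simp: cell_ini_def proj_def tm_conf_def tm_init_def enc_def string_content_def of_nat_diff)
qed

lemma mrun_append: "mrun c z (w @ [g]) = (if mrun c z w = 0 then 0 else cell_mon M B c (mrun c z w - 1) g)"
  by (simp add: mrun_def)

text \<open>As long as no monitor fails, each letter is forced to agree with the current
  configuration, so the word follows the computation.\<close>

lemma mrun_proj:
  "(\<forall>c<N. mrun c (Suc (cell_ini M B x c)) w \<noteq> 0) \<Longrightarrow>
    \<forall>c<N. mrun c (Suc (cell_ini M B x c)) w = Suc (proj (tm_conf M x (length w)) c)"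
proof (induction w rule: rev_induct)
  case Nil
  show ?case using proj_init by simp
next
  case (snoc g w)
  have nz: "mrun c (Suc (cell_ini M B x c)) w \<noteq> 0 \<and> cell_mon M B c (mrun c (Suc (cell_ini M B x c)) w - 1) g \<noteq> 0"
    if "c < N" for c
    using snoc.prems that by (auto simp: mrun_append split: if_splits)
  have IH: "mrun c (Suc (cell_ini M B x c)) w = Suc (proj (tm_conf M x (length w)) c)" if "c < N" for c
    using snoc.IH nz that by blast
  have "cell_mon M B c (proj (tm_conf M x (length w)) c) g \<noteq> 0" if "c < N" for c
    using nz[OF that] IH[OF that] by simp
  note l = mon_letter[OF refl this]
  show ?case using proj_step[OF refl l] by (simp add: mrun_append IH)
qed

lemma acc_proj:
  assumes "c < N" shows "cell_acc M B (proj (tm_conf M x t) c) \<longleftrightarrow> fst (tm_conf M x t) = 1"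
proof -
  have hd: "\<forall>(ct, h)\<in>set (snd (tm_conf M x t)). \<bar>h\<bar> \<le> int B" using heads[of _ _ t] by auto
  obtain ct h where ch: "snd (tm_conf M x t) ! (c div H) = (ct, h)" by fastforce
  show ?thesis unfolding cell_acc_def proj_dest(3)[OF valid_conf assms hd ch] ..
qed

lemma mrun_exists: "\<exists>w. set w \<subseteq> {..<G} \<and> (\<forall>c<N. mrun c (Suc (cell_ini M B x c)) w = Suc (proj (tm_conf M x t) c))"
proof (induction t)
  case 0
  show ?case using proj_init by (intro exI[of _ "[]"]) simp
next
  case (Suc t)
  obtain w where w: "set w \<subseteq> {..<G}" "\<forall>c<N. mrun c (Suc (cell_ini M B x c)) w = Suc (proj (tm_conf M x t) c)"
    using Suc.IH by blast
  let ?C = "tm_conf M x t"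
  have v: "valid (fst ?C, snd ?C)" using valid_conf by simp
  have q: "fst ?C < Q" using v by (simp add: valid_def)
  obtain g where g: "g < G" "let_state M g = fst ?C" "map (let_sym M g) [0..<K] = map read_tape (snd ?C)"
    using letter_exists[OF q conjunct1[OF valid_read[OF v]] conjunct2[OF valid_read[OF v]]] by blast
  show ?case using w g proj_step[OF refl g(2,3)] by (intro exI[of _ "w @ [g]"]) (simp add: mrun_append)
qed

theorem macc_iff: "(\<exists>w. set w \<subseteq> {..<G} \<and> (\<forall>c<N. macc c w)) \<longleftrightarrow> (\<exists>t. fst (tm_conf M x t) = 1)"
proof
  assume "\<exists>w. set w \<subseteq> {..<G} \<and> (\<forall>c<N. macc c w)"
  then obtain w where w: "\<And>c. c < N \<Longrightarrow> macc c w" by blast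
  have N: "0 < N" using sizes by simp
  have "mrun 0 (Suc (cell_ini M B x 0)) w = Suc (proj (tm_conf M x (length w)) 0)"
    using mrun_proj[of w] w N by (simp add: macc_def)
  then show "\<exists>t. fst (tm_conf M x t) = 1" using w[OF N] acc_proj[OF N] by (auto simp: macc_def)
next
  assume "\<exists>t. fst (tm_conf M x t) = 1"
  then obtain t where t: "fst (tm_conf M x t) = 1" by blast
  obtain w where "set w \<subseteq> {..<G}" "\<forall>c<N. mrun c (Suc (cell_ini M B x c)) w = Suc (proj (tm_conf M x t) c)"
    using mrun_exists by blast
  then show "\<exists>w. set w \<subseteq> {..<G} \<and> (\<forall>c<N. macc c w)" using acc_proj t by (auto simp: macc_def)
qed

end

lemma tm_conf_halted:
  assumes "fst (tm_conf M x t) = 1 \<or> fst (tm_conf M x t) = 2" "t \<le> t'"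
  shows "tm_conf M x t' = tm_conf M x t"
  using assms(2)
proof (induction t' rule: dec_induct)
  case (step n)
  then show ?case using assms(1) by (cases "tm_conf M x t") (auto simp: tm_conf_def)
qed simp

lemma decides_iff:
  assumes "tm_decides M L" shows "x \<in> L \<longleftrightarrow> (\<exists>t. fst (tm_conf M x t) = 1)"
proof
  show "x \<in> L \<Longrightarrow> \<exists>t. fst (tm_conf M x t) = 1" using assms unfolding tm_decides_def by (metis (full_types))
  assume "\<exists>t. fst (tm_conf M x t) = 1"
  then obtain t where t: "fst (tm_conf M x t) = 1" by blast
  show "x \<in> L"
  proof (rule ccontr)
    assume "x \<notin> L"
    then obtain t' where t': "fst (tm_conf M x t') = 2" using assms unfolding tm_decides_def by (metis (full_types))
    have "tm_conf M x (max t t') = tm_conf M x t" "tm_conf M x (max t t') = tm_conf M x t'"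
      using t t' by (intro tm_conf_halted; simp)+
    then show False using t t' by simp
  qed
qed

section \<open>Printing the reduction\<close>

lemma nat_bits_nth:
  "j < length (nat_bits v) \<longleftrightarrow> v div 2 ^ j \<noteq> 0" "j < length (nat_bits v) \<Longrightarrow> nat_bits v ! j = odd (v div 2 ^ j)"
proof -
  have "(j < length (nat_bits v) \<longleftrightarrow> v div 2 ^ j \<noteq> 0) \<and> (j < length (nat_bits v) \<longrightarrow> nat_bits v ! j = odd (v div 2 ^ j))"
  proof (induction v arbitrary: j rule: nat_bits.induct)
    case (1 v)
    show ?case
    proof (cases "v = 0")
      case True
      then show ?thesis by (simp add: nat_bits.simps[of 0])
    next
      case False
      then have b: "nat_bits v = odd v # nat_bits (v div 2)" by (subst nat_bits.simps) simp
      show ?thesis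
      proof (cases j)
        case 0
        then show ?thesis using b False by simp
      next
        case (Suc i)
        have h: "v div 2 ^ Suc i = v div 2 div 2 ^ i" by (simp add: div_mult2_eq)
        show ?thesis unfolding Suc h b length_Cons Suc_less_eq nth_Cons_Suc by (rule 1[OF False])
      qed
    qed
  qed
  then show "j < length (nat_bits v) \<longleftrightarrow> v div 2 ^ j \<noteq> 0" "j < length (nat_bits v) \<Longrightarrow> nat_bits v ! j = odd (v div 2 ^ j)"
    by blast+
qed

lemma length_nat_bits_le: "length (nat_bits v) \<le> v"
proof (rule ccontr)
  assume "\<not> length (nat_bits v) \<le> v"
  then have "v div 2 ^ v \<noteq> 0" using nat_bits_nth(1)[of v v] by simp
  then show False using less_exp[of v] by simp
qed

text \<open>Powers of two would break the polynomial bounds on values, so a shift is an iterated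
  halving.\<close>

definition Shr where "Shr a j = Bind 76 a (It 70 71 j (Vr 76) (Vr 76) (Div (Vr 71) (Nm 2)))"
definition Len where
  "Len e = Bind 72 e (It 73 74 (Vr 72) (Vr 72) (Nm 0) (Add (Vr 74) (Ite (Shr (Vr 72) (Vr 73)) (Nm 1) (Nm 0))))"
definition Prt where
  "Prt e = PSeq (PFor 75 (Len e) (PSeq (PBit (Nm 1)) (PBit (Md (Shr e (Vr 75)) (Nm 2))))) (PBit (Nm 0))"

lemma ev_Shr:
  assumes "ev x j (\<eta>(76 := ev x a \<eta> \<alpha>)) \<alpha> = k" shows "ev x (Shr a j) \<eta> \<alpha> = ev x a \<eta> \<alpha> div 2 ^ k"
proof -
  let ?v = "ev x a \<eta> \<alpha>"
  have "rec_nat ?v (\<lambda>_ z. min (z div 2) ?v) i = ?v div 2 ^ i" for i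
  proof (induction i)
    case (Suc i)
    have "?v div 2 ^ i div 2 \<le> ?v" by (meson div_le_dividend le_trans)
    then show ?case using Suc by (simp add: div_mult2_eq mult.commute[of 2])
  qed simp
  then show ?thesis using assms by (simp add: Shr_def ev.simps(11) ev_macros)
qed

lemma ev_Len: "ev x (Len e) \<eta> \<alpha> = length (nat_bits (ev x e \<eta> \<alpha>))"
proof -
  let ?v = "ev x e \<eta> \<alpha>"
  let ?f = "\<lambda>j z. min (z + (if ?v div 2 ^ j \<noteq> 0 then 1 else 0)) ?v"
  have "rec_nat 0 ?f k = min k (length (nat_bits ?v))" for k
  proof (induction k)
    case (Suc k)
    show ?case using Suc nat_bits_nth(1)[of k ?v] length_nat_bits_le[of ?v]
      by (cases "k < length (nat_bits ?v)") simp_all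
  qed simp
  from this[of ?v] show ?thesis using length_nat_bits_le[of ?v]
    by (simp add: Len_def ev.simps(11) ev_macros ev_Ite holds_in_def ev_Shr cong: if_cong)
qed

lemma pout_Prt:
  assumes "\<And>j. ev x e (\<eta>(75 := j)) arr0 = v" shows "pout x (Prt e) \<eta> = encode_nat v"
proof -
  have e: "ev x e \<eta> arr0 = v" using assms[of "\<eta> 75"] by simp
  have bits: "nat_bits v = map (\<lambda>j. odd (v div 2 ^ j)) [0..<length (nat_bits v)]"
    by (rule nth_equalityI) (simp_all add: nat_bits_nth(2))
  have "pout x (Prt e) \<eta> = concat (map (\<lambda>j. [True, odd (v div 2 ^ j)]) [0..<length (nat_bits v)]) @ [False]"
    by (simp add: Prt_def ev_Len e ev_Md ev_macros ev_Shr assms odd_iff_mod_2_eq_one del: fun_upd_apply) (simp add: ev_macros)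
  also have "\<dots> = encode_nat v" unfolding encode_nat_def by (subst bits) (simp add: o_def)
  finally show ?thesis .
qed

primrec Tab :: "(nat \<Rightarrow> nat) \<Rightarrow> nat \<Rightarrow> exp \<Rightarrow> exp" where
  "Tab f 0 e = Nm 0"
| "Tab f (Suc n) e = Ite (Eq e (Nm n)) (Nm (f n)) (Tab f n e)"

lemma ev_Tab: "ev x e \<eta> \<alpha> < n \<Longrightarrow> ev x (Tab f n e) \<eta> \<alpha> = f (ev x e \<eta> \<alpha>)"
  by (induction n) (auto simp: holds_in_ev less_Suc_eq)

primrec Pow :: "nat \<Rightarrow> exp" where
  "Pow 0 = Nm 1" | "Pow (Suc d) = Mul (Vr 0) (Pow d)"

lemma ev_Pow: "ev x (Pow d) \<eta> \<alpha> = \<eta> 0 ^ d"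
  by (induction d) (simp_all add: ev_macros)

lemma qfree_macros:
  "qfree (Conj a b) \<longleftrightarrow> qfree a \<and> qfree b" "qfree (Neg a) \<longleftrightarrow> qfree a" "qfree (Imp a b) \<longleftrightarrow> qfree a \<and> qfree b"
  "qfree (Eq a b) \<longleftrightarrow> qfree a \<and> qfree b" "qfree (Lt a b) \<longleftrightarrow> qfree a \<and> qfree b" "qfree (Md a b) \<longleftrightarrow> qfree a \<and> qfree b"
  "qfree (Shr a b) \<longleftrightarrow> qfree a \<and> qfree b" "qfree (Len a) \<longleftrightarrow> qfree a" "qfreep (Prt a) \<longleftrightarrow> qfree a"
  by (auto simp: Conj_def Neg_def Imp_def Eq_def Lt_def Md_def Shr_def Len_def Prt_def)

lemma qfree_Tab: "qfree e \<Longrightarrow> qfree (Tab f n e)"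
  by (induction n) (auto simp: qfree_macros)

lemma qfree_Pow: "qfree (Pow d)"
  by (induction d) auto

section \<open>The reduction as a printing program\<close>

context
  fixes M :: tm and d :: nat
begin

text \<open>
  Variables \<open>80\<close> and \<open>81\<close> hold a progress state and a letter; \<open>90\<close>, \<open>91\<close> and \<open>92\<close> hold a monitor, its state and
  a letter. Everything that depends on the machine alone is a finite table.
\<close>

definition xB where "xB = Add (Pow d) (Nm d)"
definition xH where "xH = Add (Mul (Nm 2) xB) (Nm 1)"
definition xN where "xN = Mul (Nm (tm_tapes M)) xH"
definition xE where "xE = Add (Mul (Mul (Nm (tm_states M)) xH) (Nm (tm_symbols M))) (Nm 1)"
definition nG :: nat where "nG = tm_states M * tm_symbols M ^ tm_tapes M"
definition xA where "xA = Add (Nm (nG + 2)) (Mul (Nm 2) xN)"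
definition xK where "xK = Add (Mul (Nm 2) xN) (Nm 1)"
definition xStates where "xStates = Mul xK xE"
definition xTab where
  "xTab f = Tab (\<lambda>e. f (e div tm_tapes M) (e mod tm_tapes M)) (nG * tm_tapes M) (Add (Mul (Vr 92) (Nm (tm_tapes M))) (Vr 93))"
definition xMon where
  "xMon = Bind 93 (Div (Vr 90) xH) (Bind 94 (Md (Vr 90) xH) (Bind 95 (Md (Vr 91) (Nm (tm_symbols M)))
     (Bind 96 (Md (Div (Vr 91) (Nm (tm_symbols M))) xH) (Bind 97 (Add (Vr 96) (xTab (let_move M)))
       (Ite (Conj (Eq (Div (Div (Vr 91) (Nm (tm_symbols M))) xH) (Tab (let_state M) nG (Vr 92)))
           (Conj (Imp (Eq (Vr 96) (Vr 94)) (Eq (Vr 95) (xTab (let_sym M)))) (Conj (Vr 97) (Lt (Vr 97) (Add xH (Nm 1))))))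
         (Add (Nm 1) (Add (Mul (Add (Mul (Tab (let_next M) nG (Vr 92)) xH) (Sub (Vr 97) (Nm 1))) (Nm (tm_symbols M)))
           (Ite (Eq (Vr 96) (Vr 94)) (xTab (let_write M)) (Vr 95))))
         (Nm 0))))))"
definition xIni where
  "xIni c = Add (Mul xB (Nm (tm_symbols M)))
     (Ite (Conj (Eq (Div c xH) (Nm 0)) (Neg (Lt (Md c xH) xB))) (Inp (Sub (Md c xH) xB)) (Nm 0))"
definition xAcc where "xAcc e = Eq (Div (Div e (Nm (tm_symbols M))) xH) (Nm 1)"
text \<open>The progress state \<open>(l, 0)\<close> has the code \<open>l * xE\<close>, so changing
  the level is a multiplication.\<close>

definition xStep where
  "xStep = Bind 82 (Div (Vr 80) xE) (Bind 83 (Md (Vr 80) xE)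
     (Ite (Lt (Nm nG) (Vr 81))
        (Ite (Lt (Vr 82) (Sub (Vr 81) (Nm (nG + 1)))) (Mul (Sub (Vr 81) (Nm (nG + 1))) xE) (Vr 80))
     (Ite (Eq (Md (Vr 82) (Nm 2)) (Nm 0)) (Vr 80)
     (Ite (Eq (Vr 81) (Nm nG))
        (Ite (Imp (Vr 83) (xAcc (Sub (Vr 83) (Nm 1)))) (Add (Mul (Vr 82) xE) (Add (Nm 1) (xIni (Div (Vr 82) (Nm 2)))))
          (Mul (Add (Vr 82) (Nm 1)) xE))
     (Ite (Eq (Vr 83) (Nm 0)) (Vr 80)
     (Bind 84 (Bind 90 (Div (Vr 82) (Nm 2)) (Bind 91 (Sub (Vr 83) (Nm 1)) (Bind 92 (Vr 81) xMon)))
        (Ite (Vr 84) (Add (Mul (Vr 82) xE) (Vr 84)) (Mul (Add (Vr 82) (Nm 1)) xE))))))))"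
definition xFin where "xFin = Ite (Conj (Md (Div (Vr 80) xE) (Nm 2)) (Md (Vr 80) xE)) (Nm 1) (Nm 0)"
text \<open>The leading automaton has one state, so its transitions are a row of zeros. The last two
  numbers are the sign \<open>Minus\<close> and the length \<open>2 * xN + 1\<close>.\<close>

definition print_instance where
  "print_instance = PSeq (Prt xA) (PSeq (Prt (Nm 1)) (PSeq (Prt (Nm 0)) (PSeq (PFor 88 xA (Prt (Nm 0)))
     (PSeq (Prt xStates) (PSeq (Prt (Nm 0)) (PSeq (PFor 80 xStates (PFor 81 xA (Prt xStep)))
     (PSeq (PFor 80 xStates (Prt xFin)) (PSeq (Prt (Nm 1)) (Prt xK)))))))))"

lemma qfreep_print_instance: "qfreep print_instance"
  by (simp add: print_instance_def qfree_macros qfree_Tab qfree_Pow xB_def xH_def xN_def xE_def xA_def xK_def xStates_def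
    xTab_def xMon_def xIni_def xAcc_def xStep_def xFin_def)

end

locale tm_reduction = tm_monitors M "length x ^ d + d" x for M x d
begin

abbreviation "B \<equiv> length x ^ d + d"

definition cells where "cells = N"
definition width where "width = D + 1"
definition target where "target = level_fdfa"
definition prg where "prg = prog"

lemma prg_simps:
  "nstates prg = (2 * cells + 1) * width" "init prg = 0"
  "z \<in> final prg \<longleftrightarrow> z < nstates prg \<and> odd (z div width) \<and> z mod width \<noteq> 0"
  "step prg z a = fst (level_step (z div width, z mod width) a) * width + snd (level_step (z div width, z mod width) a)"
  unfolding prg_def prog_def cells_def width_def pair_code_def dts.simps dfa.simps by simp_all

lemma target_simps:
  "alph target = G + 2 + 2 * cells" "nstates (leading target) = 1" "init (leading target) = 0"
  "step (leading target) q a = 0" "progress target q = prg"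
  unfolding target_def cells_def prg_def by (simp_all only: level_fdfa_simps)

lemma ev_sizes:
  assumes "\<eta> 0 = length x"
  shows "ev x (xB d) \<eta> \<alpha> = B" "ev x (xH d) \<eta> \<alpha> = H" "ev x (xN M d) \<eta> \<alpha> = cells" "ev x (xE M d) \<eta> \<alpha> = width"
    "ev x (xA M d) \<eta> \<alpha> = alph target" "ev x (xK M d) \<eta> \<alpha> = 2 * cells + 1"
    "ev x (xStates M d) \<eta> \<alpha> = nstates prg"
proof -
  show B: "ev x (xB d) \<eta> \<alpha> = B" using assms by (simp add: xB_def ev_macros ev_Pow)
  then show H: "ev x (xH d) \<eta> \<alpha> = H" by (simp add: xH_def ev_macros)
  then show N: "ev x (xN M d) \<eta> \<alpha> = cells" by (simp only: xN_def ev_macros cells_def)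
  show E: "ev x (xE M d) \<eta> \<alpha> = width" using H by (simp only: xE_def ev_macros width_def)
  show "ev x (xA M d) \<eta> \<alpha> = alph target" using N by (simp only: xA_def nG_def ev_macros target_simps)
  show K: "ev x (xK M d) \<eta> \<alpha> = 2 * cells + 1" using N by (simp only: xK_def ev_macros)
  show "ev x (xStates M d) \<eta> \<alpha> = nstates prg" using K E by (simp only: xStates_def ev_macros prg_simps)
qed

lemma nG: "nG M = G" by (simp add: nG_def)

lemma ev_xTab:
  assumes "\<eta> 92 < G" "\<eta> 93 < K" shows "ev x (xTab M f) \<eta> \<alpha> = f (\<eta> 92) (\<eta> 93)"
proof -
  have "Suc (\<eta> 92) * K \<le> G * K" using assms(1) by (intro mult_le_mono1) simp
  then have "\<eta> 92 * K + \<eta> 93 < nG M * K" using assms(2) unfolding nG mult_Suc by linarith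
  then show ?thesis using assms(2) by (simp add: xTab_def ev_Tab ev_macros)
qed

lemma ev_xMon:
  assumes "\<eta> 0 = length x" "\<eta> 90 < cells" "\<eta> 92 < G"
  shows "ev x (xMon M d) \<eta> \<alpha> = cell_mon M B (\<eta> 90) (\<eta> 91) (\<eta> 92)"
proof -
  have i: "\<eta> 90 div H < K" using assms(2) unfolding cells_def by (rule less_mult_imp_div_less)
  show ?thesis using assms(1,3) i unfolding xMon_def cell_mon_def Let_def
    by (simp add: holds_in_ev ev_sizes ev_xTab ev_Tab nG less_Suc_eq_le)
qed

lemma ev_xIni: "\<eta> 0 = length x \<Longrightarrow> ev x (xIni M d c) \<eta> \<alpha> = cell_ini M B x (ev x c \<eta> \<alpha>)"
  unfolding xIni_def cell_ini_def by (simp add: holds_in_ev ev_sizes ev.simps(9) not_less)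

lemma holds_in_xAcc: "\<eta> 0 = length x \<Longrightarrow> holds_in x (xAcc M d e) \<eta> \<alpha> \<longleftrightarrow> cell_acc M B (ev x e \<eta> \<alpha>)"
  unfolding xAcc_def cell_acc_def by (simp add: holds_in_ev ev_sizes)

lemma ev_xStep:
  assumes "\<eta> 0 = length x" "\<eta> 80 < nstates prg" "\<eta> 81 < alph target"
  shows "ev x (xStep M d) \<eta> \<alpha> = step prg (\<eta> 80) (\<eta> 81)"
proof -
  obtain l r where lr: "\<eta> 80 div width = l" "\<eta> 80 mod width = r" by blast
  have "l < 2 * cells + 1" using assms(2) unfolding prg_simps(1) lr(1)[symmetric] by (rule less_mult_imp_div_less)
  then have c: "l div 2 < cells" if "odd l" using that by (auto elim!: oddE)
  have z: "l * width + r = \<eta> 80" unfolding lr[symmetric] by simp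
  show ?thesis
    unfolding prg_simps(4) lr level_step_def xStep_def using assms(1) c z
    by (simp add: holds_in_ev ev_sizes holds_in_xAcc ev_xIni ev_xMon nG lr even_iff_mod_2_eq_zero cong: if_cong)
qed

lemma ev_xFin:
  assumes "\<eta> 0 = length x" "\<eta> 80 < nstates prg"
  shows "ev x (xFin M d) \<eta> \<alpha> = of_bool (\<eta> 80 \<in> final prg)"
proof -
  have m: "holds_in x (Md a b) \<eta> \<alpha> \<longleftrightarrow> ev x a \<eta> \<alpha> mod ev x b \<eta> \<alpha> \<noteq> 0" for a b by (simp add: holds_in_def ev_Md)
  show ?thesis using assms by (simp add: xFin_def holds_in_ev m ev_sizes prg_simps(3) odd_iff_mod_2_eq_one)
qed

lemma pout_print_instance: "pout x (print_instance M d) (env0 x) = encode_instance target Minus (2 * cells + 1)"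
proof -
  let ?enc = "\<lambda>ns. concat (map encode_nat ns)"
  let ?A = "alph target"
  have e: "env0 x 0 = length x" by (simp add: env0_def)
  have blocks: "?enc (concat (map f is)) = concat (map (\<lambda>i. ?enc (f i)) is)" for f :: "nat \<Rightarrow> nat list" and "is"
    by (induction "is") simp_all
  have single: "?enc (map f is) = concat (map (\<lambda>i. encode_nat (f i)) is)" for f :: "nat \<Rightarrow> nat" and "is"
    by (simp add: o_def)
  have step: "pout x (Prt (xStep M d)) ((env0 x)(80 := p, 81 := a)) = encode_nat (step prg p a)"
    if "p < nstates prg" "a < ?A" for p a
    by (rule pout_Prt) (use that e in \<open>simp add: ev_xStep\<close>)
  have fin: "pout x (Prt (xFin M d)) ((env0 x)(80 := p)) = encode_nat (of_bool (p \<in> final prg))" if "p < nstates prg" for p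
    by (rule pout_Prt) (use that e in \<open>simp add: ev_xFin\<close>)
  have const: "pout x (Prt (Nm c)) \<eta> = encode_nat c" for c \<eta> by (rule pout_Prt) (simp add: ev_macros)
  have A: "pout x (Prt (xA M d)) (env0 x) = encode_nat ?A"
    and St: "pout x (Prt (xStates M d)) (env0 x) = encode_nat (nstates prg)"
    and k: "pout x (Prt (xK M d)) (env0 x) = encode_nat (2 * cells + 1)"
    by (rule pout_Prt; simp add: e ev_sizes)+
  have "pout x (print_instance M d) (env0 x) = encode_nat ?A @ encode_nat 1 @ encode_nat 0 @ concat (map (\<lambda>_. encode_nat 0) [0..<?A])
      @ encode_nat (nstates prg) @ encode_nat (init prg)
      @ concat (map (\<lambda>p. concat (map (\<lambda>a. encode_nat (step prg p a)) [0..<?A])) [0..<nstates prg])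
      @ concat (map (\<lambda>p. encode_nat (of_bool (p \<in> final prg))) [0..<nstates prg]) @ encode_nat 1 @ encode_nat (2 * cells + 1)"
  proof -
    have "map (\<lambda>p. concat (map (\<lambda>a. pout x (Prt (xStep M d)) ((env0 x)(80 := p, 81 := a))) [0..<?A])) [0..<nstates prg]
      = map (\<lambda>p. concat (map (\<lambda>a. encode_nat (step prg p a)) [0..<?A])) [0..<nstates prg]"
      by (intro map_cong refl arg_cong[of _ _ concat]) (simp add: step)
    moreover have "map (\<lambda>p. pout x (Prt (xFin M d)) ((env0 x)(80 := p))) [0..<nstates prg]
      = map (\<lambda>p. encode_nat (of_bool (p \<in> final prg))) [0..<nstates prg]"
      by (intro map_cong refl) (simp add: fin)
    ultimately show ?thesis
      using e unfolding print_instance_def pout.simps A St k const prg_simps(2) by (simp add: ev_sizes del: map_eq_conv)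
  qed
  also have "\<dots> = encode_instance target Minus (2 * cells + 1)"
    by (simp add: encode_instance_def fdfa_numbers_def dfa_numbers_def dts_numbers_def blocks single
      target_simps(2-5) o_def)
  finally show ?thesis .
qed

lemma print_instance_correct:
  assumes "tm_decides M L"
  shows "x \<in> L \<Longrightarrow> pout x (print_instance M d) (env0 x) \<in> position_yes"
    "x \<notin> L \<Longrightarrow> pout x (print_instance M d) (env0 x) \<in> position_no"
proof -
  have iff: "x \<in> L \<longleftrightarrow> wagner_position (alph target) (fdfa_language target) Minus (2 * cells + 1)"
    unfolding decides_iff[OF assms] target_def cells_def level_fdfa_position macc_iff ..
  have wf: "wf_fdfa target" "saturated target" "0 < 2 * cells + 1"
    unfolding target_def by (rule wf_level_fdfa saturated_level_fdfa | simp)+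
  show "pout x (print_instance M d) (env0 x) \<in> position_yes" if "x \<in> L"
    unfolding pout_print_instance position_yes_def mem_Collect_eq
    by (intro exI conjI, rule refl) (use wf iff that in \<open>simp_all only:\<close>)
  show "pout x (print_instance M d) (env0 x) \<in> position_no" if "x \<notin> L"
    unfolding pout_print_instance position_no_def mem_Collect_eq
    by (intro exI conjI, rule refl) (use wf iff that in \<open>simp_all only: simp_thms\<close>)
qed

end

theorem position_PSPACE_hard: "promise_PSPACE_hard position_yes position_no"
  unfolding promise_PSPACE_hard_def
proof
  fix L assume "L \<in> PSPACE"
  then obtain M where M: "wf_tm M" "tm_decides M L" "tm_poly_space M" by (auto simp: PSPACE_def)
  obtain d where d: "\<And>x t. \<forall>(c, h)\<in>set (snd (tm_conf M x t)). \<bar>h\<bar> \<le> int (length x ^ d + d)"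
    using M(3) unfolding tm_poly_space_def by blast
  have "tm_reduction M x d" for x
  proof
    show "wf_tm M" by (rule M(1))
    show "\<bar>h\<bar> \<le> int (length x ^ d + d)" if "(c, h) \<in> set (snd (tm_conf M x t))" for t c h
      using bspec[OF d[of x t] that] by simp
  qed
  then show "\<exists>f. poly_time_computable f \<and> (\<forall>x. (x \<in> L \<longrightarrow> f x \<in> position_yes) \<and> (x \<notin> L \<longrightarrow> f x \<in> position_no))"
    using poly_time_pout[OF qfreep_print_instance[of M d]] tm_reduction.print_instance_correct[OF _ M(2)] by blast
qed

theorem corollary19:
  shows "promise_PSPACE_complete position_yes position_no"
  using position_in_PSPACE position_PSPACE_hard by (simp add: promise_PSPACE_complete_def)

end
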